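(* Let $f:\mathbb{C}\to\mathbb{C}$ be a transcendental entire function of disjoint type. Suppose that $f$ has finite order or, more generally, that $f$ can be written as a finite composition of finite-order functions in the class $\mathcal{B}$. Then the Julia set $J(f)$ is a Cantor bouquet.
   Context: For a transcendental entire function $f$, $J(f)$ denotes the Julia set (the points where the family of iterates $\{f^n\}_{n>0}$ is not equicontinuous with respect to the spherical metric) and $F(f)=\mathbb{C}\setminus J(f)$ the Fatou set. $\operatorname{Sing}(f^{-1})$ is the set of critical and (finite) asymptotic values of $f$. The class $\mathcal{B}$ (Eremenko-Lyubich class) consists of all transcendental entire functions with $\operatorname{Sing}(f^{-1})$ bounded. $f$ is hyperbolic if the postsingular set $\mathcal{P}(f)=\overline{\bigcup_{j\ge 0} f^j(\operatorname{Sing}(f^{-1}))}$ is a compact subset of $F(f)$. $f$ is of disjoint type if it is hyperbolic and $F(f)$ is connected. $f$ has finite order if there are constants $c,\rho>0$ with $|f(z)|\le c\cdot e^{|z|^{\rho}}$ for all $z\in\mathbb{C}$. A straight brush is a subset $B\subset[0,+\infty)\times(\mathbb{R}\setminus\mathbb{Q})$ such that: (i) $B$ is closed in $\mathbb{R}^2$; (ii) for every $(x,y)\in B$ there is $t_y\ge 0$ with $\{x:(x,y)\in B\}=[t_y,+\infty)$; the set $[t_y,+\infty)\times\{y\}$ is called the hair attached at $y$; (iii) the set $\{y:(x,y)\in B\text{ for some }x\}$ is dense in $\mathbb{R}\setminus\mathbb{Q}$, and for every $(x,y)\in B$ there are two sequences of hairs attached respectively at $\beta_n,\gamma_n\in\mathbb{R}\setminus\mathbb{Q}$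 with $\beta_n<y<\gamma_n$, $\beta_n,\gamma_n\to y$ and $t_{\beta_n},t_{\gamma_n}\to t_y$ as $n\to\infty$. A Cantor bouquet is a subset of the plane that is ambiently homeomorphic to a straight brush, i.e. it is the image of a straight brush under a homeomorphism of the plane onto itself. *)

theory Defs
  imports "HOL-Complex_Analysis.Complex_Analysis"
    "HOL-Computational_Algebra.Polynomial"
begin

definition transcendental_entire :: "(complex \<Rightarrow> complex) \<Rightarrow> bool" where
  "transcendental_entire f \<longleftrightarrow>
     f holomorphic_on UNIV \<and> \<not> (\<exists>p :: complex poly. \<forall>z. f z = poly p z)"

(* The geodesic distance on the unit sphere, transported to the plane by stereographic
   projection: the quotient is half the chordal distance, hence lies in [0,1]. *)
definition spherical_dist :: "complex \<Rightarrow> complex \<Rightarrow> real" where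
  "spherical_dist z w =
     2 * arcsin (norm (z - w) / (sqrt (1 + (norm z)\<^sup>2) * sqrt (1 + (norm w)\<^sup>2)))"

(* The spherical metric is used for the values only; in the domain it
   induces the usual topology, so neighbourhoods are the usual ones. *)
definition iterates_equicontinuous_at :: "(complex \<Rightarrow> complex) \<Rightarrow> complex \<Rightarrow> bool" where
  "iterates_equicontinuous_at f z \<longleftrightarrow>
     (\<forall>\<epsilon>>0. \<forall>\<^sub>F w in nhds z. \<forall>n>0. spherical_dist ((f ^^ n) w) ((f ^^ n) z) < \<epsilon>)"

definition Julia_set :: "(complex \<Rightarrow> complex) \<Rightarrow> complex set" where
  "Julia_set f = {z. \<not> iterates_equicontinuous_at f z}"

definition Fatou_set :: "(complex \<Rightarrow> complex) \<Rightarrow> complex set" where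
  "Fatou_set f = - Julia_set f"

definition critical_values :: "(complex \<Rightarrow> complex) \<Rightarrow> complex set" where
  "critical_values f = f ` {z. deriv f z = 0}"

definition asymptotic_values :: "(complex \<Rightarrow> complex) \<Rightarrow> complex set" where
  "asymptotic_values f =
     {a. \<exists>\<gamma> :: real \<Rightarrow> complex. continuous_on {0..} \<gamma> \<and>
           filterlim \<gamma> at_infinity at_top \<and> ((\<lambda>t. f (\<gamma> t)) \<longlongrightarrow> a) at_top}"

definition singular_values :: "(complex \<Rightarrow> complex) \<Rightarrow> complex set" where
  "singular_values f = critical_values f \<union> asymptotic_values f"

definition postsingular_set :: "(complex \<Rightarrow> complex) \<Rightarrow> complex set" where
  "postsingular_set f = closure (\<Union>j. (f ^^ j) ` singular_values f)"

definition class_B :: "(complex \<Rightarrow> complex) set" where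
  "class_B = {f. transcendental_entire f \<and> bounded (singular_values f)}"

definition hyperbolic :: "(complex \<Rightarrow> complex) \<Rightarrow> bool" where
  "hyperbolic f \<longleftrightarrow> compact (postsingular_set f) \<and> postsingular_set f \<subseteq> Fatou_set f"

definition disjoint_type :: "(complex \<Rightarrow> complex) \<Rightarrow> bool" where
  "disjoint_type f \<longleftrightarrow> hyperbolic f \<and> connected (Fatou_set f)"

definition finite_order :: "(complex \<Rightarrow> complex) \<Rightarrow> bool" where
  "finite_order f \<longleftrightarrow>
     (\<exists>c>0. \<exists>\<rho>>0. \<forall>z. norm (f z) \<le> c * exp (norm z powr \<rho>))"

definition hair_addresses :: "(real \<times> real) set \<Rightarrow> real set" where
  "hair_addresses B = {y. \<exists>x. (x, y) \<in> B}"

(* The function t is determined by B on hair_addresses B, which is the only place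
   where its values matter. *)
definition straight_brush :: "(real \<times> real) set \<Rightarrow> bool" where
  "straight_brush B \<longleftrightarrow>
     B \<subseteq> {0..} \<times> (UNIV - \<rat>) \<and>
     closed B \<and>
     (\<exists>t :: real \<Rightarrow> real.
        (\<forall>y \<in> hair_addresses B. 0 \<le> t y \<and> {x. (x, y) \<in> B} = {t y..}) \<and>
        UNIV - \<rat> \<subseteq> closure (hair_addresses B) \<and>
        (\<forall>y \<in> hair_addresses B. \<exists>\<beta> \<gamma> :: nat \<Rightarrow> real.
           (\<forall>n. \<beta> n \<in> hair_addresses B \<and> \<gamma> n \<in> hair_addresses B \<and> \<beta> n < y \<and> y < \<gamma> n) \<and>
           \<beta> \<longlonglongrightarrow> y \<and> \<gamma> \<longlonglongrightarrow> y \<and>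
           (\<lambda>n. t (\<beta> n)) \<longlonglongrightarrow> t y \<and> (\<lambda>n. t (\<gamma> n)) \<longlonglongrightarrow> t y))"

definition Cantor_bouquet :: "complex set \<Rightarrow> bool" where
  "Cantor_bouquet X \<longleftrightarrow>
     (\<exists>B h k. straight_brush B \<and> homeomorphism UNIV UNIV h k \<and>
              X = h ` (\<lambda>(x, y). Complex x y) ` B)"

end

(* A disjoint type map acts on its simply connected Fatou set like an inner function of the disc
   with an interior fixed point.  In a logarithmic coordinate at infinity, inverse branches lift to
   univalent hyperbolic contractions of a half-plane; read in the disc, near the unit circle, the
   same branches are Euclidean contractions.  Comparing the two coordinates extends the Riemann
   map of the Fatou set to a continuous map of the plane onto the closed disc that sends the Julia
   set into the circle.  Finite order gives tracts of bounded slope, hence a linear head start,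
   which orders every fibre over the circle by speed of escape.  By length-area estimates and
   Janiszewski's theorem, fibres extend hyperbolic lines to closed ordered leaves; a Whitney map
   along all leaves, with invariance of domain, straightens them simultaneously, and a Baire
   category argument moves the heights of the hairs off the rationals. *)
theory Submission
 imports Defs "HOL-Real_Asymp.Real_Asymp"
begin

text \<open>Two contractions are played against each other. The covering \<open>q\<close> of a
  neighbourhood \<open>W\<close> of the Julia set by a half-plane lets lifts act on Julia points,
  but they contract only hyperbolically (factor \<open>La\<close>) and tracts are unbounded. The
  strip coordinate sees only the Fatou set, but there a tract of level \<open>m + 1\<close> has
  Euclidean diameter at most \<open>kp ^ m * C0\<close>. The transition map \<open>lam\<close>
  commutes with the period, which lets each estimate be used on the other side. The obstacle is
  simultaneity: it is not enough that each fibre is an arc, since one homeomorphism of the plane has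
  to straighten all of them. Hence no arc is ever parametrised. A fibre is handled through a closed
  order: a linear lead with constants \<open>K\<close> and \<open>M\<close>, once gained, is kept
  forever, and two points of a fibre of which neither ever leads coincide by contraction. Continuity
  of leaves under limits is then a statement about this order, and it rests on connected sets that
  join a Julia point to the Fatou set without meeting the upper parts of other leaves.\<close>

lemmas hol_cont = holomorphic_on_imp_continuous_on
lemmas hol_comp = holomorphic_on_compose_gen
lemmas cont_at = continuous_on_eq_continuous_at
lemmas hol_sub = holomorphic_on_subset
lemmas cont_sub = continuous_on_subset
lemmas cont_comp = continuous_on_compose2
lemmas trans_def = transcendental_entire_def
lemmas compact_im = compact_continuous_image
lemmas conn_im = connected_continuous_image
lemmas isCont_comp = isCont_tendsto_compose
lemmas cont_eps = continuous_at_eps_delta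
lemmas diff_bound = field_differentiable_bound
lemmas hol_intros = holomorphic_intros
lemmas cont_intros = continuous_intros
notation LIMSEQ (infix "---->" 60)
notation tendsto (infixr "--->" 55)
notation holomorphic_on (infixl "(hol'_on)" 50)

section \<open>Inverse branches over regular values\<close>

lemma LIMSEQ_dist_inverse:
 fixes x :: "nat => 'a::metric_space"
 assumes "!!n. dist (x n) z < inverse (real (Suc n))" shows "x ----> z"
 by (rule metric_tendsto_imp_tendsto[OF LIMSEQ_inverse_real_of_nat])
  (rule always_eventually, rule allI, use assms in "simp add: less_imp_le del: of_nat_Suc")

text \<open>The set of agreement is closed by continuity and open because \<open>f\<close> is
  injective near a point with nonzero derivative. The source is an arbitrary connected space, so
  that discs, half-planes, strips and intervals are covered at once; with \<open>f = exp\<close>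
  this is uniqueness of logarithms.\<close>

lemma unique_lift:
 fixes f :: "complex => complex" and h k :: "'a::topological_space => complex"
 assumes f: "f hol_on UNIV" and S: "connected S"
  and h: "continuous_on S h" and k: "continuous_on S k"
  and eq: "!!x. x : S ==> f (h x) = f (k x)"
  and d: "!!x. x : S ==> deriv f (h x) ~= 0"
  and a: "a : S" "h a = k a" and x: "x : S"
 shows "h x = k x"
proof -
 define A where "A = {x : S. h x - k x = 0}"
 have cl: "closedin (top_of_set S) A"
  unfolding A_def by (intro continuous_closedin_preimage_constant cont_intros h k)
 have op: "openin (top_of_set S) A"
 proof (subst openin_subopen, intro ballI)
  fix y assume y: "y : A"
  hence yS: "y : S" and hy: "h y = k y" by (auto simp: A_def)
  obtain r where r: "r > 0" "inj_on f (ball (h y) r)"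
   using has_complex_derivative_locally_injective[OF f UNIV_I open_UNIV d[OF yS]] by metis
  let ?T = "(S Int h -` ball (h y) r) Int (S Int k -` ball (h y) r)"
  have "openin (top_of_set S) ?T"
   by (intro openin_Int continuous_openin_preimage_gen h k open_ball)
  moreover have "y : ?T" using yS hy r by auto
  moreover have "?T <= A"
   using r(2) eq by (auto simp: A_def inj_on_def)
  ultimately show "EX T. openin (top_of_set S) T & y : T & T <= A" by blast
 qed
 have "A = {} | A = S"
  using S cl op unfolding connected_clopen by blast
 thus ?thesis using a x by (auto simp: A_def)
qed

text \<open>The neighbourhood \<open>U\<close> serves to recognise another branch as
  \<open>k\<close> once one of its values falls into \<open>U\<close>.\<close>

lemma local_inverse:
 fixes f :: "complex => complex"
 assumes f: "f hol_on UNIV" and d: "deriv f z ~= 0"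
 obtains ep U k where "ep > 0" "open U" "z : U" "k hol_on ball (f z) ep" "k (f z) = z"
  "!!w. w : ball (f z) ep ==> f (k w) = w"
  "!!u. u : U ==> f u : ball (f z) ep & k (f u) = u"
proof -
 obtain r where r: "r > 0" "open (f ` ball z r)" "inj_on f (ball z r)"
  using has_complex_derivative_locally_invertible[OF f UNIV_I open_UNIV d] by metis
 have fb: "f hol_on ball z r" using f hol_sub by blast
 obtain k where k: "k hol_on f ` ball z r" "!!u. u : ball z r ==> k (f u) = u"
  using holomorphic_has_inverse[OF fb open_ball r(3)] by metis
 have "f z : f ` ball z r" using r by auto
 then obtain e where e: "e > 0" "ball (f z) e <= f ` ball z r"
  using r(2) by (meson openE)
 show thesis
 proof (rule that[of e "ball z r Int f -` ball (f z) e" k])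
  show "open (ball z r Int f -` ball (f z) e)"
   using continuous_open_preimage[OF hol_cont[OF fb] open_ball open_ball]
   by (simp add: Int_def vimage_def)
  show "k hol_on ball (f z) e" using k(1) e(2) hol_sub by blast
 qed (use r e k in auto)
qed

lemma deriv_nonzero_over_regular:
 assumes "f z ~: singular_values f"
 shows "deriv f z ~= 0"
 using assms unfolding singular_values_def critical_values_def by blast

lemma deriv_nonzero_branch:
 fixes f :: "complex => complex"
 assumes f: "f hol_on UNIV" and T: "open T" "x : T"
  and h: "h hol_on T" "!!w. w : T ==> f (h w) = w"
 shows "deriv f (h x) ~= 0"
proof
 assume "deriv f (h x) = 0"
 have "((%w. f (h w)) has_field_derivative deriv f (h x) * deriv h x) (at x)"
 proof (rule DERIV_chain2[where f=f and g=h])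
  show "(f has_field_derivative deriv f (h x)) (at (h x))" using f holomorphic_derivI by blast
  show "(h has_field_derivative deriv h x) (at x)" using h(1) T holomorphic_derivI by blast
 qed
 moreover have "((%w. f (h w)) has_field_derivative 1) (at x)"
  by (rule has_field_derivative_transform_within_open[of "%w. w" 1 x T]) (use T h(2) in auto)
 ultimately have "deriv f (h x) * deriv h x = 1" by (rule DERIV_unique)
 thus False using `deriv f (h x) = 0` by simp
qed

text \<open>A branch of the inverse along a ray either converges, or runs to infinity along an asymptotic path.\<close>

lemma radial_limit_branch:
 fixes f :: "complex => complex"
 assumes f: "f hol_on UNIV" and r: "r > 0"
  and h: "h hol_on ball w0 r" "!!w. w : ball w0 r ==> f (h w) = w"
  and z: "dist w0 zt = r" "zt ~: singular_values f"
 obtains ep k where "ep > 0" "k hol_on ball zt ep" "!!w. w : ball zt ep ==> f (k w) = w"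
  "!!w. w : ball zt ep Int ball w0 r ==> k w = h w"
proof -
 \<comment> \<open>The radius is parametrised by [0, infinity), the form required of an asymptotic
   path.\<close>
 define p where "p t = w0 + of_real (1 - 1 / (t + 1)) * (zt - w0)" for t :: real
 define ga where "ga t = h (p t)" for t
 have pb: "p t : ball w0 r" if "t >= 0" for t
 proof -
  have "dist w0 (p t) = abs(1 - 1 / (t+1)) * r"
   using z(1) by (simp add: p_def dist_norm norm_mult norm_minus_commute del: of_real_diff)
  also have "... < r" using that r by (auto simp: abs_if field_simps)
  finally show ?thesis by simp
 qed
 have plim: "(p ---> zt) at_top"
 proof -
  have "((%t::real. 1 - 1 / (t+1)) ---> 1) at_top" by real_asymp
  hence "(p ---> w0 + of_real 1 * (zt - w0)) at_top"
   unfolding p_def by (intro tendsto_intros)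
  thus ?thesis by simp
 qed
 have ch: "continuous_on (ball w0 r) h" using h(1) by (rule hol_cont)
 have cga: "continuous_on {0..} ga"
  unfolding ga_def
 proof (rule cont_comp[OF ch])
  show "continuous_on {0..} p" unfolding p_def by (intro cont_intros) auto
 qed (use pb in auto)
 have ftend: "((%t. f (ga t)) ---> zt) at_top"
 proof (rule Lim_transform_eventually[OF plim])
  show "\<forall>\<^sub>F t in at_top. p t = f (ga t)"
   using eventually_ge_at_top[of 0] by eventually_elim (use h(2) pb in "auto simp: ga_def")
 qed
 have "~ filterlim ga at_infinity at_top"
 proof
  assume "filterlim ga at_infinity at_top"
  hence "zt : asymptotic_values f" unfolding asymptotic_values_def using cga ftend by blast
  thus False using z(2) by (auto simp: singular_values_def)
 qed
 then obtain B where B: "~ (\<forall>\<^sub>F t in at_top. norm (ga t) >= B)" "B > 0"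
  using filterlim_at_infinity[of 0 ga at_top] by (auto simp: )
 have ex: "EX t >= T. norm (ga t) <= B" for T
  using B(1) unfolding eventually_at_top_linorder by (metis linear)
 have "ALL n::nat. EX t. t >= real n & norm (ga t) <= B"
  using ex by blast
 then obtain t where t: "!!n::nat. t n >= real n & norm (ga (t n)) <= B"
  by metis
 have "bounded (range (%n. ga (t n)))" using t by (auto simp: bounded_iff)
 then obtain zs s where s: "strict_mono (s :: nat => nat)" "((%n. ga (t n)) o s) ----> zs"
  using bounded_imp_convergent_subsequence by blast
 have tt: "filterlim (%n. t (s n)) at_top sequentially"
 proof (rule filterlim_at_top_mono[OF filterlim_real_sequentially])
  show "\<forall>\<^sub>F n in sequentially. real n <= t (s n)"
   using t seq_suble[OF s(1)] by (intro always_eventually allI) (meson of_nat_mono order_trans)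
 qed
 have fl1: "(%n. f (ga (t (s n)))) ----> zt"
  using filterlim_compose[OF ftend tt] by simp
 have fc: "continuous_on UNIV f" using f by (rule hol_cont)
 have "(%n. f (ga (t (s n)))) ----> f zs"
  using continuous_on_tendsto_compose[OF fc, of "%n. ga (t (s n))" zs] s(2) by (simp add: o_def)
 hence fzs: "f zs = zt" using fl1 LIMSEQ_unique by blast
 hence "deriv f zs ~= 0" using z(2) deriv_nonzero_over_regular by blast
 then obtain ep U k where k: "ep > 0" "open U" "zs : U" "k hol_on ball zt ep"
  "!!w. w : ball zt ep ==> f (k w) = w" "!!u. u : U ==> f u : ball zt ep & k (f u) = u"
  using local_inverse[OF f, of zs] fzs by metis
 have "\<forall>\<^sub>F n in sequentially. ga (t (s n)) : U"
  using s(2) k(2,3) by (auto simp: o_def tendsto_def)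
 then obtain n where n: "ga (t (s n)) : U" by (auto simp: eventually_sequentially)
 let ?w = "p (t (s n))"
 have wb: "?w : ball w0 r" using pb t by (meson of_nat_0_le_iff order_trans)
 have hw: "h ?w = ga (t (s n))" by (simp add: ga_def)
 have fw: "f (h ?w) = ?w" using h(2) wb by blast
 have wk: "?w : ball zt ep" "k ?w = h ?w" using k(6)[OF n] fw hw by auto
 have conn: "connected (ball zt ep Int ball w0 r)"
  by (intro convex_connected convex_Int convex_ball)
 have agree: "k w = h w" if w: "w : ball zt ep Int ball w0 r" for w
 proof (rule unique_lift[where h=k and k=h and x=w and a="?w", OF f conn])
  show "continuous_on (ball zt ep Int ball w0 r) k"
   using hol_cont[OF k(4)] cont_sub by blast
  show "continuous_on (ball zt ep Int ball w0 r) h"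
   using ch cont_sub by blast
  show "?w : ball zt ep Int ball w0 r" using wk wb by blast
  fix x assume x: "x : ball zt ep Int ball w0 r"
  thus "f (k x) = f (h x)" using k(5) h(2) by auto
  show "deriv f (k x) ~= 0" using deriv_nonzero_branch[OF f open_ball _ k(4,5)] x by blast
 qed (use wk w in auto)
 show thesis by (rule that[OF k(1,4,5) agree])
qed

text \<open>Each boundary point carries a local branch by \<open>radial_limit_branch\<close>. These
  agree on overlaps and, with the given disc, cover an open neighbourhood of the closed disc; the
  distance from \<open>w0\<close> to its complement is attained and is the new radius.\<close>

lemma branch_extends:
 fixes f :: "complex => complex"
 assumes f: "f hol_on UNIV" and r: "r > 0"
  and h: "h hol_on ball w0 r" "!!w. w : ball w0 r ==> f (h w) = w"
  and reg: "sphere w0 r Int singular_values f = {}"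
 obtains r' H where "r' > r" "H hol_on ball w0 r'" "!!w. w : ball w0 r' ==> f (H w) = w"
  "H w0 = h w0"
proof -
 have ex: "EX ep>0. EX k. k hol_on ball zt ep & (ALL w:ball zt ep. f (k w) = w)
   & (ALL w:ball zt ep Int ball w0 r. k w = h w)" if "zt : sphere w0 r" for zt
 proof -
  have "dist w0 zt = r" "zt ~: singular_values f" using that reg by auto
  from radial_limit_branch[OF f r h this] show ?thesis by metis
 qed
 then obtain ep K where K: "!!zt. zt : sphere w0 r ==> ep zt > 0 & K zt hol_on ball zt (ep zt)
   & (ALL w:ball zt (ep zt). f (K zt w) = w) & (ALL w:ball zt (ep zt) Int ball w0 r. K zt w = h w)"
  by metis
 have KK: "K zt w = K xi w" if z: "zt : sphere w0 r" "xi : sphere w0 r" and w: "w : ball zt (ep zt)" "w : ball xi (ep xi)" for zt xi w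
 proof -
  let ?B = "ball zt (ep zt) Int ball xi (ep xi)"
  \<comment> \<open>The point \<open>m\<close> divides the segment between the centres in proportion
    to the radii, so it lies in both discs, and by convexity in the closed disc. Hence the overlap
    meets the open disc, where both branches equal \<open>h\<close>.\<close>
  define t where "t = ep zt / (ep zt + ep xi)"
  have e: "0 < ep zt" "0 < ep xi" using K z by auto
  hence t: "0 < t" "0 < 1 - t" "t * (ep zt + ep xi) = ep zt" "(1 - t) * (ep zt + ep xi) = ep xi" by (auto simp: t_def field_simps)
  define m where "m = (1 - t) *\<^sub>R zt + t *\<^sub>R xi"
  have "dist zt xi < ep zt + ep xi" using w dist_triangle2[of zt xi w] by simp
  hence "t * dist zt xi < ep zt" "(1 - t) * dist zt xi < ep xi" using t mult_strict_left_mono by metis+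
  moreover have "zt - m = t *\<^sub>R (zt - xi)" "xi - m = (1 - t) *\<^sub>R (xi - zt)" by (simp_all add: m_def algebra_simps)
  ultimately have "m : ?B" using t by (simp add: dist_norm norm_minus_commute)
  moreover have "m : cball w0 r" unfolding m_def using z t by (intro convexD_alt convex_cball) auto
  hence "m : closure (ball w0 r)" using r by simp
  ultimately have "?B Int ball w0 r ~= {}" by (metis disjoint_iff open_Int open_Int_closure_eq_empty open_ball)
  then obtain u where u: "u : ?B Int ball w0 r" by blast
  show ?thesis
  proof (rule analytic_continuation_open[of "?B Int ball w0 r" ?B "K zt" "K xi"])
   show "connected ?B" by (intro convex_connected convex_Int convex_ball)
   show "K zt hol_on ?B" "K xi hol_on ?B" using K z by (auto intro: hol_sub)
  qed (use u K z w in auto)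
 qed
 define H where "H w = (if w : ball w0 r then h w else K (SOME zt. zt : sphere w0 r & w : ball zt (ep zt)) w)" for w
 have HK: "H w = K zt w" if z: "zt : sphere w0 r" "w : ball zt (ep zt)" for w zt
 proof (cases "w : ball w0 r")
  case True
  thus ?thesis using K[OF z(1)] z(2) by (simp add: H_def)
 next
  case False
  have "EX zt. zt : sphere w0 r & w : ball zt (ep zt)" using z by blast
  from someI_ex[OF this] show ?thesis using False KK z by (metis H_def)
 qed
 define U where "U = ball w0 r Un (UN zt:sphere w0 r. ball zt (ep zt))"
 have U: "closed (- U)" "cball w0 r <= U" using K by (force simp: U_def closed_def)+
 obtain r' where r': "r' > r" "ball w0 r' <= U"
 proof (cases "- U = {}")
  case False
  then obtain x where x: "x : - U" "!!y. y : - U ==> dist w0 x <= dist w0 y" using distance_attains_inf[OF U(1)] by metis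
  show thesis by (rule that[of "dist w0 x"]) (use x U(2) in force)+
 qed (use that[of "r + 1"] in auto)
 have "f (H w) = w & H field_differentiable at w" if wU: "w : U" for w
 proof (cases "w : ball w0 r")
  case True
  have "H hol_on ball w0 r" using h(1) by (rule holomorphic_transform) (auto simp: H_def)
  thus ?thesis using True h(2) holomorphic_on_imp_differentiable_at[OF _ open_ball] by (auto simp: H_def)
 next
  case False
  then obtain zt where z: "zt : sphere w0 r" "w : ball zt (ep zt)" using wU by (auto simp: U_def)
  have "H hol_on ball zt (ep zt)" by (rule holomorphic_transform[of "K zt"]) (use K[OF z(1)] HK[OF z(1)] in auto)
  thus ?thesis using z(2) K[OF z(1)] HK[OF z] holomorphic_on_imp_differentiable_at[OF _ open_ball] by auto
 qed
 hence "H field_differentiable at w" "f (H w) = w" if "w : ball w0 r'" for w using r'(2) that by blast+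
 hence "H hol_on ball w0 r'" "!!w. w : ball w0 r' ==> f (H w) = w"
  by (simp_all add: holomorphic_on_def field_differentiable_at_within)
 thus thesis using that[of r' H] r'(1) r by (simp add: H_def)
qed

lemma branch_unique:
 fixes f :: "complex => complex"
 assumes f: "f hol_on UNIV" and T: "open T" "connected T"
  and h: "h hol_on T" "!!w. w : T ==> f (h w) = w"
  and k: "k hol_on T" "!!w. w : T ==> f (k w) = w"
  and a: "a : T" "h a = k a" and x: "x : T"
 shows "h x = k x"
proof (rule unique_lift[where h=h and k=k and x=x and a=a, OF f T(2)])
 show "continuous_on T h" "continuous_on T k" by (intro hol_cont h k)+
 show "f (h w) = f (k w)" if "w : T" for w using that h k by simp
 show "deriv f (h w) ~= 0" if "w : T" for w by (rule deriv_nonzero_branch[OF f T(1) that h])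
qed (rule a x)+

text \<open>Branches with the same value at the centre agree, so together they form a branch on the
  ball of supremal radius. Were that radius below \<open>R\<close>, its circle would be free of
  singular values and \<open>branch_extends\<close> would apply.\<close>

lemma branch_on_ball:
 fixes f :: "complex => complex"
 assumes f: "f hol_on UNIV" and R: "R > 0"
  and reg: "ball w0 R Int singular_values f = {}" and z0: "f z0 = w0"
 obtains h where "h hol_on ball w0 R" "!!w. w : ball w0 R ==> f (h w) = w" "h w0 = z0"
proof -
 define br where "br r h \<longleftrightarrow> h hol_on ball w0 r & (ALL w : ball w0 r. f (h w) = w) & h w0 = z0"
  for r and h :: "complex => complex"
 define A where "A = {r. 0 < r & r <= R & (EX h. br r h)}"
 have "w0 ~: singular_values f" using reg R by (meson centre_in_ball disjoint_iff)
 hence "deriv f z0 ~= 0" using z0 deriv_nonzero_over_regular by blast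
 then obtain ep k where k: "ep > 0" "k hol_on ball w0 ep" "k w0 = z0" "!!w. w : ball w0 ep ==> f (k w) = w"
  using local_inverse[OF f, of z0] z0 by metis
 have "min ep R : A" unfolding A_def br_def using k R
  by (auto intro!: exI[of _ k] intro: hol_sub)
 hence Ane: "A ~= {}" by blast
 have Abdd: "bdd_above A" unfolding A_def by (auto intro!: bdd_aboveI[of _ R])
 define s where "s = Sup A"
 have s0: "s > 0" using `min ep R : A` cSup_upper[OF _ Abdd] k(1) R unfolding s_def
  by (meson min_less_iff_conj less_le_trans)
 have sR: "s <= R" unfolding s_def using cSup_least[OF Ane] by (auto simp: A_def)
 have "ALL r. EX h. r : A --> br r h" unfolding A_def by blast
 then obtain hr where hr: "!!r. r : A ==> br r (hr r)" by metis
 have ex: "EX r : A. dist w0 w < r" if "w : ball w0 s" for w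
  using that less_cSup_iff[OF Ane Abdd] unfolding s_def by auto
 have agr: "hr r w = hr r' w" if "r : A" "r' : A" "dist w0 w < r" "dist w0 w < r'" for r r' w
 proof (rule branch_unique[OF f, of "ball w0 (min r r')" "hr r" "hr r'" w0])
  show "hr r hol_on ball w0 (min r r')" "hr r' hol_on ball w0 (min r r')"
   using hr[OF that(1)] hr[OF that(2)] unfolding br_def by (auto intro: hol_sub)
 qed (use that hr in "auto simp: br_def A_def")
 obtain rr where rr: "!!w. w : ball w0 s ==> rr w : A & dist w0 w < rr w" using ex by metis
 define h where "h w = hr (rr w) w" for w
 have "br s h" unfolding br_def
 proof (intro conjI ballI)
  have "br (rr w0) (hr (rr w0))" using rr[of w0] s0 hr by auto
  thus "h w0 = z0" unfolding br_def h_def by blast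
  show "f (h w) = w" if "w : ball w0 s" for w
  proof -
   have "br (rr w) (hr (rr w))" "w : ball w0 (rr w)" using rr[OF that] hr by auto
   thus ?thesis unfolding br_def h_def by blast
  qed
  have "h field_differentiable at w" if w: "w : ball w0 s" for w
  proof -
   have 1: "rr w : A" "dist w0 w < rr w" using rr[OF w] by auto
   have "hr (rr w) hol_on ball w0 (min s (rr w))"
    using hr[OF 1(1)] by (auto simp: br_def intro: hol_sub)
   hence "h hol_on ball w0 (min s (rr w))"
   proof (rule holomorphic_transform)
    fix x assume "x : ball w0 (min s (rr w))"
    hence x: "x : ball w0 s" "dist w0 x < rr w" by auto
    show "hr (rr w) x = h x"
     unfolding h_def using rr[OF x(1)] by (intro agr 1 x) auto
   qed
   thus ?thesis using 1 w by (intro holomorphic_on_imp_differentiable_at[OF _ open_ball, of h w0 "min s (rr w)"]) auto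
  qed
  thus "h hol_on ball w0 s"
   by (simp add: holomorphic_on_def field_differentiable_at_within)
 qed
 have "s = R"
 proof (rule ccontr)
  assume "s ~= R"
  hence "s < R" using sR by simp
  hence "sphere w0 s Int singular_values f = {}" using reg by auto
  then obtain r' H where H: "r' > s" "H hol_on ball w0 r'" "!!w. w : ball w0 r' ==> f (H w) = w" "H w0 = h w0"
   using branch_extends[OF f s0, of h w0] `br s h` unfolding br_def by metis
  have "br (min r' R) H" using H `br s h` by (auto simp: br_def intro: hol_sub)
  hence "min r' R : A" using H(1) s0 R by (auto simp: A_def)
  hence "min r' R <= s" unfolding s_def using Abdd by (rule cSup_upper)
  thus False using H(1) `s < R` by auto
 qed
 thus thesis using `br s h` that unfolding br_def by blast
qed

text \<open>The sheets over a small disc are its images under all inverse branches there; distinct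
  branches have disjoint images by \<open>branch_unique\<close>.\<close>

lemma covering_over_regular:
 fixes f :: "complex => complex"
 assumes f: "f hol_on UNIV" and V: "open V" "V Int singular_values f = {}"
 shows "covering_space (f -` V) f (V Int range f)"
proof
 have cf: "continuous_on A f" for A
  using f hol_cont cont_sub by blast
 thus "continuous_on (f -` V) f" .
 show "f ` (f -` V) = V Int range f" by auto
 fix x assume x: "x : V Int range f"
 then obtain e where e: "e > 0" "ball x e <= V" using V(1) by (meson IntD1 openE)
 \<comment> \<open>A third of the radius: the disc of radius \<open>2 * e / 3\<close> about any
   point of \<open>T\<close> stays in \<open>ball x e\<close> and contains \<open>T\<close>, so the
   branch through any preimage is defined on all of \<open>T\<close>.\<close>
 define T where "T = ball x (e/3)"
 have T: "open T" "connected T" "T <= V" "x : T" using e by (auto simp: T_def)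
 define BR where "BR = {h. h hol_on T & (ALL w:T. f (h w) = w)}"
 have through: "EX h : BR. h (f z) = z" if z: "f z : T" for z
 proof -
  have sub: "ball (f z) (2*e/3) <= ball x e"
  proof
   fix u assume "u : ball (f z) (2*e/3)"
   thus "u : ball x e" using z dist_triangle[of x u "f z"] by (auto simp: T_def)
  qed
  have T2: "T <= ball (f z) (2*e/3)"
  proof
   fix u assume "u : T"
   thus "u : ball (f z) (2*e/3)" using z dist_triangle3[of "f z" u x] by (auto simp: T_def dist_commute)
  qed
  have "ball (f z) (2*e/3) Int singular_values f = {}" using sub e V by blast
  then obtain h where "h hol_on ball (f z) (2*e/3)" "!!w. w : ball (f z) (2*e/3) ==> f (h w) = w" "h (f z) = z"
   using branch_on_ball[OF f _ _ refl, of "2*e/3" z] e(1) by auto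
  thus ?thesis using T2 unfolding BR_def by (intro bexI[of _ h]) (auto intro: hol_sub)
 qed
 have TR: "T <= V Int range f"
 proof
  fix w assume w: "w : T"
  obtain z where z: "x = f z" using x by auto
  then obtain h where "h : BR" using through[of z] T by auto
  hence "f (h w) = w" using w by (auto simp: BR_def)
  thus "w : V Int range f" using T w by (metis IntI rangeI subsetD)
 qed
 have inj: "inj_on h T" if "h : BR" for h using that unfolding BR_def inj_on_def by (metis (mono_tags, lifting) mem_Collect_eq)
 have oph: "open (h ` T)" if "h : BR" for h
  using open_mapping_thm3[OF _ T(1) inj[OF that]] that by (auto simp: BR_def)
 show "EX T. x : T & openin (top_of_set (V Int range f)) T & (EX v. \<Union> v = f -` V Int f -` T &
     (ALL u:v. openin (top_of_set (f -` V)) u) & pairwise disjnt v & (ALL u:v. EX q. homeomorphism u T f q))"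
 proof (intro exI[of _ T] exI[of _ "(%h. h ` T) ` BR"] conjI ballI)
  show "x : T" by (rule T)
  show "openin (top_of_set (V Int range f)) T" using T TR by (simp add: open_subset)
  show "\<Union> ((%h. h ` T) ` BR) = f -` V Int f -` T"
  proof
   show "\<Union> ((%h. h ` T) ` BR) <= f -` V Int f -` T" using T by (auto simp: BR_def)
   show "f -` V Int f -` T <= \<Union> ((%h. h ` T) ` BR)"
   proof
    fix z assume "z : f -` V Int f -` T"
    then obtain h where "h : BR" "h (f z) = z" "f z : T" using through by auto
    thus "z : \<Union> ((%h. h ` T) ` BR)" by (metis UN_iff image_eqI)
   qed
  qed
  show "openin (top_of_set (f -` V)) u" if "u : (%h. h ` T) ` BR" for u
   using that oph T by (intro open_subset) (auto simp: BR_def)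
  show "pairwise disjnt ((%h. h ` T) ` BR)"
   unfolding pairwise_def
  proof (intro ballI impI)
   fix u v assume "u : (%h. h ` T) ` BR" "v : (%h. h ` T) ` BR" "u ~= v"
   then obtain h k where hk: "h : BR" "k : BR" "u = h ` T" "v = k ` T" by blast
   show "disjnt u v"
   proof (rule ccontr)
    assume "~ disjnt u v"
    then obtain a b where ab: "a : T" "b : T" "h a = k b" using hk by (auto simp: disjnt_def)
    hence "a = b" using hk unfolding BR_def by (metis (mono_tags, lifting) mem_Collect_eq)
    hence "h w = k w" if "w : T" for w
     using branch_unique[OF f T(1,2), of h k a w] hk ab that by (auto simp: BR_def)
    thus False using `u ~= v` hk by auto
   qed
  qed
  show "EX q. homeomorphism u T f q" if u: "u : (%h. h ` T) ` BR" for u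
  proof -
   obtain h where h: "h : BR" "u = h ` T" using u by (elim imageE)
   have "homeomorphism u T f h" unfolding homeomorphism_def
    using h cf by (auto simp: BR_def image_iff intro: hol_cont)
   thus ?thesis by blast
  qed
 qed
qed

text \<open>A map of a convex domain lifts through the covering; what must be checked is that
  \<open>e\<close> takes its values in the range of \<open>f\<close>. Inside \<open>V\<close> that
  range is open and relatively closed, so its preimage in \<open>Om\<close> is everything.\<close>

theorem holomorphic_lift:
 fixes f e :: "complex => complex"
 assumes f: "f hol_on UNIV" and V: "open V" "V Int singular_values f = {}"
  and Om: "open Om" "convex Om" and e: "e hol_on Om" "e ` Om <= V"
  and a: "a : Om" "f z0 = e a"
 obtains G where "G hol_on Om" "G a = z0" "!!w. w : Om ==> f (G w) = e w"
proof -
 let ?S = "V Int range f"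
 have cov: "covering_space (f -` V) f ?S" by (rule covering_over_regular[OF f V])
 have cf: "continuous_on UNIV f" using f hol_cont by blast
 have ce: "continuous_on Om e" using e(1) hol_cont by blast
 have opS: "open (range f Int V)"
 proof -
  have "f (z0) : V" using a e by auto
  hence d: "deriv f z0 ~= 0" using V deriv_nonzero_over_regular by blast
  have "~ f constant_on UNIV"
  proof
   assume "f constant_on UNIV"
   then obtain c where "!!z. f z = c" by (auto simp: constant_on_def)
   hence "f = (%z. c)" by auto
   thus False using d by simp
  qed
  hence "open (range f)" using open_mapping_thm[OF f open_UNIV connected_UNIV open_UNIV] by auto
  thus ?thesis using V(1) by auto
 qed
 \<comment> \<open>A branch on a disc about a value of \<open>f\<close> close to \<open>w\<close>
   reaches \<open>w\<close> itself.\<close>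
 have clS: "w : range f" if w: "w : V" "w : closure (range f)" for w
 proof -
  obtain r where r: "r > 0" "ball w r <= V" using w V(1) by (meson openE)
  obtain z where z: "dist (f z) w < r/2" using w(2) r(1) by (metis closure_approachable half_gt_zero imageE)
  have "ball (f z) (r/2) <= ball w r"
  proof
   fix u assume "u : ball (f z) (r/2)"
   thus "u : ball w r" using z dist_triangle[of w u "f z"] by (auto simp: dist_commute)
  qed
  hence "ball (f z) (r/2) Int singular_values f = {}" using r V by blast
  then obtain h where "!!w. w : ball (f z) (r/2) ==> f (h w) = w"
   using branch_on_ball[OF f _ _ refl, of "r/2" z] r(1) half_gt_zero by metis
  hence "f (h w) = w" using z by simp
  thus ?thesis by (metis rangeI)
 qed
 have eS: "e : Om \<rightarrow> ?S"
 proof -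
  let ?A = "Om Int e -` (range f Int V)"
  have "openin (top_of_set Om) ?A" by (rule continuous_openin_preimage_gen[OF ce opS])
  moreover have "?A = Om Int e -` closure (range f)"
  proof -
   have "e x : range f Int V \<longleftrightarrow> e x : closure (range f)" if "x : Om" for x
    using that clS[of "e x"] e(2) closure_subset[of "range f"] by blast
   thus ?thesis by blast
  qed
  hence "closedin (top_of_set Om) ?A" by (metis ce closed_closure continuous_closedin_preimage)
  moreover have "a : ?A" using a e by (metis IntI image_subset_iff rangeI vimageI)
  ultimately have "?A = Om" using convex_connected[OF Om(2)] unfolding connected_clopen by blast
  thus ?thesis by blast
 qed
 have z0: "z0 : f -` V" using a e by auto
 obtain G where G: "continuous_on Om G" "G : Om \<rightarrow> f -` V" "G a = z0" "!!y. y : Om ==> f (G y) = e y"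
 proof (rule covering_space_lift_strong[OF cov z0 a(1) _ _ ce eS])
  show "simply_connected Om" by (rule convex_imp_simply_connected[OF Om(2)])
  show "locally path_connected Om" by (rule convex_imp_locally_path_connected[OF Om(2)])
 qed (use a in auto)
 have "G field_differentiable at w" if w: "w : Om" for w
 proof -
  have "deriv f (G w) ~= 0" using G w V deriv_nonzero_over_regular by fastforce
  then obtain ep U k where k: "ep > 0" "open U" "G w : U" "k hol_on ball (f (G w)) ep"
    "!!u. u : U ==> f u : ball (f (G w)) ep & k (f u) = u"
   using local_inverse[OF f, of "G w"] by metis
  let ?N = "Om Int G -` U"
  have N: "open ?N" by (rule continuous_open_preimage[OF G(1) Om(1) k(2)])
  have wN: "w : ?N" using w k by auto
  have "(k o e) hol_on ?N"
  proof (rule holomorphic_on_compose)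
   show "e hol_on ?N" using e(1) hol_sub by blast
   show "k hol_on e ` ?N" using k G by (intro hol_sub[OF k(4)]) force
  qed
  hence "G hol_on ?N"
   by (rule holomorphic_transform) (use k G in force)
  thus ?thesis using N wN holomorphic_on_imp_differentiable_at by blast
 qed
 hence "G hol_on Om" by (simp add: holomorphic_on_def field_differentiable_at_within)
 thus thesis using G that by blast
qed

lemma lift_unique:
 fixes f e :: "complex => complex"
 assumes f: "f hol_on UNIV" and V: "V Int singular_values f = {}"
  and Om: "connected Om" and e: "e ` Om <= V"
  and G: "continuous_on Om G" "!!w. w : Om ==> f (G w) = e w"
  and H: "continuous_on Om H" "!!w. w : Om ==> f (H w) = e w"
  and a: "a : Om" "G a = H a" and w: "w : Om"
 shows "G w = H w"
proof (rule unique_lift[where h=G and k=H, OF f Om G(1) H(1) _ _ a w])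
 fix x assume x: "x : Om"
 show "f (G x) = f (H x)" using x G H by simp
 show "deriv f (G x) ~= 0" using x G e V deriv_nonzero_over_regular by (metis disjoint_iff image_subset_iff)
qed

section \<open>Logarithmic coordinates\<close>

definition per :: "int => complex" where "per n = of_int (2 * n) * (of_real pi * \<i>)"

lemma Re_per [simp]: "Re (per n) = 0" by (simp add: per_def)
lemma Im_per [simp]: "Im (per n) = 2 * pi * of_int n" by (simp add: per_def)
lemma per_0 [simp]: "per 0 = 0" by (simp add: per_def)
lemma per_minus: "per (- n) = - per n" by (simp add: per_def)
lemma per_eq_0_iff [simp]: "per n = 0 \<longleftrightarrow> n = 0" by (simp add: complex_eq_iff)
lemma per_eq_iff [simp]: "per m = per n \<longleftrightarrow> m = n" by (simp add: complex_eq_iff)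
lemma exp_per [simp]: "exp (per n) = 1"
 using exp_eq[of "per n" 0] by (auto simp: per_def mult.assoc)
lemma exp_add_per [simp]: "exp (w + per n) = exp w" by (simp add: exp_add)
lemma exp_eq_per: "exp w = exp z \<longleftrightarrow> (EX n. w = z + per n)"
 using exp_eq[of w z] by (auto simp: per_def mult.assoc)

section \<open>Transcendence excludes periodic lifts\<close>

lemma entire_to_infinity_polynomial:
 assumes f: "f hol_on UNIV" and inf: "!!M::real. EX R. ALL z. norm z > R --> norm (f z) > M"
 shows "EX p. ALL z. f z = poly p z"
proof -
 have "filterlim f at_infinity at_infinity"
  unfolding filterlim_at_infinity[OF order_refl] eventually_at_infinity
  using inf by (meson less_imp_le gt_ex less_le_trans linorder_not_le)
 hence "((%z. inverse (f z)) ---> 0) at_infinity"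
  by (rule filterlim_compose[OF tendsto_inverse_0])
 then obtain a n where a: "!!z. f z = (SUM i<=n. a i * z ^ i)"
  using pole_at_infinity[OF f, of 0] by (auto simp: o_def)
 have "f z = poly (SUM i<=n. monom (a i) i) z" for z
  by (simp add: a poly_sum poly_monom)
 thus ?thesis by blast
qed

lemma continuous_image_cball_bounded:
 fixes f :: "complex => complex"
 assumes "f hol_on UNIV"
 obtains M where "!!z. norm z <= R ==> norm (f z) <= M"
proof -
 have "compact (f ` cball 0 R)"
  using assms by (intro compact_im) (auto intro: hol_cont hol_sub)
 then obtain M where "!!w. w : f ` cball 0 R ==> norm w <= M"
  by (metis bounded_iff compact_imp_bounded)
 thus thesis using that by (metis imageI mem_cball_0)
qed

text \<open>With a period the image of a half-plane would contain a neighbourhood of infinity: it is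
  open, and outside a large disc it is closed, since arguments can be reduced to a compact
  rectangle. There \<open>f\<close> would be large, hence a polynomial. The target coordinate
  \<open>q\<close> is left open: it is \<open>exp\<close> for logarithmic branches and the exterior
  coordinate later.\<close>

lemma no_periodic_lift:
 fixes f G q :: "complex => complex"
 assumes f: "transcendental_entire f" and G: "G hol_on {w. X < Re w}"
  and fG: "!!w. X < Re w ==> f (G w) = q w"
  and q: "!!M. EX x. ALL w. x <= Re w --> norm (q w) > M"
  and c: "c > 0" "!!w. X < Re w ==> G (w + of_real c * \<i>) = G w"
 shows False
proof -
 have hf: "f hol_on UNIV" using f by (simp add: trans_def)
 have contG: "continuous_on {w. X < Re w} G" using G hol_cont by blast
 have opn: "open {w. x < Re w}" for x by (rule open_halfspace_Re_gt)
 have pern: "G (w + of_nat n * (of_real c * \<i>)) = G w" if "X < Re w" for w n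
 proof (induction n)
  case (Suc n)
  have "G (w + of_nat (Suc n) * (of_real c * \<i>)) = G ((w + of_nat n * (of_real c * \<i>)) + of_real c * \<i>)"
   by (simp add: algebra_simps)
  also have "... = G (w + of_nat n * (of_real c * \<i>))" using that by (intro c(2)) simp
  finally show ?case using Suc by simp
 qed simp
 have perz: "G (w + of_int n * (of_real c * \<i>)) = G w" if w: "X < Re w" for w n
 proof (cases "n >= 0")
  case True thus ?thesis using pern[OF w, of "nat n"] by (simp add: of_nat_nat)
 next
  case False
  have "G ((w + of_int n * (of_real c * \<i>)) + of_nat (nat (-n)) * (of_real c * \<i>)) = G (w + of_int n * (of_real c * \<i>))"
   using w by (intro pern) simp
  thus ?thesis using False by (simp add: of_nat_nat)
 qed
 have red: "EX w'. Re w' = Re w & 0 <= Im w' & Im w' <= c & G w' = G w" if w: "X < Re w" for w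
 proof -
  define n where "n = - \<lfloor>Im w / c\<rfloor>"
  have "of_int \<lfloor>Im w / c\<rfloor> <= Im w / c" "Im w / c <= of_int \<lfloor>Im w / c\<rfloor> + 1" by linarith+
  hence "of_int \<lfloor>Im w / c\<rfloor> * c <= Im w / c * c" "Im w / c * c <= (of_int \<lfloor>Im w / c\<rfloor> + 1) * c"
   using c(1) by (intro mult_right_mono; simp)+
  hence "of_int \<lfloor>Im w / c\<rfloor> * c <= Im w" "Im w <= (of_int \<lfloor>Im w / c\<rfloor> + 1) * c"
   using c(1) by simp_all
  thus ?thesis using perz[OF w, of n]
   by (intro exI[of _ "w + of_int n * (of_real c * \<i>)"]) (auto simp: n_def algebra_simps)
 qed
 have Ginf: "EX x>X. ALL w. x <= Re w --> norm (G w) > B" for B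
 proof -
  obtain M where M: "!!z. norm z <= B ==> norm (f z) <= M" using continuous_image_cball_bounded[OF hf, of B] by blast
  obtain x where x: "!!w. x <= Re w ==> norm (q w) > M" using q[of M] by blast
  show ?thesis
  proof (intro exI[of _ "max x (X+1)"] conjI allI impI)
   fix w assume "max x (X + 1) <= Re w"
   hence "norm (f (G w)) > M" using fG x by simp
   thus "norm (G w) > B" using M not_le by blast
  qed simp
 qed
 have "EX R. ALL z. norm z > R --> norm (f z) > M" for M
 proof -
  obtain x where x: "!!w. x <= Re w ==> norm (q w) > M" using q[of M] by blast
  define x0 where "x0 = max x (X+1)"
  have x0: "x0 > X" "!!w. x0 <= Re w ==> norm (q w) > M" using x by (auto simp: x0_def)
  define A where "A = G ` {w. x0 < Re w}"
  have "compact (G ` cbox (Complex x0 0) (Complex x0 c))"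
   using x0 by (intro compact_im cont_sub[OF contG] compact_cbox) (auto simp: in_cbox_complex_iff)
  then obtain R0 where R0: "!!z. z : G ` cbox (Complex x0 0) (Complex x0 c) ==> norm z <= R0"
   by (metis bounded_iff compact_imp_bounded)
  \<comment> \<open>Values of \<open>G\<close> on the line \<open>Re w = x0\<close> stay within
    radius \<open>R\<close>, so beyond it a limit of values from the right of this line is again
    such a value.\<close>
  define R where "R = max R0 0"
  have nR: "norm (G w) <= R" if "Re w = x0" for w
  proof -
   have "X < Re w" using that x0 by simp
   from red[OF this] obtain w' where "Re w' = Re w" "0 <= Im w'" "Im w' <= c" "G w' = G w" by blast
   hence "w' : cbox (Complex x0 0) (Complex x0 c)" using that by (auto simp: in_cbox_complex_iff)
   thus ?thesis using R0[OF imageI[of w' _ G]] `G w' = G w` by (auto simp: R_def)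
  qed
  have oA: "open A" unfolding A_def
  proof (rule open_mapping_thm[OF G opn convex_connected[OF convex_halfspace_Re_gt] opn])
   show "{w. x0 < Re w} <= {w. X < Re w}" using x0 by auto
   show "~ G constant_on {w. X < Re w}"
   proof
    assume "G constant_on {w. X < Re w}"
    then obtain a where a: "!!w. X < Re w ==> G w = a" by (auto simp: constant_on_def)
    obtain y where y: "y > X" "!!w. y <= Re w ==> norm (G w) > norm a" using Ginf by blast
    thus False using a[of "of_real y"] y(2)[of "of_real y"] by auto
   qed
  qed
  have clA: "z : A" if z: "z : closure A" "norm z > R" for z
  proof -
   obtain s where s: "!!n. s n : A" "s ----> z" using z(1) closure_sequential by blast
   have "EX w. x0 <= Re w & 0 <= Im w & Im w <= c & G w = s n" for n
   proof -
    obtain w where "x0 < Re w" "s n = G w" using s(1)[of n] by (auto simp: A_def)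
    thus ?thesis using red[of w] x0 by (metis less_imp_le less_trans)
   qed
   then obtain w where w: "!!n. x0 <= Re (w n) & 0 <= Im (w n) & Im (w n) <= c & G (w n) = s n" by metis
   obtain y where y: "!!w. y <= Re w ==> norm (G w) > norm z + 1" using Ginf[of "norm z + 1"] by blast
   have "\<forall>\<^sub>F n in sequentially. dist (s n) z < 1" using s(2) by (simp add: tendstoD)
   then obtain N where N: "!!n. n >= N ==> dist (s n) z < 1" by (auto simp: eventually_sequentially)
   have wN: "w (n + N) : cbox (Complex x0 0) (Complex y c)" for n
   proof -
    have "norm (s (n+N)) <= norm z + 1" using N[of "n+N"] norm_triangle_ineq2[of "s (n+N)" z] by (simp add: dist_norm)
    hence "Re (w (n+N)) < y" using y[of "w (n+N)"] w[of "n+N"] by force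
    thus ?thesis using w[of "n+N"] by (auto simp: in_cbox_complex_iff)
   qed
   have "compact (cbox (Complex x0 0) (Complex y c))" by (rule compact_cbox)
   then obtain l r where lr: "l : cbox (Complex x0 0) (Complex y c)" "strict_mono r" "((%n. w (n + N)) o r) ----> l"
    using wN unfolding compact_eq_seq_compact_metric seq_compact_def by metis
   have lX: "X < Re l" "x0 <= Re l" using lr(1) x0 by (auto simp: in_cbox_complex_iff)
   have wX: "X < Re (w k)" for k using w[of k] x0 by linarith
   have "(%n. G (w (r n + N))) ----> G l"
    using lr(3) lX wX by (intro continuous_on_tendsto_compose[OF contG]) (auto simp: o_def)
   moreover have "(%n. G (w (r n + N))) ----> z"
   proof -
    have "(%n. s (r n + N)) ----> z"
    proof -
     have "strict_mono (%n. r n + N)" using lr(2) by (simp add: strict_mono_def)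
     thus ?thesis using LIMSEQ_subseq_LIMSEQ[OF s(2)] by (auto simp: o_def)
    qed
    thus ?thesis using w by simp
   qed
   ultimately have zl: "z = G l" using LIMSEQ_unique by blast
   hence "Re l ~= x0" using nR[of l] z(2) by (metis not_less)
   thus "z : A" using lX zl by (auto simp: A_def)
  qed
  have conn: "connected {z::complex. R < norm z}"
  proof -
   have "connected (- cball (0::complex) R)" by (rule connected_complement_bounded_convex) auto
   moreover have "- cball (0::complex) R = {z. R < norm z}" by auto
   ultimately show ?thesis by simp
  qed
  let ?E = "{z::complex. R < norm z}"
  have "openin (top_of_set ?E) (?E Int A)" using oA by (simp add: openin_open_Int)
  moreover have "?E Int A = ?E Int closure A" using clA closure_subset by blast
  hence "closedin (top_of_set ?E) (?E Int A)" by (metis closed_closure closedin_closed_Int)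
  moreover obtain y where "y > X" "!!w. y <= Re w ==> norm (G w) > R" using Ginf by blast
  hence "G (of_real (max y (x0+1))) : ?E Int A" by (auto simp: A_def intro!: imageI)
  ultimately have "?E Int A = ?E" using conn unfolding connected_clopen by blast
  hence "z : A" if "norm z > R" for z using that by blast
  moreover have "norm (f z) > M" if zA: "z : A" for z
  proof -
   obtain w where "x0 < Re w" "z = G w" using zA unfolding A_def by blast
   thus ?thesis using fG[of w] x0 by simp
  qed
  ultimately show ?thesis by blast
 qed
 thus False using entire_to_infinity_polynomial[OF hf] f by (auto simp: trans_def)
qed

text \<open>A disc of radius greater than pi contains two points differing by \<open>per 1\<close>;
  Bloch's theorem, with constant 1/12, finds such a disc in the image. This is the origin of the
  factors \<open>12 * pi\<close> below.\<close>

lemma Bloch_bound: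
 fixes L :: "complex => complex"
 assumes L: "L hol_on ball w r" and r: "r > 0"
  and disj: "!!a b. a : ball w r ==> b : ball w r ==> L a ~= L b + per 1"
 shows "norm (deriv L w) * r <= 12 * pi"
proof (rule ccontr)
 assume "~ ?thesis"
 hence gt: "norm (deriv L w) * r > 12 * pi" by simp
 define r' where "r' = r * norm (deriv L w) / 12"
 have r': "r' > pi" using gt by (simp add: r'_def mult.commute)
 obtain b where b: "ball b r' <= L ` ball w r" using Bloch[OF L r, of r'] unfolding r'_def by blast
 have "b + of_real pi * \<i> : ball b r'" "b - of_real pi * \<i> : ball b r'"
  using r' by (auto simp: dist_norm norm_mult)
 hence "b + of_real pi * \<i> : L ` ball w r" "b - of_real pi * \<i> : L ` ball w r" using b by (blast intro: subsetD)+
 then obtain u v where uv: "u : ball w r" "v : ball w r" "b + of_real pi * \<i> = L u" "b - of_real pi * \<i> = L v"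
  by (elim imageE)
 have "L u = L v + per 1" unfolding uv(3,4)[symmetric] by (simp add: per_def)
 thus False using disj uv by blast
qed

text \<open>The path runs horizontally to abscissa $X+m$, then vertically, then back: this bounds hyperbolic
  length in the half-plane.\<close>

lemma half_plane_increment:
 fixes L :: "complex => complex"
 assumes L: "L hol_on {w. X < Re w}" and C: "!!w. X < Re w ==> norm (deriv L w) * (Re w - X) <= C"
  and ab: "X < Re a" "X < Re b" and m: "Re a - X <= m" "Re b - X <= m" "abs(Im a - Im b) <= m"
 shows "norm (L a - L b) <= C * (ln (m / (Re a - X)) + ln (m / (Re b - X)) + 1)"
proof -
 have C0: "C >= 0" using C[OF ab(1)] ab(1) by (meson mult_nonneg_nonneg norm_ge_zero order_trans diff_ge_0_iff_ge less_imp_le)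
 have op: "open {w. X < Re w}" by (rule open_halfspace_Re_gt)
 have hor: "norm (L (Complex (X + m) (Im w)) - L w) <= C * ln (m / (Re w - X))" if w: "X < Re w" "Re w - X <= m" for w
 proof (cases "Re w - X = m")
  case True
  hence "Complex (X + m) (Im w) = w" by (simp add: complex_eq_iff)
  thus ?thesis using True w by simp
 next
  case False
  define x where "x = Re w - X"
  have x: "x > 0" "x < m" using False w by (auto simp: x_def)
  let ?g = "%t. Complex (X + t) (Im w)"
  have "norm (L (?g m) - L (?g x)) <= C * ln m - C * ln x"
  proof (rule differentiable_bound_general[OF x(2)])
   have gc: "continuous_on {x..m} ?g"
    unfolding Complex_eq by (intro cont_intros)
   show "continuous_on {x..m} (%t. L (?g t))"
    by (rule cont_comp[OF hol_cont[OF L] gc]) (use x in auto)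
   show "continuous_on {x..m} (%t. C * ln t)" using x by (intro cont_intros) auto
   fix t assume t: "x < t" "t < m"
   have "(L has_field_derivative deriv L (?g t)) (at (?g t))"
    using L op t x by (intro holomorphic_derivI) auto
   moreover have "(?g has_vector_derivative 1) (at t)"
    unfolding Complex_eq by (auto intro!: derivative_eq_intros simp: has_vector_derivative_def scaleR_conv_of_real)
   ultimately show "((%t. L (?g t)) has_vector_derivative 1 * deriv L (?g t)) (at t)"
    using field_vector_diff_chain_at[of ?g 1 t L "deriv L (?g t)"] by (simp add: o_def)
   show "((%t. C * ln t) has_vector_derivative C * (1/t)) (at t)"
    using t x by (auto intro!: derivative_eq_intros simp: has_real_derivative_iff_has_vector_derivative[symmetric])
   show "norm (1 * deriv L (?g t)) <= C * (1/t)"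
    using C[of "?g t"] t x by (simp add: field_simps)
  qed
  moreover have "?g x = w" by (simp add: x_def complex_eq_iff)
  moreover have "C * ln m - C * ln x = C * ln (m / x)" using x by (simp add: ln_div right_diff_distrib)
  ultimately show ?thesis by (simp add: x_def)
 qed
 have m0: "m > 0" using ab m by auto
 let ?a = "Complex (X + m) (Im a)" and ?b = "Complex (X + m) (Im b)"
 have ver: "norm (L ?a - L ?b) <= C / m * norm (?a - ?b)"
 proof (rule diff_bound[where f = L and f' = "deriv L" and S = "closed_segment ?a ?b"])
  have seg: "Re z = X + m" if zz: "z : closed_segment ?a ?b" for z
  proof -
   obtain u where "z = (1 - u) *\<^sub>R ?a + u *\<^sub>R ?b" using zz unfolding in_segment by blast
   hence "Re z = (1 - u) * (X + m) + u * (X + m)" by simp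
   thus ?thesis by (simp add: algebra_simps)
  qed
  fix z assume z: "z : closed_segment ?a ?b"
  show "(L has_field_derivative deriv L z) (at z within closed_segment ?a ?b)"
   using holomorphic_derivI[OF L op, of z] seg[OF z] m0 by (auto intro: has_field_derivative_at_within)
  show "norm (deriv L z) <= C / m" using C[of z] seg[OF z] m0 by (simp add: field_simps)
 qed auto
 have "norm (?a - ?b) <= m" using m(3) cmod_eq_Im[of "?a - ?b"] by simp
 hence "C / m * norm (?a - ?b) <= C" using m0 C0 by (simp add: divide_simps mult_left_mono)
 hence ver': "norm (L ?a - L ?b) <= C" using ver by linarith
 have "norm (L a - L b) <= norm (L ?a - L a) + norm (L ?a - L ?b) + norm (L ?b - L b)"
  using norm_triangle_ineq4[of "L ?a - L b" "L ?a - L a"] norm_triangle_ineq[of "L ?a - L ?b" "L ?b - L b"] by simp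
 also have "... <= C * ln (m / (Re a - X)) + C + C * ln (m / (Re b - X))"
  using hor[OF ab(1) m(1)] hor[OF ab(2) m(2)] ver' by linarith
 finally show ?thesis by (simp add: algebra_simps)
qed

section \<open>Inverse branches in logarithmic coordinates\<close>

lemma nonvanishing_log:
 fixes G :: "complex => complex"
 assumes "open Om" "convex Om" "G hol_on Om" "!!w. w : Om ==> G w ~= 0"
 obtains L where "L hol_on Om" "!!w. w : Om ==> exp (L w) = G w"
 using simply_connected_eq_holomorphic_log[OF assms(1)] convex_imp_simply_connected[OF assms(2)] assms(3,4)
 by metis

text \<open>All inverse branches of the logarithmic transform of \<open>f\<close> at once, one for
  each tract and choice of logarithm, on a common half-plane. Tracts occur only as images of these
  maps.\<close>

definition log_branches :: "(complex => complex) => real => (complex => complex) set" where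
 "log_branches f X = {L. L hol_on {w. X < Re w} & (ALL w. X < Re w --> f (exp (L w)) = exp w)}"

text \<open>The second conjunct keeps 0 out of every tract, so that preimages have a
  logarithm.\<close>

definition log_level :: "(complex => complex) => real => bool" where
 "log_level f X \<longleftrightarrow> singular_values f <= cball 0 (exp X) & norm (f 0) <= exp X"

lemma log_level_mono: "log_level f X ==> X <= Y ==> log_level f Y"
 unfolding log_level_def by (meson exp_le_cancel_iff order_trans subset_cball)

lemma log_level_exists:
 assumes "bounded (singular_values f)" obtains X where "X >= Y" "log_level f X"
proof -
 obtain B where B: "singular_values f <= cball 0 B" using bounded_subset_ballD[OF assms, of 0] ball_subset_cball by blast
 define X where "X = max Y (ln (max 1 (max B (norm (f 0)))))"
 have "exp X >= max 1 (max B (norm (f 0)))"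
  unfolding X_def by (metis exp_le_cancel_iff exp_ln less_max_iff_disj max.cobounded2 zero_less_one)
 hence "exp X >= B" "exp X >= norm (f 0)" by auto
 hence "log_level f X" unfolding log_level_def using B subset_cball[of B "exp X" 0] by auto
 thus thesis using that[of X] by (simp add: X_def)
qed

context
 fixes f :: "complex => complex" and X :: real
 assumes tr: "transcendental_entire f" and lev: "log_level f X"
begin

lemma log_level_regular: "{z. exp X < norm z} Int singular_values f = {}"
 using lev by (auto simp: log_level_def)

lemma entire: "f hol_on UNIV" using tr by (simp add: trans_def)

lemma log_branch_deriv_nonzero:
 assumes "L : log_branches f X" "X < Re w"
 shows "deriv (%u. f (exp u)) (L w) ~= 0"
proof -
 have "f (exp (L w)) = exp w" using assms by (auto simp: log_branches_def)
 moreover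
 have "exp w : {z. exp X < norm z}" using assms(2) by simp
 hence "exp w ~: singular_values f" using log_level_regular by blast
 ultimately have "deriv f (exp (L w)) ~= 0" using deriv_nonzero_over_regular by metis
 moreover have "((%u. f (exp u)) has_field_derivative deriv f (exp (L w)) * exp (L w)) (at (L w))"
  by (rule DERIV_chain2[where f=f and g=exp]) (use entire in "auto intro: holomorphic_derivI")
 ultimately show ?thesis by (simp add: DERIV_imp_deriv)
qed

lemma log_branch_unique:
 assumes "L : log_branches f X" "M : log_branches f X" "X < Re a" "L a = M a" "X < Re w"
 shows "L w = M w"
proof (rule unique_lift[where f = "%u. f (exp u)" and h = L and k = M and S = "{w. X < Re w}" and a = a])
 have "(f o exp) hol_on UNIV"
  by (intro holomorphic_on_compose holomorphic_on_exp hol_sub[OF entire]) auto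
 thus "(%u. f (exp u)) hol_on UNIV" by (simp add: o_def)
 show "continuous_on {w. X < Re w} L" "continuous_on {w. X < Re w} M"
  using assms by (auto simp: log_branches_def intro: hol_cont)
qed (use assms log_branch_deriv_nonzero in "auto simp: log_branches_def convex_connected convex_halfspace_Re_gt")

text \<open>Lift \<open>exp\<close> through \<open>f\<close>, take a logarithm of the zero-free lift
  and correct it by a period.\<close>

lemma log_branch_through:
 assumes "f (exp l) = exp a" "X < Re a"
 obtains L where "L : log_branches f X" "L a = l"
proof -
 have cv: "open {w. X < Re w}" "convex {w. X < Re w}" by (auto simp: open_halfspace_Re_gt convex_halfspace_Re_gt)
 obtain G where G: "G hol_on {w. X < Re w}" "G a = exp l" "!!w. w : {w. X < Re w} ==> f (G w) = exp w"
 proof (rule holomorphic_lift[OF entire _ log_level_regular cv, of exp a "exp l"])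
  have "{z. exp X < norm z} = - cball 0 (exp X)" by auto
  thus "open {z::complex. exp X < norm z}" by (metis closed_cball open_Compl)
 qed (use assms in "auto intro: hol_intros")
 have G0: "G w ~= 0" if "w : {w. X < Re w}" for w
 proof
  assume "G w = 0"
  hence "f 0 = exp w" using G(3)[OF that] by simp
  hence "norm (f 0) = exp (Re w)" by simp
  thus False using lev that unfolding log_level_def by (simp add: not_le[symmetric])
 qed
 obtain L where L: "L hol_on {w. X < Re w}" "!!w. w : {w. X < Re w} ==> exp (L w) = G w"
  using nonvanishing_log[OF cv G(1) G0] by metis
 have "exp (L a) = exp l" using L(2)[of a] G(2) assms(2) by simp
 then obtain n where n: "L a = l + per n" using exp_eq_per by blast
 have "(%w. L w + per (-n)) : log_branches f X"
  unfolding log_branches_def using L G(3) by (auto intro!: hol_intros)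
 moreover have "L a + per (-n) = l" using n by (simp add: per_minus)
 ultimately show thesis by (rule that)
qed

lemma log_branch_shift:
 assumes "L : log_branches f X"
 shows "(%w. L (w + per m) + per n) : log_branches f X"
proof -
 have "(L o (%w. w + per m)) hol_on {w. X < Re w}"
 proof (rule hol_comp)
  show "L hol_on {w. X < Re w}" using assms by (simp add: log_branches_def)
 qed (auto intro: hol_intros)
 thus ?thesis using assms unfolding log_branches_def by (auto intro!: hol_intros simp: o_def)
qed

text \<open>The arguments differ by a period, and by uniqueness that would be a period of
  \<open>exp o L\<close>, which \<open>no_periodic_lift\<close> excludes. Images of branches are
  therefore disjoint from their own translates, as \<open>Bloch_bound\<close> requires.\<close>

lemma log_branch_inj:
 assumes L: "L : log_branches f X" and w: "X < Re w" "X < Re u" and eq: "L u = L w + per n"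
 shows "u = w" "n = 0"
proof -
 have "exp (L u) = exp (L w)" using eq by simp
 hence "exp u = exp w" using L w unfolding log_branches_def by (metis (mono_tags, lifting) mem_Collect_eq)
 then obtain j where j: "u = w + per j" using exp_eq_per by blast
 have "j = 0"
 proof (rule ccontr)
  assume j0: "j ~= 0"
  have sh: "L (v + per j) + per (-n) = L v" if "X < Re v" for v
   using log_branch_unique[OF log_branch_shift[OF L, of j "-n"] L w(1) _ that] eq j by (simp add: per_minus)
  have Lp: "exp (L (v + per j)) = exp (L v)" if "X < Re v" for v
   using sh[OF that] by (metis exp_add_per)
  have "exp (L (v + of_real (2 * pi * abs(of_int j)) * \<i>)) = exp (L v)" if "X < Re v" for v
  proof (cases "j > 0")
   case True
   hence "per j = of_real (2 * pi * abs(of_int j)) * \<i>" by (simp add: per_def)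
   thus ?thesis using Lp that by metis
  next
   case False
   hence "per j = - (of_real (2 * pi * abs(of_int j)) * \<i>)" by (simp add: per_def)
   thus ?thesis using Lp[of "v + of_real (2 * pi * abs(of_int j)) * \<i>"] that by simp
  qed
  moreover have "(exp o L) hol_on {w. X < Re w}"
   using L by (intro holomorphic_on_compose hol_intros) (auto simp: log_branches_def)
  moreover have "EX x. ALL w. x <= Re w --> norm (exp w) > M" for M
  proof (intro exI[of _ "ln (abs M + 1) + 1"] allI impI)
   fix w assume "ln (abs M + 1) + 1 <= Re w"
   hence "ln (abs M + 1) < Re w" by simp
   hence "exp (ln (abs M + 1)) < exp (Re w)" by (simp only: exp_less_cancel_iff)
   thus "M < norm (exp w)" by simp
  qed
  ultimately show False
   using no_periodic_lift[OF tr, of "exp o L" X exp "2 * pi * abs(of_int j)"] j0 L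
   by (simp add: log_branches_def)
 qed
 thus "u = w" "n = 0" using j eq by auto
qed

lemma log_branch_deriv_bound:
 assumes L: "L : log_branches f X" and w: "X < Re w"
 shows "norm (deriv L w) * (Re w - X) <= 12 * pi"
proof (rule Bloch_bound)
 have sub: "ball w (Re w - X) <= {w. X < Re w}"
 proof
  fix v assume "v : ball w (Re w - X)"
  thus "v : {w. X < Re w}" using abs_Re_le_cmod[of "w - v"] by (auto simp: dist_norm)
 qed
 thus "L hol_on ball w (Re w - X)" using L hol_sub by (auto simp: log_branches_def)
 show "L a ~= L b + per 1" if ab: "a : ball w (Re w - X)" "b : ball w (Re w - X)" for a b
 proof
  assume "L a = L b + per 1"
  moreover have "X < Re a" "X < Re b" using ab sub by blast+
  ultimately show False using log_branch_inj(2)[OF L, of b a 1] by simp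
 qed
qed (use w in simp)

end

section \<open>Slope and head start for functions of finite order\<close>

text \<open>A component of the complement of a closed connected unbounded set has a connected
  unbounded complement, hence is simply connected. The logarithm is chosen component by
  component.\<close>

lemma log_on_complement:
 assumes "closed G" "connected G" "~ bounded G" "0 : G"
 obtains h where "h hol_on - G" "!!z. z ~: G ==> exp (h z) = z"
proof -
 have "EX h. h hol_on V & (ALL z:V. z = exp (h z))" if V: "V : components (- G)" for V
 proof -
  have o: "open V" using open_components[OF _ V] assms(1) by (simp add: open_Compl)
  have "connected (- V)" using component_complement_connected[OF assms(2)] V by (simp add: Compl_eq_Diff_UNIV)
  moreover have G: "G <= - V" using in_components_subset[OF V] by blast
  ultimately have "components (- V) = {- V}" using assms(4) by (auto simp: components_eq_sing_iff)
  moreover have "~ bounded (- V)" using G assms(3) bounded_subset by blast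
  ultimately have "simply_connected V"
   using simply_connected_eq_unbounded_complement_components[OF o] in_components_connected[OF V] by simp
  moreover have "(%z. z) hol_on V" "ALL z:V. z ~= 0" using G assms(4) by (auto intro: hol_intros)
  ultimately show ?thesis using simply_connected_eq_holomorphic_log[OF o] by blast
 qed
 then obtain H where H: "!!V. V : components (- G) ==> H V hol_on V & (ALL z:V. z = exp (H V z))" by metis
 let ?C = "connected_component_set (- G)"
 have C: "?C z : components (- G)" "z : ?C z" "open (?C z)" if "z ~: G" for z
  using that assms(1) by (auto simp: components_def open_connected_component open_Compl)
 show thesis
 proof (rule that[of "%z. H (?C z) z"])
  show "exp (H (?C z) z) = z" if "z ~: G" for z using H[OF C(1)[OF that]] C(2)[OF that] by metis
  have "(%z. H (?C z) z) field_differentiable at z" if z: "z ~: G" for z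
  proof -
   have "H (?C z) hol_on ?C z" using H C(1)[OF z] by blast
   hence "(%z. H (?C z) z) hol_on ?C z"
    by (rule holomorphic_transform) (metis connected_component_eq)
   thus ?thesis using C[OF z] by (auto simp: holomorphic_on_open field_differentiable_def)
  qed
  thus "(%z. H (?C z) z) hol_on - G"
   by (auto simp: holomorphic_on_def intro: field_differentiable_at_within)
 qed
qed

text \<open>Follow the circle about 0 through z up to its first encounter with G.\<close>

lemma log_along_circle:
 assumes G: "closed G" "0 : G" and h: "continuous_on (- G) h" "!!z. z ~: G ==> exp (h z) = z"
  and z: "z ~: G" and p: "p : G" "norm p = norm z"
 obtains q where "q : G" "norm q = norm z"
  "!!V. open V ==> q : V ==> EX y:V. y ~: G & norm y = norm z & abs(Im (h y) - Im (h z)) <= 2 * pi"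
proof -
 define r where "r = norm z"
 have r: "0 < r" using z G(2) by (auto simp: r_def)
 define ci where "ci tht = of_real r * cis (Arg z + tht)" for tht
 have z0: "z = ci 0" using rcis_cmod_Arg[of z] by (simp add: ci_def r_def rcis_def)
 have nci: "norm (ci tht) = r" for tht using r by (simp add: ci_def norm_mult)
 have cont: "continuous_on S ci" for S unfolding ci_def cis_conv_exp by (intro cont_intros)
 \<comment> \<open>The angle from \<open>z\<close> to \<open>p\<close>, counted counterclockwise;
   \<open>ph'\<close> brings it into [0, 2 pi].\<close>
 define ph where "ph = Arg p - Arg z"
 define ph' where "ph' = (if 0 <= ph then ph else ph + 2 * pi)"
 have "ci ph = p" using rcis_cmod_Arg[of p] p(2) by (simp add: ci_def ph_def r_def rcis_def)
 moreover have "ci (ph + 2 * pi) = ci ph" by (simp add: ci_def cis_mult[symmetric] add.assoc[symmetric])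
 ultimately have ph: "ci ph' : G" "0 <= ph'" "ph' <= 2 * pi"
  using p(1) Arg_bounded[of p] Arg_bounded[of z] by (auto simp: ph'_def ph_def)
 define S where "S = {0..2*pi} Int ci -` G"
 have "closed S" unfolding S_def by (intro continuous_closed_preimage cont G) auto
 moreover have S: "ph' : S" "bdd_below S" using ph by (auto simp: S_def)
 ultimately have "Inf S : S" by (intro closed_contains_Inf) auto
 moreover define s where "s = Inf S"
 ultimately have s: "ci s : G" "0 < s" "s <= 2 * pi" using z z0 by (auto simp: S_def less_le)
 have before: "ci tht ~: G" if "0 <= tht" "tht < s" for tht
  using that s cInf_lower[OF _ S(2), of tht] by (force simp: S_def s_def)
 have Imh: "h (ci tht) = h z + \<i> * of_real tht" if th: "0 <= tht" "tht < s" for tht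
 proof (rule unique_lift[where f = exp and S = "{0..<s}" and h = "%tht. h (ci tht)" and a = 0])
  show "continuous_on {0..<s} (%tht. h (ci tht))"
   by (rule cont_comp[OF h(1) cont]) (use before in auto)
  show "continuous_on {0..<s} (%tht. h z + \<i> * of_real tht)" by (intro cont_intros)
  fix x assume "x : {0..<s}"
  hence "exp (h (ci x)) = ci x" using before by (simp add: h(2))
  also have "... = z * exp (\<i> * of_real x)" by (subst z0) (simp add: ci_def cis_mult[symmetric] cis_conv_exp[symmetric])
  finally show "exp (h (ci x)) = exp (h z + \<i> * of_real x)" by (simp add: exp_add h(2)[OF z])
 qed (use th z0 in "auto intro: holomorphic_on_exp simp: DERIV_imp_deriv[OF DERIV_exp]")
 show thesis
 proof (rule that[OF s(1)])
  show "norm (ci s) = norm z" using nci by (simp add: r_def)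
  fix V assume V: "open V" "ci s : V"
  have "isCont ci s" using cont[of UNIV] by (simp add: cont_at)
  hence "\<forall>\<^sub>F tht in at s. ci tht : V" unfolding isCont_def by (rule topological_tendstoD[OF _ V])
  then obtain d where d: "d > 0" "!!tht. tht ~= s ==> dist tht s < d ==> ci tht : V" unfolding eventually_at by auto
  define tht where "tht = max 0 (s - d/2)"
  have tht: "0 <= tht" "tht < s" "ci tht : V" using d s by (auto simp: tht_def dist_real_def abs_if intro!: d(2))
  show "EX y:V. y ~: G & norm y = norm z & abs(Im (h y) - Im (h z)) <= 2 * pi"
   using tht s(3) before[of tht] Imh[of tht] nci[of tht] by (intro bexI[of _ "ci tht"]) (auto simp: r_def)
 qed
qed

text \<open>The unit disc is mapped below the level, which forces the values of branches to have
  positive real part.\<close>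

definition nice_level :: "(complex => complex) => real => bool" where
 "nice_level f X \<longleftrightarrow> log_level f X & 0 <= X & (ALL z. norm z <= 1 --> norm (f z) <= exp X)"

lemma nice_level_mono: "nice_level f X ==> X <= Y ==> nice_level f Y"
 unfolding nice_level_def by (meson exp_le_cancel_iff order_trans log_level_mono)

lemma nice_level_exists:
 assumes "f : class_B" obtains X where "nice_level f X"
proof -
 have f: "f hol_on UNIV" "bounded (singular_values f)" using assms by (auto simp: class_B_def trans_def)
 obtain M where M: "!!z. norm z <= 1 ==> norm (f z) <= M" using continuous_image_cball_bounded[OF f(1)] by blast
 obtain X where X: "X >= max 0 (ln (max M 1))" "log_level f X" using log_level_exists[OF f(2)] by blast
 have "max M 1 <= exp X" using X(1) by (metis exp_le_cancel_iff exp_ln less_max_iff_disj max.bounded_iff zero_less_one)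
 thus thesis using that[of X] X M unfolding nice_level_def by (meson max.bounded_iff order_trans)
qed

lemma transcendental_unbounded:
 assumes "transcendental_entire f" obtains z where "norm (f z) > B"
proof -
 have "~ bounded (range f)"
 proof
  assume b: "bounded (range f)"
  have "f hol_on UNIV" using assms by (simp add: trans_def)
  then obtain c where "!!z. f z = c" using Liouville_theorem b by (metis constant_on_def UNIV_I)
  hence "ALL z. f z = poly [:c:] z" by simp
  thus False using assms unfolding trans_def by blast
 qed
 thus thesis using that unfolding bounded_iff by (auto simp: not_le)
qed

lemma log_branch_exists:
 assumes "transcendental_entire f" and lev: "log_level f X"
 obtains L where "L : log_branches f X"
proof -
 obtain z where z: "norm (f z) > exp X" using transcendental_unbounded[OF assms(1)] by blast
 have "z ~= 0" using z lev by (auto simp: log_level_def)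
 moreover have "f z ~= 0" using z by (metis exp_gt_zero less_asym norm_zero)
 ultimately have "f (exp (Ln z)) = exp (Ln (f z))" by simp
 moreover have "X < Re (Ln (f z))" using z `f z ~= 0` by (metis Re_Ln exp_ln_iff exp_less_cancel_iff zero_less_norm_iff)
 ultimately show thesis using log_branch_through[OF assms(1) lev] that by metis
qed

abbreviation sloped :: "real => real => complex => complex => bool" where
 "sloped al be x y == abs(Im x - Im y) <= al * max (Re x) (Re y) + be"

text \<open>The margin 1 keeps arguments off the line \<open>Re x = X\<close>, where the derivative
  bound for branches degenerates.\<close>

definition slope_bound :: "(complex => complex) => real => real => real => bool" where
 "slope_bound f X al be \<longleftrightarrow> 0 <= al & 0 <= be &
   (ALL L : log_branches f X. ALL x y. X + 1 <= Re x --> X + 1 <= Re y --> sloped al be (L x) (L y))"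

text \<open>A lead of the images under an inverse branch comes from a lead of the arguments, with
  one factor \<open>K\<close> and every large additive constant. The growth from \<open>M\<close> to
  \<open>4 * M\<close> pays for later changes of coordinate.\<close>

definition head_start_bound :: "(complex => complex) => real => real => real => real => bool" where
 "head_start_bound f X al be K \<longleftrightarrow>
   (EX M0. ALL M>=M0. ALL L:log_branches f X. ALL x y. X + 1 <= Re x --> X + 1 <= Re y -->
    sloped al be x y --> Re (L y) >= K * Re (L x) + M --> Re y >= K * Re x + 4 * M)"

locale finite_order_level =
 fixes g :: "complex => complex" and X A rh :: real
 assumes tr: "transcendental_entire g" and nice: "nice_level g X"
  and A: "A >= 0" and rh: "rh > 0" and order: "!!z. norm (g z) <= exp (A + norm z powr rh)"
begin

abbreviation "B == log_branches g X"

lemma lev: "log_level g X" and X0: "X >= 0" and unit: "norm z <= 1 ==> norm (g z) <= exp X"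
 using nice by (auto simp: nice_level_def)

lemma BD: assumes "L : B" shows "L hol_on {w. X < Re w}" and "X < Re w ==> g (exp (L w)) = exp w"
 using assms by (auto simp: log_branches_def)

lemmas deriv_bound = log_branch_deriv_bound[OF tr lev]
lemmas B_inj = log_branch_inj[OF tr lev]
lemmas B_unique = log_branch_unique[OF tr lev]
lemmas B_shift = log_branch_shift[OF tr lev]

lemma B_pos: assumes "L : B" "X < Re w" shows "0 < Re (L w)"
proof (rule ccontr)
 assume "~ ?thesis"
 hence "norm (g (exp (L w))) <= exp X" by (intro unit) simp
 thus False using BD(2)[OF assms] assms(2) by simp
qed

text \<open>The growth hypothesis in logarithmic coordinates: \<open>Re w\<close> is at most
  \<open>A + exp (rh * Re (L w))\<close>. Later uses of finite order pass through this
  inequality.\<close>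

lemma ln_order: assumes "L : B" "X < Re w" shows "ln (Re w) <= rh * Re (L w) + ln (A + 1)"
proof -
 have "norm (g (exp (L w))) <= exp (A + exp (Re (L w)) powr rh)" using order[of "exp (L w)"] by simp
 hence "Re w <= A + exp (rh * Re (L w))" using BD(2)[OF assms] by (simp add: powr_def)
 also have "... <= (A + 1) * exp (rh * Re (L w))"
 proof -
  have "1 <= exp (rh * Re (L w))" using B_pos[OF assms] rh by simp
  hence "A * 1 <= A * exp (rh * Re (L w))" using A by (intro mult_left_mono)
  thus ?thesis by (simp add: algebra_simps)
 qed
 finally have "ln (Re w) <= ln ((A + 1) * exp (rh * Re (L w)))" using assms X0 by (intro ln_mono) auto
 thus ?thesis using A by (simp add: ln_mult)
qed

lemma B_same_tract:
 assumes "L : B" "M : B" "X < Re u" "X < Re w" "exp (L u) = exp (M w)"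
 obtains m n where "u = w + per m" "!!v. X < Re v ==> L (v + per m) = M v + per n"
proof -
 have "exp u = exp w" using assms BD(2) by metis
 then obtain m where m: "u = w + per m" using exp_eq_per by blast
 obtain n where n: "L u = M w + per n" using assms(5) exp_eq_per by blast
 have eq: "L (v + per m) + per (-n) = M v" if "X < Re v" for v
  using B_unique[OF B_shift[OF assms(1), of m "-n"] assms(2,4) _ that] n m by (simp add: per_minus)
 have "L (v + per m) = M v + per n" if "X < Re v" for v
  using eq[OF that] by (simp add: per_minus algebra_simps)
 thus thesis using that m by blast
qed

lemma exp_B_inj: assumes "L : B" "X < Re u" "X < Re w" "exp (L u) = exp (L w)" shows "u = w"
 using assms B_inj exp_eq_per by metis

lemma B_open: assumes "L : B" "open S" "S <= {w. X < Re w}" shows "open ((%u. exp (L u)) ` S)"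
proof -
 have "(exp o L) hol_on S"
  using BD(1)[OF assms(1)] assms(3) by (intro holomorphic_on_compose hol_intros) (rule hol_sub)
 thus ?thesis
 proof (subst open_mapping_thm3[of "%u. exp (L u)" S])
  show "inj_on (%u. exp (L u)) S" using exp_B_inj[OF assms(1)] assms(3) by (auto simp: inj_on_def)
 qed (use assms in "auto simp: o_def")
qed

lemma B_lipschitz:
 assumes L: "L : B" and S: "convex S" "S <= {w. X + d <= Re w}" "d > 0" and uw: "u : S" "w : S"
 shows "norm (L u - L w) <= 12 * pi / d * norm (u - w)"
proof (rule diff_bound[OF S(1) _ _ uw(1,2), where f' = "deriv L"])
 fix z assume "z : S"
 hence z: "X + d <= Re z" using S by auto
 thus "(L has_field_derivative deriv L z) (at z within S)"
  using holomorphic_derivI[OF BD(1)[OF L] open_halfspace_Re_gt, of z] S(3) by (auto intro: has_field_derivative_at_within)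
 have "norm (deriv L z) * d <= norm (deriv L z) * (Re z - X)" using z by (intro mult_left_mono) auto
 also have "... <= 12 * pi" using deriv_bound[OF L] z S(3) by simp
 finally show "norm (deriv L z) <= 12 * pi / d" using S(3) by (simp add: field_simps)
qed

end

text \<open>The image of the positive axis under a reference branch, joined to 0, separates the tracts;
  the argument along it grows at most linearly in terms of the logarithmic modulus.\<close>

context finite_order_level begin

text \<open>The path from \<open>X + 1\<close> to \<open>t\<close> has hyperbolic length about
  \<open>ln t\<close>, and \<open>ln_order\<close> bounds \<open>ln t\<close> linearly by the real
  part of the image.\<close>

lemma B_ray:
 assumes L: "L : B" "X + 1 <= t"
 shows "abs(Im (L (of_real t))) <= 12 * pi * (rh * Re (L (of_real t)) + ln (A + 1) + 1) + abs(Im (L (of_real (X+1))))"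
proof -
 have "norm (L (of_real t) - L (of_real (X+1))) <= 12 * pi * (ln ((t - X) / (t - X)) + ln ((t - X) / 1) + 1)"
  using half_plane_increment[OF BD(1)[OF L(1)] deriv_bound[OF L(1)], of "of_real t" "of_real (X+1)" "t - X"] assms by simp
 also have "... <= 12 * pi * (ln t + 1)" using assms X0 by simp
 also have "... <= 12 * pi * (rh * Re (L (of_real t)) + ln (A + 1) + 1)"
  using ln_order[OF L(1), of "of_real t"] assms by (intro mult_left_mono) auto
 finally show ?thesis using abs_Im_le_cmod[of "L (of_real t) - L (of_real (X+1))"] by simp
qed

lemma B_ray_big:
 assumes "L : B" obtains T where "T >= X + 1" "!!t. t >= T ==> b < norm (exp (L (of_real t)))"
proof -
 define e where "e = rh * ln (max b 1) + ln (A + 1)"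
 show thesis
 proof (rule that[of "max (X + 1) (exp e + 1)"])
  fix t assume t: "t >= max (X + 1) (exp e + 1)"
  hence "exp e < t" by simp
  hence "e < ln t" by (metis exp_gt_zero ln_exp ln_less_cancel_iff order.strict_trans)
  hence "rh * ln (max b 1) < rh * Re (L (of_real t))" using ln_order[OF assms, of "of_real t"] t by (simp add: e_def)
  hence "ln (max b 1) < Re (L (of_real t))" using mult_less_cancel_left_pos[OF rh] by blast
  hence "exp (ln (max b 1)) < norm (exp (L (of_real t)))" by (simp only: norm_exp_eq_Re exp_less_cancel_iff)
  moreover have "b <= exp (ln (max b 1))" by simp
  ultimately show "b < norm (exp (L (of_real t)))" by linarith
 qed simp
qed

lemma B_log_constant:
 assumes "L : B" "connected S" "S <= {w. X < Re w}" and h: "continuous_on V h" "!!z. z : V ==> exp (h z) = z"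
  and V: "!!w. w : S ==> exp (L w) : V"
 obtains c where "!!w. w : S ==> L w = h (exp (L w)) + c"
proof (cases "S = {}")
 case False
 then obtain s where s: "s : S" by blast
 have cL: "continuous_on S L"
  using hol_cont[OF BD(1)[OF assms(1)]] assms(3) cont_sub by blast
 have e: "exp (L s) = exp (h (exp (L s)))" using h(2) V s by simp
 show thesis
 proof (rule that[of "L s - h (exp (L s))"], rule unique_lift[where f = exp and S = S and a = s and h = L])
  show "continuous_on S (%w. h (exp (L w)) + (L s - h (exp (L s))))"
   by (intro cont_intros cont_comp[OF h(1)] cL) (use V in auto)
  show "exp (L x) = exp (h (exp (L x)) + (L s - h (exp (L s))))" if "x : S" for x
   using e h(2)[OF V[OF that]] by (simp add: exp_add exp_diff)
 qed (use s cL assms(2) in "auto intro: holomorphic_on_exp simp: DERIV_imp_deriv[OF DERIV_exp]")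
qed (use that in auto)

text \<open>One logarithm \<open>h\<close> on the complement of \<open>G\<close> serves all tracts.
  A branch whose far part misses \<open>G\<close> is \<open>h\<close> plus a constant there; a
  branch meeting \<open>G\<close> shares its tract with \<open>L0\<close> and is a translate of it.
  On each circle \<open>Im h\<close> is compared with the argument along the ray.\<close>

lemma slope_normalised:
 obtains al be Y where "al >= 0" "Y >= X" "!!L. L : B ==> EX c. ALL w. Y < Re w --> abs(Im (L w) - c) <= al * Re (L w) + be"
proof -
 obtain L0 where L0: "L0 : B" using log_branch_exists[OF tr lev] by blast
 define ga where "ga t = exp (L0 (of_real t))" for t :: real
 have cga: "continuous_on {X+1..} ga" unfolding ga_def
  by (intro cont_intros cont_comp[OF hol_cont[OF BD(1)[OF L0]]]) auto
 have entg: "g hol_on UNIV" using tr by (simp add: trans_def)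
 have level: "EX Y>=C. ALL z. norm z <= b --> norm (g z) <= exp Y" for b C
 proof -
  obtain M where M: "!!z. norm z <= b ==> norm (g z) <= M" using continuous_image_cball_bounded[OF entg] by blast
  have "M <= exp (ln (max M 1))" by simp
  also have "... <= exp (max C (ln (max M 1)))" by (subst exp_le_cancel_iff) simp
  finally show ?thesis using M by (intro exI[of _ "max C (ln (max M 1))"]) force
 qed
 \<comment> \<open>Beyond radius \<open>R\<close> the set \<open>G\<close> consists of the ray only;
   beyond \<open>R1\<close> a point of the ray has parameter larger than \<open>X1 + 1\<close>.
   Above the levels \<open>X1\<close> and \<open>X2\<close> images under branches lie outside these
   discs.\<close>
 define R where "R = norm (ga (X+1))"
 obtain X1 where X1: "X1 >= X + 1" "!!z. norm z <= R ==> norm (g z) <= exp X1" using level by blast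
 have "compact (ga ` {X+1..X1+1})" by (intro compact_im cont_sub[OF cga]) auto
 then obtain R1 where R1: "!!t. X + 1 <= t ==> t <= X1 + 1 ==> norm (ga t) <= R1"
  using compact_imp_bounded by (fastforce simp: bounded_iff)
 obtain X2 where X2: "X2 >= X1" "!!z. norm z <= R1 ==> norm (g z) <= exp X2" using level by blast
 have far: "b < norm (exp (L w))" if "L : B" "Y < Re w" "X <= Y" "!!z. norm z <= b ==> norm (g z) <= exp Y" for L w b Y
  using that(4)[of "exp (L w)"] BD(2)[OF that(1), of w] that(2,3) by (force simp: not_less)
 define G where "G = closed_segment 0 (ga (X+1)) Un ga ` {X+1..}"
 have "open (- ga ` {X+1..})"
 proof (subst open_subopen, rule ballI)
  fix z assume z: "z : - ga ` {X+1..}"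
  obtain T where T: "T >= X + 1" "!!t. t >= T ==> norm z + 1 < norm (ga t)" using B_ray_big[OF L0, of "norm z + 1"] unfolding ga_def by blast
  have "compact (ga ` {X+1..T})" by (intro compact_im cont_sub[OF cga]) auto
  hence "open (ball z 1 Int - ga ` {X+1..T})" by (intro open_Int open_ball open_Compl compact_imp_closed)
  moreover have "ga t ~: ball z 1" if "t >= T" for t
   using T(2)[OF that] norm_triangle_ineq2[of "ga t" z] by (simp add: dist_norm norm_minus_commute)
  hence "ga t : ga ` {X+1..T}" if "ga t : ball z 1" "X + 1 <= t" for t using that by (meson atLeastAtMost_iff imageI linear)
  hence "ball z 1 Int ga ` {X+1..} <= ga ` {X+1..T}" by blast
  hence "ball z 1 Int - ga ` {X+1..T} <= - ga ` {X+1..}" by blast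
  ultimately show "EX T. open T & z : T & T <= - ga ` {X+1..}" using z by (intro exI[of _ "ball z 1 Int - ga ` {X+1..T}"]) auto
 qed
 hence G: "closed G" unfolding G_def closed_def by (simp add: open_Int closed_segment closed_def[symmetric] del: Compl_Un)
 moreover have "connected G" unfolding G_def
  by (intro connected_Un connected_segment conn_im cga) auto
 moreover have "~ bounded G"
 proof
  assume "bounded G"
  then obtain b where b: "!!z. z : G ==> norm z <= b" by (auto simp: bounded_iff)
  obtain T where "T >= X + 1" "b < norm (ga T)" using B_ray_big[OF L0, of b] unfolding ga_def by blast
  thus False using b[of "ga T"] by (auto simp: G_def)
 qed
 moreover have G0: "0 : G" by (simp add: G_def)
 ultimately obtain h where h: "h hol_on - G" "!!z. z ~: G ==> exp (h z) = z" by (rule log_on_complement) blast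
 note ch = hol_cont[OF h(1)]
 have GR: "z : ga ` {X+1..}" if "z : G" "R < norm z" for z
  using that segment_bound(1)[of z 0 "ga (X+1)"] by (auto simp: G_def R_def)
 have ray: "u : \<real>" if u: "X < Re u" "exp (L0 u) : ga ` {X+1..}" for u
 proof -
  obtain t where t: "t >= X + 1" "exp (L0 u) = exp (L0 (of_real t))" using u(2) by (auto simp: ga_def)
  hence "u = of_real t" using exp_B_inj[OF L0 u(1)] by simp
  thus ?thesis by simp
 qed
 have off: "exp (L0 u) : - G" if "X1 < Re u" "Im u ~= 0" for u
  using that GR[of "exp (L0 u)"] far[OF L0 that(1) _ X1(2)] X1(1) ray[of u] by (auto simp: complex_is_Real_iff)
 have const: "EX c. ALL w:S. L0 w = h (exp (L0 w)) + c" if S: "convex S" "!!w. w : S ==> X1 < Re w & Im w ~= 0" for S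
 proof -
  have "S <= {w. X < Re w}" using S(2) X1(1) by force
  from B_log_constant[OF L0 convex_connected[OF S(1)] this ch] show ?thesis using h(2) off S(2) by (metis ComplD)
 qed
 \<comment> \<open>Real arguments are mapped into the ray, so the parts above and below the real
   axis are treated separately, and their constants \<open>c1\<close> and \<open>c2\<close> may
   differ.\<close>
 have "convex ({w. X1 < Re w} Int {w. 0 < Im w})" "convex ({w. X1 < Re w} Int {w. Im w < 0})"
  by (intro convex_Int convex_halfspace_Re_gt convex_halfspace_Im_gt convex_halfspace_Im_lt)+
 from const[OF this(1)] const[OF this(2)]
 obtain c1 c2 where c: "!!w. X1 < Re w ==> 0 < Im w ==> L0 w = h (exp (L0 w)) + c1"
  "!!w. X1 < Re w ==> Im w < 0 ==> L0 w = h (exp (L0 w)) + c2" by auto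
 define C where "C = abs(Im c1) + abs(Im c2)"
 have C: "abs(Im (L0 w) - Im (h (exp (L0 w)))) <= C" if "X1 < Re w" "Im w ~= 0" for w
 proof -
  have "Im (L0 w) = Im (h (exp (L0 w))) + Im c1 | Im (L0 w) = Im (h (exp (L0 w))) + Im c2"
   using c[OF that(1)] that(2) by (metis linorder_neqE_linordered_idom plus_complex.sel(2))
  thus ?thesis by (auto simp: C_def)
 qed
 define al where "al = 12 * pi * rh"
 define b0 where "b0 = 12 * pi * (ln (A + 1) + 1) + abs(Im (L0 (of_real (X+1))))"
 have ray_bound: "abs(Im (L0 (of_real t))) <= al * Re (L0 (of_real t)) + b0" if "X + 1 <= t" for t
  using B_ray[OF L0 that] by (simp add: al_def b0_def algebra_simps)
 have hb: "abs(Im (h z)) <= al * ln (norm z) + (b0 + 3 * pi + C + 2 * pi)" if z: "z ~: G" "R1 < norm z" for z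
 proof -
  have "R <= R1" using R1[of "X+1"] X1(1) by (simp add: R_def)
  obtain T where T: "T >= X + 1" "norm z < norm (ga T)" using B_ray_big[OF L0, of "norm z"] unfolding ga_def by blast
  have "EX t. X + 1 <= t & t <= T & norm (ga t) = norm z"
   using T z(2) `R <= R1` cont_sub[OF cga, of "{X+1..T}"]
   by (intro IVT') (auto simp: R_def intro!: cont_intros)
  then obtain p where "p : G" "norm p = norm z" by (auto simp: G_def)
  from log_along_circle[OF G G0 ch h(2) z(1) this]
  obtain q where q: "q : G" "norm q = norm z"
   "!!V. open V ==> q : V ==> EX y:V. y ~: G & norm y = norm z & abs(Im (h y) - Im (h z)) <= 2 * pi" by blast
  obtain t where t: "X + 1 <= t" "q = ga t" using GR[OF q(1)] q(2) z(2) `R <= R1` by auto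
  have tX: "X1 + 1 < t" using R1[OF t(1)] q(2) t(2) z(2) by force
  \<comment> \<open>Arguments in this ball have real part above \<open>X + 1/2\<close>, so
    \<open>L0\<close> is Lipschitz there with constant \<open>24 * pi\<close> and differs from its
    value at \<open>t\<close> by at most \<open>3 * pi\<close>.\<close>
  let ?b = "ball (complex_of_real t) (1/8)"
  have nr: "t - 1/8 < Re u" if "u : ?b" for u
   using that abs_Re_le_cmod[of "of_real t - u"] by (simp add: dist_norm)
  have "open ((%u. exp (L0 u)) ` ?b)" by (rule B_open[OF L0 open_ball]) (use nr tX X1(1) in force)
  moreover have "q : (%u. exp (L0 u)) ` ?b" unfolding t(2) ga_def by (intro imageI) simp
  ultimately obtain u where u: "u : ?b" "exp (L0 u) ~: G" "abs(Im (h (exp (L0 u))) - Im (h z)) <= 2 * pi" using q(3) by blast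
  have Xu: "X1 < Re u" using nr[OF u(1)] tX by simp
  have "Im u ~= 0"
  proof
   assume "Im u = 0"
   hence "u = of_real (Re u)" by (simp add: complex_eq_iff)
   hence "exp (L0 u) = ga (Re u)" unfolding ga_def by metis
   thus False using u(2) Xu X1(1) by (auto simp: G_def)
  qed
  note Cu = C[OF Xu this]
  have "norm (L0 u - L0 (of_real t)) <= 12 * pi / (1/2) * norm (u - of_real t)"
   by (rule B_lipschitz[OF L0, of ?b]) (use u(1) nr tX X1(1) in force)+
  also have "... <= 12 * pi / (1/2) * (1/8)" using u(1) by (intro mult_left_mono) (auto simp: dist_norm norm_minus_commute)
  finally have "norm (L0 u - L0 (of_real t)) <= 3 * pi" by simp
  moreover have "Re (L0 (of_real t)) = ln (norm z)" using q(2) t(2) by (metis ga_def ln_exp norm_exp_eq_Re)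
  ultimately show ?thesis using ray_bound[OF t(1)] u(3) Cu abs_Im_le_cmod[of "L0 u - L0 (of_real t)"] by simp
 qed
 define be where "be = b0 + 3 * pi + C + 2 * pi + C"
 have hB: "abs(Im (h (exp (L w)))) <= al * Re (L w) + (be - C)" if "L : B" "X2 < Re w" "exp (L w) ~: G" for L w
  using hb[OF that(3)] far[OF that(1,2) _ X2(2)] X1(1) X2(1) by (simp add: be_def)
 have C0: "0 <= C" by (simp add: C_def)
 have L0b: "abs(Im (L0 w)) <= al * Re (L0 w) + be" if w: "X2 < Re w" for w
 proof (cases "Im w = 0")
  case True
  hence "w = of_real (Re w)" by (simp add: complex_eq_iff)
  hence "abs(Im (L0 w)) <= al * Re (L0 w) + b0" using ray_bound[of "Re w"] w X1(1) X2(1) by (metis add_increasing2 dual_order.trans less_imp_le order.refl)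
  thus ?thesis using C0 pi_gt_zero unfolding be_def by linarith
 next
  case False
  thus ?thesis using C[of w] hB[OF L0 w] off[of w] w X2(1) by force
 qed
 show thesis
 proof (rule that[of al X2 be])
  show "al >= 0" "X2 >= X" using rh X1(1) X2(1) by (auto simp: al_def)
  fix L assume L: "L : B"
  show "EX c. ALL w. X2 < Re w --> abs(Im (L w) - c) <= al * Re (L w) + be"
  proof (cases "EX u. X2 < Re u & exp (L u) : G")
   case False
   then obtain c where "!!w. w : {w. X2 < Re w} ==> L w = h (exp (L w)) + c"
    by (rule_tac B_log_constant[OF L convex_connected[OF convex_halfspace_Re_gt[of X2]] _ ch]) (use h(2) X1(1) X2(1) in auto)
   hence "Im (L w) - Im c = Im (h (exp (L w)))" if "X2 < Re w" for w using that by (metis add_diff_cancel_right' mem_Collect_eq plus_complex.sel(2))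
   thus ?thesis using hB[OF L] False C0 by (intro exI[of _ "Im c"]) force
  next
   case True
   then obtain u where u: "X2 < Re u" "exp (L u) : G" by blast
   hence "exp (L u) : ga ` {X+1..}" using GR far[OF L u(1) _ X2(2)] R1[of "X+1"] X1(1) X2(1) by (force simp: R_def)
   then obtain t where t: "t >= X + 1" "exp (L u) = exp (L0 (of_real t))" by (auto simp: ga_def)
   have "X < Re u" "X < Re (complex_of_real t)" using t u X1(1) X2(1) by auto
   from B_same_tract[OF L L0 this t(2)]
   obtain m n where mn: "!!v. X < Re v ==> L (v + per m) = L0 v + per n" by blast
   have "L w = L0 (w + per (-m)) + per n" if "X2 < Re w" for w
    using mn[of "w + per (-m)"] that X1(1) X2(1) by (simp add: per_minus)
   thus ?thesis using L0b[of "_ + per (-m)"] by (intro exI[of _ "Im (per n)"]) simp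
  qed
 qed
qed

text \<open>Shifting the argument to the right by \<open>Y - X\<close> reaches the range of
  \<open>slope_normalised\<close> and changes values by at most \<open>e\<close>.\<close>

lemma slope: obtains al be where "slope_bound g X al be"
proof -
 obtain al be Y where al: "al >= 0" "Y >= X"
  and Y: "!!L. L : B ==> EX c. ALL w. Y < Re w --> abs(Im (L w) - c) <= al * Re (L w) + be" by (rule slope_normalised) blast
 define e where "e = 12 * pi * (Y - X)"
 define be' where "be' = al * e + abs be + e"
 have e: "0 <= e" using al(2) by (simp add: e_def)
 have "slope_bound g X (2 * al) (2 * be')" unfolding slope_bound_def
 proof (intro conjI ballI allI impI)
  fix L w1 w2 assume L: "L : B" and w: "X + 1 <= Re w1" "X + 1 <= Re w2"
  obtain c where c: "!!w. Y < Re w ==> abs(Im (L w) - c) <= al * Re (L w) + be" using Y[OF L] by blast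
  have b: "abs(Im (L w) - c) <= al * max (Re (L w1)) (Re (L w2)) + be'" if w: "X + 1 <= Re w" "Re (L w) <= max (Re (L w1)) (Re (L w2))" for w
  proof -
   let ?w = "w + of_real (Y - X)"
   have "norm (L w - L ?w) <= 12 * pi / 1 * norm (w - ?w)"
    by (rule B_lipschitz[OF L convex_halfspace_Re_ge[of "X+1"]]) (use w al in auto)
   moreover have "norm (w - ?w) = Y - X" using al(2) by (simp only: norm_minus_commute[of w] add_diff_cancel_left' norm_of_real)
   ultimately have n: "norm (L w - L ?w) <= e" by (simp add: e_def)
   have "abs(Im (L ?w) - c) <= al * Re (L ?w) + be" using w al(2) by (intro c) simp
   also have "al * Re (L ?w) <= al * (max (Re (L w1)) (Re (L w2)) + e)"
    using n abs_Re_le_cmod[of "L w - L ?w"] w(2) al(1) by (intro mult_left_mono) auto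
   finally show ?thesis using n abs_Im_le_cmod[of "L w - L ?w"] by (simp add: be'_def distrib_left)
  qed
  show "sloped (2 * al) (2 * be') (L w1) (L w2)" using b[OF w(1)] b[OF w(2)] by linarith
 qed (use e al(1) in "auto simp: be'_def")
 thus thesis by (rule that)
qed

text \<open>By contraposition: without the lead, \<open>x\<close> and \<open>y\<close> have
  hyperbolic distance at most about \<open>2 * ln m\<close>, with \<open>m\<close> a multiple of
  \<open>Re x * M\<close>. Their images then differ by at most \<open>24 * pi\<close> times
  \<open>ln (Re x) + ln M\<close> plus a constant, and \<open>ln_order\<close> makes this linear in
  \<open>Re (L x)\<close>.\<close>

lemma head_start:
 assumes "al >= 0" "be >= 0" shows "EX K0>=1. ALL K>=K0. head_start_bound g X al be K"
\<comment> \<open>The two horizontal legs of the path, each with factor \<open>12 * pi\<close>,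
  times the order \<open>rh\<close>, give \<open>24 * pi * rh\<close>; one unit accounts for
  \<open>Re (L x)\<close> itself and one is slack.\<close>
proof (intro exI[of _ "24 * pi * rh + 2"] conjI allI impI)
 show "24 * pi * rh + 2 >= 1" using rh by (simp add: add_increasing)
 fix K assume K: "K >= 24 * pi * rh + 2"
 have K1: "K >= 1" using K rh by (meson add_increasing less_imp_le mult_nonneg_nonneg one_le_numeral order_trans pi_ge_zero zero_le_numeral)
 define Q where "Q = 1 + al + be"
 have Q: "Q >= 1" using assms by (simp add: Q_def)
 define e where "e = ln (Q * (K + 4)) + ln (A+1) + 1"
 \<comment> \<open>Beyond some threshold the loss that is logarithmic in \<open>M\<close> stays
   below \<open>M\<close>.\<close>
 have "filterlim (%M. M - 24 * pi * (ln M + e)) at_top at_top" by real_asymp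
 hence "\<forall>\<^sub>F M in at_top. M - 24 * pi * (ln M + e) > 0" unfolding filterlim_at_top_dense by (rule spec)
 then obtain N where N: "ALL M>=N. M - 24 * pi * (ln M + e) > 0" by (auto simp: eventually_at_top_linorder)
 define M0 where "M0 = max N 1"
 have M0: "M0 >= 1" "M >= M0 ==> 24 * pi * (ln M + e) < M" for M using N by (auto simp: M0_def)
 show "head_start_bound g X al be K" unfolding head_start_bound_def
 proof (intro exI[of _ M0] allI ballI impI)
  fix M L x y
  assume M: "M0 <= M" and L: "L : B" and x: "X + 1 <= Re x" and y: "X + 1 <= Re y"
   and sl: "sloped al be x y" and Re: "K * Re (L x) + M <= Re (L y)"
  show "K * Re x + 4 * M <= Re y"
  proof (rule ccontr)
   assume "~ ?thesis"
   hence lt: "Re y < K * Re x + 4 * M" by simp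
   have M1: "M >= 1" using M M0 by simp
   define m where "m = Q * (K + 4) * (Re x * M)"
   have x1: "Re x >= 1" using x X0 by simp
   have xM: "Re x <= Re x * M" "M <= Re x * M" "1 <= Re x * M"
    using x1 M1 mult_left_mono[of 1 M "Re x"] mult_right_mono[of 1 "Re x" M] mult_mono[of 1 "Re x" 1 M] by simp_all
   have mx: "max (Re x) (Re y) <= (K + 4) * (Re x * M)"
   proof -
    have "K * Re x <= K * (Re x * M)" using xM K1 by (intro mult_left_mono) auto
    hence "Re y <= (K + 4) * (Re x * M)" using lt xM by (simp add: distrib_right)
    moreover have "1 * (Re x * M) <= (K + 4) * (Re x * M)" using K1 xM by (intro mult_right_mono) auto
    ultimately show ?thesis using xM by simp
   qed
   have big: "1 <= (K + 4) * (Re x * M)"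
    using mx x1 by linarith
   have mm: "max (Re x) (Re y) <= m" "abs(Im x - Im y) <= m"
   proof -
    have "1 * ((K + 4) * (Re x * M)) <= Q * ((K + 4) * (Re x * M))" using Q big by (intro mult_right_mono) auto
    thus "max (Re x) (Re y) <= m" using mx by (simp add: m_def mult.assoc)
    have "al * max (Re x) (Re y) <= al * ((K + 4) * (Re x * M))" using mx assms by (intro mult_left_mono)
    moreover have "be * 1 <= be * ((K + 4) * (Re x * M))" using big assms by (intro mult_left_mono)
    ultimately have "abs(Im x - Im y) <= (al + be) * ((K + 4) * (Re x * M))" using sl by (simp add: distrib_right)
    also have "... <= Q * ((K + 4) * (Re x * M))" using big by (intro mult_right_mono) (auto simp: Q_def)
    finally show "abs(Im x - Im y) <= m" by (simp add: m_def mult.assoc)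
   qed
   have "norm (L x - L y) <= 12 * pi * (ln (m / (Re x - X)) + ln (m / (Re y - X)) + 1)"
    by (rule half_plane_increment[OF BD(1)[OF L] deriv_bound[OF L]]) (use x y mm X0 in auto)
   also have "... <= 12 * pi * (ln m + ln m + 1)"
   proof (intro mult_left_mono add_mono order_refl)
    have m0: "m > 0" using mm x1 by linarith
    show "ln (m / (Re x - X)) <= ln m" "ln (m / (Re y - X)) <= ln m" using m0 x y by (auto simp: ln_div)
   qed auto
   also have "... <= 24 * pi * (ln m + 1)" by simp
   also have "ln m = ln (Q * (K + 4)) + ln (Re x) + ln M"
    using Q K1 x1 M1 by (simp add: m_def ln_mult)
   also have "ln (Re x) <= rh * Re (L x) + ln (A + 1)" using ln_order[OF L] x by simp
   finally have "norm (L x - L y) <= 24 * pi * (ln (Q * (K + 4)) + (rh * Re (L x) + ln (A + 1)) + ln M + 1)"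
    by simp
   also have "... = 24 * pi * rh * Re (L x) + 24 * pi * (ln M + e)"
    by (simp add: e_def algebra_simps)
   also have "... < 24 * pi * rh * Re (L x) + M" using M0(2)[OF M] by simp
   finally have "Re (L y) - Re (L x) < 24 * pi * rh * Re (L x) + M"
    using abs_Re_le_cmod[of "L x - L y"] by simp
   moreover have "(24 * pi * rh + 1) * Re (L x) <= (K - 1) * Re (L x)"
    using K B_pos[OF L, of x] x by (intro mult_right_mono) auto
   moreover have "0 < Re (L x)" using B_pos[OF L, of x] x by simp
   ultimately show False using Re by (simp add: algebra_simps)
  qed
 qed
qed

end

section \<open>Compositions\<close>

text \<open>The head start is required for all slope constants \<open>al\<close> and
  \<open>be\<close>, because in a composition they come from the other factor.\<close>

definition linear_head_start :: "(complex => complex) => bool" where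
 "linear_head_start f \<longleftrightarrow> (EX X0. ALL X>=X0. (EX al be. slope_bound f X al be) &
   (ALL al>=0. ALL be>=0. EX K0>=1. ALL K>=K0. head_start_bound f X al be K))"

lemma finite_order_levelI:
 assumes "finite_order g" "g : class_B"
 obtains X0 A rh where "!!X. X >= X0 ==> finite_order_level g X A rh"
proof -
 obtain c rh where c: "c > 0" "rh > 0" "!!z. norm (g z) <= c * exp (norm z powr rh)"
  using assms(1) by (auto simp: finite_order_def)
 define A where "A = max 0 (ln c)"
 have "c <= exp A" using c(1) by (metis A_def exp_le_cancel_iff exp_ln max.cobounded2)
 hence "norm (g z) <= exp (A + norm z powr rh)" for z
  using order_trans[OF c(3)[of z] mult_right_mono[of c "exp A" "exp (norm z powr rh)"]] by (simp add: exp_add)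
 moreover obtain X0 where "nice_level g X0" using nice_level_exists[OF assms(2)] by blast
 moreover have "transcendental_entire g" using assms(2) by (simp add: class_B_def)
 ultimately have "finite_order_level g X A rh" if "X >= X0" for X
  using that c(2) nice_level_mono by unfold_locales (auto simp: A_def)
 thus thesis using that by blast
qed

lemma linear_head_start_finite_order:
 assumes "finite_order g" "g : class_B"
 shows "linear_head_start g"
proof -
 obtain X0 A rh where lev: "!!X. X >= X0 ==> finite_order_level g X A rh" using finite_order_levelI[OF assms] by blast
 show ?thesis unfolding linear_head_start_def
 proof (intro exI[of _ X0] allI impI)
  fix X assume "X >= X0"
  then interpret finite_order_level g X A rh by (rule lev)
  show "(EX al be. slope_bound g X al be) & (ALL al>=0. ALL be>=0. EX K0>=1. ALL K>=K0. head_start_bound g X al be K)"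
   using slope head_start by metis
 qed
qed

text \<open>The outer map is below the level on the disc of radius \<open>exp (Y + 1)\<close>, so
  \<open>g (exp (L w))\<close> stays outside that disc and has a logarithm \<open>L1\<close>. The
  branch \<open>M\<close> of \<open>g\<close> is then fixed by its value at one point.\<close>

lemma log_branch_factor:
 assumes h: "h hol_on UNIV" and g: "transcendental_entire g" "log_level g Y"
  and big: "!!y. norm y <= exp (Y + 1) ==> norm (h y) <= exp X"
  and L: "L : log_branches (h o g) X"
 obtains L1 M where "L1 : log_branches h X" "M : log_branches g Y"
  "!!w. X < Re w ==> Y + 1 < Re (L1 w)" "!!w. X < Re w ==> L w = M (L1 w)"
proof -
 let ?H = "{w. X < Re w}"
 have H: "open ?H" "convex ?H" by (auto simp: open_halfspace_Re_gt convex_halfspace_Re_gt)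
 have Lh: "L hol_on ?H" and Lf: "!!w. w : ?H ==> h (g (exp (L w))) = exp w"
  using L by (auto simp: log_branches_def)
 have hg: "g hol_on UNIV" using g by (simp add: trans_def)
 define y where "y w = g (exp (L w))" for w
 have "((g o exp) o L) hol_on ?H"
  by (intro holomorphic_on_compose Lh holomorphic_on_exp hol_sub[OF hg]) auto
 hence yh: "y hol_on ?H" by (simp add: y_def[abs_def] o_def)
 have ybig: "norm (y w) > exp (Y + 1)" if "w : ?H" for w
 proof (rule ccontr)
  assume "~ ?thesis"
  hence "norm (h (y w)) <= exp X" by (intro big) simp
  thus False using Lf[OF that] that by (simp add: y_def)
 qed
 hence y0: "y w ~= 0" if "w : ?H" for w using that by (metis exp_gt_zero less_asym norm_zero)
 obtain L1 where L1: "L1 hol_on ?H" "!!w. w : ?H ==> exp (L1 w) = y w"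
  using nonvanishing_log[OF H yh y0] by metis
 have L1Y: "Y + 1 < Re (L1 w)" if "X < Re w" for w
 proof -
  have "exp (Y + 1) < exp (Re (L1 w))" using ybig[of w] L1(2)[of w] that by (metis mem_Collect_eq norm_exp_eq_Re)
  thus ?thesis by simp
 qed
 let ?a = "of_real (X + 1) :: complex"
 have aH: "?a : ?H" by simp
 have eq: "g (exp (L ?a)) = exp (L1 ?a)" using L1(2)[OF aH] by (simp add: y_def)
 obtain M where M: "M : log_branches g Y" "M (L1 ?a) = L ?a"
  using log_branch_through[OF g eq] L1Y[of ?a] by auto
 have Mh: "M hol_on {w. Y < Re w}" using M by (simp add: log_branches_def)
 have "M (L1 w) = L w" if w: "w : ?H" for w
 proof (rule unique_lift[where f = "%u. g (exp u)" and S = ?H and h = "%w. M (L1 w)" and k = L and a = ?a])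
  have "(g o exp) hol_on UNIV"
   by (intro holomorphic_on_compose holomorphic_on_exp hol_sub[OF hg]) auto
  thus "(%u. g (exp u)) hol_on UNIV" by (simp add: o_def)
  show "continuous_on ?H (%w. M (L1 w))"
   by (rule cont_comp[OF hol_cont[OF Mh] hol_cont[OF L1(1)]])
    (use L1Y in force)
  show "continuous_on ?H L" using Lh by (rule hol_cont)
  fix x assume x: "x : ?H"
  have Yx: "Y < Re (L1 x)" using L1Y[of x] x by simp
  hence "g (exp (M (L1 x))) = exp (L1 x)" using M by (simp add: log_branches_def)
  thus "g (exp (M (L1 x))) = g (exp (L x))" using L1(2)[OF x] by (simp add: y_def)
  show "deriv (%u. g (exp u)) (M (L1 x)) ~= 0" by (rule log_branch_deriv_nonzero[OF g M(1) Yx])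
 qed (use w aH M H convex_connected in auto)
 moreover have "L1 : log_branches h X" using L1 Lf by (auto simp: log_branches_def y_def)
 ultimately show thesis using that[of L1 M] M(1) L1Y by simp
qed

text \<open>Slope is inherited from the branch \<open>N\<close> of the inner map. A lead is pulled
  back first through \<open>N\<close>, using the slope of branches of \<open>h\<close>, and then
  through \<open>L1\<close>.\<close>

lemma linear_head_start_compose:
 assumes h: "h hol_on UNIV" "linear_head_start h" and g: "finite_order g" "g : class_B"
 shows "linear_head_start (h o g)"
proof -
 obtain X0 A rh where lev: "!!X. X >= X0 ==> finite_order_level g X A rh" using finite_order_levelI[OF g] by blast
 define Y where "Y = X0"
 interpret finite_order_level g Y A rh using lev by (simp add: Y_def)
 obtain X1 where X1: "!!X. X >= X1 ==> (EX al be. slope_bound h X al be) &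
   (ALL al>=0. ALL be>=0. EX K0>=1. ALL K>=K0. head_start_bound h X al be K)"
  using h(2) unfolding linear_head_start_def by blast
 obtain R where R: "!!y. norm y <= exp (Y + 1) ==> norm (h y) <= R" using continuous_image_cball_bounded[OF h(1)] by blast
 define X2 where "X2 = max X1 (ln (max R 1))"
 have "(EX al be. slope_bound (h o g) X al be) & (ALL al>=0. ALL be>=0. EX K0>=1. ALL K>=K0. head_start_bound (h o g) X al be K)"
  if X: "X >= X2" for X
 proof -
  have "max R 1 <= exp X" using X unfolding X2_def by (metis exp_le_cancel_iff exp_ln less_max_iff_disj max.bounded_iff zero_less_one)
  hence big: "norm y <= exp (Y + 1) ==> norm (h y) <= exp X" for y using R[of y] by simp
  have X1': "X >= X1" using X by (simp add: X2_def)
  obtain alh beh where sh: "slope_bound h X alh beh" using X1[OF X1'] by blast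
  obtain alg beg where sg: "slope_bound g Y alg beg" by (rule slope)
  have factor: "EX L1 N. L1 : log_branches h X & N : log_branches g Y &
    (ALL w. X < Re w --> Y + 1 < Re (L1 w) & L w = N (L1 w))" if "L : log_branches (h o g) X" for L
   using log_branch_factor[OF h(1) tr lev big that] by metis
  have "slope_bound (h o g) X alg beg" unfolding slope_bound_def
  proof (intro conjI ballI allI impI)
   show "0 <= alg" "0 <= beg" using sg by (auto simp: slope_bound_def)
   fix L x y assume L: "L : log_branches (h o g) X" and xy: "X + 1 <= Re x" "X + 1 <= Re y"
   obtain L1 N where "N : log_branches g Y" "!!w. X < Re w ==> Y + 1 < Re (L1 w) & L w = N (L1 w)" using factor[OF L] by blast
   thus "sloped alg beg (L x) (L y)" using sg xy by (simp add: slope_bound_def less_imp_le)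
  qed
  moreover have "EX K0>=1. ALL K>=K0. head_start_bound (h o g) X al be K" if ab: "al >= 0" "be >= 0" for al be
  proof -
   obtain K1 where K1: "K1 >= 1" "!!K. K >= K1 ==> head_start_bound h X al be K" using X1[OF X1'] ab by blast
   obtain K2 where K2: "K2 >= 1" "!!K. K >= K2 ==> head_start_bound g Y alh beh K"
    using head_start[of alh beh] sh by (auto simp: slope_bound_def)
   have "head_start_bound (h o g) X al be K" if K: "K >= max K1 K2" for K
   proof -
    obtain M1 where M1: "!!M L x y. M >= M1 ==> L:log_branches h X ==> X + 1 <= Re x ==> X + 1 <= Re y ==>
     sloped al be x y ==> Re (L y) >= K * Re (L x) + M ==> Re y >= K * Re x + 4 * M"
     using K1(2)[of K] K unfolding head_start_bound_def by (metis max.bounded_iff)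
    obtain M2 where M2: "!!M L x y. M >= M2 ==> L:log_branches g Y ==> Y + 1 <= Re x ==> Y + 1 <= Re y ==>
     sloped alh beh x y ==> Re (L y) >= K * Re (L x) + M ==> Re y >= K * Re x + 4 * M"
     using K2(2)[of K] K unfolding head_start_bound_def by (metis max.bounded_iff)
    show ?thesis unfolding head_start_bound_def
    proof (intro exI[of _ "max 0 (max M1 M2)"] allI ballI impI)
     fix M L x y assume M: "max 0 (max M1 M2) <= M" and L: "L : log_branches (h o g) X"
      and xy: "X + 1 <= Re x" "X + 1 <= Re y" "sloped al be x y" and Re: "K * Re (L x) + M <= Re (L y)"
     obtain L1 N where N: "L1 : log_branches h X" "N : log_branches g Y"
      "!!w. X < Re w ==> Y + 1 < Re (L1 w) & L w = N (L1 w)" using factor[OF L] by blast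
     have "sloped alh beh (L1 x) (L1 y)" using sh N(1) xy by (auto simp: slope_bound_def)
     hence "Re (L1 y) >= K * Re (L1 x) + 4 * M" using M2[OF _ N(2), of M "L1 x" "L1 y"] N(3)[of x] N(3)[of y] M xy Re by simp
     thus "K * Re x + 4 * M <= Re y" using M1[OF _ N(1) xy, of M] M by simp
    qed
   qed
   thus ?thesis using K1(1) by (intro exI[of _ "max K1 K2"]) auto
  qed
  ultimately show ?thesis by blast
 qed
 thus ?thesis unfolding linear_head_start_def by blast
qed

lemma foldr_comp: "foldr (\<circ>) gs k = foldr (\<circ>) gs id o k"
 by (induction gs) (auto simp: o_def)

text \<open>Induction removes the innermost factor, since \<open>linear_head_start_compose\<close>
  asks for finite order of the inner map.\<close>

lemma linear_head_start_composition:
 assumes "gs ~= []" "ALL g : set gs. finite_order g & g : class_B"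
 shows "foldr (\<circ>) gs id hol_on UNIV & linear_head_start (foldr (\<circ>) gs id)"
 using assms
proof (induction gs rule: rev_nonempty_induct)
 case (single g)
 thus ?case using linear_head_start_finite_order[of g] by (auto simp: class_B_def trans_def)
next
 case (snoc g gs)
 hence "ALL g : set gs. finite_order g & g : class_B" by simp
 from snoc.IH[OF this] have IH: "foldr (\<circ>) gs id hol_on UNIV" "linear_head_start (foldr (\<circ>) gs id)" by blast+
 have g: "finite_order g" "g : class_B" using snoc.prems by simp_all
 hence "g hol_on UNIV" by (simp add: class_B_def trans_def)
 have eq: "foldr (\<circ>) (gs @ [g]) id = foldr (\<circ>) gs id o g" using foldr_comp[of gs "g o id"] by simp
 have "(foldr (\<circ>) gs id o g) hol_on UNIV"
  by (rule hol_comp[OF `g hol_on UNIV` IH(1)]) auto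
 thus ?case unfolding eq using linear_head_start_compose[OF IH g] by blast
qed

section \<open>The Fatou set of a disjoint type map\<close>

text \<open>The sine of half of \<open>spherical_dist\<close>; it is algebraic and defines the same
  equicontinuity.\<close>

definition chord :: "complex => complex => real" where
 "chord z w = norm (z - w) / (sqrt (1 + (norm z)\<^sup>2) * sqrt (1 + (norm w)\<^sup>2))"

lemma chord_nonneg: "chord z w >= 0" by (simp add: chord_def)

lemma chord_commute: "chord z w = chord w z" by (simp add: chord_def norm_minus_commute mult.commute)

lemma chord_le_1: "chord z w <= 1"
proof -
 have "(norm (z - w))\<^sup>2 + (norm (1 + cnj z * w))\<^sup>2 = (1 + (norm z)\<^sup>2) * (1 + (norm w)\<^sup>2)"
  by (simp only: cmod_power2) (simp add: power2_eq_square algebra_simps)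
 hence "(norm (z - w))\<^sup>2 <= (1 + (norm z)\<^sup>2) * (1 + (norm w)\<^sup>2)"
  by (metis le_add_same_cancel1 zero_le_power2)
 hence "norm (z - w) <= sqrt ((1 + (norm z)\<^sup>2) * (1 + (norm w)\<^sup>2))" by (rule real_le_rsqrt)
 thus ?thesis by (simp add: chord_def real_sqrt_mult divide_le_eq add_pos_nonneg)
qed

lemma chord_le_dist: "chord z w <= dist z w"
proof -
 have "1 <= sqrt (1 + (norm z)\<^sup>2) * sqrt (1 + (norm w)\<^sup>2)"
  by (simp add: real_sqrt_mult[symmetric]) (simp add: algebra_simps)
 thus ?thesis unfolding chord_def dist_norm
  by (simp add: divide_le_eq mult_le_cancel_left1 mult_less_0_iff)
qed

text \<open>For \<open>norm w >= 2 * M + 1\<close> the numerator of \<open>chord\<close> is at least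
  \<open>norm w / 2\<close> and the root belonging to \<open>w\<close> at most
  \<open>2 * norm w\<close>; this is the constant 4.\<close>

lemma chord_bounded:
 assumes "norm z <= M" "M >= 0" "chord z w < 1 / (4 * sqrt (1 + M\<^sup>2))"
 shows "norm w < 2 * M + 1"
proof (rule ccontr)
 assume "~ ?thesis"
 hence w: "norm w >= 2 * M + 1" by simp
 have 1: "norm w / 2 <= norm (z - w)" using norm_triangle_ineq2[of w z] w assms by (simp add: norm_minus_commute)
 have w1: "1 <= norm w" using w assms by linarith
 have 2: "sqrt (1 + (norm w)\<^sup>2) <= 2 * norm w"
 proof (rule real_le_lsqrt)
  have "1 <= (norm w)\<^sup>2" using w1 by simp
  thus "1 + (norm w)\<^sup>2 <= (2 * norm w)\<^sup>2" by (simp add: power_mult_distrib)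
 qed (use w1 in auto)
 have 3: "sqrt (1 + (norm z)\<^sup>2) <= sqrt (1 + M\<^sup>2)" using assms(1) by (simp add: power_mono)
 have "1 / (4 * sqrt (1 + M\<^sup>2)) = (norm w / 2) / (sqrt (1 + M\<^sup>2) * (2 * norm w))" using w1 by (auto simp: field_simps)
 also have "... <= chord z w" unfolding chord_def
  using 1 2 3 w1 by (intro frac_le mult_mono mult_pos_pos) (auto simp: add_pos_nonneg)
 finally show False using assms(3) by simp
qed

lemma equicontinuous_chord:
 "iterates_equicontinuous_at f z \<longleftrightarrow> (ALL ep>0. \<forall>\<^sub>F w in nhds z. ALL n>0. chord ((f ^^ n) w) ((f ^^ n) z) < ep)"
proof -
 have sd: "spherical_dist z w = 2 * arcsin (chord z w)" for z w by (simp add: spherical_dist_def chord_def)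
 have less: "chord z w < ep / 2" if "spherical_dist z w < ep" for z w ep
 proof -
  let ?t = "arcsin (chord z w)"
  have c: "-1 <= chord z w" "chord z w <= 1" using chord_le_1 chord_nonneg[of z w] by auto
  have "chord z w = sin ?t" using c by simp
  also have "... <= ?t" using arcsin_bounded[of "chord z w"] chord_nonneg[of z w] c arcsin_le_arcsin[of 0 "chord z w"]
   by (intro sin_x_le_x) simp
  finally show ?thesis using that sd[of z w] by simp
 qed
 have gre: "spherical_dist z w < ep" if "chord z w < sin (min (ep/2) (pi/2))" "ep > 0" for z w ep
 proof -
  have c: "-1 <= chord z w" using chord_nonneg[of z w] by simp
  have "arcsin (chord z w) < arcsin (sin (min (ep/2) (pi/2)))" using that c by (intro arcsin_less_arcsin) auto
  also have "... = min (ep/2) (pi/2)" using that pi_gt_zero by (intro arcsin_sin) (auto simp: min_def)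
  finally show ?thesis using sd[of z w] by simp
 qed
 have sp: "sin (min (ep/2) (pi/2)) > 0" if "ep > 0" for ep using that pi_gt_zero by (intro sin_gt_zero) (auto simp: min_def)
 show ?thesis unfolding iterates_equicontinuous_at_def
 proof safe
  fix ep :: real assume h: "ALL ep>0. \<forall>\<^sub>F w in nhds z. ALL n>0. spherical_dist ((f ^^ n) w) ((f ^^ n) z) < ep" and e: "ep > 0"
  have "0 < 2 * ep" using e by simp
  with h have "\<forall>\<^sub>F w in nhds z. ALL n>0. spherical_dist ((f ^^ n) w) ((f ^^ n) z) < 2 * ep"
   by blast
  thus "\<forall>\<^sub>F w in nhds z. ALL n>0. chord ((f ^^ n) w) ((f ^^ n) z) < ep"
  proof (rule eventually_mono, intro allI impI)
   fix w and n :: nat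
   assume "ALL n>0. spherical_dist ((f ^^ n) w) ((f ^^ n) z) < 2 * ep" "0 < n"
   hence "spherical_dist ((f ^^ n) w) ((f ^^ n) z) < 2 * ep" by blast
   from less[OF this] show "chord ((f ^^ n) w) ((f ^^ n) z) < ep" by simp
  qed
 next
  fix ep :: real assume h: "ALL ep>0. \<forall>\<^sub>F w in nhds z. ALL n>0. chord ((f ^^ n) w) ((f ^^ n) z) < ep" and e: "ep > 0"
  have "\<forall>\<^sub>F w in nhds z. ALL n>0. chord ((f ^^ n) w) ((f ^^ n) z) < sin (min (ep/2) (pi/2))"
   using h sp[OF e] by blast
  thus "\<forall>\<^sub>F w in nhds z. ALL n>0. spherical_dist ((f ^^ n) w) ((f ^^ n) z) < ep"
   by (rule eventually_mono) (meson gre e)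
 qed
qed

section \<open>Bounded and unbounded orbits near Fatou points\<close>

lemma funpow_holomorphic: "f hol_on UNIV ==> (f ^^ n) hol_on UNIV"
proof (induction n)
 case (Suc n)
 hence "(f o f ^^ n) hol_on UNIV" by (intro hol_comp[of "f ^^ n" UNIV f UNIV]) auto
 thus ?case by (simp only: funpow.simps)
qed (auto simp: id_def intro: hol_intros)

text \<open>Cauchy's inequality gives all iterates one Lipschitz constant on the disc of half the
  radius.\<close>

lemma bounded_iterates_Fatou:
 assumes f: "f hol_on UNIV" and r: "r > 0"
  and M: "!!n w. w : ball z r ==> norm ((f ^^ n) w) <= M"
 shows "z : Fatou_set f"
proof -
 have "norm ((f ^^ 0) z) <= M" by (rule M) (use r in simp)
 hence M0: "M >= 0" using norm_ge_zero order_trans by blast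
 have lip: "dist ((f ^^ n) w) ((f ^^ n) z) <= (2 * M / r) * dist w z" if w: "w : ball z (r/2)" for n w
 proof -
  have h: "(f ^^ n) hol_on S" for S using funpow_holomorphic[OF f] hol_sub by blast
  have "norm ((f ^^ n) w - (f ^^ n) z) <= 2 * M / r * norm (w - z)"
  proof (rule diff_bound[where S = "ball z (r/2)" and f' = "deriv (f ^^ n)"])
   fix u assume u: "u : ball z (r/2)"
   show "((f ^^ n) has_field_derivative deriv (f ^^ n) u) (at u within ball z (r/2))"
    using h[of UNIV] by (auto intro: holomorphic_derivI has_field_derivative_at_within)
   have "norm ((deriv ^^ 1) (f ^^ n) u) <= fact 1 * M / (r/2) ^ 1"
   proof (rule Cauchy_inequality)
    show "continuous_on (cball u (r/2)) (f ^^ n)" using h hol_cont by blast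
    fix x assume "norm (u - x) = r/2"
    hence "x : ball z r" using u dist_triangle[of z x u] by (auto simp: dist_norm)
    thus "norm ((f ^^ n) x) <= M" by (rule M)
   qed (use h r in auto)
   thus "norm (deriv (f ^^ n) u) <= 2 * M / r" by (simp add: mult.commute)
  qed (use w r in auto)
  thus ?thesis by (simp add: dist_norm)
 qed
 have "iterates_equicontinuous_at f z" unfolding equicontinuous_chord
 proof (intro allI impI)
  fix ep :: real assume e: "ep > 0"
  let ?d = "min (r/2) (ep / (2 * M / r + 1))"
  have d: "?d > 0" using r e M0 by (simp add: add_nonneg_pos)
  show "\<forall>\<^sub>F w in nhds z. ALL n>0. chord ((f ^^ n) w) ((f ^^ n) z) < ep"
   unfolding eventually_nhds_metric
  proof (intro exI[of _ ?d] conjI allI impI d)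
   fix w n assume w: "dist w z < ?d"
   have "w : ball z (r/2)" using w by (simp add: dist_commute)
   have "chord ((f ^^ n) w) ((f ^^ n) z) <= dist ((f ^^ n) w) ((f ^^ n) z)" by (rule chord_le_dist)
   also have "... <= (2 * M / r) * dist w z" by (rule lip) fact
   also have "... <= (2 * M / r + 1) * dist w z" by (intro mult_right_mono) auto
   also have "... < ep"
   proof -
    have "2 * M / r + 1 > 0" using M0 r by (simp add: add_nonneg_pos)
    thus ?thesis using w by (simp add: field_simps)
   qed
   finally show "chord ((f ^^ n) w) ((f ^^ n) z) < ep" .
  qed
 qed
 thus ?thesis by (simp add: Fatou_set_def Julia_set_def)
qed

lemma Fatou_bounded_orbit_nbhd:
 assumes z: "z : Fatou_set f" and M: "!!n. norm ((f ^^ n) z) <= M"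
 obtains r M' where "r > 0" "!!n w. w : ball z r ==> norm ((f ^^ n) w) <= M'"
proof -
 have M0: "M >= 0" using M[of 0] norm_ge_zero order_trans by blast
 have "iterates_equicontinuous_at f z" using z by (simp add: Fatou_set_def Julia_set_def)
 hence "\<forall>\<^sub>F w in nhds z. ALL n>0. chord ((f ^^ n) w) ((f ^^ n) z) < 1 / (4 * sqrt (1 + M\<^sup>2))"
  unfolding equicontinuous_chord by (auto simp: add_pos_nonneg)
 then obtain r where r: "r > 0" "!!w n. dist w z < r ==> n > 0 ==> chord ((f ^^ n) w) ((f ^^ n) z) < 1 / (4 * sqrt (1 + M\<^sup>2))"
  unfolding eventually_nhds_metric by blast
 show thesis
 proof (rule that[of "min r 1" "2 * M + 1"])
  fix n w assume w: "w : ball z (min r 1)"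
  show "norm ((f ^^ n) w) <= 2 * M + 1"
  proof (cases "n > 0")
   case True
   hence "chord ((f ^^ n) z) ((f ^^ n) w) < 1 / (4 * sqrt (1 + M\<^sup>2))"
    using r(2)[of w n] w by (simp add: dist_commute chord_commute)
   thus ?thesis using chord_bounded[OF M M0] by (simp add: less_imp_le)
  next
   case False
   thus ?thesis using M[of 0] M0 w norm_triangle_ineq2[of w z] by (simp add: dist_norm norm_minus_commute)
  qed
 qed (use r in auto)
qed

text \<open>Reciprocals of the iterates along which the orbit of \<open>z\<close> grows are
  zero-free and bounded by 1 near \<open>z\<close>. By Montel and Hurwitz a limit that vanishes at
  \<open>z\<close> vanishes identically, so neighbouring orbits are unbounded too.\<close>

lemma Fatou_unbounded_orbit_nbhd:
 assumes f: "f hol_on UNIV" and z: "z : Fatou_set f" and unb: "~ bounded (range (%n. (f ^^ n) z))"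
 obtains r where "r > 0" "!!w. w : ball z r ==> ~ bounded (range (%n. (f ^^ n) w))"
proof -
 have "iterates_equicontinuous_at f z" using z by (simp add: Fatou_set_def Julia_set_def)
 hence "\<forall>\<^sub>F w in nhds z. ALL n>0. chord ((f ^^ n) w) ((f ^^ n) z) < 1 / (4 * sqrt (1 + 1\<^sup>2))"
  unfolding equicontinuous_chord by (auto simp: add_pos_nonneg)
 then obtain r where r: "r > 0" "!!w n. dist w z < r ==> n > 0 ==> chord ((f ^^ n) w) ((f ^^ n) z) < 1 / (4 * sqrt (1 + 1\<^sup>2))"
  unfolding eventually_nhds_metric by blast
 have "EX n>0. norm ((f ^^ n) z) > B" for B
 proof (rule ccontr)
  assume "~ ?thesis"
  hence B: "norm ((f ^^ n) z) <= B" if "n > 0" for n using that by (meson not_less)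
  have "norm ((f ^^ n) z) <= max B (norm z)" for n using B[of n] by (cases "n > 0") auto
  thus False using unb by (auto simp: bounded_iff)
 qed
 hence "ALL k::nat. EX n>0. norm ((f ^^ n) z) > real k + 3" by blast
 then obtain m where m: "!!k::nat. m k > 0 & norm ((f ^^ (m k)) z) > real k + 3" by metis
 define H where "H k w = inverse ((f ^^ (m k)) w)" for k w
 have big: "norm ((f ^^ (m k)) w) > 1" if w: "w : ball z r" for k w
 proof (rule ccontr)
  assume "~ ?thesis"
  hence "norm ((f ^^ (m k)) w) <= 1" by simp
  moreover have "chord ((f ^^ (m k)) w) ((f ^^ (m k)) z) < 1 / (4 * sqrt (1 + 1\<^sup>2))" using r(2) w m by (simp add: dist_commute)
  ultimately have "norm ((f ^^ (m k)) z) < 2 * 1 + 1" by (intro chord_bounded) auto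
  thus False using m[of k] by simp
 qed
 have nz: "(f ^^ (m k)) w ~= 0" if "w : ball z r" for k w using big[OF that, of k] by auto
 have Hh: "H k hol_on ball z r" for k
  unfolding H_def using nz by (intro hol_intros hol_sub[OF funpow_holomorphic[OF f]]) auto
 have H1: "norm (H k w) <= 1" if "w : ball z r" for k w
  using big[OF that, of k] by (simp add: H_def norm_inverse inverse_le_1_iff)
 have Hz: "(%k. H k z) ----> 0"
 proof (rule Lim_null_comparison)
  show "\<forall>\<^sub>F k in sequentially. norm (H k z) <= inverse (real k + 3)"
  proof (rule always_eventually, rule allI)
   fix k
   show "norm (H k z) <= inverse (real k + 3)"
    unfolding H_def norm_inverse using m[of k] by (intro le_imp_inverse_le) auto
  qed
  show "(%k. inverse (real k + 3)) ----> 0" by real_asymp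
 qed
 show thesis
 proof (rule that[OF r(1)])
  fix w assume w: "w : ball z r"
  show "~ bounded (range (%n. (f ^^ n) w))"
  proof
   assume "bounded (range (%n. (f ^^ n) w))"
   then obtain B where B: "B > 0" "!!n. norm ((f ^^ n) w) <= B" unfolding bounded_pos by blast
   obtain g sig where g: "g hol_on ball z r" "strict_mono (sig :: nat => nat)"
    "!!x. x : ball z r ==> ((%n. H (sig n) x) ---> g x) sequentially"
    "!!K. compact K ==> K <= ball z r ==> uniform_limit K (H o sig) g sequentially"
   proof (rule Montel[of "ball z r" "range H" H])
    show "EX B. ALL h:range H. ALL z:K. norm (h z) <= B" if "compact K" "K <= ball z r" for K
     using H1 that by (intro exI[of _ 1]) blast
   qed (use Hh in auto)
   have gz: "g z = 0"
   proof -
    have "(%n. H (sig n) z) ----> 0" using LIMSEQ_subseq_LIMSEQ[OF Hz g(2)] by (simp add: o_def)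
    thus ?thesis using g(3)[of z] r(1) LIMSEQ_unique by auto
   qed
   have "g constant_on ball z r"
   proof (rule ccontr)
    assume nc: "~ g constant_on ball z r"
    have "g z ~= 0"
    proof (rule Hurwitz_no_zeros[OF open_ball connected_ball _ g(1) g(4) nc])
     show "(H o sig) n hol_on ball z r" for n using Hh by simp
     show "(H o sig) n u ~= 0" if "u : ball z r" for n u using nz[OF that] by (simp add: H_def)
    qed (use r in auto)
    thus False using gz by simp
   qed
   hence "g w = 0" using gz w r(1) unfolding constant_on_def by (metis centre_in_ball)
   hence "(%n. H (sig n) w) ----> 0" using g(3)[OF w] by simp
   hence "\<forall>\<^sub>F n in sequentially. norm (H (sig n) w) < inverse B"
    using B(1) by (auto dest!: tendstoD[of _ 0 sequentially "inverse B"] simp: dist_norm)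
   then obtain n where "norm (H (sig n) w) < inverse B" by (auto simp: eventually_sequentially)
   hence "B < norm ((f ^^ (m (sig n))) w)"
    using B(1) nz[OF w, of "sig n"] by (simp add: H_def norm_inverse)
   thus False using B(2)[of "m (sig n)"] by simp
  qed
 qed
qed

text \<open>Without singular values the identity would lift to a global inverse and \<open>f\<close>
  would be injective; but \<open>exp (L w)\<close> and \<open>exp (L (w + per 1))\<close> for a
  logarithmic branch have the same image and differ.\<close>

lemma singular_values_nonempty:
 assumes tr: "transcendental_entire f"
 shows "singular_values f ~= {}"
proof
 assume S: "singular_values f = {}"
 have f: "f hol_on UNIV" using tr by (simp add: trans_def)
 obtain G where G: "G hol_on UNIV" "G (f 0) = 0" "!!w. f (G w) = w"
  using holomorphic_lift[OF f, of UNIV UNIV "%z. z" "f 0" 0] S by auto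
 have inj: "G (f z) = z" for z
 proof (rule lift_unique[OF f, of UNIV UNIV f "%z. G (f z)" "%z. z" 0])
  show "continuous_on UNIV (%z. G (f z))"
   by (rule cont_comp[OF hol_cont[OF G(1)] hol_cont[OF f]]) auto
 qed (use S G in auto)
 obtain X where X: "log_level f X" using log_level_exists[of f 0] S by auto
 obtain z where z: "norm (f z) > exp X" using transcendental_unbounded[OF tr] by blast
 have "z ~= 0" using z X by (auto simp: log_level_def)
 moreover have fz: "f z ~= 0" using z by (metis exp_gt_zero less_asym norm_zero)
 ultimately have "f (exp (Ln z)) = exp (Ln (f z))" by simp
 moreover have XR: "X < Re (Ln (f z))" using z fz by (metis Re_Ln exp_ln_iff exp_less_cancel_iff zero_less_norm_iff)
 ultimately obtain L where L: "L : log_branches f X" using log_branch_through[OF tr X] by metis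
 let ?w = "Ln (f z)"
 have "f (exp (L ?w)) = exp ?w" "f (exp (L (?w + per 1))) = exp ?w"
  using L XR by (auto simp: log_branches_def)
 hence "exp (L (?w + per 1)) = exp (L ?w)" using inj by metis
 then obtain n where "L (?w + per 1) = L ?w + per n" using exp_eq_per by blast
 hence "?w + per 1 = ?w" by (intro log_branch_inj(1)[OF tr X L, of ?w "?w + per 1" n]) (use XR in simp_all)
 thus False by simp
qed

text \<open>Between a fixed base point and abscissa \<open>2 * t\<close> a logarithmic branch
  changes only by a multiple of \<open>ln t\<close>, so every value of modulus
  \<open>exp (2 * t)\<close> is taken inside the disc of radius \<open>exp t\<close>.\<close>

lemma circle_in_image:
 assumes tr: "transcendental_entire f" and lev: "log_level f X"
 obtains T where "T > 0" "!!t u. t >= T ==> norm u = exp (2 * t) ==> EX z. norm z < exp t & f z = u"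
proof -
 obtain L where L: "L : log_branches f X" using log_branch_exists[OF tr lev] by blast
 define b where "b = complex_of_real (X + 1)"
 define c where "c = Re (L b)"
 have "filterlim (%t. t - (c + 12 * pi * (ln (2 * t - X) + 1))) at_top at_top" by real_asymp
 hence "\<forall>\<^sub>F t in at_top. 0 < t - (c + 12 * pi * (ln (2 * t - X) + 1))" unfolding filterlim_at_top_dense by (rule spec)
 moreover have "\<forall>\<^sub>F t in at_top. 2 * t - X >= 1 + 2 * pi" by real_asymp
 moreover have "\<forall>\<^sub>F t in at_top. (t::real) > 0" by (rule eventually_gt_at_top)
 ultimately have "\<forall>\<^sub>F t in at_top. 0 < t - (c + 12 * pi * (ln (2 * t - X) + 1)) & 2 * t - X >= 1 + 2 * pi & t > 0"
  by eventually_elim auto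
 then obtain T0 where T0: "!!t. t >= T0 ==> 0 < t - (c + 12 * pi * (ln (2 * t - X) + 1)) & 2 * t - X >= 1 + 2 * pi & t > 0"
  unfolding eventually_at_top_linorder by blast
 show thesis
 proof (rule that[of "T0"])
  show "T0 > 0" using T0[of T0] by simp
  fix t and u :: complex assume t: "T0 <= t" and u: "norm u = exp (2 * t)"
  have u0: "u ~= 0" using u by auto
  let ?w = "Ln u"
  have Rw: "Re ?w = 2 * t" using u u0 by simp
  have Iw: "abs(Im ?w) <= pi" using mpi_less_Im_Ln[OF u0] Im_Ln_le_pi[OF u0] by simp
  note T = T0[OF t]
  have T1: "2 * t - X >= 1" using T pi_gt_zero by linarith
  have "norm (L ?w - L b) <= 12 * pi * (ln ((2 * t - X) / (Re ?w - X)) + ln ((2 * t - X) / (Re b - X)) + 1)"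
  proof (rule half_plane_increment[OF _ log_branch_deriv_bound[OF tr lev L]])
   show "L hol_on {w. X < Re w}" using L by (simp add: log_branches_def)
   have "2 * t > X" using T pi_gt_zero by linarith
   thus "X < Re ?w" using Rw by linarith
   show "Re ?w - X <= 2 * t - X" using Rw by linarith
   show "abs(Im ?w - Im b) <= 2 * t - X" using Iw T pi_gt_zero unfolding b_def by (auto simp del: abs_le_iff)
   show "X < Re b" "Re b - X <= 2 * t - X" using T1 unfolding b_def by simp_all
  qed auto
  also have "... = 12 * pi * (ln (2 * t - X) + 1)" using Rw T pi_gt_zero unfolding b_def by simp
  finally have "Re (L ?w) - c <= 12 * pi * (ln (2 * t - X) + 1)" using abs_Re_le_cmod[of "L ?w - L b"] by (simp add: c_def)
  hence "Re (L ?w) < t" using T by linarith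
  moreover have "f (exp (L ?w)) = u"
  proof -
   have "X < Re ?w" using Rw T1 by linarith
   hence "f (exp (L ?w)) = exp ?w" using L unfolding log_branches_def by blast
   thus ?thesis using u0 by simp
  qed
  ultimately show "EX z. norm z < exp t & f z = u" by (intro exI[of _ "exp (L ?w)"]) simp
 qed
qed

text \<open>Each use of \<open>circle_in_image\<close> doubles the exponent; the maximum principle
  first moves the point given by induction from the disc of radius \<open>exp (2 * t)\<close> to its
  boundary circle. This will show that the Fatou set is not the whole plane.\<close>

lemma iterates_unbounded_somewhere:
 assumes tr: "transcendental_entire f" and S: "bounded (singular_values f)"
 obtains R where "!!M. EX n z. norm z <= R & norm ((f ^^ n) z) > M"
proof -
 have f: "f hol_on UNIV" using tr by (simp add: trans_def)
 obtain X where X: "log_level f X" using log_level_exists[OF S] by blast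
 obtain T where T: "T > 0" "!!t u. t >= T ==> norm u = exp (2 * t) ==> EX z. norm z < exp t & f z = u"
  using circle_in_image[OF tr X] by blast
 have step: "EX z. norm z <= exp t & norm ((f ^^ n) z) >= exp (2 ^ n * t)" if "t >= T" for n t
  using that
 proof (induction n arbitrary: t)
  case 0
  show ?case by (intro exI[of _ "of_real (exp t)"]) (simp add: norm_of_real)
 next
  case (Suc n)
  have "2 * t >= T" using Suc.prems T(1) by simp
  from Suc.IH[OF this] obtain z where z: "norm z <= exp (2 * t)" "norm ((f ^^ n) z) >= exp (2 ^ n * (2 * t))" by blast
  have "EX u. norm u = exp (2 * t) & norm ((f ^^ n) u) >= exp (2 ^ n * (2 * t))"
  proof (rule ccontr)
   assume "~ ?thesis"
   hence lt: "norm ((f ^^ n) u) < exp (2 ^ n * (2 * t))" if "norm u = exp (2 * t)" for u using that by (meson not_less)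
   have hn: "(f ^^ n) hol_on S" for S using funpow_holomorphic[OF f] hol_sub by blast
   have sph: "sphere (0::complex) (exp (2*t)) ~= {}" by simp
   have "continuous_on (sphere 0 (exp (2*t))) (%u. norm ((f ^^ n) u))"
    by (intro cont_intros hol_cont[OF hn])
   then obtain u0 where u0: "u0 : sphere 0 (exp (2*t))" "!!u. u : sphere 0 (exp (2*t)) ==> norm ((f ^^ n) u) <= norm ((f ^^ n) u0)"
    using continuous_attains_sup[OF compact_sphere sph] by metis
   have "norm ((f ^^ n) z) <= norm ((f ^^ n) u0)"
   proof (rule maximum_modulus_frontier[of "f ^^ n" "cball 0 (exp (2 * t))"])
    show "continuous_on (closure (cball 0 (exp (2 * t)))) (f ^^ n)" by (rule hol_cont[OF hn])
    show "norm ((f ^^ n) x) <= norm ((f ^^ n) u0)" if "x : frontier (cball 0 (exp (2 * t)))" for x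
     using that by (intro u0) (simp add: frontier_cball)
   qed (use hn z in auto)
   thus False using lt[of u0] u0(1) z(2) by simp
  qed
  then obtain u where u: "norm u = exp (2 * t)" "norm ((f ^^ n) u) >= exp (2 ^ n * (2 * t))" by blast
  obtain y where y: "norm y < exp t" "f y = u" using T(2)[OF Suc.prems u(1)] by blast
  thus ?case using u(2) by (intro exI[of _ y]) (simp add: funpow_Suc_right mult_ac del: funpow.simps)
 qed
 show thesis
 proof (rule that[of "exp T"])
  fix M :: real
  obtain n :: nat where n: "abs M / T < real n" using reals_Archimedean2 by blast
  have "M <= abs M" by simp
  also have "... < real n * T" using n T(1) by (simp add: field_simps)
  also have "... <= 2 ^ n * T" using T(1) by (intro mult_right_mono) (simp_all add: of_nat_less_two_power less_imp_le)
  also have "... < exp (2 ^ n * T)" using exp_ge_add_one_self[of "2 ^ n * T"] by linarith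
  finally show "EX n z. norm z <= exp T & norm ((f ^^ n) z) > M" using step[of T n] by (meson less_le_trans order_refl)
 qed
qed

section \<open>Topology and dynamics of the Fatou set\<close>

locale disjoint_type_map =
 fixes f :: "complex => complex"
 assumes tr: "transcendental_entire f" and dis: "disjoint_type f"
begin

abbreviation "F == Fatou_set f"
abbreviation "J == Julia_set f"

lemma f_hol: "f hol_on S"
 using tr hol_sub unfolding trans_def by blast

lemma f_cont: "continuous_on S f" using f_hol hol_cont by blast

lemma fn_hol: "(f ^^ n) hol_on S"
 using funpow_holomorphic[OF f_hol] hol_sub by blast

lemma J_eq: "J = - F" by (simp add: Fatou_set_def)

definition "PS = postsingular_set f"

lemma PS: "compact PS" "PS <= F" "singular_values f <= PS" "PS ~= {}" "f ` PS <= PS"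
proof -
 show "compact PS" "PS <= F" using dis by (auto simp: disjoint_type_def hyperbolic_def PS_def)
 show S: "singular_values f <= PS"
 proof
  fix z assume "z : singular_values f"
  hence "z : (UN j. (f ^^ j) ` singular_values f)" by (intro UN_I[of 0]) auto
  thus "z : PS" unfolding PS_def postsingular_set_def by (rule subsetD[OF closure_subset])
 qed
 thus "PS ~= {}" using singular_values_nonempty[OF tr] by auto
 let ?U = "UN j. (f ^^ j) ` singular_values f"
 have "f ` closure ?U <= closure (f ` ?U)"
  by (rule image_closure_subset[OF f_cont closed_closure closure_subset])
 also have "... <= closure ?U"
 proof (rule closure_mono, rule subsetI)
  fix y assume "y : f ` ?U"
  then obtain j s where "s : singular_values f" "y = f ((f ^^ j) s)" by blast
  thus "y : ?U" by (intro UN_I[of "Suc j"]) (auto intro!: image_eqI[of _ _ s])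
 qed
 finally show "f ` PS <= PS" by (simp add: PS_def postsingular_set_def)
qed

lemma sing_bounded: "bounded (singular_values f)"
 using PS compact_imp_bounded bounded_subset by blast

lemma PS_orbit: "z : PS ==> (f ^^ n) z : PS"
 using PS(5) by (induction n) auto

lemma F_connected: "connected F" using dis by (simp add: disjoint_type_def)

text \<open>The points with bounded orbit form a clopen subset of the connected set
  \<open>F\<close>, and the postsingular set consists of such points.\<close>

lemma F_bounded_orbit: assumes "z : F" shows "bounded (range (%n. (f ^^ n) z))"
proof -
 define A where "A = {z : F. bounded (range (%n. (f ^^ n) z))}"
 have op: "openin (top_of_set F) A"
 proof (subst openin_subopen, intro ballI)
  fix z assume z: "z : A"
  then obtain M where "!!n. norm ((f ^^ n) z) <= M" unfolding A_def bounded_iff by auto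
  then obtain r M' where r: "r > 0" "!!n w. w : ball z r ==> norm ((f ^^ n) w) <= M'"
   using Fatou_bounded_orbit_nbhd[of z f M] z unfolding A_def by blast
  have "F Int ball z r <= A" unfolding A_def bounded_iff using r(2) by blast
  moreover have "openin (top_of_set F) (F Int ball z r)" by (simp add: openin_open_Int)
  ultimately show "EX T. openin (top_of_set F) T & z : T & T <= A" using z r(1) unfolding A_def by (intro exI[of _ "F Int ball z r"]) auto
 qed
 have "openin (top_of_set F) (F - A)"
 proof (subst openin_subopen, intro ballI)
  fix z assume z: "z : F - A"
  then obtain r where r: "r > 0" "!!w. w : ball z r ==> ~ bounded (range (%n. (f ^^ n) w))"
   using Fatou_unbounded_orbit_nbhd[OF f_hol, of z] unfolding A_def by blast
  have "F Int ball z r <= F - A" unfolding A_def using r(2) by blast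
  moreover have "openin (top_of_set F) (F Int ball z r)" by (simp add: openin_open_Int)
  ultimately show "EX T. openin (top_of_set F) T & z : T & T <= F - A" using z r(1) by (intro exI[of _ "F Int ball z r"]) auto
 qed
 hence cl: "closedin (top_of_set F) A" by (simp add: closedin_def A_def)
 obtain s where "s : PS" using PS(4) by blast
 hence "s : A" unfolding A_def using PS(2) PS_orbit[of s] compact_imp_bounded[OF PS(1)]
  by (auto intro!: bounded_subset[of PS])
 hence "A = F" using F_connected op cl unfolding connected_clopen by blast
 thus ?thesis using assms unfolding A_def by blast
qed

lemma F_loc_bounded:
 assumes "z : F" obtains r M where "r > 0" "!!n w. w : ball z r ==> norm ((f ^^ n) w) <= M"
proof -
 obtain M where "!!n. norm ((f ^^ n) z) <= M" using F_bounded_orbit[OF assms] unfolding bounded_iff by auto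
 thus thesis using Fatou_bounded_orbit_nbhd[OF assms, of M] that by blast
qed

lemma F_open: "open F"
proof (rule openI)
 fix z assume "z : F"
 then obtain r M where r: "r > 0" "!!n w. w : ball z r ==> norm ((f ^^ n) w) <= M" using F_loc_bounded by blast
 have "ball z (r/2) <= F"
 proof
  fix w assume w: "w : ball z (r/2)"
  have "ball w (r/2) <= ball z r"
  proof
   fix u assume "u : ball w (r/2)"
   thus "u : ball z r" using w dist_triangle[of z u w] by auto
  qed
  thus "w : F" using r by (intro bounded_iterates_Fatou[OF f_hol, of "r/2" w M]) auto
 qed
 thus "EX e>0. ball z e <= F" using r(1) by (intro exI[of _ "r/2"]) auto
qed

lemma J_closed: "closed J" unfolding J_eq using F_open by (rule closed_Compl)

lemma F_compact_bounded:
 assumes "compact K" "K <= F" obtains M where "!!n w. w : K ==> norm ((f ^^ n) w) <= M"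
proof -
 have "EX r M. r > 0 & (ALL n. ALL w:ball z r. norm ((f ^^ n) w) <= M)" if z: "z : K" for z
 proof -
  have "z : F" using z assms(2) by blast
  then obtain r M where "r > 0" "!!n w. w : ball z r ==> norm ((f ^^ n) w) <= M" using F_loc_bounded by blast
  thus ?thesis by blast
 qed
 then obtain r M where rM: "!!z. z : K ==> r z > 0 & (ALL n. ALL w:ball z (r z). norm ((f ^^ n) w) <= M z)" by metis
 have "K <= (UN z:K. ball z (r z))" using rM by auto
 then obtain K' where K': "K' <= K" "finite K'" "K <= (UN z:K'. ball z (r z))"
  using compactE_image[OF assms(1), of K "%z. ball z (r z)"] by auto
 show thesis
 proof (rule that[of "Max (insert 0 (M ` K'))"])
  fix n w assume "w : K"
  then obtain z where z: "z : K'" "w : ball z (r z)" using K'(3) by blast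
  hence "norm ((f ^^ n) w) <= M z" using rM K'(1) by blast
  also have "... <= Max (insert 0 (M ` K'))" using z K'(2) by (intro Max_ge) auto
  finally show "norm ((f ^^ n) w) <= Max (insert 0 (M ` K'))" .
 qed
qed

text \<open>Local boundedness of orbits characterises \<open>F\<close>; it passes to preimages by
  continuity and to images by the open mapping theorem.\<close>

lemma F_invariant: "f z : F \<longleftrightarrow> z : F"
proof
 assume "f z : F"
 then obtain r M where r: "r > 0" "!!n w. w : ball (f z) r ==> norm ((f ^^ n) w) <= M" using F_loc_bounded by blast
 have "isCont f z" using f_cont[of UNIV] by (simp add: cont_at)
 then obtain d where d: "d > 0" "!!w. dist w z < d ==> dist (f w) (f z) < r"
  using r(1) unfolding cont_eps by metis
 show "z : F"
 proof (rule bounded_iterates_Fatou[OF f_hol, of "min d 1" z "max M (norm z + 1)"])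
  fix n w assume w: "w : ball z (min d 1)"
  show "norm ((f ^^ n) w) <= max M (norm z + 1)"
  proof (cases n)
   case 0
   have "norm w <= norm z + 1" using w norm_triangle_ineq2[of w z] by (simp add: dist_norm norm_minus_commute)
   thus ?thesis using 0 by (simp add: le_max_iff_disj)
  next
   case (Suc m)
   have "f w : ball (f z) r" using d(2)[of w] w by (simp add: dist_commute)
   hence "norm ((f ^^ m) (f w)) <= M" by (rule r(2))
   thus ?thesis using Suc by (simp add: funpow_Suc_right del: funpow.simps)
  qed
 qed (use d in auto)
next
 assume "z : F"
 then obtain r M where r: "r > 0" "!!n w. w : ball z r ==> norm ((f ^^ n) w) <= M" using F_loc_bounded by blast
 have "~ f constant_on UNIV"
 proof
  assume "f constant_on UNIV"
  then obtain c where c: "!!z. f z = c" by (auto simp: constant_on_def)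
  hence "ALL z. f z = poly [:c:] z" by simp
  thus False using tr unfolding trans_def by blast
 qed
 hence "open (f ` ball z r)"
  using open_mapping_thm[OF f_hol[of UNIV] open_UNIV connected_UNIV open_ball] by auto
 then obtain e where e: "e > 0" "ball (f z) e <= f ` ball z r" using r(1) by (meson centre_in_ball imageI openE)
 show "f z : F"
 proof (rule bounded_iterates_Fatou[OF f_hol e(1)])
  fix n w assume "w : ball (f z) e"
  then obtain u where "u : ball z r" "w = f u" using e(2) by blast
  thus "norm ((f ^^ n) w) <= M" using r(2)[of u "Suc n"] by (simp add: funpow_Suc_right del: funpow.simps)
 qed
qed

lemma Fn_invariant: "(f ^^ n) z : F \<longleftrightarrow> z : F"
 by (induction n) (auto simp: F_invariant)

text \<open>The iterates are uniformly bounded on a loop in \<open>F\<close>, and by the maximum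
  principle also on the region it encloses.\<close>

lemma F_simply_connected: "simply_connected F"
 unfolding simply_connected_eq_winding_number_zero[OF F_open]
proof (intro conjI allI impI F_connected)
 fix g z assume g: "path g & path_image g <= F & pathfinish g = pathstart g & z ~: F"
 show "winding_number g z = 0"
 proof (rule ccontr)
  assume nz: "winding_number g z ~= 0"
  have zp: "z ~: path_image g" using g by blast
  have "z ~: outside (path_image g)"
   using winding_number_zero_in_outside[of g z] g nz by blast
  hence "z : inside (path_image g)" using zp inside_Un_outside[of "path_image g"] by blast
  let ?I = "inside (path_image g)"
  have cp: "compact (path_image g)" using g by (simp add: compact_path_image)
  have opI: "open ?I" using cp by (simp add: compact_imp_closed open_inside)
  have bI: "bounded ?I" using cp by (simp add: bounded_inside compact_imp_bounded)
  have fr: "frontier ?I <= path_image g" using cp by (simp add: compact_imp_closed frontier_inside_subset)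
  obtain M where M: "!!n w. w : path_image g ==> norm ((f ^^ n) w) <= M" using F_compact_bounded[OF cp] g by blast
  have MI: "norm ((f ^^ n) w) <= M" if "w : ?I" for n w
  proof (rule maximum_modulus_frontier[of "f ^^ n" ?I])
   show "continuous_on (closure ?I) (f ^^ n)" by (rule hol_cont[OF fn_hol])
  qed (use fn_hol bI fr M that in auto)
  obtain r where r: "r > 0" "ball z r <= ?I" using opI `z : ?I` by (meson openE)
  hence "z : F" using MI by (intro bounded_iterates_Fatou[OF f_hol r(1), of z M]) auto
  thus False using g by blast
 qed
qed

lemma F_not_UNIV: "F ~= UNIV"
proof
 assume "F = UNIV"
 obtain R where R: "!!M. EX n z. norm z <= R & norm ((f ^^ n) z) > M"
  using iterates_unbounded_somewhere[OF tr sing_bounded] by blast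
 obtain M where "!!n w. w : cball 0 R ==> norm ((f ^^ n) w) <= M"
  using F_compact_bounded[OF compact_cball] `F = UNIV` by blast
 moreover obtain n z where "norm z <= R" "norm ((f ^^ n) z) > M" using R by blast
 ultimately show False by (meson mem_cball_0 not_less)
qed

text \<open>By the great Picard theorem all values but at most one have infinitely many preimages,
  and preimages of points of the open set \<open>F\<close> stay in \<open>F\<close>.\<close>

lemma f_not_injective_on_F: obtains x y where "x : F" "y : F" "x ~= y" "f x = f y"
proof -
 let ?h = "%z. f (inverse z)"
 have hol: "?h hol_on UNIV - {0}"
 proof -
  have "(f o inverse) hol_on UNIV - {0}"
   by (intro holomorphic_on_compose hol_intros f_hol) auto
  thus ?thesis by (simp add: o_def)
 qed
 have n2: "~ ((inverse o ?h) ---> l) (at 0)" for l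
 proof
  assume "((inverse o ?h) ---> l) (at 0)"
  hence "((inverse o f) ---> l) at_infinity" by (simp add: lim_at_infinity_0 o_def)
  then obtain a n where a: "!!z. f z = (SUM i<=n. a i * z^i)" using pole_at_infinity[OF f_hol] by blast
  have "f z = poly (SUM i<=n. monom (a i) i) z" for z by (simp add: a poly_sum poly_monom)
  thus False using tr unfolding trans_def by blast
 qed
 have n1: "~ (?h ---> l) (at 0)" for l
 proof
  assume "(?h ---> l) (at 0)"
  hence "(f ---> l) at_infinity" by (simp add: lim_at_infinity_0 o_def)
  hence "f z = l" for z using Liouville_weak[OF f_hol] by blast
  hence "ALL z. f z = poly [:l:] z" by simp
  thus False using tr unfolding trans_def by blast
 qed
 obtain a where a: "!!w. w ~= a ==> infinite {x. x : UNIV - {0} & ?h x = w}"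
  using great_Picard_infinite[OF open_UNIV UNIV_I hol n1 n2] by blast
 obtain s where s: "s : PS" using PS(4) by blast
 have "EX w:F. w ~= a"
 proof (rule ccontr)
  assume "~ ?thesis"
  hence "F <= {a}" by blast
  hence "open {a}" using F_open s PS(2) by (metis subsetD subset_singletonD empty_iff)
  thus False by (simp add: not_open_singleton)
 qed
 then obtain w where w: "w : F" "w ~= a" by blast
 let ?S = "{x. x : UNIV - {0} & ?h x = w}"
 obtain x where "x : ?S" using infinite_imp_nonempty[OF a[OF w(2)]] by blast
 hence x: "x ~= 0" "f (inverse x) = w" by auto
 have "infinite (?S - {x})" using a[OF w(2)] by (rule Diff_infinite_finite[rotated]) simp
 from infinite_imp_nonempty[OF this] obtain y where "y : ?S - {x}" by blast
 hence y: "y ~= 0" "f (inverse y) = w" "y ~= x" by auto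
 show thesis
 proof (rule that)
  show "inverse x : F" "inverse y : F" using x y w F_invariant by metis+
  show "inverse x ~= inverse y" using y(3) by simp
  show "f (inverse x) = f (inverse y)" using x y by simp
 qed
qed

end

section \<open>Uniformisation of the Fatou set\<close>

abbreviation "moeb == Moebius_function 0"

lemma moeb_facts:
 assumes "norm a < 1"
 shows "moeb a hol_on ball 0 1" "moeb a a = 0" "moeb a 0 = - a"
  "norm z < 1 ==> norm (moeb a z) < 1"
  "norm z < 1 ==> moeb (-a) (moeb a z) = z" "norm z < 1 ==> moeb a (moeb (-a) z) = z"
 using assms by (auto simp: Moebius_function_holomorphic Moebius_function_eq_zero Moebius_function_of_zero
   Moebius_function_norm_lt_1 Moebius_function_compose)

lemma norm_cnj_mult_less_1:
 assumes "norm a < 1" "norm z < 1" shows "norm (cnj a * z) < 1"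
proof -
 have "norm (cnj a * z) <= norm a * 1" using assms by (simp only: norm_mult complex_mod_cnj) (intro mult_left_mono; simp)
 thus ?thesis using assms by simp
qed

lemma moeb_deriv:
 assumes a: "norm a < 1" and z: "norm z < 1"
 shows "(moeb a has_field_derivative (1 - of_real ((norm a)\<^sup>2)) / (1 - cnj a * z)\<^sup>2) (at z)"
proof -
 have nz: "1 - cnj a * z ~= 0"
 proof
  assume "1 - cnj a * z = 0"
  hence "norm (cnj a * z) = 1" by (metis norm_one right_minus_eq)
  moreover have "norm (cnj a * z) < 1" by (rule norm_cnj_mult_less_1[OF a z])
  ultimately show False by simp
 qed
 have eq: "moeb a = (%z. (z - a) / (1 - cnj a * z))" by (auto simp: Moebius_function_simple)
 have "((%z. (z - a) / (1 - cnj a * z)) has_field_derivative (1 * (1 - cnj a * z) - (z - a) * (- cnj a)) / ((1 - cnj a * z) * (1 - cnj a * z))) (at z)"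
  using nz by (intro DERIV_divide) (auto intro!: derivative_eq_intros)
 moreover have "1 * (1 - cnj a * z) - (z - a) * (- cnj a) = 1 - of_real ((norm a)\<^sup>2)"
  by (simp only: complex_norm_square) (simp add: algebra_simps)
 ultimately have "((%z. (z - a) / (1 - cnj a * z)) has_field_derivative (1 - of_real ((norm a)\<^sup>2)) / ((1 - cnj a * z) * (1 - cnj a * z))) (at z)"
  by (simp only:)
 thus ?thesis unfolding eq by (simp only: power2_eq_square[of "1 - cnj a * z"])
qed

text \<open>Schwarz--Pick: conjugating by Moebius maps reduces to a self-map of the disc fixing the origin.\<close>

lemma Schwarz_conj:
 assumes h: "h hol_on ball 0 1" "!!z. norm z < 1 ==> norm (h z) < 1" and a: "norm a < 1"
 defines "k == %z. moeb (h a) (h (moeb (-a) z))"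
 shows "k hol_on ball 0 1" "k 0 = 0" "!!z. norm z < 1 ==> norm (k z) < 1"
proof -
 have ha: "norm (h a) < 1" and ma: "norm (- a) < 1" using h a by auto
 have "(moeb (h a) o (h o moeb (-a))) hol_on ball 0 1"
  by (intro hol_comp[of _ _ _ "ball 0 1"] moeb_facts(1) ha ma h(1))
   (use moeb_facts(4)[OF ma] h in auto)
 thus "k hol_on ball 0 1" by (simp add: k_def o_def)
 show "k 0 = 0" using moeb_facts(2)[OF ha] moeb_facts(3)[OF ma] by (simp add: k_def)
 show "!!z. norm z < 1 ==> norm (k z) < 1"
  unfolding k_def using moeb_facts(4)[OF ha] moeb_facts(4)[OF ma] h by blast
qed

text \<open>Equality in Schwarz's lemma would make the conjugated map a rotation and hence
  \<open>h\<close> injective; strictness is stated in this form to match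
  \<open>f_not_injective_on_F\<close>.\<close>

lemma Schwarz_Pick:
 assumes h: "h hol_on ball 0 1" "!!z. norm z < 1 ==> norm (h z) < 1" and ab: "norm a < 1" "norm b < 1"
 shows "norm (moeb (h a) (h b)) <= norm (moeb a b)"
  and "~ inj_on h (ball 0 1) ==> a ~= b ==> norm (moeb (h a) (h b)) < norm (moeb a b)"
proof -
 define k where "k z = moeb (h a) (h (moeb (-a) z))" for z
 have k: "k hol_on ball 0 1" "k 0 = 0" "!!z. norm z < 1 ==> norm (k z) < 1"
  using Schwarz_conj[OF h ab(1)] by (simp_all add: k_def[abs_def])
 have xi: "norm (moeb a b) < 1" using moeb_facts(4)[OF ab] .
 have kab: "k (moeb a b) = moeb (h a) (h b)" using moeb_facts(5)[OF ab] by (simp add: k_def)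
 show le: "norm (moeb (h a) (h b)) <= norm (moeb a b)" using Schwarz_Lemma(1)[OF k xi] kab by simp
 assume ni: "~ inj_on h (ball 0 1)" and ne: "a ~= b"
 have ma: "norm (- a) < 1" using ab by simp
 have x0: "moeb a b ~= 0"
 proof
  assume "moeb a b = 0"
  hence "b = moeb (-a) 0" using moeb_facts(5)[OF ab] by metis
  thus False using moeb_facts(3)[OF ma] ne by simp
 qed
 show "norm (moeb (h a) (h b)) < norm (moeb a b)"
 proof (rule ccontr)
  assume "~ ?thesis"
  hence "norm (k (moeb a b)) = norm (moeb a b)" using le kab by simp
  then obtain al where al: "!!z. norm z < 1 ==> k z = al * z" "norm al = 1"
   using Schwarz_Lemma(3)[OF k xi] x0 xi by blast
  have "inj_on h (ball 0 1)"
  proof (rule inj_onI)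
   fix x y :: complex assume xy: "x : ball 0 1" "y : ball 0 1" "h x = h y"
   have n: "norm x < 1" "norm y < 1" using xy by auto
   have "k (moeb a x) = k (moeb a y)" using moeb_facts(5)[OF ab(1)] n xy(3) by (simp add: k_def)
   hence "al * moeb a x = al * moeb a y" using al(1) moeb_facts(4)[OF ab(1)] n by metis
   hence "moeb a x = moeb a y" using al(2) by auto
   thus "x = y" using moeb_facts(5)[OF ab(1)] n by metis
  qed
  thus False using ni by simp
 qed
qed

lemma Schwarz_Pick_deriv:
 assumes h: "h hol_on ball 0 1" "!!z. norm z < 1 ==> norm (h z) < 1" and a: "norm a < 1"
 shows "norm (deriv h a) * (1 - (norm a)\<^sup>2) <= 1 - (norm (h a))\<^sup>2"
proof -
 define k where "k z = moeb (h a) (h (moeb (-a) z))" for z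
 have k: "k hol_on ball 0 1" "k 0 = 0" "!!z. norm z < 1 ==> norm (k z) < 1"
  using Schwarz_conj[OF h a] by (simp_all add: k_def[abs_def])
 have ha: "norm (h a) < 1" and ma: "norm (- a) < 1" using h a by auto
 have m0: "moeb (-a) 0 = a" using moeb_facts(3)[OF ma] by simp
 have d1: "(moeb (-a) has_field_derivative (1 - of_real ((norm a)\<^sup>2))) (at 0)"
  using moeb_deriv[OF ma, of 0] by simp
 have d2: "(h has_field_derivative deriv h a) (at (moeb (-a) 0))"
  using holomorphic_derivI[OF h(1) open_ball, of a] a m0 by simp
 have d3: "(moeb (h a) has_field_derivative (1 - of_real ((norm (h a))\<^sup>2)) / (1 - cnj (h a) * h a)\<^sup>2) (at (h (moeb (-a) 0)))"
  using moeb_deriv[OF ha ha] m0 by simp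
 have "(k has_field_derivative (1 - of_real ((norm (h a))\<^sup>2)) / (1 - cnj (h a) * h a)\<^sup>2 * (deriv h a * (1 - of_real ((norm a)\<^sup>2)))) (at 0)"
  unfolding k_def
  by (rule DERIV_chain2[where g = "%z. h (moeb (-a) z)", OF d3]) (rule DERIV_chain2[where g = "moeb (-a)", OF d2 d1])
 hence dk: "deriv k 0 = (1 - of_real ((norm (h a))\<^sup>2)) / (1 - cnj (h a) * h a)\<^sup>2 * (deriv h a * (1 - of_real ((norm a)\<^sup>2)))"
  by (rule DERIV_imp_deriv)
 have c: "cnj (h a) * h a = of_real ((norm (h a))\<^sup>2)" by (metis complex_norm_square mult.commute)
 define s where "s = 1 - (norm (h a))\<^sup>2"
 define t where "t = 1 - (norm a)\<^sup>2"
 have st: "s > 0" "t > 0" using ha a by (auto simp: s_def t_def power_less_one_iff abs_square_less_1)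
 have "deriv k 0 = of_real s / (of_real s)\<^sup>2 * (deriv h a * of_real t)"
  unfolding dk c by (simp add: s_def t_def)
 hence "norm (deriv k 0) = s / s\<^sup>2 * (norm (deriv h a) * t)" using st by (simp add: norm_mult norm_divide norm_power)
 also have "... = norm (deriv h a) * t / s" using st by (simp add: power2_eq_square)
 finally have "norm (deriv h a) * t / s <= 1" using Schwarz_Lemma(2)[OF k, of 0] by simp
 thus ?thesis using st by (simp add: s_def t_def divide_le_eq)
qed

text \<open>The Cayley transform turns the target half-plane into the disc. It will be applied on
  discs touching the imaginary axis, of fixed radius in the strip and of growing radius in the
  half-plane.\<close>

lemma Schwarz_Pick_half_plane:
 assumes h: "h hol_on ball c rh" "!!z. z : ball c rh ==> Re (h z) > 0" and s: "s : ball c rh"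
 shows "norm (deriv h s) * (rh\<^sup>2 - (dist c s)\<^sup>2) <= 2 * rh * Re (h s)"
proof -
 have rh: "rh > 0" using s by (meson le_less_trans mem_ball zero_le_dist)
 define a where "a = (s - c) / of_real rh"
 have na: "norm a = dist c s / rh" using rh by (simp add: a_def norm_divide dist_norm norm_minus_commute)
 hence a: "norm a < 1" using s rh by simp
 define m where "m u = c + of_real rh * u" for u
 have ma: "m a = s" using rh by (simp add: m_def a_def)
 have mb: "m u : ball c rh" if "norm u < 1" for u using that rh by (simp add: m_def dist_norm norm_mult)
 define k where "k u = (h (m u) - 1) / (h (m u) + 1)" for u
 have nz: "h (m u) + 1 ~= 0" if "norm u < 1" for u
 proof
  assume "h (m u) + 1 = 0"
  hence "Re (h (m u)) = -1" by (simp add: complex_eq_iff)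
  thus False using h(2)[OF mb[OF that]] by simp
 qed
 have id: "(norm (w + 1))\<^sup>2 - (norm (w - 1))\<^sup>2 = 4 * Re w" for w :: complex
  by (simp only: cmod_power2) (simp add: power2_eq_square algebra_simps)
 have k1: "norm (k u) < 1" if u: "norm u < 1" for u
 proof -
  have "(norm (h (m u) - 1))\<^sup>2 < (norm (h (m u) + 1))\<^sup>2" using id[of "h (m u)"] h(2)[OF mb[OF u]] by simp
  hence "norm (h (m u) - 1) < norm (h (m u) + 1)" by (rule power_less_imp_less_base) simp
  thus ?thesis using nz[OF u] by (simp add: k_def norm_divide)
 qed
 have hm: "(%u. h (m u)) hol_on ball 0 1"
 proof -
  have "(h o m) hol_on ball 0 1"
  proof (rule hol_comp[OF _ h(1)])
   show "m hol_on ball 0 1" unfolding m_def[abs_def] by (intro hol_intros)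
  qed (use mb in auto)
  thus ?thesis by (simp add: o_def)
 qed
 have kh: "k hol_on ball 0 1"
  unfolding k_def using hm nz by (intro hol_intros) auto
 have dm: "((%u. h (m u)) has_field_derivative deriv h s * of_real rh) (at a)"
 proof (rule DERIV_chain2[where f = h and g = m])
  show "(h has_field_derivative deriv h s) (at (m a))" using holomorphic_derivI[OF h(1) open_ball s] ma by simp
  show "(m has_field_derivative of_real rh) (at a)" unfolding m_def by (auto intro!: derivative_eq_intros)
 qed
 let ?H = "h s"
 have "(k has_field_derivative ((deriv h s * of_real rh) * (?H + 1) - (?H - 1) * (deriv h s * of_real rh)) / ((?H + 1) * (?H + 1))) (at a)"
  unfolding k_def
  using DERIV_divide[OF DERIV_diff[OF dm DERIV_const[of 1]] DERIV_add[OF dm DERIV_const[of 1]]] nz[OF a] ma by simp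
 moreover have "((deriv h s * of_real rh) * (?H + 1) - (?H - 1) * (deriv h s * of_real rh)) / ((?H + 1) * (?H + 1))
   = 2 * (deriv h s * of_real rh) / (?H + 1)\<^sup>2" by (simp add: algebra_simps power2_eq_square)
 ultimately have "deriv k a = 2 * (deriv h s * of_real rh) / (?H + 1)\<^sup>2" by (metis DERIV_imp_deriv)
 hence dk: "norm (deriv k a) = 2 * (norm (deriv h s) * rh) / (norm (?H + 1))\<^sup>2"
  using rh by (simp add: norm_mult norm_divide norm_power)
 define q where "q = (norm (?H + 1))\<^sup>2"
 have q: "q > 0" using nz[OF a] ma by (simp add: q_def)
 have "(norm (k a))\<^sup>2 = (norm (?H - 1))\<^sup>2 / q" by (simp add: k_def ma norm_divide power_divide q_def)
 hence "1 - (norm (k a))\<^sup>2 = 4 * Re ?H / q" using id[of ?H] q by (simp add: q_def field_simps)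
 hence "2 * (norm (deriv h s) * rh) / q * (1 - (norm a)\<^sup>2) <= 4 * Re ?H / q"
  using Schwarz_Pick_deriv[OF kh k1 a] dk by (simp add: q_def)
 hence "2 * (norm (deriv h s) * rh) * (1 - (norm a)\<^sup>2) / q <= 4 * Re ?H / q" by (simp only: times_divide_eq_left)
 hence "2 * (norm (deriv h s) * rh) * (1 - (norm a)\<^sup>2) <= 4 * Re ?H" using q by (simp only: divide_le_cancel)
 hence "norm (deriv h s) * rh * (1 - (norm a)\<^sup>2) <= 2 * Re ?H" by (simp add: mult_ac)
 hence le: "rh * (norm (deriv h s) * rh * (1 - (norm a)\<^sup>2)) <= rh * (2 * Re ?H)" using rh by (intro mult_left_mono) auto
 have "norm (deriv h s) * (rh\<^sup>2 - (dist c s)\<^sup>2) = rh * (norm (deriv h s) * rh * (1 - (norm a)\<^sup>2))"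
  unfolding na using rh by (simp add: field_simps power2_eq_square)
 also note le
 also have "rh * (2 * Re ?H) = 2 * rh * Re (h s)" by simp
 finally show ?thesis .
qed

text \<open>Non-injective self-maps of the disc strictly contract the pseudo-hyperbolic distance, so the
  displacement is minimised on an invariant compactum at a fixed point.\<close>

lemma disc_fixed_point:
 assumes g: "g hol_on ball 0 1" "!!z. norm z < 1 ==> norm (g z) < 1" "~ inj_on g (ball 0 1)"
  and K: "compact K" "K ~= {}" "K <= ball 0 1" "g ` K <= K"
 obtains p where "p : K" "g p = p"
proof -
 have cg: "continuous_on K g" using g(1) K(3) hol_cont cont_sub by blast
 have "continuous_on K (%x. norm ((g x - x) / (1 - cnj x * g x)))"
 proof (intro cont_intros cg ballI)
  fix x assume "x : K"
  hence x: "norm x < 1" using K by auto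
  have "norm (cnj x * g x) < 1" by (rule norm_cnj_mult_less_1[OF x g(2)[OF x]])
  thus "1 - cnj x * g x ~= 0" by auto
 qed
 hence "continuous_on K (%x. norm (moeb x (g x)))" by (simp add: Moebius_function_simple)
 from continuous_attains_inf[OF K(1,2) this]
 obtain p where p: "p : K" "!!y. y : K ==> norm (moeb p (g p)) <= norm (moeb y (g y))" by blast
 have "g p = p"
 proof (rule ccontr)
  assume ne: "g p ~= p"
  have gp: "g p : K" using p K(4) by blast
  have n: "norm p < 1" "norm (g p) < 1" using p gp K(3) by auto
  have "norm (moeb (g p) (g (g p))) < norm (moeb p (g p))"
   by (rule Schwarz_Pick(2)[OF g(1,2) n g(3)]) (use ne in auto)
  thus False using p(2)[OF gp] by simp
 qed
 thus thesis using p(1) that by blast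
qed

text \<open>The quotient \<open>h\<close> is a self-map of the disc with
  \<open>m = norm (h 0) < 1\<close>, and Schwarz-Pick gives
  \<open>norm (h u) <= (t + m) / (1 + t * m)\<close> for \<open>t = norm u\<close>. This lies below
  the linear bound with \<open>l = (1 - m) / 2\<close>.\<close>

lemma self_map_factor:
 assumes g: "g hol_on ball 0 1" "!!z. norm z < 1 ==> norm (g z) < 1" "~ inj_on g (ball 0 1)" "g 0 = 0"
 obtains h l where "0 < l" "l <= 1" "!!u. norm u < 1 ==> g u = u * h u"
  "!!u. norm u < 1 ==> norm (h u) <= 1 - (1 - norm u) * l"
proof -
 obtain h where h: "h hol_on ball 0 1" "!!z. norm z < 1 ==> g z = z * h z" "deriv g 0 = h 0"
  using Schwarz3[OF g(1,4)] by metis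
 have nrot: "~ (EX al. (ALL z. norm z < 1 --> g z = al * z) & norm al = 1)"
 proof
  assume "EX al. (ALL z. norm z < 1 --> g z = al * z) & norm al = 1"
  then obtain al where al: "!!z. norm z < 1 ==> g z = al * z" "norm al = 1" by blast
  have "inj_on g (ball 0 1)"
  proof (rule inj_onI)
   fix x y :: complex assume "x : ball 0 1" "y : ball 0 1" "g x = g y"
   hence "al * x = al * y" using al(1) by simp
   thus "x = y" using al(2) by auto
  qed
  thus False using g(3) by simp
 qed
 have h1: "norm (h z) < 1" if z: "norm z < 1" for z
 proof (cases "z = 0")
  case True
  have "norm (h 0) <= 1" "norm (h 0) ~= 1"
   using Schwarz_Lemma(2,3)[OF g(1,4,2) z] nrot h(3) by auto
  thus ?thesis using True by simp
 next
  case False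
  have "norm (g z) <= norm z" "norm (g z) ~= norm z"
   using Schwarz_Lemma(1,3)[OF g(1,4,2) z] nrot z False by blast+
  hence "norm z * norm (h z) < norm z" using h(2)[OF z] by (simp add: norm_mult)
  thus ?thesis using False by simp
 qed
 define m where "m = norm (h 0)"
 have m: "0 <= m" "m < 1" using h1[of 0] by (auto simp: m_def)
 have est: "norm (h u) <= 1 - (1 - norm u) * ((1 - m) / 2)" if u: "norm u < 1" for u
 proof -
  define t where "t = norm u"
  define x where "x = norm (h u)"
  have t: "0 <= t" "t < 1" and x: "0 <= x" "x < 1" using u h1[OF u] by (auto simp: t_def x_def)
  have "norm (moeb (h 0) (h u)) <= norm (moeb 0 u)" by (rule Schwarz_Pick(1)[OF h(1) h1]) (use u in auto)
  hence SP: "norm (h u - h 0) <= t * norm (1 - cnj (h 0) * h u)"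
  proof -
   assume a: "norm (moeb (h 0) (h u)) <= norm (moeb 0 u)"
   have "norm (cnj (h 0) * h u) < 1" using norm_cnj_mult_less_1[OF h1[of 0] h1[OF u]] by simp
   hence "1 - cnj (h 0) * h u ~= 0" by auto
   thus ?thesis using a by (simp add: Moebius_function_simple norm_divide divide_le_eq t_def)
  qed
  \<comment> \<open>The mixed terms cancel, which replaces complex quantities by the moduli
    \<open>x\<close> and \<open>m\<close>.\<close>
  have id: "(norm (h u - h 0))\<^sup>2 - (x - m)\<^sup>2 = (norm (1 - cnj (h 0) * h u))\<^sup>2 - (1 - m * x)\<^sup>2"
  proof -
   have "(norm (A - B))\<^sup>2 = (norm A)\<^sup>2 + (norm B)\<^sup>2 - 2 * Re (cnj B * A)" for A B :: complex
    by (simp only: cmod_power2) (simp add: power2_eq_square algebra_simps)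
   from this[of "h u" "h 0"] this[of 1 "cnj (h 0) * h u"] show ?thesis
    by (simp add: x_def m_def norm_mult power2_eq_square algebra_simps)
  qed
  define D where "D = norm (1 - cnj (h 0) * h u)"
  have mx: "m * x < 1" using m x by (metis mult.commute mult_left_le_one_le mult_less_cancel_right2 less_eq_real_def le_less_trans)
  have D: "D >= 1 - m * x"
   using norm_triangle_ineq2[of 1 "cnj (h 0) * h u"] by (simp add: D_def norm_mult m_def x_def)
  have "(norm (h u - h 0))\<^sup>2 <= (t * D)\<^sup>2" using SP by (intro power_mono) (auto simp: D_def)
  hence "(x - m)\<^sup>2 + D\<^sup>2 - (1 - m * x)\<^sup>2 <= t\<^sup>2 * D\<^sup>2" using id by (simp add: D_def power_mult_distrib)
  hence "(x - m)\<^sup>2 <= (1 - m * x)\<^sup>2 - (1 - t\<^sup>2) * D\<^sup>2" by (simp add: algebra_simps)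
  also have "... <= (1 - m * x)\<^sup>2 - (1 - t\<^sup>2) * (1 - m * x)\<^sup>2"
  proof -
   have "(1 - m * x)\<^sup>2 <= D\<^sup>2" using D mx by (intro power_mono) auto
   moreover have "0 <= 1 - t\<^sup>2" using t by (simp add: power_le_one)
   ultimately show ?thesis by (simp add: mult_left_mono)
  qed
  also have "... = (t * (1 - m * x))\<^sup>2" by (simp add: power_mult_distrib left_diff_distrib)
  finally have "abs(x - m) <= abs(t * (1 - m * x))" by (simp add: abs_le_square_iff)
  hence "x - m <= t * (1 - m * x)" using t mx by (simp add: abs_mult)
  hence "x * (1 + t * m) <= t + m" by (simp add: algebra_simps)
  have "x <= 1 - (1 - t) * ((1 - m) / 2)"
  proof (rule ccontr)
   assume "~ ?thesis"
   hence "(1 - (1 - t) * ((1 - m) / 2)) * (1 + t * m) < x * (1 + t * m)"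
    using t m by (intro mult_strict_right_mono) (auto simp: add_pos_nonneg)
   hence lt: "(1 - (1 - t) * ((1 - m) / 2)) * (1 + t * m) < t + m" using `x * (1 + t * m) <= t + m` by linarith
   have "(1 - t) * (1 - m) * ((1 + t * m) / 2) <= (1 - t) * (1 - m) * 1"
    using t m mult_le_one[of t m] by (intro mult_left_mono mult_nonneg_nonneg) auto
   hence "(1 + t * m) - (t + m) >= (1 - t) * ((1 - m) / 2) * (1 + t * m)" by (simp add: algebra_simps)
   thus False using lt by (simp add: algebra_simps)
  qed
  thus ?thesis by (simp add: x_def t_def)
 qed
 show thesis using that[of "(1 - m) / 2" h] m h(2) est by simp
qed

definition strip :: "real => complex set" where "strip x = {s. - x < Re s & Re s < 0}"

lemma strip_open: "open (strip x)" and strip_convex: "convex (strip x)"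
proof -
 have e: "strip x = {s. - x < Re s} Int {s. Re s < 0}" by (auto simp: strip_def)
 show "open (strip x)" unfolding e by (intro open_Int open_halfspace_Re_gt open_halfspace_Re_lt)
 show "convex (strip x)" unfolding e by (intro convex_Int convex_halfspace_Re_gt convex_halfspace_Re_lt)
qed

locale uniformised = disjoint_type_map +
 fixes ph ps :: "complex => complex" and p :: complex
 assumes ph_hol: "ph hol_on F" and ps_hol: "ps hol_on ball 0 1"
  and ph_in: "z : F ==> norm (ph z) < 1" and ps_in: "norm u < 1 ==> ps u : F"
  and psph: "z : F ==> ps (ph z) = z" and phps: "norm u < 1 ==> ph (ps u) = u"
  and ps0: "ps 0 = p" and fp: "f p = p"

text \<open>The image of the postsingular set is a compact invariant set, so
  \<open>disc_fixed_point\<close> applies to the conjugated map; a Moebius map then moves the fixed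
  point to 0.\<close>

lemma (in disjoint_type_map) uniformised_exists:
 obtains ph ps p where "uniformised f ph ps p"
proof -
 have "F ~= {}" using PS(2,4) by blast
 then obtain ph ps where ph: "ph hol_on F" "ps hol_on ball 0 1"
  "!!z. z : F ==> ph z : ball 0 1 & ps (ph z) = z" "!!z. z : ball 0 1 ==> ps z : F & ph (ps z) = z"
  using F_simply_connected F_not_UNIV unfolding simply_connected_eq_biholomorphic_to_disc[OF F_open] by blast
 define g where "g u = ph (f (ps u))" for u
 have gin: "norm (g z) < 1" if "norm z < 1" for z
  using ph(3)[of "f (ps z)"] ph(4)[of z] that F_invariant[of "ps z"] by (simp add: g_def)
 have "(ph o (f o ps)) hol_on ball 0 1"
  by (intro hol_comp[OF _ ph(1)] holomorphic_on_compose ph(2) f_hol)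
   (use ph(4) F_invariant in auto)
 hence ghol: "g hol_on ball 0 1" by (simp add: g_def[abs_def] o_def)
 have gninj: "~ inj_on g (ball 0 1)"
 proof
  assume inj: "inj_on g (ball 0 1)"
  obtain x y where xy: "x : F" "y : F" "x ~= y" "f x = f y" by (rule f_not_injective_on_F)
  have "g (ph x) = g (ph y)" using xy ph(3) by (simp add: g_def)
  hence "ph x = ph y" using inj xy ph(3) by (simp add: inj_on_def)
  thus False using xy ph(3) by metis
 qed
 have "compact (ph ` PS)"
  using PS(1,2) ph(1) hol_cont cont_sub by (metis compact_im)
 moreover have "g ` ph ` PS <= ph ` PS"
 proof
  fix y assume "y : g ` ph ` PS"
  then obtain z where z: "z : PS" "y = g (ph z)" by blast
  hence "y = ph (f z)" using PS(2) ph(3) by (auto simp: g_def)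
  thus "y : ph ` PS" using PS(5) z by blast
 qed
 moreover have "ph ` PS ~= {}" "ph ` PS <= ball 0 1" using PS(2,4) ph(3) by auto
 ultimately obtain q where q: "q : ph ` PS" "g q = q" using disc_fixed_point[OF ghol gin gninj] by metis
 hence q1: "norm q < 1" using PS(2) ph(3) by auto
 hence q1': "norm (- q) < 1" by simp
 show thesis
 proof (rule that[of "moeb q o ph" "ps o moeb (-q)" "ps q"], unfold_locales)
  show "moeb q o ph hol_on F"
   by (rule hol_comp[OF ph(1) moeb_facts(1)[OF q1]]) (use ph(3) in auto)
  show "ps o moeb (-q) hol_on ball 0 1"
   by (rule hol_comp[OF moeb_facts(1)[OF q1'] ph(2)]) (use moeb_facts(4)[OF q1'] in auto)
  show "norm ((moeb q o ph) z) < 1" if "z : F" for z using ph(3)[OF that] moeb_facts(4)[OF q1] by simp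
  show "(ps o moeb (-q)) u : F" if "norm u < 1" for u using ph(4)[of "moeb (-q) u"] moeb_facts(4)[OF q1' that] by simp
  show "(ps o moeb (-q)) ((moeb q o ph) z) = z" if "z : F" for z
   using ph(3)[OF that] moeb_facts(5)[OF q1] by simp
  show "(moeb q o ph) ((ps o moeb (-q)) u) = u" if "norm u < 1" for u
   using ph(4)[of "moeb (-q) u"] moeb_facts(4)[OF q1' that] moeb_facts(6)[OF q1 that] by simp
  show "(ps o moeb (-q)) 0 = ps q" using moeb_facts(3)[OF q1'] by simp
  have "f (ps q) : F" using ph(4)[of q] q1 F_invariant by simp
  thus "f (ps q) = ps q" using ph(3)[of "f (ps q)"] q(2) by (simp add: g_def)
 qed
qed

context uniformised begin

definition "g u = ph (f (ps u))" for u

lemma g_in: "norm u < 1 ==> norm (g u) < 1"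
 using ph_in ps_in F_invariant by (simp add: g_def)

lemma psg: "norm u < 1 ==> f (ps u) = ps (g u)"
 using psph ps_in F_invariant by (simp add: g_def)

lemma phf: "z : F ==> ph (f z) = g (ph z)"
 using psph by (simp add: g_def)

lemma gn_in: "norm u < 1 ==> norm ((g ^^ n) u) < 1"
 by (induction n) (auto simp: g_in)

lemma psgn: "norm u < 1 ==> (f ^^ n) (ps u) = ps ((g ^^ n) u)"
 by (induction n) (auto simp: gn_in psg)

lemma phfn: "z : F ==> ph ((f ^^ n) z) = (g ^^ n) (ph z)"
 using psgn[OF ph_in, of z n] psph[of z] phps[OF gn_in[OF ph_in]] by simp

lemma g0: "g 0 = 0"
 using phps[of 0] by (simp add: g_def ps0 fp)

lemma pF: "p : F" using ps_in[of 0] ps0 by simp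

lemma php: "ph p = 0" using phps[of 0] ps0 by simp

lemma g_hol: "g hol_on ball 0 1"
proof -
 have "(ph o (f o ps)) hol_on ball 0 1"
  by (intro hol_comp[OF _ ph_hol] holomorphic_on_compose ps_hol f_hol)
   (use ps_in F_invariant in auto)
 thus ?thesis by (simp add: g_def[abs_def] o_def)
qed

lemma g_ninj: "~ inj_on g (ball 0 1)"
proof
 assume inj: "inj_on g (ball 0 1)"
 obtain x y where xy: "x : F" "y : F" "x ~= y" "f x = f y" by (rule f_not_injective_on_F)
 have "g (ph x) = g (ph y)" using xy phf[of x] phf[of y] by simp
 hence "ph x = ph y" using inj_onD[OF inj] ph_in xy by simp
 thus False using xy psph by metis
qed

lemma g_bound: obtains l where "0 < l" "l <= 1" "!!u. norm u < 1 ==> norm (g u) <= norm u * (1 - (1 - norm u) * l)"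
proof -
 obtain h l where h: "0 < l" "l <= 1" "!!u. norm u < 1 ==> g u = u * h u"
  "!!u. norm u < 1 ==> norm (h u) <= 1 - (1 - norm u) * l"
  using self_map_factor[OF g_hol g_in g_ninj g0] by metis
 show thesis
  by (rule that[OF h(1,2)]) (simp add: h(3) norm_mult h(4) mult_left_mono)
qed

lemma g_le: assumes "norm u < 1" shows "norm (g u) <= norm u"
 and "u ~= 0 ==> norm (g u) < norm u"
proof -
 obtain l where l: "0 < l" "l <= 1" "!!u. norm u < 1 ==> norm (g u) <= norm u * (1 - (1 - norm u) * l)" using g_bound by blast
 have 1: "(1 - norm u) * l > 0" using assms l by simp
 have "norm u * (1 - (1 - norm u) * l) <= norm u * 1" using 1 by (intro mult_left_mono) auto
 thus "norm (g u) <= norm u" using l(3)[OF assms] by simp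
 assume "u ~= 0"
 hence "norm u * (1 - (1 - norm u) * l) < norm u * 1" using 1 by (intro mult_strict_left_mono) auto
 thus "norm (g u) < norm u" using l(3)[OF assms] by simp
qed

lemma gn_to_0: assumes u: "norm u < 1" and r: "r > 0" shows "EX n. norm ((g ^^ n) u) < r"
proof -
 obtain l where l: "0 < l" "l <= 1" "!!u. norm u < 1 ==> norm (g u) <= norm u * (1 - (1 - norm u) * l)" using g_bound by blast
 define m where "m = 1 - (1 - norm u) * l"
 have "(1 - norm u) * l <= 1 * 1" using l u by (intro mult_mono) auto
 hence m: "0 <= m" "m < 1" using l u by (simp_all add: m_def)
 have *: "norm ((g ^^ n) u) <= norm u & norm ((g ^^ n) u) <= m ^ n" for n
 proof (induction n)
  case (Suc n)
  define v where "v = (g ^^ n) u"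
  have v: "norm v <= norm u" "norm v <= m ^ n" using Suc by (auto simp: v_def)
  hence v1: "norm v < 1" using u by simp
  have "norm (g v) <= norm v * (1 - (1 - norm v) * l)" by (rule l(3)[OF v1])
  also have "... <= norm v * m"
   unfolding m_def using v l by (intro mult_left_mono diff_left_mono mult_right_mono) auto
  also have "... <= m ^ n * m" using v m by (intro mult_right_mono) auto
  finally have "norm (g v) <= m ^ Suc n" by (simp add: mult.commute)
  moreover have "norm (g v) <= norm u" using g_le(1)[OF v1] v by simp
  ultimately show ?case by (simp add: v_def)
 qed (use u in auto)
 obtain n where "m ^ n < r" using real_arch_pow_inv[OF r m(2)] by blast
 thus ?thesis using *[of n] by (intro exI[of _ n]) linarith
qed

text \<open>Logarithmic lifts of inverse branches of the inner function g near the unit circle.\<close>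

definition inner_branches :: "real => (complex => complex) set" where
 "inner_branches x = {b. b hol_on strip x & (ALL s : strip x. Re (b s) < 0 & g (exp (b s)) = exp s)}"

text \<open>Since \<open>g\<close> reduces moduli by a definite amount, an inverse branch divides
  the distance to the axis by at least \<open>1 + c\<close>. Schwarz-Pick turns this comparison of
  distances into a bound for the Euclidean derivative.\<close>

lemma inner_branch_contract:
 assumes l0: "l0 > 0"
 obtains l kp where "0 < l" "l < l0" "0 < kp" "kp < 1"
  "!!b s. b : inner_branches l0 ==> s : strip l ==> abs(Re (b s)) <= kp * abs(Re s)"
  "!!b s. b : inner_branches l0 ==> s : strip l ==> norm (deriv b s) <= kp"
proof -
 obtain l where l: "0 < l" "l <= 1" "!!u. norm u < 1 ==> norm (g u) <= norm u * (1 - (1 - norm u) * l)" using g_bound by blast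
 define c where "c = l * exp (- l0)"
 have c: "0 < c" "c <= 1" using l l0 mult_le_one[of l "exp (-l0)"] by (auto simp: c_def)
 define l1 where "l1 = l0 * ((c / 2) / (1 + c))"
 have "(c / 2) / (1 + c) <= 1/4" using c by (simp add: divide_simps)
 hence l1: "0 < l1" "l1 <= l0 / 4" using c l0 mult_left_mono[of "(c / 2) / (1 + c)" "1/4" l0] by (auto simp: l1_def)
 define kp where "kp = 1 / (1 + c / 2)"
 have kp: "0 < kp" "kp < 1" using c by (auto simp: kp_def)
 have re: "- Re (b s) * (1 + c) <= - Re s" if b: "b : inner_branches l0" and s: "s : strip l0" for b s
 proof -
  define t where "t = - Re (b s)"
  define x where "x = - Re s"
  have tx: "t > 0" "x > 0" "x < l0" using b s by (auto simp: inner_branches_def t_def x_def strip_def)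
  have u: "norm (exp (b s)) = exp (- t)" "norm (exp (b s)) < 1" using tx by (auto simp: t_def)
  have gx: "norm (g (exp (b s))) = exp (- x)" using b s by (auto simp: inner_branches_def x_def)
  have "exp (- x) <= exp (- t) * (1 - (1 - exp (- t)) * l)" using l(3)[OF u(2)] gx u(1) by simp
  also have "... <= exp (- t) * exp (- ((1 - exp (- t)) * l))"
   using exp_ge_add_one_self[of "- ((1 - exp (- t)) * l)"] by (intro mult_left_mono) auto
  also have "... = exp (- (t + (1 - exp (- t)) * l))" by (simp add: exp_add[symmetric] algebra_simps)
  finally have 1: "t + (1 - exp (- t)) * l <= x" by simp
  have "0 <= (1 - exp (- t)) * l" using l tx by simp
  hence tl: "t <= l0" using 1 tx by linarith
  have "t * exp (- t) <= 1 - exp (- t)"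
  proof -
   have "(1 + t) * exp (- t) <= exp t * exp (- t)" using exp_ge_add_one_self[of t] by (intro mult_right_mono) auto
   thus ?thesis by (simp add: exp_minus algebra_simps)
  qed
  moreover have "t * exp (- l0) <= t * exp (- t)" using tl tx by (intro mult_left_mono) auto
  ultimately have "t * exp (- l0) * l <= (1 - exp (- t)) * l" using l by (intro mult_right_mono) auto
  hence "t * (1 + c) <= x" using 1 by (simp add: c_def algebra_simps)
  thus ?thesis by (simp add: t_def x_def)
 qed
 show thesis
 proof (rule that[of l1 kp])
  show "0 < l1" "l1 < l0" "0 < kp" "kp < 1" using l1 kp l0 by auto
  fix b s assume b: "b : inner_branches l0" and s1: "s : strip l1"
  have s: "s : strip l0" using s1 l1 l0 by (auto simp: strip_def)
  have neg: "Re (b s) < 0" "Re s < 0" using b s by (auto simp: inner_branches_def strip_def)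
  have R: "- Re (b s) <= - Re s / (1 + c)" using re[OF b s] c by (simp add: field_simps)
  also have "... <= - Re s / (1 + c / 2)" using neg c by (intro divide_left_mono) auto
  finally show "abs(Re (b s)) <= kp * abs(Re s)" using neg by (simp add: kp_def)
  define rh where "rh = l0 / 2"
  define x where "x = - Re s"
  \<comment> \<open>The disc of radius \<open>l0 / 2\<close> about \<open>cc\<close> touches both
    edges of the wide strip at the height of \<open>s\<close>.\<close>
  define cc where "cc = Complex (- rh) (Im s)"
  have x: "0 < x" "x < l1" using s1 by (auto simp: x_def strip_def)
  have rh: "rh > 0" "2 * rh = l0" "x < rh" using l0 x l1 by (auto simp: rh_def)
  have sub: "ball cc rh <= strip l0"
  proof
   fix w assume "w : ball cc rh"
   hence "abs(- rh - Re w) < rh" using abs_Re_le_cmod[of "cc - w"] by (auto simp: dist_norm cc_def)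
   thus "w : strip l0" using rh(2) by (auto simp: strip_def)
  qed
  have d: "dist cc s = rh - x"
  proof -
   have "dist cc s = abs(- rh - Re s)" unfolding dist_norm by (subst cmod_eq_Re) (simp_all add: cc_def)
   thus ?thesis using rh by (simp add: x_def)
  qed
  have "norm (deriv (%s. - b s) s) * (rh\<^sup>2 - (dist cc s)\<^sup>2) <= 2 * rh * Re (- b s)"
  proof (rule Schwarz_Pick_half_plane)
   show "(%s. - b s) hol_on ball cc rh"
    using b sub by (intro hol_intros) (auto simp: inner_branches_def intro: hol_sub)
   show "Re (- b z) > 0" if "z : ball cc rh" for z using b sub that by (auto simp: inner_branches_def)
   show "s : ball cc rh" using d x by simp
  qed
  moreover have "deriv (%s. - b s) s = - deriv b s"
  proof (rule DERIV_imp_deriv)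
   have "b hol_on strip l0" using b by (simp add: inner_branches_def)
   thus "((%s. - b s) has_field_derivative - deriv b s) (at s)"
    using holomorphic_derivI[OF _ strip_open s] by (intro DERIV_minus)
  qed
  moreover have "rh\<^sup>2 - (dist cc s)\<^sup>2 = x * (l0 - x)" unfolding d using rh(2) by (simp add: power2_eq_square algebra_simps)
  ultimately have D: "norm (deriv b s) * (x * (l0 - x)) <= l0 * (- Re (b s))" using rh(2) by simp
  also have "... <= l0 * (x / (1 + c))" using R l0 by (intro mult_left_mono) (auto simp: x_def)
  finally have "x * (norm (deriv b s) * (l0 - x)) <= x * (l0 / (1 + c))" by (simp add: mult_ac)
  hence D1: "norm (deriv b s) * (l0 - x) <= l0 / (1 + c)" using x(1) by (simp only: mult_le_cancel_left_pos)
  have "norm (deriv b s) * (l0 - l1) <= norm (deriv b s) * (l0 - x)" using x by (intro mult_left_mono) auto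
  also have "l0 - l1 = l0 * ((1 + c / 2) / (1 + c))" using c by (simp add: l1_def field_simps)
  finally have "norm (deriv b s) * (1 + c / 2) * (l0 / (1 + c)) <= 1 * (l0 / (1 + c))" using D1 by (simp add: mult_ac)
  hence "norm (deriv b s) * (1 + c / 2) <= 1" using l0 c by (simp only: mult_le_cancel_right) auto
  thus "norm (deriv b s) <= kp" using c by (simp add: kp_def field_simps)
 qed
qed

end

section \<open>Exterior coordinate\<close>

abbreviation "hp == {w::complex. 0 < Re w}"

lemma hp_facts: "open hp" "convex hp" "connected hp"
 by (auto simp: open_halfspace_Re_gt convex_halfspace_Re_gt convex_connected)

context uniformised begin

text \<open>The removed set is a closed hyperbolic disc about the fixed point. What remains is a
  neighbourhood of \<open>J\<close>, and its preimage under \<open>f\<close> lies in it because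
  \<open>g\<close> shrinks moduli.\<close>

definition "far l = - ps ` cball 0 (exp (- l))" for l

lemma ps_cont: "continuous_on (ball 0 1) ps" and ph_cont: "continuous_on F ph"
 by (intro hol_cont ps_hol ph_hol)+

lemma ps_inj: "inj_on ps (ball 0 1)"
 by (rule inj_on_inverseI[where g = ph]) (simp add: phps)

lemma ps_open: assumes "open S" "S <= ball 0 1" shows "open (ps ` S)"
 using invariance_of_domain[OF cont_sub[OF ps_cont assms(2)] assms(1) inj_on_subset[OF ps_inj assms(2)]] .

lemma cball_exp: "0 < l ==> cball (0::complex) (exp (- l)) <= ball 0 1"
proof
 fix x :: complex assume "0 < l" "x : cball 0 (exp (- l))"
 hence "norm x <= exp (- l)" "exp (- l) < 1" by auto
 hence "norm x < 1" by (rule le_less_trans)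
 thus "x : ball 0 1" by simp
qed

lemma far_facts: assumes "l > 0"
 shows "compact (- far l)" "open (far l)" "connected (far l)" "J <= far l"
  "z : F ==> z : far l \<longleftrightarrow> exp (- l) < norm (ph z)"
proof -
 have sub: "cball (0::complex) (exp (- l)) <= ball 0 1" using cball_exp assms by blast
 have cont: "continuous_on (cball 0 (exp (- l))) ps" by (rule cont_sub[OF ps_cont sub])
 show c: "compact (- far l)" unfolding far_def using compact_im[OF cont] by simp
 thus "open (far l)" using closed_def compact_imp_closed by force
 obtain k where "homeomorphism (cball 0 (exp (- l))) (ps ` cball 0 (exp (- l))) ps k"
  using homeomorphism_compact[OF compact_cball cont refl inj_on_subset[OF ps_inj sub]] by blast
 hence "ps ` cball 0 (exp (- l)) homeomorphic cball (0::complex) (exp (- l))"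
  using homeomorphic_def homeomorphic_sym by blast
 thus "connected (far l)" unfolding far_def
  by (rule connected_complement_homeomorphic_convex_compact) auto
 show "J <= far l" using ps_in sub by (force simp: far_def J_eq)
 assume z: "z : F"
 have "z : ps ` cball 0 (exp (- l)) \<longleftrightarrow> norm (ph z) <= exp (- l)"
  using z psph[OF z] phps sub by (auto simp: subset_iff intro!: image_eqI[of _ _ "ph z"])
 thus "z : far l \<longleftrightarrow> exp (- l) < norm (ph z)" by (auto simp: far_def)
qed

text \<open>Inversion at \<open>p\<close> turns \<open>far l\<close> together with infinity into a
  bounded domain \<open>Om\<close> around 0. Its complement is connected, so the Riemann mapping
  theorem applies; the normalisation puts infinity at 0.\<close>

lemma exterior_map:
 assumes l: "l > 0"
 obtains mu mu' where "mu hol_on ball 0 1" "mu' hol_on {u. u = 0 | p + 1/u : far l}"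
  "!!u. norm u < 1 ==> (mu u = 0 | p + 1/mu u : far l) & mu' (mu u) = u"
  "!!u. u = 0 | p + 1/u : far l ==> norm (mu' u) < 1 & mu (mu' u) = u" "mu 0 = 0"
proof -
 define Om where "Om = {u. u = 0 | p + 1/u : far l}"
 have pD: "p ~: far l" using far_facts(5)[OF l pF] php by simp
 have sub: "ball (0::complex) (exp (- l)) <= ball 0 1" using cball_exp[OF l] ball_subset_cball by (rule order_trans[rotated])
 have "ps ` ball 0 (exp (- l)) <= - far l" by (auto simp: far_def)
 moreover have "open (ps ` ball 0 (exp (- l)))" using ps_open[OF open_ball sub] .
 moreover have "p : ps ` ball 0 (exp (- l))" using ps0 by (intro image_eqI[of _ _ 0]) auto
 ultimately have "EX ep>0. ball p ep <= - far l" by (meson open_contains_ball subset_trans)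
 then obtain ep where ep: "ep > 0" "ball p ep <= - far l" by blast
 obtain B where B: "B > 0" "- far l <= ball 0 B" using bounded_subset_ballD[OF compact_imp_bounded[OF far_facts(1)[OF l]], of 0] by blast
 have bd: "bounded Om"
 proof (rule boundedI[of _ "1/ep"])
  fix u assume "u : Om"
  hence "u = 0 | ep <= norm (1/u)" using ep(2) by (force simp: Om_def dist_norm)
  thus "norm u <= 1/ep" using ep(1) by (cases "u = 0") (simp_all add: norm_divide pos_le_divide_eq mult.commute)
 qed
 define r where "r = 1 / (B + norm p)"
 have Bp: "B + norm p > 0" using B(1) by (simp add: add_pos_nonneg)
 hence r: "r > 0" by (simp add: r_def)
 have rb: "ball 0 r <= Om"
 proof
  fix u :: complex assume u: "u : ball 0 r"
  show "u : Om"
  proof (cases "u = 0")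
   case False
   hence "B + norm p < norm (1/u)" using u Bp by (simp add: r_def norm_divide field_simps)
   hence "B < norm (p + 1/u)" using norm_triangle_ineq2[of "1/u" "-p"] by (simp add: add.commute)
   hence "p + 1/u ~: - far l" using B(2) by force
   thus ?thesis by (simp add: Om_def)
  qed (simp add: Om_def)
 qed
 have e1: "Om = ball 0 r Un (- {0} Int (%u. p + 1/u) -` far l)" using rb r by (auto simp: Om_def)
 have "open (- {0} Int (%u. p + 1/u) -` far l)"
  by (rule continuous_open_preimage) (auto intro!: cont_intros far_facts(2)[OF l] simp: open_Compl)
 hence op: "open Om" unfolding e1 by blast
 have e2: "Om = ball 0 r Un (%z. 1/(z-p)) ` far l"
 proof
  show "Om <= ball 0 r Un (%z. 1/(z-p)) ` far l"
  proof
   fix u assume "u : Om"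
   thus "u : ball 0 r Un (%z. 1/(z-p)) ` far l"
    using r by (auto simp: Om_def intro!: image_eqI[of _ _ "p + 1/u"])
  qed
  show "ball 0 r Un (%z. 1/(z-p)) ` far l <= Om" using rb by (auto simp: Om_def)
 qed
 have "connected ((%z. 1/(z-p)) ` far l)"
  by (rule conn_im[OF _ far_facts(3)[OF l]]) (use pD in "auto intro!: cont_intros")
 moreover have "ball 0 r Int (%z. 1/(z-p)) ` far l ~= {}"
 proof -
  have "complex_of_real (r/2) : ball 0 r" "complex_of_real (r/2) ~= 0" using r by auto
  hence "p + 1/complex_of_real (r/2) : far l" using rb unfolding Om_def by blast
  hence "complex_of_real (r/2) : (%z. 1/(z-p)) ` far l" by (rule rev_image_eqI) simp
  thus ?thesis using `complex_of_real (r/2) : ball 0 r` by blast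
 qed
 ultimately have con: "connected Om" unfolding e2 by (intro connected_Un) auto
 have neq: "ps (exp s) ~= p" if "Re s <= - l" for s
 proof
  assume "ps (exp s) = p"
  moreover have "norm (exp s) < 1" using that l by simp
  ultimately have "exp s = 0" using phps[of "exp s"] php by simp
  thus False by simp
 qed
 \<comment> \<open>Passing through \<open>exp\<close> removes the centre \<open>p\<close>, where the
   inversion is undefined, and shows the complement as a continuous image of a half-plane.\<close>
 have "- Om = (%s. 1/(ps (exp s) - p)) ` {s. Re s <= - l}"
 proof
  show "- Om <= (%s. 1/(ps (exp s) - p)) ` {s. Re s <= - l}"
  proof
   fix u assume "u : - Om"
   hence u: "u ~= 0" "p + 1/u : ps ` cball 0 (exp (- l))" by (auto simp: Om_def far_def)
   then obtain v where v: "p + 1/u = ps v" "norm v <= exp (- l)" by auto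
   hence "v ~= 0" using u(1) ps0 by auto
   hence v1: "exp (Ln v) = v" by simp
   have "exp (Re (Ln v)) <= exp (- l)" using v(2) v1 by (metis norm_exp_eq_Re)
   thus "u : (%s. 1/(ps (exp s) - p)) ` {s. Re s <= - l}"
    by (intro image_eqI[of _ _ "Ln v"]) (auto simp: v1 v(1)[symmetric])
  qed
  show "(%s. 1/(ps (exp s) - p)) ` {s. Re s <= - l} <= - Om"
   using neq by (auto simp: Om_def far_def)
 qed
 moreover have "connected ((%s. 1/(ps (exp s) - p)) ` {s. Re s <= - l})"
 proof (rule conn_im)
  have "continuous_on {s. Re s <= - l} (%s. ps (exp s))"
   by (rule cont_comp[OF ps_cont]) (use l in "auto intro!: cont_intros")
  thus "continuous_on {s. Re s <= - l} (%s. 1/(ps (exp s) - p))"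
   using neq by (auto intro!: cont_intros)
 qed (simp add: convex_connected convex_halfspace_Re_le)
 ultimately have con2: "connected (- Om)" by simp
 have "simply_connected Om" using simply_connected_iff_simple[OF op bd] con con2 by blast
 moreover have "Om ~= UNIV" using bd by (metis not_bounded_UNIV)
 moreover have zOm: "0 : Om" by (simp add: Om_def)
 ultimately obtain h k where hk: "h hol_on Om" "k hol_on ball 0 1"
  "!!z. z : Om ==> h z : ball 0 1 & k (h z) = z" "!!z. z : ball 0 1 ==> k z : Om & h (k z) = z"
  unfolding simply_connected_eq_biholomorphic_to_disc[OF op] by blast
 define a where "a = h 0"
 have a: "norm a < 1" "norm (- a) < 1" "k a = 0" using hk(3)[OF zOm] by (auto simp: a_def)
 show thesis
 proof (rule that[of "k o moeb (-a)" "moeb a o h"])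
  show "(k o moeb (-a)) hol_on ball 0 1"
   by (rule hol_comp[OF moeb_facts(1)[OF a(2)] hk(2)]) (use moeb_facts(4)[OF a(2)] in auto)
  show "moeb a o h hol_on {u. u = 0 | p + 1/u : far l}" unfolding Om_def[symmetric]
   by (rule hol_comp[OF hk(1) moeb_facts(1)[OF a(1)]]) (use hk(3) in auto)
  show "((k o moeb (-a)) u = 0 | p + 1/(k o moeb (-a)) u : far l) & (moeb a o h) ((k o moeb (-a)) u) = u"
   if "norm u < 1" for u
   using hk(4)[of "moeb (-a) u"] moeb_facts(4)[OF a(2) that] moeb_facts(6)[OF a(1) that] by (auto simp: Om_def)
  show "norm ((moeb a o h) u) < 1 & (k o moeb (-a)) ((moeb a o h) u) = u" if "u = 0 | p + 1/u : far l" for u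
  proof -
   have "u : Om" using that by (simp add: Om_def)
   hence "norm (h u) < 1" "k (h u) = u" using hk(3) by auto
   thus ?thesis using moeb_facts(4)[OF a(1)] moeb_facts(5)[OF a(1)] by simp
  qed
  show "(k o moeb (-a)) 0 = 0" using moeb_facts(3)[OF a(2)] a(3) by simp
 qed
qed

end

text \<open>Two levels occur: inverse branches exist over the larger set \<open>far l0\<close>, and
  their Euclidean contraction is available over \<open>far l\<close>.\<close>

locale exterior = uniformised +
 fixes l0 l kp :: real and mu mu' :: "complex => complex"
 assumes l: "0 < l" "l < l0" and kp: "0 < kp" "kp < 1"
  and inner_Re: "b : inner_branches l0 ==> s : strip l ==> abs(Re (b s)) <= kp * abs(Re s)"
  and inner_deriv: "b : inner_branches l0 ==> s : strip l ==> norm (deriv b s) <= kp"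
  and regular: "far l0 Int singular_values f = {}"
  and mu_hol: "mu hol_on ball 0 1" and mu'_hol: "mu' hol_on {u. u = 0 | p + 1/u : far l}"
  and mu_in: "norm u < 1 ==> mu u = 0 | p + 1/mu u : far l" and mu'mu: "norm u < 1 ==> mu' (mu u) = u"
  and mu'_in: "u = 0 | p + 1/u : far l ==> norm (mu' u) < 1"
  and mumu': "u = 0 | p + 1/u : far l ==> mu (mu' u) = u" and mu0: "mu 0 = 0"

lemma (in uniformised) exterior_exists:
 obtains l0 l kp mu mu' where "exterior f ph ps p l0 l kp mu mu'"
proof -
 have "compact (ph ` PS)" using compact_im[OF cont_sub[OF ph_cont PS(2)] PS(1)] .
 moreover have "ph ` PS <= ball 0 1" using ph_in PS(2) by auto
 ultimately have "EX r<1. ph ` PS <= cball 0 r"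
 proof -
  assume c: "compact (ph ` PS)" and s: "ph ` PS <= ball 0 1"
  have "compact (norm ` ph ` PS)" "norm ` ph ` PS ~= {}" using c PS(4) by (auto intro!: compact_im cont_intros)
  from compact_attains_sup[OF this] obtain m where "m : norm ` ph ` PS" "ALL t : norm ` ph ` PS. t <= m" by (elim bexE)
  thus ?thesis using s by (intro exI[of _ m]) auto
 qed
 then obtain r where r: "r < 1" "ph ` PS <= cball 0 r" by blast
 define r' where "r' = max r (1/2)"
 define l0 where "l0 = - ln r'"
 have r': "0 < r'" "r' < 1" "ph ` PS <= cball 0 r'" using r by (auto simp: r'_def)
 hence l0: "l0 > 0" "exp (- l0) = r'" by (auto simp: l0_def)
 obtain l kp where c: "0 < l" "l < l0" "0 < kp" "kp < 1"
  "!!b s. b : inner_branches l0 ==> s : strip l ==> abs(Re (b s)) <= kp * abs(Re s)"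
  "!!b s. b : inner_branches l0 ==> s : strip l ==> norm (deriv b s) <= kp"
  by (rule inner_branch_contract[OF l0(1)]) blast
 obtain mu mu' where m: "mu hol_on ball 0 1" "mu' hol_on {u. u = 0 | p + 1/u : far l}"
  "!!u. norm u < 1 ==> (mu u = 0 | p + 1/mu u : far l) & mu' (mu u) = u"
  "!!u. u = 0 | p + 1/u : far l ==> norm (mu' u) < 1 & mu (mu' u) = u" "mu 0 = 0"
  by (rule exterior_map[OF c(1)]) blast
 have "far l0 Int singular_values f = {}"
  using PS(2,3) r'(3) far_facts(5)[OF l0(1)] unfolding l0(2) by (force simp: image_subset_iff)
 hence "exterior f ph ps p l0 l kp mu mu'"
  using c m by unfold_locales auto
 thus thesis by (rule that)
qed

section \<open>Lifts to the exterior coordinate\<close>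

lemma norm_exp_minus_1: "norm (exp z - 1) <= norm z * exp (norm z)" for z :: complex
proof -
 have "norm (exp z - exp 0) <= exp (norm z) * norm (z - 0)"
 proof (rule diff_bound[OF convex_cball, of 0 "norm z"])
  show "(exp has_field_derivative exp u) (at u within cball 0 (norm z))" for u :: complex
   by (auto intro: derivative_eq_intros)
  show "norm (exp u) <= exp (norm z)" if "u : cball 0 (norm z)" for u :: complex
   using that norm_exp[of u] by (auto intro: order_trans)
 qed auto
 thus ?thesis by (simp add: mult.commute)
qed

context exterior begin

abbreviation "W == far l"
text \<open>The universal covering of \<open>W\<close>, which is a disc punctured at infinity; the
  deck transformations are the translations by \<open>per k\<close>. Large real part means close to
  infinity.\<close>

definition "q w = p + 1 / mu (exp (- w))" for w
definition "xi z = mu' (1 / (z - p))" for z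
text \<open>The real part of any point over \<open>z\<close>: a substitute for
  \<open>ln (norm z)\<close> that is available on all of \<open>W\<close>.\<close>

definition "N z = - ln (norm (xi z))" for z

lemmas W = far_facts[OF l(1)]

lemma p_W: "p ~: W" using W(5)[OF pF] php by simp

lemma mu'0: "mu' 0 = 0" using mu'mu[of 0] mu0 by simp

lemma xi: assumes "z : W" shows "norm (xi z) < 1" "xi z ~= 0" "mu (xi z) = 1 / (z - p)"
proof -
 have z: "z ~= p" "p + 1 / (1 / (z - p)) : W" using assms p_W by auto
 thus "norm (xi z) < 1" "mu (xi z) = 1 / (z - p)"
  unfolding xi_def by (metis mu'_in, metis mumu')
 thus "xi z ~= 0" using mu0 z(1) by auto
qed

lemma q_W: assumes "0 < Re w" shows "q w : W" "xi (q w) = exp (- w)"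
proof -
 have 1: "norm (exp (- w)) < 1" using assms by simp
 have "mu (exp (- w)) ~= 0" using mu'mu[OF 1] mu'0 by auto
 thus "q w : W" "xi (q w) = exp (- w)"
  using mu_in[OF 1] mu'mu[OF 1] by (auto simp: q_def xi_def)
qed

lemma q_eqI: assumes "0 < Re w" "z : W" "exp (- w) = xi z" shows "q w = z"
proof -
 have "z ~= p" using assms(2) p_W by auto
 thus ?thesis unfolding q_def assms(3) xi(3)[OF assms(2)] by simp
qed

lemma N_q: "0 < Re w ==> N (q w) = Re w" by (simp add: N_def q_W(2))

lemma N_pos: "z : W ==> 0 < N z" using xi[of z] by (simp add: N_def ln_less_zero)

lemma q_surj: assumes "z : W" obtains w where "0 < Re w" "Re w = N z" "q w = z"
proof -
 have e: "exp (- (- Ln (xi z))) = xi z" using xi[OF assms] by simp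
 have "Re (- Ln (xi z)) = N z" using xi[OF assms] by (simp add: N_def)
 moreover from this have "0 < Re (- Ln (xi z))" using N_pos[OF assms] by simp
 ultimately show thesis using that q_eqI[OF _ assms e] by blast
qed

lemma q_per [simp]: "q (w + per k) = q w"
 using exp_add_per[of "- w" "- k"] by (simp add: q_def per_minus)

lemma q_eq: assumes "0 < Re a" "0 < Re b" "q a = q b" obtains k where "b = a + per k"
proof -
 have "exp (- a) = exp (- b)" using q_W(2)[OF assms(1)] q_W(2)[OF assms(2)] assms(3) by simp
 then obtain n where "- a = - b + per n" using exp_eq_per by blast
 thus thesis using that[of n] by (simp add: algebra_simps)
qed

lemma xi_hol: "xi hol_on W"
proof -
 have "(mu' o (%z. 1 / (z - p))) hol_on W"
  by (rule hol_comp[OF _ mu'_hol]) (use p_W in "auto intro!: hol_intros")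
 thus ?thesis by (simp add: xi_def[abs_def] o_def)
qed

lemma N_cont: "continuous_on W N" unfolding N_def[abs_def]
 by (intro cont_intros hol_cont xi_hol) (use xi(2) in auto)

lemma q_hol: "q hol_on hp"
proof -
 have "(mu o (%w. exp (- w))) hol_on hp"
  by (rule hol_comp[OF _ mu_hol]) (auto intro!: hol_intros)
 moreover have "mu (exp (- w)) ~= 0" if "w : hp" for w
  using mu'mu[of "exp (- w)"] mu'0 that by auto
 ultimately show ?thesis unfolding q_def[abs_def] by (auto intro!: hol_intros simp: o_def)
qed

lemma q_cont: "continuous_on hp q" using q_hol hol_cont by blast

lemma N_bounded_imp: obtains B where "!!z. z : W ==> N z <= R ==> norm z <= B"
proof -
 have "open {u. u = 0 | p + 1/u : W}"
 proof -
  have "{u. u = 0 | p + 1/u : W} = mu ` ball 0 1"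
  proof (intro equalityI subsetI)
   fix u assume "u : {u. u = 0 | p + 1/u : W}"
   hence u: "u = 0 | p + 1/u : W" by simp
   show "u : mu ` ball 0 1" using mu'_in[OF u] mumu'[OF u] by (intro image_eqI[of _ _ "mu' u"]) simp_all
  next
   fix u assume "u : mu ` ball 0 1"
   thus "u : {u. u = 0 | p + 1/u : W}" using mu_in by fastforce
  qed
  moreover have "inj_on mu (ball 0 1)" by (rule inj_on_inverseI[where g = mu']) (simp add: mu'mu)
  ultimately show ?thesis
   using invariance_of_domain[OF hol_cont[OF mu_hol] open_ball] by simp
 qed
 hence "isCont mu' 0"
  using hol_cont[OF mu'_hol] by (simp add: cont_at)
 then obtain d where d: "d > 0" "!!u. dist u 0 < d ==> dist (mu' u) (mu' 0) < exp (- R)"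
  unfolding cont_eps by (metis exp_gt_zero)
 show thesis
 proof (rule that[of "norm p + 1 / d"], rule ccontr)
  fix z assume z: "z : W" "N z <= R" "~ norm z <= norm p + 1 / d"
  have "norm (z - p) > 1 / d" using norm_triangle_ineq2[of z p] z(3) by linarith
  hence "norm (1 / (z - p)) < d"
   using d(1) by (simp add: norm_divide pos_divide_less_eq[of d] divide_less_eq mult.commute less_le_trans)
  hence "norm (xi z) < exp (- R)" using d(2)[of "1 / (z - p)"] by (simp add: xi_def mu'0)
  hence "ln (norm (xi z)) < - R" using xi(2)[OF z(1)] by (metis exp_less_cancel_iff exp_ln zero_less_norm_iff)
  thus False using z(2) by (simp add: N_def)
 qed
qed

lemma q_large: obtains R where "R > 0" "!!w. R <= Re w ==> B < norm (q w)"
proof -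
 have "isCont mu 0" using hol_cont[OF mu_hol] by (simp add: cont_at)
 moreover have B: "1 / (abs B + norm p + 1) > 0" by (simp add: add_nonneg_pos)
 ultimately obtain d where d: "d > 0" "!!u. dist u 0 < d ==> dist (mu u) (mu 0) < 1 / (abs B + norm p + 1)"
  unfolding cont_eps by metis
 show thesis
 proof (rule that[of "max 1 (1 - ln d)"])
  fix w assume w: "max 1 (1 - ln d) <= Re w"
  hence Rw: "0 < Re w" by simp
  have "exp (- Re w) < exp (ln d)" using w by (simp only: exp_less_cancel_iff)
  hence "norm (exp (- w)) < d" using d(1) by simp
  hence m: "norm (mu (exp (- w))) < 1 / (abs B + norm p + 1)" using d(2)[of "exp (- w)"] by (simp add: mu0)
  have "mu (exp (- w)) ~= 0" using mu'mu[of "exp (- w)"] mu'0 Rw by auto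
  hence "norm (1 / mu (exp (- w))) > abs B + norm p + 1"
  proof -
   have "0 < abs B + norm p + 1" by (simp add: add_nonneg_pos)
   hence "norm (mu (exp (- w))) * (abs B + norm p + 1) < 1" using m by (simp only: pos_less_divide_eq)
   thus ?thesis using `mu (exp (- w)) ~= 0` by (simp add: norm_divide pos_less_divide_eq mult.commute)
  qed
  thus "B < norm (q w)"
   using norm_triangle_ineq2[of "1 / mu (exp (- w))" "- p"] by (simp add: q_def add.commute)
 qed simp
qed

lemma W_regular: "W Int singular_values f = {}"
proof -
 have "exp (- l0) < exp (- l)" using l by simp
 hence "ps ` cball 0 (exp (- l0)) <= ps ` cball 0 (exp (- l))" by (intro image_mono subset_cball) simp
 thus ?thesis using regular unfolding far_def by blast
qed

lemma f_W: assumes "f z : W" shows "z : W"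
proof (rule ccontr)
 assume "z ~: W"
 then obtain u where u: "z = ps u" "norm u <= exp (- l)" by (auto simp: far_def)
 hence "norm u < 1" using cball_exp[OF l(1)] by auto
 hence "f z = ps (g u)" "norm (g u) <= exp (- l)" using psg u g_le(1)[of u] by auto
 thus False using assms by (auto simp: far_def)
qed

lemma fn_W: "(f ^^ n) z : W ==> j <= n ==> (f ^^ j) z : W"
proof (induction n)
 case (Suc n)
 thus ?case using f_W[of "(f ^^ n) z"] by (cases "j = Suc n") auto
qed simp

text \<open>Orbits in \<open>F\<close> are attracted to \<open>p\<close> and therefore leave
  \<open>W\<close>.\<close>

lemma J_iff: "z : J \<longleftrightarrow> (ALL n. (f ^^ n) z : W)"
proof
 assume "z : J"
 thus "ALL n. (f ^^ n) z : W" using W(4) Fn_invariant J_eq by blast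
next
 assume *: "ALL n. (f ^^ n) z : W"
 show "z : J"
 proof (rule ccontr)
  assume "z ~: J"
  hence z: "z : F" by (simp add: J_eq)
  obtain n where "norm ((g ^^ n) (ph z)) < exp (- l)" using gn_to_0[OF ph_in[OF z]] by (meson exp_gt_zero)
  thus False using *[rule_format, of n] W(5)[of "(f ^^ n) z"] phfn[OF z] Fn_invariant z by simp
 qed
qed

text \<open>Moduli shrink strictly under \<open>g\<close>, so even the preimage \<open>C\<close> of
  a closed set containing \<open>W\<close> lies in the open set \<open>W\<close>. On
  \<open>C\<close> either \<open>N\<close> exceeds 1 or the point belongs to a compact set, where
  \<open>N\<close> attains a positive minimum.\<close>

lemma delta_ex: "EX d>0. ALL w. 0 < Re w --> f (q w) : W --> d < Re w"
proof -
 define C where "C = f -` (- ps ` ball 0 (exp (- l)))"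
 have b1: "ball (0::complex) (exp (- l)) <= ball 0 1" using cball_exp[OF l(1)] ball_subset_cball by (rule order_trans[rotated])
 have C: "closed C" unfolding C_def
  by (intro closed_vimage closed_Compl ps_open[OF open_ball b1] f_cont)
 have CW: "C <= W"
 proof
  fix z assume z: "z : C"
  show "z : W"
  proof (rule ccontr)
   assume "z ~: W"
   then obtain u where u: "z = ps u" "norm u <= exp (- l)" by (auto simp: far_def)
   hence u1: "norm u < 1" using cball_exp[OF l(1)] by auto
   have "norm (g u) < exp (- l)"
   proof (cases "u = 0")
    case False
    thus ?thesis using g_le(2)[OF u1 False] u(2) by simp
   qed (simp add: g0)
   thus False using z psg[OF u1] u(1) by (auto simp: C_def)
  qed
 qed
 obtain B where B: "!!z. z : W ==> N z <= 1 ==> norm z <= B" using N_bounded_imp[of 1] by metis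
 have c: "compact (C Int cball 0 B)" using C by (simp add: closed_Int_compact)
 have "EX d>0. ALL z:C Int cball 0 B. d <= N z"
 proof (cases "C Int cball 0 B = {}")
  case False
  have "continuous_on (C Int cball 0 B) N" by (rule cont_sub[OF N_cont]) (use CW in auto)
  from continuous_attains_inf[OF c False this] obtain x where x: "x : C Int cball 0 B" "ALL y : C Int cball 0 B. N x <= N y" by (elim bexE)
  thus ?thesis using N_pos[of x] CW by (intro exI[of _ "N x"]) auto
 qed (auto intro: exI[of _ 1])
 then obtain d where d: "d > 0" "!!z. z : C ==> norm z <= B ==> d <= N z" by auto
 have "min d 1 / 2 < Re w" if w: "0 < Re w" "f (q w) : W" for w
 proof -
  have "q w : C" using w(2) by (auto simp: C_def far_def)
  hence "min d 1 <= N (q w)" using B[OF q_W(1)[OF w(1)]] d(2)[of "q w"] by fastforce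
  thus ?thesis using N_q[OF w(1)] d(1) by (auto simp: min_def split: if_splits)
 qed
 thus ?thesis using d(1) by (intro exI[of _ "min d 1 / 2"]) auto
qed

definition "de = (SOME d. d > 0 & (ALL w. 0 < Re w --> f (q w) : W --> d < Re w))"

lemma de: "de > 0" "0 < Re w ==> f (q w) : W ==> de < Re w"
 using someI_ex[of "%d. d > 0 & (ALL w. 0 < Re w --> f (q w) : W --> d < Re w)"] delta_ex
 unfolding de_def by blast+

lemma q_lift:
 assumes O: "open Om" "convex Om" and h: "h hol_on Om" "!!s. s : Om ==> h s : W"
  and a: "a : Om" "0 < Re b" "q b = h a"
 obtains H where "H hol_on Om" "!!s. s : Om ==> 0 < Re (H s) & q (H s) = h s" "H a = b"
proof -
 have hh: "(xi o h) hol_on Om" by (rule hol_comp[OF h(1) xi_hol]) (use h(2) in auto)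
 have nz: "(xi o h) s ~= 0" if "s : Om" for s using xi(2)[OF h(2)[OF that]] by simp
 obtain L where L: "L hol_on Om" "!!s. s : Om ==> exp (L s) = (xi o h) s"
  using nonvanishing_log[OF O hh nz] by blast
 hence L: "L hol_on Om" "!!s. s : Om ==> exp (L s) = xi (h s)" by auto
 have "exp (L a) = exp (- b)" using L(2)[OF a(1)] q_W(2)[OF a(2)] a(3) by simp
 then obtain n where n: "L a = - b + per n" using exp_eq_per by blast
 define H where "H s = - L s + per n" for s
 have e: "exp (- H s) = xi (h s)" if "s : Om" for s
  using L(2)[OF that] exp_add_per[of "L s" "- n"] by (simp add: H_def per_minus)
 have pos: "0 < Re (H s)" if "s : Om" for s
 proof -
  have "norm (exp (- H s)) < 1" using e[OF that] xi(1)[OF h(2)[OF that]] by simp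
  thus ?thesis by simp
 qed
 show thesis
 proof (rule that[of H])
  show "H hol_on Om" unfolding H_def[abs_def] using L(1) by (intro hol_intros)
  show "H a = b" by (simp add: H_def n)
  show "0 < Re (H s) & q (H s) = h s" if "s : Om" for s
   using pos[OF that] q_eqI[OF pos[OF that] h(2)[OF that] e[OF that]] by simp
 qed
qed

lemma q_lift_unique:
 assumes "connected S" "continuous_on S H" "continuous_on S K"
  "!!s. s : S ==> 0 < Re (H s)" "!!s. s : S ==> 0 < Re (K s)" "!!s. s : S ==> q (H s) = q (K s)"
  and a: "a : S" "H a = K a" and s: "s : S"
 shows "H s = K s"
proof -
 have "- H s = - K s"
 proof (rule unique_lift[where f = exp and h = "%s. - H s" and k = "%s. - K s" and S = S and a = a])
  fix x assume "x : S"
  thus "exp (- H x) = exp (- K x)" using q_W(2) assms(4-6) by metis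
  show "deriv exp (- H x) ~= 0" by (simp add: DERIV_imp_deriv[OF DERIV_exp])
 qed (use assms in "auto intro!: cont_intros hol_intros")
 thus ?thesis by simp
qed

text \<open>Inverse branches of \<open>f\<close> over \<open>W\<close>, lifted to self-maps of the
  half-plane. They replace \<open>log_branches\<close> and are not confined to a neighbourhood of
  infinity.\<close>

definition "lift1 G \<longleftrightarrow> G hol_on hp & (ALL w. 0 < Re w --> 0 < Re (G w) & f (q (G w)) = q w)" for G

lemma lift1_de: "lift1 G ==> 0 < Re w ==> de < Re (G w)"
 using de(2)[of "G w"] q_W(1)[of w] by (simp add: lift1_def)

lemma lift1_through:
 assumes "0 < Re a" "0 < Re b" "f (q b) = q a"
 obtains G where "lift1 G" "G a = b"
proof -
 obtain h where h: "h hol_on hp" "h a = q b" "!!w. w : hp ==> f (h w) = q w"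
 proof (rule holomorphic_lift[OF f_hol W(2) W_regular hp_facts(1,2) q_hol])
  show "q ` hp <= W" using q_W(1) by auto
  show "a : hp" "f (q b) = q a" using assms by auto
 qed blast
 have hW: "h w : W" if "w : hp" for w using f_W[of "h w"] h(3)[OF that] q_W(1) that by simp
 obtain G where G: "G hol_on hp" "!!s. s : hp ==> 0 < Re (G s) & q (G s) = h s" "G a = b"
  by (rule q_lift[OF hp_facts(1,2) h(1) hW, of a b]) (use assms h(2) in auto)
 have "lift1 G" unfolding lift1_def using G h(3) by auto
 thus thesis using that G(3) by blast
qed

lemma lift1_unique:
 assumes G: "lift1 G" and H: "lift1 H" and ab: "0 < Re a" "0 < Re b" "q (G a) = q (H b)"
 obtains j k where "b = a + per j" "!!w. 0 < Re w ==> H (w + per j) = G w + per k"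
proof -
 have "q a = q b" using G H ab by (metis lift1_def)
 then obtain j where j: "b = a + per j" using q_eq[OF ab(1,2)] by blast
 have cG: "continuous_on hp G" and cH: "continuous_on hp H"
  using G H hol_cont by (auto simp: lift1_def)
 have cH': "continuous_on hp (%w. H (w + per j))"
  by (rule cont_comp[OF cH]) (auto intro!: cont_intros)
 have Re: "0 < Re (G a)" "0 < Re (H b)" using G H ab by (auto simp: lift1_def)
 obtain k where k: "H b = G a + per k" using q_eq[OF Re ab(3)] by blast
 have qq: "q (G w) = q (H (w + per j))" if "w : hp" for w
 proof (rule lift_unique[where G = "%w. q (G w)" and H = "%w. q (H (w + per j))", OF f_hol W_regular hp_facts(3), of q])
  show "q ` hp <= W" using q_W(1) by auto
  show "continuous_on hp (%w. q (G w))" by (rule cont_comp[OF q_cont cG]) (use G in "auto simp: lift1_def")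
  show "continuous_on hp (%w. q (H (w + per j)))" by (rule cont_comp[OF q_cont cH']) (use H in "auto simp: lift1_def")
  show "a : hp" "q (G a) = q (H (a + per j))" using ab j by auto
  show "f (q (G w)) = q w" if "w : hp" for w using G that by (simp add: lift1_def)
  show "f (q (H (w + per j))) = q w" if "w : hp" for w using H that by (simp add: lift1_def)
 qed (rule that)
 have "H (w + per j) = G w + per k" if "0 < Re w" for w
 proof (rule q_lift_unique[where H = "%w. H (w + per j)" and K = "%w. G w + per k", OF hp_facts(3) cH'])
  show "continuous_on hp (%w. G w + per k)" by (intro cont_intros cG)
  show "a : hp" "H (a + per j) = G a + per k" using ab k j by auto
  show "0 < Re (H (s + per j))" "0 < Re (G s + per k)" "q (H (s + per j)) = q (G s + per k)" if "s : hp" for s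
   using that G H qq[OF that] by (auto simp: lift1_def)
 qed (use that in auto)
 thus thesis using that j by blast
qed

text \<open>The argument of \<open>log_branch_inj\<close> with the covering \<open>q\<close> in
  place of \<open>exp\<close>.\<close>

lemma lift1_inj:
 assumes G: "lift1 G" and ab: "0 < Re a" "0 < Re b" "G b = G a + per n"
 shows "b = a & n = 0"
proof -
 have qab: "q (G a) = q (G b)" using ab(3) by simp
 obtain j k where j: "b = a + per j" "!!w. 0 < Re w ==> G (w + per j) = G w + per k"
  using lift1_unique[OF G G ab(1,2) qab] by blast
 have "j = 0"
 proof (rule ccontr)
  assume j0: "j ~= 0"
  have Lp: "q (G (v + per j)) = q (G v)" if "0 < Re v" for v using j(2)[OF that] by simp
  have per: "q (G (v + of_real (2 * pi * abs(of_int j)) * \<i>)) = q (G v)" if "0 < Re v" for v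
  proof (cases "j > 0")
   case True
   hence "per j = of_real (2 * pi * abs(of_int j)) * \<i>" by (simp add: per_def)
   thus ?thesis using Lp that by metis
  next
   case False
   hence "per j = - (of_real (2 * pi * abs(of_int j)) * \<i>)" by (simp add: per_def)
   thus ?thesis using Lp[of "v + of_real (2 * pi * abs(of_int j)) * \<i>"] that by simp
  qed
  have "(q o G) hol_on hp"
   by (rule hol_comp[OF _ q_hol]) (use G in "auto simp: lift1_def")
  hence h: "(%w. q (G w)) hol_on hp" by (simp add: o_def)
  have big: "EX x. ALL w. x <= Re w --> M < norm (q w)" for M using q_large[of M] by metis
  show False
   by (rule no_periodic_lift[OF tr h _ big _ per]) (use G j0 in "auto simp: lift1_def")
 qed
 thus ?thesis using j(1) ab(3) by simp
qed

text \<open>Bloch bounds \<open>norm (deriv G w) * Re w\<close> by \<open>12 * pi\<close>,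
  Schwarz-Pick by \<open>Re (G w) - de\<close>; adding these bounds with weights \<open>de\<close>
  and \<open>12 * pi\<close> produces this factor.\<close>

definition "La = 12 * pi / (12 * pi + de)"

lemma La: "0 < La" "La < 1" using de(1) by (auto simp: La_def divide_less_eq add_pos_pos)

text \<open>As \<open>Re G\<close> exceeds \<open>de\<close>, Schwarz-Pick applies to
  \<open>G - de\<close> on discs touching the axis with radius tending to infinity. The gain
  \<open>de\<close> fades in comparison with a large \<open>Re (G w)\<close>, and there the bound
  from Bloch takes over.\<close>

lemma lift1_deriv:
 assumes G: "lift1 G" and w: "0 < Re w"
 shows "norm (deriv G w) * Re w <= 12 * pi" "norm (deriv G w) * Re w <= La * Re (G w)"
proof -
 let ?d = "norm (deriv G w) * Re w"
 have hol: "G hol_on hp" using G by (simp add: lift1_def)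
 have sub: "ball w (Re w) <= hp"
 proof
  fix v assume "v : ball w (Re w)"
  thus "v : hp" using abs_Re_le_cmod[of "w - v"] by (auto simp: dist_norm)
 qed
 show 1: "?d <= 12 * pi"
 proof (rule Bloch_bound[OF hol_sub[OF hol sub] w])
  fix a b assume ab: "a : ball w (Re w)" "b : ball w (Re w)"
  hence "0 < Re a" "0 < Re b" using sub by auto
  thus "G a ~= G b + per 1" using lift1_inj[OF G, of b a 1] by auto
 qed
 have 2: "?d <= Re (G w) - de"
 proof (rule ccontr)
  assume n: "~ ?d <= Re (G w) - de"
  define x where "x = Re w"
  have "eventually (%R. (norm (deriv G w) * (R\<^sup>2 - (R - x)\<^sup>2)) / (2 * R) > Re (G w) - de) at_top"
  proof (rule order_tendstoD)
   show "((%R. (norm (deriv G w) * (R\<^sup>2 - (R - x)\<^sup>2)) / (2 * R)) ---> norm (deriv G w) * x) at_top"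
   proof -
    have "eventually (%R. norm (deriv G w) * (x - x\<^sup>2 / (2 * R)) = (norm (deriv G w) * (R\<^sup>2 - (R - x)\<^sup>2)) / (2 * R)) at_top"
     using eventually_gt_at_top[of 0] by eventually_elim (simp add: field_simps power2_eq_square)
    moreover have "((%R. norm (deriv G w) * (x - x\<^sup>2 / (2 * R))) ---> norm (deriv G w) * (x - 0)) at_top"
     by (intro tendsto_intros real_tendsto_divide_at_top[OF tendsto_const]) real_asymp
    ultimately show ?thesis by (simp add: tendsto_cong)
   qed
   show "Re (G w) - de < norm (deriv G w) * x" using n by (simp add: x_def)
  qed
  then obtain R where R: "R > x" "(norm (deriv G w) * (R\<^sup>2 - (R - x)\<^sup>2)) / (2 * R) > Re (G w) - de"
   using eventually_conj[OF _ eventually_gt_at_top[of x]] by (metis (mono_tags, lifting) eventually_at_top_linorder order_refl)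
  define c where "c = Complex R (Im w)"
  have dc: "dist c w = R - x" unfolding dist_norm using R(1) by (subst cmod_eq_Re) (simp_all add: c_def x_def)
  have subR: "ball c R <= hp"
  proof
   fix v assume "v : ball c R"
   thus "v : hp" using abs_Re_le_cmod[of "c - v"] by (auto simp: dist_norm c_def)
  qed
  have "norm (deriv (%v. G v - of_real de) w) * (R\<^sup>2 - (dist c w)\<^sup>2) <= 2 * R * Re (G w - of_real de)"
  proof (rule Schwarz_Pick_half_plane)
   show "(%v. G v - of_real de) hol_on ball c R"
    by (intro hol_intros hol_sub[OF hol subR])
   show "0 < Re (G z - of_real de)" if "z : ball c R" for z using lift1_de[OF G, of z] subR that by auto
   show "w : ball c R" using dc w by (simp add: x_def)
  qed
  moreover have "deriv (%v. G v - of_real de) w = deriv G w"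
   using holomorphic_on_imp_differentiable_at[OF hol hp_facts(1)] w by simp
  ultimately have "norm (deriv G w) * (R\<^sup>2 - (R - x)\<^sup>2) <= 2 * R * (Re (G w) - de)" by (simp add: dc)
  moreover have "2 * R > 0" using R(1) w by (simp add: x_def)
  ultimately have "(norm (deriv G w) * (R\<^sup>2 - (R - x)\<^sup>2)) / (2 * R) <= Re (G w) - de"
   by (simp only: pos_divide_le_eq mult.commute)
  thus False using R(2) by simp
 qed
 have "12 * pi * ?d + de * ?d <= 12 * pi * (Re (G w) - de) + de * (12 * pi)"
  using 1 2 de(1) by (intro add_mono mult_left_mono) auto
 hence "?d * (12 * pi + de) <= 12 * pi * Re (G w)" by (simp add: algebra_simps)
 thus "?d <= La * Re (G w)" unfolding La_def using de(1) by (simp add: pos_le_divide_eq add_pos_pos)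
qed

section \<open>Compositions of lifts and their hyperbolic contraction\<close>

primrec lifts :: "nat => (complex => complex) set" where
 "lifts 0 = {id}"
| "lifts (Suc m) = {G o H | G H. lift1 G & H : lifts m}"

lemma lifts_facts: "G : lifts m ==> G hol_on hp & (ALL w. 0 < Re w --> 0 < Re (G w) & (f ^^ m) (q (G w)) = q w)"
proof (induction m arbitrary: G)
 case (Suc m)
 then obtain K H where GH: "G = K o H" "lift1 K" "H : lifts m" by auto
 note IH = Suc.IH[OF GH(3)]
 have "(K o H) hol_on hp"
  by (rule hol_comp[of H hp K hp]) (use IH GH(2) in "auto simp: lift1_def")
 moreover have "(f ^^ Suc m) (q (K (H w))) = q w" if "0 < Re w" for w
  using IH GH(2) that by (simp add: funpow_swap1 lift1_def)
 ultimately show ?case unfolding GH(1) using GH(2) IH by (simp add: lift1_def o_def)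
qed (simp add: holomorphic_on_id)

lemma lifts_hol: "G : lifts m ==> G hol_on hp"
 and lifts_Re: "G : lifts m ==> 0 < Re w ==> 0 < Re (G w)"
 and lifts_f: "G : lifts m ==> 0 < Re w ==> (f ^^ m) (q (G w)) = q w"
 using lifts_facts by blast+

text \<open>The recursion splits off the factor that inverts the first application of
  \<open>f\<close>; here the factor at the other end of the orbit is exposed.\<close>

lemma lifts_Suc_right: "G : lifts (Suc m) ==> EX H K. H : lifts m & lift1 K & G = H o K"
proof (induction m arbitrary: G)
 case 0
 thus ?case by auto
next
 case (Suc m)
 then obtain G1 H where GH: "G = G1 o H" "lift1 G1" "H : lifts (Suc m)" by (auto simp del: lifts.simps(2) simp: lifts.simps(2)[of "Suc m"])
 then obtain H' K where "H' : lifts m" "lift1 K" "H = H' o K" using Suc.IH by blast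
 hence "G1 o H' : lifts (Suc m)" "G = (G1 o H') o K" using GH by (auto simp: comp_assoc)
 thus ?case using `lift1 K` by blast
qed

lemma lifts_through:
 assumes "0 < Re b" "(f ^^ m) (q b) : W"
 obtains G a where "G : lifts m" "0 < Re a" "G a = b" "q a = (f ^^ m) (q b)"
 using assms
proof (induction m arbitrary: b thesis)
 case (Suc m)
 have "f (q b) : W" using fn_W[OF Suc.prems(3), of 1] by simp
 then obtain c where c: "0 < Re c" "q c = f (q b)" by (rule q_surj)
 hence "(f ^^ m) (q c) : W" using Suc.prems(3) by (simp add: funpow_swap1)
 then obtain H a where H: "H : lifts m" "0 < Re a" "H a = c" "q a = (f ^^ m) (q c)" using Suc.IH[OF _ c(1)] by blast
 obtain K where K: "lift1 K" "K c = b" using lift1_through[OF c(1) Suc.prems(2)] c(2) by metis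
 have "K o H : lifts (Suc m)" using K H by auto
 thus ?case by (rule Suc.prems(1)[OF _ H(2)]) (use K H c(2) in "auto simp: funpow_swap1")
qed auto

lemma lifts_unique:
 assumes "G : lifts m" "H : lifts m" "0 < Re a" "0 < Re b" "q (G a) = q (H b)"
 obtains j k where "b = a + per j" "!!w. 0 < Re w ==> H (w + per j) = G w + per k"
 using assms
proof (induction m arbitrary: G H thesis)
 case 0
 thus ?case by (metis (no_types, lifting) empty_iff id_apply insert_iff lifts.simps(1) q_eq)
next
 case (Suc m)
 obtain G1 G2 where G: "G = G1 o G2" "lift1 G1" "G2 : lifts m" using Suc.prems by auto
 obtain H1 H2 where H: "H = H1 o H2" "lift1 H1" "H2 : lifts m" using Suc.prems by auto
 have pos: "0 < Re (G2 a)" "0 < Re (H2 b)" using G H Suc.prems lifts_Re by blast+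
 have e: "q (G1 (G2 a)) = q (H1 (H2 b))" using Suc.prems(6) G H by simp
 obtain n k where n: "H2 b = G2 a + per n" "!!w. 0 < Re w ==> H1 (w + per n) = G1 w + per k"
  using lift1_unique[OF G(2) H(2) pos e] by blast
 hence e2: "q (G2 a) = q (H2 b)" by simp
 obtain j i where j: "b = a + per j" "!!w. 0 < Re w ==> H2 (w + per j) = G2 w + per i"
  using Suc.IH[OF _ G(3) H(3) Suc.prems(4,5) e2] by blast
 have "n = i" using n(1) j(2)[OF Suc.prems(4)] j(1) by simp
 hence "H (w + per j) = G w + per k" if "0 < Re w" for w
  using that j(2) n(2)[OF lifts_Re[OF G(3) that]] by (simp add: G(1) H(1))
 thus ?case using Suc.prems(1) j(1) by blast
qed

lemma lifts_inj:
 "G : lifts m ==> 0 < Re a ==> 0 < Re b ==> G b = G a + per n ==> m = 0 | b = a & n = 0"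
proof (induction m arbitrary: G n)
 case (Suc m)
 obtain G1 G2 where G: "G = G1 o G2" "lift1 G1" "G2 : lifts m" using Suc.prems by auto
 have "G2 b = G2 a & n = 0"
  by (rule lift1_inj[OF G(2)]) (use Suc.prems G lifts_Re in auto)
 thus ?case using Suc.IH[OF G(3) Suc.prems(2,3), of 0] G(3) by (cases m) auto
qed simp

lemma lifts_deriv: "G : lifts m ==> 0 < Re w ==> norm (deriv G w) * Re w <= La ^ m * Re (G w)"
proof (induction m arbitrary: G)
 case 0
 hence "G = (%w. w)" by auto
 thus ?case by simp
next
 case (Suc m)
 obtain G1 H where G: "G = G1 o H" "lift1 G1" "H : lifts m" using Suc.prems by auto
 have Hw: "0 < Re (H w)" using lifts_Re[OF G(3) Suc.prems(2)] .
 have "(H has_field_derivative deriv H w) (at w)" "(G1 has_field_derivative deriv G1 (H w)) (at (H w))"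
  using holomorphic_derivI[OF lifts_hol[OF G(3)] hp_facts(1)] holomorphic_derivI[of G1 hp] hp_facts(1) Suc.prems(2) Hw G(2)
  by (auto simp: lift1_def)
 hence "deriv G w = deriv G1 (H w) * deriv H w" unfolding G(1) o_def
  by (intro DERIV_imp_deriv DERIV_chain2[where f = G1 and g = H])
 hence "norm (deriv G w) * Re w = norm (deriv G1 (H w)) * (norm (deriv H w) * Re w)" by (simp add: norm_mult)
 also have "... <= norm (deriv G1 (H w)) * (La ^ m * Re (H w))" using Suc.IH[OF G(3) Suc.prems(2)] by (intro mult_left_mono) auto
 also have "... = La ^ m * (norm (deriv G1 (H w)) * Re (H w))" by simp
 also have "... <= La ^ m * (La * Re (G1 (H w)))" using lift1_deriv(2)[OF G(2) Hw] La by (intro mult_left_mono) auto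
 finally show ?case by (simp add: G(1) o_def mult_ac)
qed

text \<open>Take the logarithm of \<open>G - c\<close> with \<open>c\<close> on the axis at the
  height of \<open>G a\<close>: its derivative is \<open>deriv G w / (G w - c)\<close>, which
  \<open>lifts_deriv\<close> bounds by \<open>La ^ m / Re w\<close>. Exponentiating returns to
  \<open>G\<close>.\<close>

lemma lifts_increment:
 assumes G: "G : lifts m" and ab: "0 < Re a" "0 < Re b" and M: "Re a <= M" "Re b <= M" "abs(Im a - Im b) <= M"
 defines "t == La ^ m * (ln (M / Re a) + ln (M / Re b) + 1)"
 shows "norm (G a - G b) <= Re (G a) * (t * exp t)"
proof -
 define c where "c = Complex 0 (Im (G a))"
 have pos: "0 < Re (G w - c)" if "0 < Re w" for w using lifts_Re[OF G that] by (simp add: c_def)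
 have nz: "G w - c ~: \<real>\<^sub>\<le>\<^sub>0" if "0 < Re w" for w using pos[OF that] by (auto simp: complex_nonpos_Reals_iff)
 define L where "L w = Ln (G w - c)" for w
 have e: "exp (L w) = G w - c" if "0 < Re w" for w unfolding L_def using pos[OF that] by (intro exp_Ln) auto
 have dG: "(G has_field_derivative deriv G w) (at w)" if "0 < Re w" for w
  using holomorphic_derivI[OF lifts_hol[OF G] hp_facts(1)] that by simp
 have dL: "(L has_field_derivative deriv G w / (G w - c)) (at w)" if "0 < Re w" for w
  unfolding L_def using dG[OF that] nz[OF that] by (auto intro!: derivative_eq_intros simp: divide_inverse mult.commute)
 have "norm (L b - L a) <= La ^ m * (ln (M / (Re b - 0)) + ln (M / (Re a - 0)) + 1)"
 proof (rule half_plane_increment[where X = 0])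
  show "L hol_on {w. 0 < Re w}" using dL hp_facts(1) by (subst holomorphic_on_open) auto
  fix w assume w: "0 < Re w"
  have "Re (G w) <= norm (G w - c)" using complex_Re_le_cmod[of "G w - c"] by (simp add: c_def)
  moreover have "norm (deriv L w) = norm (deriv G w) / norm (G w - c)" by (simp add: DERIV_imp_deriv[OF dL[OF w]] norm_divide)
  ultimately have "norm (deriv L w) * (Re w - 0) <= norm (deriv G w) * Re w / Re (G w)"
   using lifts_Re[OF G w] w by (simp add: frac_le)
  also have "... <= La ^ m" using lifts_deriv[OF G w] lifts_Re[OF G w] by (simp add: pos_divide_le_eq)
  finally show "norm (deriv L w) * (Re w - 0) <= La ^ m" .
 qed (use ab M in auto)
 hence L: "norm (L b - L a) <= t" by (simp add: t_def algebra_simps)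
 have ca: "G a - c = of_real (Re (G a))" by (simp add: c_def complex_eq_iff)
 have "exp (L b) = exp (L a) * exp (L b - L a)" by (simp add: exp_diff)
 hence "G b - c = (G a - c) * exp (L b - L a)" using e ab by simp
 hence "G b - G a = (G a - c) * (exp (L b - L a) - 1)" by (simp only: right_diff_distrib mult_1_right) (simp add: algebra_simps)
 hence "norm (G b - G a) = norm ((G a - c) * (exp (L b - L a) - 1))" by simp
 also have "... = Re (G a) * norm (exp (L b - L a) - 1)"
  unfolding norm_mult ca using lifts_Re[OF G ab(1)] by simp
 also have "... <= Re (G a) * (norm (L b - L a) * exp (norm (L b - L a)))"
  using lifts_Re[OF G ab(1)] norm_exp_minus_1[of "L b - L a"] by (intro mult_left_mono) auto
 also have "... <= Re (G a) * (t * exp t)"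
  using L lifts_Re[OF G ab(1)] order_trans[OF norm_ge_zero L] by (intro mult_left_mono mult_mono) auto
 finally show ?thesis by (simp add: norm_minus_commute)
qed

end

section \<open>Head start for lifts\<close>

context exterior begin

text \<open>Near infinity \<open>q w = exp w * k (exp (- w))\<close> with \<open>k\<close>
  holomorphic and nonzero at 0, so a logarithm of \<open>k\<close> is the bounded
  correction.\<close>

lemma q_log:
 obtains lq R C where "R > 0" "C >= 0" "lq hol_on {w. R < Re w}"
  "!!w. R < Re w ==> exp (lq w) = q w" "!!w. R < Re w ==> norm (lq w - w) <= C"
proof -
 obtain h where h: "h hol_on ball 0 1" "!!u. norm u < 1 ==> mu u = u * h u" "deriv mu 0 = h 0"
  using Schwarz3[OF mu_hol mu0] by auto
 have "inj_on mu (ball 0 1)" by (rule inj_on_inverseI[where g = mu']) (simp add: mu'mu)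
 hence h0: "h 0 ~= 0" using holomorphic_injective_imp_regular[OF mu_hol open_ball, of 0] h(3) by simp
 define k where "k u = p * u + 1 / h u" for u
 have ch: "isCont h 0" using hol_cont[OF h(1)] by (simp add: cont_at)
 hence ck: "isCont k 0" unfolding k_def using h0 by (intro cont_intros)
 have k0: "k 0 ~= 0" using h0 by (simp add: k_def)
 obtain r1 r2 where r12: "r1 > 0" "r2 > 0" "!!u. dist 0 u < r1 ==> h u ~= 0" "!!u. dist 0 u < r2 ==> k u ~= 0"
  using continuous_at_avoid[OF ch h0] continuous_at_avoid[OF ck k0] by blast
 define r0 where "r0 = min r1 r2"
 have r0: "r0 > 0" "!!u. dist 0 u < r0 ==> h u ~= 0 & k u ~= 0" using r12 by (auto simp: r0_def)
 define r where "r = min r0 (1/2)"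
 have r: "r > 0" "r < 1" "!!u. u : ball 0 r ==> h u ~= 0 & k u ~= 0" using r0 by (auto simp: r_def)
 have "h hol_on ball 0 r" by (rule hol_sub[OF h(1)]) (use r in auto)
 hence kh: "k hol_on ball 0 r" unfolding k_def[abs_def] using r(3) by (auto intro!: hol_intros)
 obtain L where L: "L hol_on ball 0 r" "!!u. u : ball 0 r ==> exp (L u) = k u"
  using nonvanishing_log[OF open_ball convex_ball kh] r(3) by blast
 have "continuous_on (cball 0 (r/2)) L"
  by (rule cont_sub[OF hol_cont[OF L(1)]]) (use r(1) in auto)
 hence "bounded (L ` cball 0 (r/2))" by (intro compact_imp_bounded compact_im) auto
 then obtain C where C: "C > 0" "!!u. norm u <= r/2 ==> norm (L u) <= C" by (auto simp: bounded_pos)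
 have e: "norm (exp (- w)) < r / 2" if "1 - ln (r/2) < Re w" for w
 proof -
  have "exp (- Re w) < exp (ln (r/2))" using that by (simp only: exp_less_cancel_iff)
  thus ?thesis using r(1) by simp
 qed
 show thesis
 proof (rule that[of "max 1 (1 - ln (r/2))" C "%w. w + L (exp (- w))"])
  have "(L o (%w. exp (- w))) hol_on {w. max 1 (1 - ln (r/2)) < Re w}"
  proof (rule hol_comp[OF _ L(1)])
   show "(%w. exp (- w)) ` {w. max 1 (1 - ln (r/2)) < Re w} <= ball 0 r" using e r(1) by (force intro: less_trans)
  qed (auto intro!: hol_intros)
  thus "(%w. w + L (exp (- w))) hol_on {w. max 1 (1 - ln (r/2)) < Re w}"
   by (auto intro!: hol_intros simp: o_def)
  show "norm (w + L (exp (- w)) - w) <= C" if "max 1 (1 - ln (r/2)) < Re w" for w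
   using C(2) e[of w] that by simp
  show "exp (w + L (exp (- w))) = q w" if "max 1 (1 - ln (r/2)) < Re w" for w
  proof -
   have n: "norm (exp (- w)) < r / 2" using e[of w] that by simp
   have b: "norm (exp (- w)) < 1" using n r(1,2) by linarith
   have "norm (exp (- w)) < r" using n r(1) by linarith
   hence b: "exp (- w) : ball 0 r" "norm (exp (- w)) < 1" using b by (simp, blast)
   have hn: "h (exp (- w)) ~= 0" using r(3)[OF b(1)] by simp
   have "exp (w + L (exp (- w))) = exp w * (p * exp (- w) + 1 / h (exp (- w)))"
    using L(2)[OF b(1)] by (simp add: exp_add k_def)
   also have "... = p + exp w / h (exp (- w))" by (simp add: distrib_left exp_minus)
   also have "... = q w" unfolding q_def h(2)[OF b(2)] by (simp add: exp_minus divide_inverse)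
   finally show ?thesis .
  qed
 qed (use C in auto)
qed

lemma lift1_large: obtains X where "X > 0" "!!G w. lift1 G ==> X < Re w ==> R < Re (G w)"
proof -
 obtain B where B: "!!z. z : W ==> N z <= R ==> norm z <= B" using N_bounded_imp[of R] by metis
 have "bounded (f ` cball 0 B)" by (intro compact_imp_bounded compact_im f_cont compact_cball)
 then obtain B' where "ALL y : f ` cball 0 B. norm y <= B'" unfolding bounded_iff by blast
 hence B': "norm (f z) <= B'" if "norm z <= B" for z using that by auto
 obtain X where X: "X > 0" "!!w. X <= Re w ==> B' < norm (q w)" using q_large[of B'] by metis
 show thesis
 proof (rule that[OF X(1)], rule ccontr)
  fix G w assume G: "lift1 G" and w: "X < Re w" and "~ R < Re (G w)"
  moreover from this have "0 < Re (G w)" "f (q (G w)) = q w" using X(1) by (auto simp: lift1_def)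
  ultimately have "norm (q w) <= B'" using B[OF q_W(1), of "G w"] N_q[of "G w"] B'[of "q (G w)"] by simp
  thus False using X(2)[of w] w by simp
 qed
qed

lemma lift1_shift:
 assumes G: "lift1 G" and w: "de <= Re w" and Y: "Y >= 0"
 shows "norm (G (w + of_real Y) - G w) <= 12 * pi / de * Y"
proof -
 have cv: "convex {v. de <= Re v}" by (simp add: convex_halfspace_Re_ge)
 have "norm (G (w + of_real Y) - G w) <= 12 * pi / de * norm (w + of_real Y - w)"
 proof (rule diff_bound[OF cv, where f' = "deriv G"])
  fix v assume v: "v : {v. de <= Re v}"
  hence v0: "0 < Re v" using de(1) by simp
  have "G hol_on hp" "v : hp" using G v0 by (simp_all add: lift1_def)
  thus "(G has_field_derivative deriv G v) (at v within {v. de <= Re v})"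
   by (rule holomorphic_derivI[OF _ hp_facts(1)])
  have "norm (deriv G v) * de <= norm (deriv G v) * Re v" using v by (intro mult_left_mono) auto
  thus "norm (deriv G v) <= 12 * pi / de" using lift1_deriv(1)[OF G v0] de(1) by (simp add: pos_le_divide_eq)
 qed (use w Y in auto)
 thus ?thesis using Y by simp
qed

text \<open>Far out, lifts are inverse branches of f in logarithmic coordinates, up to a bounded change
  of the coordinate; this transfers the head start to the lifts.\<close>

lemma lift1_log_branch:
 assumes X: "log_level f X" and G: "lift1 G" and lq: "lq hol_on {w. R < Re w}" "!!w. R < Re w ==> exp (lq w) = q w"
  and Y: "R <= Y" "!!w. Y < Re w ==> R < Re (G w)" "!!w. Y < Re w ==> X < Re (lq w)" "0 < Y"
 obtains L where "L : log_branches f X" "!!w. Y < Re w ==> L (lq w) = lq (G w)"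
proof -
 define a where "a = complex_of_real (Y + 1)"
 have a: "Y < Re a" by (simp add: a_def)
 have Gq: "f (q (G w)) = q w" "0 < Re (G w)" if "Y < Re w" for w using G that Y(4) by (auto simp: lift1_def)
 have "f (exp (lq (G a))) = exp (lq a)" using Gq(1)[OF a] lq(2) Y a by simp
 then obtain L where L: "L : log_branches f X" "L (lq a) = lq (G a)"
  using log_branch_through[OF tr X _ Y(3)[OF a]] by blast
 have clq: "continuous_on {w. R < Re w} lq" by (rule hol_cont[OF lq(1)])
 have "L (lq w) = lq (G w)" if w: "Y < Re w" for w
 proof (rule unique_lift[where f = "%u. f (exp u)" and h = "%w. L (lq w)" and k = "%w. lq (G w)" and S = "{w. Y < Re w}" and a = a])
  have "(f o exp) hol_on UNIV"
   by (intro holomorphic_on_compose holomorphic_on_exp f_hol)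
  thus "(%u. f (exp u)) hol_on UNIV" by (simp add: o_def)
  show "connected {w. Y < Re w}" by (simp add: convex_connected convex_halfspace_Re_gt)
  have clq': "continuous_on {w. Y < Re w} lq" by (rule cont_sub[OF clq]) (use Y(1) in auto)
  have "continuous_on {w. X < Re w} L" using L(1) hol_cont by (auto simp: log_branches_def)
  thus "continuous_on {w. Y < Re w} (%w. L (lq w))" by (rule cont_comp[OF _ clq']) (use Y(3) in auto)
  have "continuous_on {w. Y < Re w} G"
   by (rule cont_sub[of hp]) (use G Y(4) hol_cont in "auto simp: lift1_def")
  thus "continuous_on {w. Y < Re w} (%w. lq (G w))" by (rule cont_comp[OF clq]) (use Y(2) in auto)
  fix x assume x: "x : {w. Y < Re w}"
  have "f (exp (L (lq x))) = exp (lq x)" using L(1) Y(3) x by (simp add: log_branches_def)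
  also have "... = f (exp (lq (G x)))" using x Gq(1)[of x] lq(2)[of x] lq(2)[OF Y(2), of x] Y(1) by simp
  finally show "f (exp (L (lq x))) = f (exp (lq (G x)))" .
  show "deriv (%u. f (exp u)) (L (lq x)) ~= 0"
   using log_branch_deriv_nonzero[OF tr X L(1) Y(3)] x by simp
 qed (use a w L(2) in auto)
 thus thesis using that L(1) by blast
qed

text \<open>After its argument is shifted to the right by \<open>Y\<close>, each lift is compared
  with a logarithmic branch, and real and imaginary parts agree up to \<open>E\<close>. Slope and
  head start survive with worse additive constants.\<close>

lemma head_start_lifts:
 assumes "linear_head_start f"
 obtains al be K M where "0 <= al" "0 <= be" "1 <= K" "0 < M"
  "!!G a b. lift1 G ==> de <= Re a ==> de <= Re b ==> abs(Im (G a) - Im (G b)) <= al * max (Re (G a)) (Re (G b)) + be"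
  "!!G H a b. lift1 G ==> lift1 H ==> de <= Re a ==> de <= Re b ==> K * Re (G (H a)) + M <= Re (G (H b)) ==>
    K * Re (H a) + 2 * M <= Re (H b)"
proof -
 obtain X0 where X0: "!!X. X >= X0 ==> (EX al be. slope_bound f X al be) & (ALL al>=0. ALL be>=0. EX K0>=1. ALL K>=K0. head_start_bound f X al be K)"
  using assms unfolding linear_head_start_def by blast
 obtain X where X: "X >= X0" "log_level f X" using log_level_exists[OF sing_bounded] by blast
 obtain lq R C where lq: "R > 0" "C >= 0" "lq hol_on {w. R < Re w}"
  "!!w. R < Re w ==> exp (lq w) = q w" "!!w. R < Re w ==> norm (lq w - w) <= C" by (rule q_log) blast
 obtain Y0 where Y0: "Y0 > 0" "!!G w. lift1 G ==> Y0 < Re w ==> R < Re (G w)" using lift1_large[of R] by metis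
 define Y where "Y = max (max R Y0) (X + 1 + C)"
 have Y: "R <= Y" "0 < Y" "Y0 <= Y" "X + 1 + C <= Y" using Y0(1) by (auto simp: Y_def)
 have lqRI: "abs(Re (lq w) - Re w) <= C" "abs(Im (lq w) - Im w) <= C" if "R < Re w" for w
  using lq(5)[OF that] abs_Re_le_cmod[of "lq w - w"] abs_Im_le_cmod[of "lq w - w"] by auto
 have lqX: "X + 1 <= Re (lq w)" if "Y < Re w" for w using lqRI(1)[of w] that Y by auto
 define D where "D = 12 * pi / de * Y"
 have D0: "D >= 0" using de(1) Y(2) by (simp add: D_def)
 define E where "E = C + D"
 have br: "EX L:log_branches f X. ALL w. de <= Re w --> abs(Re (L (lq (w + of_real Y))) - Re (G w)) <= E
    & abs(Im (L (lq (w + of_real Y))) - Im (G w)) <= E" if G: "lift1 G" for G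
 proof -
  obtain L where L: "L : log_branches f X" "!!w. Y < Re w ==> L (lq w) = lq (G w)"
  proof (rule lift1_log_branch[OF X(2) G lq(3,4) Y(1)])
   show "R < Re (G w)" "X < Re (lq w)" if "Y < Re w" for w using Y0(2)[OF G, of w] lqX[OF that] that Y by auto
  qed (use Y in auto)
  have "abs(Re (L (lq (w + of_real Y))) - Re (G w)) <= E & abs(Im (L (lq (w + of_real Y))) - Im (G w)) <= E" if w: "de <= Re w" for w
  proof -
   have Yw: "Y < Re (w + of_real Y)" using w de(1) by simp
   hence R: "R < Re (G (w + of_real Y))" using Y0(2)[OF G] Y(3) by (meson le_less_trans)
   have n: "norm (G (w + of_real Y) - G w) <= D" using lift1_shift[OF G w] Y(2) by (simp add: D_def)
   show ?thesis unfolding L(2)[OF Yw] E_def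
    using lqRI[OF R] order_trans[OF abs_Re_le_cmod n] order_trans[OF abs_Im_le_cmod n] by auto
  qed
  thus ?thesis using L(1) by blast
 qed
 have E0: "E >= 0" using lq(2) D0 by (simp add: E_def)
 obtain al be where sl: "slope_bound f X al be" using X0[OF X(1)] by blast
 have al: "0 <= al" "0 <= be" using sl by (auto simp: slope_bound_def)
 define be1 where "be1 = be + al * E + 2 * E"
 have slope: "abs(Im (G a) - Im (G b)) <= al * max (Re (G a)) (Re (G b)) + be1"
  if G: "lift1 G" "de <= Re a" "de <= Re b" for G a b
 proof -
  obtain L where L: "L : log_branches f X" "ALL w. de <= Re w --> abs(Re (L (lq (w + of_real Y))) - Re (G w)) <= E
    & abs(Im (L (lq (w + of_real Y))) - Im (G w)) <= E" using br[OF G(1)] by blast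
  define x y where "x = lq (a + of_real Y)" and "y = lq (b + of_real Y)"
  have "X + 1 <= Re x" "X + 1 <= Re y" unfolding x_def y_def by (intro lqX; use G de(1) in simp)+
  hence "abs(Im (L x) - Im (L y)) <= al * max (Re (L x)) (Re (L y)) + be" using sl L(1) unfolding slope_bound_def by blast
  moreover have r: "abs(Re (L x) - Re (G a)) <= E" "abs(Im (L x) - Im (G a)) <= E" "abs(Re (L y) - Re (G b)) <= E" "abs(Im (L y) - Im (G b)) <= E"
   using L(2) G by (auto simp: x_def y_def)
  moreover have "al * max (Re (L x)) (Re (L y)) <= al * (max (Re (G a)) (Re (G b)) + E)"
   using r al(1) by (intro mult_left_mono) auto
  moreover have "al * (max (Re (G a)) (Re (G b)) + E) = al * max (Re (G a)) (Re (G b)) + al * E" by (simp add: distrib_left)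
  ultimately show ?thesis unfolding be1_def by linarith
 qed
 define be2 where "be2 = be1 + 2 * C + al * C"
 have be2: "be2 >= 0" "be1 >= 0" using al E0 lq(2) by (auto simp: be2_def be1_def)
 obtain K where K: "K >= 1" "head_start_bound f X al be2 K"
  using X0[OF X(1)] al(1) be2(1) by blast
 obtain M0 where M0: "!!M L x y. M0 <= M ==> L : log_branches f X ==> X + 1 <= Re x ==> X + 1 <= Re y ==>
  abs(Im x - Im y) <= al * max (Re x) (Re y) + be2 ==> K * Re (L x) + M <= Re (L y) ==> K * Re x + 4 * M <= Re y"
  using K(2) unfolding head_start_bound_def by blast
 \<comment> \<open>\<open>Q\<close> is the loss in the values and \<open>T\<close> the loss in the
   arguments; \<open>4 * (M - Q)\<close> still leaves \<open>2 * M\<close>, since \<open>M\<close>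
   is at least \<open>2 * Q + T\<close>.\<close>
 define Q where "Q = (K + 1) * E"
 define T where "T = (K + 1) * (Y + C)"
 define M where "M = max 1 (max (M0 + Q) (2 * Q + T))"
 have Q: "Q >= 0" "T >= 0" using K(1) E0 Y(2) lq(2) by (auto simp: Q_def T_def)
 have M: "M > 0" "M0 <= M - Q" "2 * Q + T <= M" by (auto simp: M_def)
 have "K * Re (H a) + 2 * M <= Re (H b)"
  if G: "lift1 G" "lift1 H" "de <= Re a" "de <= Re b" "K * Re (G (H a)) + M <= Re (G (H b))" for G H a b
 proof -
  obtain L where L: "L : log_branches f X" "ALL w. de <= Re w --> abs(Re (L (lq (w + of_real Y))) - Re (G w)) <= E
    & abs(Im (L (lq (w + of_real Y))) - Im (G w)) <= E" using br[OF G(1)] by blast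
  have H: "de <= Re (H a)" "de <= Re (H b)" using lift1_de[OF G(2)] G(3,4) de(1) by (meson less_imp_le less_le_trans)+
  define x y where "x = lq (H a + of_real Y)" and "y = lq (H b + of_real Y)"
  have xy: "X + 1 <= Re x" "X + 1 <= Re y" unfolding x_def y_def by (intro lqX; use H de(1) in simp)+
  have R: "R < Re (H a + of_real Y)" "R < Re (H b + of_real Y)" using H de(1) Y(1) by auto
  have i: "abs(Re x - (Re (H a) + Y)) <= C" "abs(Im x - Im (H a)) <= C" "abs(Re y - (Re (H b) + Y)) <= C" "abs(Im y - Im (H b)) <= C"
   using lqRI[OF R(1)] lqRI[OF R(2)] by (auto simp: x_def y_def)
  have r: "abs(Re (L x) - Re (G (H a))) <= E" "abs(Re (L y) - Re (G (H b))) <= E" using L(2) H by (auto simp: x_def y_def)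
  have "al * max (Re (H a)) (Re (H b)) <= al * (max (Re x) (Re y) + C)"
   using i Y(2) al(1) by (intro mult_left_mono) auto
  hence "abs(Im x - Im y) <= al * max (Re x) (Re y) + be2"
   using slope[OF G(2,3,4)] i distrib_left[of al "max (Re x) (Re y)" C] unfolding be2_def by linarith
  moreover have "K * Re (L x) + (M - Q) <= Re (L y)"
  proof -
   have "K * Re (L x) <= K * (Re (G (H a)) + E)" using r K(1) by (intro mult_left_mono) auto
   moreover have "K * (Re (G (H a)) + E) = K * Re (G (H a)) + K * E" "Q = K * E + E" by (auto simp: Q_def algebra_simps)
   ultimately show ?thesis using G(5) r by linarith
  qed
  ultimately have "K * Re x + 4 * (M - Q) <= Re y" using M0[OF M(2) L(1) xy] by blast
  moreover have "K * (Re (H a) + Y - C) <= K * Re x" using i K(1) by (intro mult_left_mono) auto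
  moreover have "K * (Re (H a) + Y - C) = K * Re (H a) + K * Y - K * C" "T = K * Y + K * C + Y + C" by (auto simp: T_def algebra_simps)
  moreover have "K * Y >= 0" using K(1) Y(2) by simp
  moreover have "Re y - Y - C <= Re (H b)" using i by linarith
  ultimately show ?thesis using M(3) Q by argo
 qed
 thus thesis by (intro that[of al be1 K M] al(1) be2(2) K(1) M(1) slope)
qed

end

section \<open>Boundary values of lifts\<close>

lemma simple_zero_log:
 assumes h: "h hol_on ball 0 1" "inj_on h (ball 0 1)" "h 0 = 0"
 obtains nv where "nv hol_on ball 0 1" "!!u. norm u < 1 ==> h u = u * exp (nv u)"
proof -
 obtain k where k: "k hol_on ball 0 1" "!!u. norm u < 1 ==> h u = u * k u" "deriv h 0 = k 0"
  using Schwarz3[OF h(1,3)] by auto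
 have "k u ~= 0" if u: "u : ball 0 1" for u
 proof (cases "u = 0")
  case True
  thus ?thesis using holomorphic_injective_imp_regular[OF h(1) open_ball h(2), of 0] k(3) by simp
 next
  case False
  show ?thesis
  proof
   assume "k u = 0"
   hence "h u = h 0" using k(2)[of u] u h(3) by simp
   thus False using inj_onD[OF h(2), of u 0] u False by simp
  qed
 qed
 then obtain L where "L hol_on ball 0 1" "!!u. u : ball 0 1 ==> exp (L u) = k u"
  using nonvanishing_log[OF open_ball convex_ball k(1)] by blast
 thus thesis using that k(2) by simp
qed

text \<open>Values in the discrete set of periods: both sides have \<open>exp\<close> equal to 1, so
  unique lifting applies.\<close>

lemma periodic_difference_constant:
 assumes S: "connected S" and d: "continuous_on S d" "!!s. s : S ==> EX n. d s = per n" and st: "s : S" "t : S"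
 shows "d s = d t"
proof (rule unique_lift[where f = exp and h = d and k = "%_. d t" and S = S and a = t])
 fix x assume "x : S"
 thus "exp (d x) = exp (d t)" using d(2)[of x] d(2)[OF st(2)] by (metis exp_per)
 show "deriv exp (d x) ~= 0" by (simp add: DERIV_imp_deriv[OF DERIV_exp])
qed (use assms in "auto intro!: hol_intros")

lemma strip_shift: "s + per k : strip x \<longleftrightarrow> s : strip x" by (simp add: strip_def)

lemma closure_strip: assumes "x > 0" shows "closure (strip x) = {s. - x <= Re s & Re s <= 0}"
proof
 have "{s. - x <= Re s & Re s <= 0} = {s. - x <= Re s} Int {s. Re s <= 0}" by auto
 hence "closed {s. - x <= Re s & Re s <= 0}" by (simp add: closed_Int closed_halfspace_Re_ge closed_halfspace_Re_le)
 thus "closure (strip x) <= {s. - x <= Re s & Re s <= 0}" by (intro closure_minimal) (auto simp: strip_def)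
 show "{s. - x <= Re s & Re s <= 0} <= closure (strip x)"
 proof
  fix s assume s: "s : {s. - x <= Re s & Re s <= 0}"
  define t where "t n = inverse (real (Suc n))" for n
  have "t ----> 0" unfolding t_def[abs_def] by (rule LIMSEQ_inverse_real_of_nat)
  hence "(%n. s + of_real (t n * (- x/2 - Re s))) ----> s + of_real (0 * (- x/2 - Re s))" by (intro tendsto_intros)
  moreover have "s + of_real (t n * (- x/2 - Re s)) : strip x" for n
  proof -
   have t: "0 < t n" "t n <= 1" by (auto simp: t_def field_simps)
   have 1: "0 <= (1 - t n) * (Re s + x)" "(1 - t n) * Re s <= 0" "0 < t n * (x/2)"
    using t s assms by (simp_all add: mult_nonneg_nonpos)
   have "Re s + t n * (- x/2 - Re s) + x = (1 - t n) * (Re s + x) + t n * (x/2)" by (simp add: algebra_simps)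
   with 1 have "0 < Re s + t n * (- x/2 - Re s) + x" by simp
   moreover have "Re s + t n * (- x/2 - Re s) = (1 - t n) * Re s - t n * (x/2)" by (simp add: algebra_simps)
   with 1 have "Re s + t n * (- x/2 - Re s) < 0" by linarith
   ultimately have "- x < Re s + t n * (- x/2 - Re s)" "Re s + t n * (- x/2 - Re s) < 0" by simp_all
   thus ?thesis by (simp add: strip_def)
  qed
  ultimately show "s : closure (strip x)" unfolding closure_sequential
   by (intro exI[of _ "%n. s + of_real (t n * (- x/2 - Re s))"]) simp
 qed
qed

context exterior begin

abbreviation "S == strip l"

lemma S_facts: "open S" "convex S" "connected S" by (auto simp: strip_open strip_convex convex_connected)

lemma exp_strip: assumes "0 < x" "s : strip x" shows "norm (exp s) < 1" "ps (exp s) : F" "ps (exp s) : far x"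
proof -
 show 1: "norm (exp s) < 1" using assms by (simp add: strip_def)
 thus 2: "ps (exp s) : F" by (rule ps_in)
 show "ps (exp s) : far x" using far_facts(5)[OF assms(1) 2] phps[OF 1] assms(2) by (simp add: strip_def)
qed

lemma psexp_hol: "(%s. ps (exp s)) hol_on strip x"
proof -
 have "(ps o exp) hol_on strip x"
  by (rule hol_comp[OF _ ps_hol]) (auto intro!: hol_intros simp: strip_def)
 thus ?thesis by (simp add: o_def)
qed

lemma psexp_eq: assumes "s : S" "t : S" "ps (exp s) = ps (exp t)" obtains k where "t = s + per k"
proof -
 have "exp t = exp s" using inj_onD[OF ps_inj assms(3)] exp_strip(1)[OF l(1)] assms by simp
 thus thesis using that exp_eq_per by blast
qed

text \<open>Both exterior coordinates are logarithms about p up to holomorphic functions of the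
  exponentials, which is why the transition map commutes with the deck transformations.\<close>

lemma lam_ex: "EX lam. lam hol_on S & (ALL s:S. 0 < Re (lam s) & q (lam s) = ps (exp s)) & (ALL s:S. ALL k. lam (s + per k) = lam s + per k)"
proof -
 define a where "a = complex_of_real (- l / 2)"
 have a: "a : S" using l(1) by (simp add: a_def strip_def)
 obtain b where b: "0 < Re b" "q b = ps (exp a)" using q_surj[OF exp_strip(3)[OF l(1) a]] by blast
 obtain lam where lam: "lam hol_on S" "!!s. s : S ==> 0 < Re (lam s) & q (lam s) = ps (exp s)" "lam a = b"
  using q_lift[OF S_facts(1,2) psexp_hol exp_strip(3)[OF l(1)] a b] by blast
 have "inj_on mu (ball 0 1)" by (rule inj_on_inverseI[where g = mu']) (simp add: mu'mu)
 then obtain nv where nv: "nv hol_on ball 0 1" "!!u. norm u < 1 ==> mu u = u * exp (nv u)"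
  using simple_zero_log[OF mu_hol _ mu0] by blast
 have "inj_on (%u. ps u - p) (ball 0 1)" using ps_inj by (simp add: inj_on_def)
 moreover have "(%u. ps u - p) hol_on ball 0 1" by (intro hol_intros ps_hol)
 ultimately obtain nv2 where nv2: "nv2 hol_on ball 0 1" "!!u. norm u < 1 ==> ps u - p = u * exp (nv2 u)"
  using simple_zero_log[of "%u. ps u - p"] ps0 by auto
 define d where "d s = lam s - nv (exp (- lam s)) - s - nv2 (exp s)" for s
 have "(nv o (%s. exp (- lam s))) hol_on S"
  by (rule hol_comp[OF _ nv(1)]) (use lam in "auto intro!: hol_intros")
 moreover have "(nv2 o exp) hol_on S"
  by (rule hol_comp[OF _ nv2(1)]) (use exp_strip(1)[OF l(1)] in "auto intro!: hol_intros")
 ultimately have "d hol_on S" unfolding d_def[abs_def] by (intro hol_intros lam(1)) (auto simp: o_def)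
 hence dc: "continuous_on S d" by (rule hol_cont)
 have dper: "EX n. d s = per n" if s: "s : S" for s
 proof -
  have "norm (exp (- lam s)) < 1" using lam(2)[OF s] by simp
  hence "1 / (ps (exp s) - p) = exp (- lam s) * exp (nv (exp (- lam s)))"
   using lam(2)[OF s] nv(2) by (metis add_diff_cancel_left' nonzero_eq_divide_eq divide_divide_eq_right mult_1 q_def)
  hence "1 / (exp (s + nv2 (exp s))) = exp (- lam s) * exp (nv (exp (- lam s)))"
   using nv2(2)[OF exp_strip(1)[OF l(1) s]] by (simp only: exp_add)
  hence "1 / (exp (s + nv2 (exp s))) = exp (- lam s + nv (exp (- lam s)))" by (simp only: exp_add)
  hence "exp (- (s + nv2 (exp s))) = exp (- lam s + nv (exp (- lam s)))" by (simp only: exp_minus inverse_eq_divide)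
  then obtain n where "- (s + nv2 (exp s)) = - lam s + nv (exp (- lam s)) + per n" using exp_eq_per by blast
  hence "d s = per n" by (simp add: d_def algebra_simps)
  thus ?thesis by blast
 qed
 have "lam (s + per k) = lam s + per k" if s: "s : S" for s k
 proof -
  have s': "s + per k : S" using s by (simp add: strip_shift)
  have "d (s + per k) = d s" by (rule periodic_difference_constant[OF S_facts(3) dc dper s' s])
  moreover have "exp (- lam (s + per k)) = exp (- lam s)"
   using q_W(2)[of "lam s"] q_W(2)[of "lam (s + per k)"] lam(2)[OF s] lam(2)[OF s'] by simp
  ultimately show ?thesis by (simp add: d_def algebra_simps)
 qed
 thus ?thesis using lam by blast
qed

definition "lam = (SOME L. L hol_on S & (ALL s:S. 0 < Re (L s) & q (L s) = ps (exp s)) & (ALL s:S. ALL k. L (s + per k) = L s + per k))"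

lemma lam: "lam hol_on S" "s : S ==> 0 < Re (lam s)" "s : S ==> q (lam s) = ps (exp s)"
 "s : S ==> lam (s + per k) = lam s + per k"
 using someI_ex[OF lam_ex] unfolding lam_def by blast+

lemma lam_cont: "continuous_on S lam" by (rule hol_cont[OF lam(1)])

lemma lam_inj: assumes "s : S" "t : S" "lam t = lam s + per k" shows "t = s + per k"
proof -
 have "ps (exp s) = ps (exp t)" using lam(3) assms by (metis q_per)
 then obtain n where n: "t = s + per n" using psexp_eq assms by blast
 hence "n = k" using lam(4)[OF assms(1)] assms(3) by simp
 thus ?thesis using n by simp
qed

lemma lam_surj: assumes "0 < Re w" "q w : F" obtains s where "s : S" "lam s = w"
proof -
 define u where "u = ph (q w)"
 have u: "norm u < 1" "exp (- l) < norm u" using ph_in[OF assms(2)] W(5)[OF assms(2)] q_W(1)[OF assms(1)] by (auto simp: u_def)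
 hence u0: "u ~= 0" by (metis exp_gt_zero norm_zero not_less_iff_gr_or_eq)
 hence s: "Ln u : S" using u ln_less_cancel_iff[of "exp (- l)" "norm u"] by (simp add: strip_def ln_less_zero)
 have "q (lam (Ln u)) = q w" using lam(3)[OF s] u0 psph[OF assms(2)] by (simp add: u_def)
 then obtain k where "w = lam (Ln u) + per k" using q_eq[OF lam(2)[OF s] assms(1)] by blast
 thus thesis using that[of "Ln u + per k"] lam(4)[OF s] s by (simp add: strip_shift)
qed

text \<open>The contraction hypotheses \<open>inner_Re\<close> and \<open>inner_deriv\<close> speak
  of branches on the wide strip. Such a branch is built by lifting over \<open>far l0\<close> and
  taking a logarithm of \<open>ph\<close>, and is then identified with \<open>G\<close> on the
  narrow strip.\<close>

lemma lift1_inner_branch: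
 assumes G: "lift1 G"
 obtains b where "b : inner_branches l0" "!!s. s : S ==> b s : S & lam (b s) = G (lam s)"
proof -
 have l00: "0 < l0" using l by simp
 define s0 where "s0 = complex_of_real (- l / 2)"
 have s0: "s0 : S" "s0 : strip l0" using l by (auto simp: s0_def strip_def)
 have Gs: "0 < Re (G (lam s))" "f (q (G (lam s))) = ps (exp s)" if "s : S" for s
  using G lam(2,3)[OF that] by (auto simp: lift1_def)
 have GF: "q (G (lam s)) : F" if "s : S" for s
  using Gs(2)[OF that] F_invariant exp_strip(2)[OF l(1) that] by metis
 obtain t0 where t0: "t0 : S" "lam t0 = G (lam s0)" using lam_surj[OF Gs(1)[OF s0(1)] GF[OF s0(1)]] by blast
 obtain h where h: "h hol_on strip l0" "h s0 = q (G (lam s0))" "!!s. s : strip l0 ==> f (h s) = ps (exp s)"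
 proof (rule holomorphic_lift[OF f_hol far_facts(2)[OF l00] regular strip_open strip_convex psexp_hol])
  show "(%s. ps (exp s)) ` strip l0 <= far l0" using exp_strip(3)[OF l00] by auto
  show "s0 : strip l0" "f (q (G (lam s0))) = ps (exp s0)" using s0 Gs(2) by auto
 qed blast
 have hF: "h s : F" if "s : strip l0" for s using h(3)[OF that] F_invariant exp_strip(2)[OF l00 that] by metis
 have "(ph o h) hol_on strip l0" by (rule hol_comp[OF h(1) ph_hol]) (use hF in auto)
 moreover have nz: "(ph o h) s ~= 0" if s: "s : strip l0" for s
 proof
  assume "(ph o h) s = 0"
  hence "h s = p" using psph[OF hF[OF s]] ps0 by simp
  hence "exp s = 0" using h(3)[OF s] fp ps0 phps[OF exp_strip(1)[OF l00 s]] php by simp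
  thus False by simp
 qed
 ultimately obtain c where c: "c hol_on strip l0" "!!s. s : strip l0 ==> exp (c s) = (ph o h) s"
  using nonvanishing_log[OF strip_open strip_convex] by blast
 have "exp (c s0) = exp t0" using c(2)[OF s0(2)] h(2) t0 lam(3)[OF t0(1)] phps[OF exp_strip(1)[OF l(1) t0(1)]] by simp
 then obtain n where n: "c s0 = t0 + per n" using exp_eq_per by blast
 define b where "b s = c s + per (- n)" for s
 have eb: "exp (b s) = ph (h s)" if "s : strip l0" for s using c(2)[OF that] by (simp add: b_def)
 have b: "b : inner_branches l0" unfolding inner_branches_def
 proof (intro CollectI conjI ballI)
  show "b hol_on strip l0" unfolding b_def[abs_def] by (intro hol_intros c(1))
  fix s assume s: "s : strip l0"
  have "norm (exp (b s)) < 1" using eb[OF s] ph_in[OF hF[OF s]] by simp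
  thus "Re (b s) < 0" by simp
  show "g (exp (b s)) = exp s"
   using eb[OF s] phf[OF hF[OF s]] h(3)[OF s] phps[OF exp_strip(1)[OF l00 s]] by simp
 qed
 have bS: "b s : S" if s: "s : S" for s
 proof -
  have "s : strip l0" using s l by (auto simp: strip_def)
  hence "Re (b s) < 0" using b by (simp add: inner_branches_def)
  moreover have "abs(Re (b s)) <= kp * abs(Re s)" by (rule inner_Re[OF b s])
  moreover have "kp * abs(Re s) <= 1 * abs(Re s)" using kp by (intro mult_right_mono) auto
  moreover have "- l < Re s" "Re s < 0" using s by (auto simp: strip_def)
  ultimately have "- l < Re (b s)" by linarith
  thus ?thesis using `Re (b s) < 0` by (simp add: strip_def)
 qed
 have SS: "S <= strip l0" using l by (auto simp: strip_def)
 have cb: "continuous_on S b"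
  using b hol_cont cont_sub[OF _ SS] by (auto simp: inner_branches_def)
 have cG: "continuous_on S (%s. G (lam s))"
  by (rule cont_comp[of hp G, OF _ lam_cont]) (use G lam(2) hol_cont in "auto simp: lift1_def")
 have hG: "h s = q (G (lam s))" if s: "s : S" for s
 proof (rule lift_unique[where G = h and H = "%s. q (G (lam s))", OF f_hol regular S_facts(3), of "%s. ps (exp s)"])
  show "(%s. ps (exp s)) ` S <= far l0" using exp_strip(3)[OF l00] SS by auto
  show "continuous_on S h" using h(1) SS hol_cont cont_sub by blast
  show "continuous_on S (%s. q (G (lam s)))" by (rule cont_comp[OF q_cont cG]) (use Gs(1) in auto)
 qed (use h SS Gs(2) s0 s in auto)
 have "lam (b s) = G (lam s)" if s: "s : S" for s
 proof (rule q_lift_unique[OF S_facts(3) _ cG _ _ _ s0(1) _ s])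
  show "continuous_on S (%s. lam (b s))" by (rule cont_comp[OF lam_cont cb]) (use bS in auto)
  show "lam (b s0) = G (lam s0)" using n t0 by (simp add: b_def per_minus)
  fix s assume s: "s : S"
  show "0 < Re (lam (b s))" "0 < Re (G (lam s))" using lam(2) bS Gs(1) s by auto
  have "q (lam (b s)) = h s" using lam(3)[OF bS[OF s]] eb[of s] SS s psph[OF hF] by auto
  thus "q (lam (b s)) = q (G (lam s))" using hG[OF s] by simp
 qed
 thus thesis using that b bS by blast
qed

text \<open>\<open>b\<close> is the lift \<open>G\<close> seen through \<open>lam\<close>. The two
  Euclidean estimates are carried along because they multiply under composition.\<close>

definition "model m G b \<longleftrightarrow> b hol_on S & b ` S <= S & (ALL s:S. lam (b s) = G (lam s)) &
 (ALL s:S. ALL t:S. norm (b s - b t) <= kp ^ m * norm (s - t)) & (ALL s:S. abs(Re (b s)) <= kp ^ m * abs(Re s))" for m G b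

lemma lift1_model: assumes G: "lift1 G" obtains b where "model 1 G b"
proof -
 obtain b where b: "b : inner_branches l0" "!!s. s : S ==> b s : S & lam (b s) = G (lam s)"
  using lift1_inner_branch[OF G] by blast
 have "b hol_on strip l0" using b by (simp add: inner_branches_def)
 moreover have "S <= strip l0" using l by (auto simp: strip_def)
 ultimately have hol: "b hol_on S" using hol_sub by blast
 have "norm (b s - b t) <= kp * norm (s - t)" if "s : S" "t : S" for s t
 proof (rule diff_bound[OF S_facts(2), where f' = "deriv b"])
  fix v assume v: "v : S"
  show "(b has_field_derivative deriv b v) (at v within S)" by (rule holomorphic_derivI[OF hol S_facts(1) v])
  show "norm (deriv b v) <= kp" by (rule inner_deriv[OF b(1) v])
 qed (use that in auto)
 hence "model 1 G b" using hol b(2) inner_Re[OF b(1)] by (auto simp: model_def)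
 thus thesis by (rule that)
qed

lemma model_comp:
 assumes "model m G b" "model n H c" shows "model (m + n) (G o H) (b o c)"
 unfolding model_def
proof (intro conjI ballI)
 show "(b o c) hol_on S"
  by (rule hol_comp[of c S b S]) (use assms in "auto simp: model_def")
 show "(b o c) ` S <= S" using assms by (auto simp: model_def)
 fix s t assume s: "s : S" and t: "t : S"
 have c: "c s : S" "c t : S" using assms s t by (auto simp: model_def)
 show "lam ((b o c) s) = (G o H) (lam s)" using assms s c by (simp add: model_def)
 have "norm ((b o c) s - (b o c) t) <= kp ^ m * norm (c s - c t)" using assms c by (simp add: model_def)
 also have "... <= kp ^ m * (kp ^ n * norm (s - t))" using assms s t kp by (intro mult_left_mono) (auto simp: model_def)
 finally show "norm ((b o c) s - (b o c) t) <= kp ^ (m + n) * norm (s - t)" by (simp add: power_add mult.assoc)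
next
 fix s assume s: "s : S"
 hence c: "c s : S" using assms by (auto simp: model_def)
 hence "abs(Re ((b o c) s)) <= kp ^ m * abs(Re (c s))" using assms by (simp add: model_def)
 also have "... <= kp ^ m * (kp ^ n * abs(Re s))" using assms s kp by (intro mult_left_mono) (auto simp: model_def)
 finally show "abs(Re ((b o c) s)) <= kp ^ (m + n) * abs(Re s)" by (simp add: power_add mult.assoc)
qed

lemma lifts_model: "G : lifts m ==> EX b. model m G b"
proof (induction m arbitrary: G)
 case 0
 thus ?case by (intro exI[of _ id]) (auto simp: model_def holomorphic_on_id)
next
 case (Suc m)
 then obtain H K where "G = K o H" "lift1 K" "H : lifts m" by auto
 thus ?case using Suc.IH lift1_model model_comp[of 1] by (metis plus_1_eq_Suc)
qed

lemma model_inj: assumes "model m G b" "G : lifts m" "s : S" "t : S" "b t = b s + per k"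
 shows "m = 0 | k = 0 & t = s"
proof -
 have "b s : S" "b t : S" using assms by (auto simp: model_def)
 moreover have "lam (b s) = G (lam s)" "lam (b t) = G (lam t)" using assms by (auto simp: model_def)
 ultimately have "G (lam t) = G (lam s) + per k" using assms(5) lam(4)[of "b s" k] by simp
 hence "m = 0 | lam t = lam s & k = 0" using lifts_inj[OF assms(2) lam(2)[OF assms(3)] lam(2)[OF assms(4)]] by blast
 thus ?thesis using lam_inj[OF assms(3,4), of 0] by auto
qed

text \<open>The models extend to the imaginary axis by reflection.\<close>

definition "bdry_model m G B \<longleftrightarrow> model m G B & (kp ^ m)-lipschitz_on (closure S) B & (ALL s. Re s = 0 --> Re (B s) = 0) &
 (ALL s r. Re s = 0 --> 0 < r --> (EX ep>0. ball (B s) ep Int {v. Re v < 0} <= B ` (S Int ball s r)))" for m G B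

lemma bdry_modelD: assumes "bdry_model m G B"
 shows "model m G B" "(kp ^ m)-lipschitz_on (closure S) B" "Re s = 0 ==> Re (B s) = 0"
  "Re s = 0 ==> 0 < r ==> EX ep>0. ball (B s) ep Int {v. Re v < 0} <= B ` (S Int ball s r)"
 using assms unfolding bdry_model_def by blast+

text \<open>Rotated by a quarter turn, \<open>B\<close> is real on the real axis and reflects to a
  holomorphic, hence open, map \<open>T\<close>. The sign of \<open>Im (T u)\<close> tells from
  which half a value comes.\<close>

lemma model_halfball:
 assumes B: "B hol_on S" "B ` S <= S" "inj_on B S" "continuous_on (closure S) B" "!!s. Re s = 0 ==> Re (B s) = 0"
  and s: "Re s = 0" "0 < r"
 shows "EX ep>0. ball (B s) ep Int {v. Re v < 0} <= B ` (S Int ball s r)"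
proof -
 define A where "A u = - \<i> * B (\<i> * u)" for u
 define R where "R = {u. abs(Im u) < l}"
 have R': "R = {u. - l < Im u} Int {u. Im u < l}" by (auto simp: R_def)
 have R: "open R" "connected R" unfolding R'
  by (auto intro!: open_Int convex_connected convex_Int open_halfspace_Im_gt open_halfspace_Im_lt convex_halfspace_Im_gt convex_halfspace_Im_lt)
 define T where "T z = (if 0 <= Im z then A z else cnj (A (cnj z)))" for z
 have T: "T hol_on R" unfolding T_def[abs_def]
 proof (rule Schwarz_reflection[OF R(1)])
  have "(B o (%u. \<i> * u)) hol_on (R Int {z. 0 < Im z})"
   by (rule hol_comp[OF _ B(1)]) (auto intro!: hol_intros simp: R_def strip_def)
  thus "A hol_on (R Int {z. 0 < Im z})" unfolding A_def[abs_def] by (auto intro!: hol_intros simp: o_def)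
  have "continuous_on (R Int {z. 0 <= Im z}) (%u. B (\<i> * u))"
   by (rule cont_comp[OF B(4)]) (auto intro!: cont_intros simp: R_def closure_strip[OF l(1)])
  thus "continuous_on (R Int {z. 0 <= Im z}) A" unfolding A_def[abs_def] by (auto intro!: cont_intros)
  show "A z : \<real>" if "z : R" "z : \<real>" for z
   using B(5)[of "\<i> * z"] that by (auto simp: A_def complex_is_Real_iff)
 qed (auto simp: R_def)
 have TS: "T (- \<i> * v) = - \<i> * B v" if "v : S" for v using that by (simp add: T_def A_def strip_def)
 have "~ T constant_on R"
 proof
  assume "T constant_on R"
  then obtain c where c: "!!u. u : R ==> T u = c" by (auto simp: constant_on_def)
  have "complex_of_real (- l/2) : S" and "complex_of_real (- l/3) : S" using l(1) by (auto simp: strip_def)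
  moreover have "- \<i> * B v = c" if "v : S" for v
   using TS[OF that] c[of "- \<i> * v"] that by (auto simp: R_def strip_def)
  ultimately have "- \<i> * B (complex_of_real (- l/2)) = - \<i> * B (complex_of_real (- l/3))" by metis
  hence "B (complex_of_real (- l/2)) = B (complex_of_real (- l/3))" by simp
  hence "complex_of_real (- l/2) = complex_of_real (- l/3)"
   using inj_onD[OF B(3)] `complex_of_real (- l/2) : S` `complex_of_real (- l/3) : S` by blast
  thus False using l(1) by (simp add: complex_eq_iff)
 qed
 from open_mapping_thm[OF T R _ _ this, of "R Int ball (- \<i> * s) r"]
 have op: "open (T ` (R Int ball (- \<i> * s) r))" using R(1) by blast
 have "T (- \<i> * s) = - \<i> * B s" using s(1) by (simp add: T_def A_def)
 moreover have "- \<i> * s : R Int ball (- \<i> * s) r" using s l(1) by (simp add: R_def)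
 ultimately have "- \<i> * B s : T ` (R Int ball (- \<i> * s) r)" by (metis image_eqI)
 then obtain ep where ep: "ep > 0" "ball (- \<i> * B s) ep <= T ` (R Int ball (- \<i> * s) r)"
  using op open_contains_ball by blast
 have "ball (B s) ep Int {v. Re v < 0} <= B ` (S Int ball s r)"
 proof
  fix v assume v: "v : ball (B s) ep Int {v. Re v < 0}"
  have "dist (- \<i> * B s) (- \<i> * v) = dist (B s) v"
   unfolding dist_norm right_diff_distrib[symmetric] norm_mult by simp
  hence "- \<i> * v : ball (- \<i> * B s) ep" using v by simp
  then obtain u where u: "u : R" "dist (- \<i> * s) u < r" "T u = - \<i> * v" using ep(2) by fastforce
  have "0 < Im (T u)" using u(3) v by simp
  have "0 < Im u"
  proof (rule ccontr)
   assume n: "~ 0 < Im u"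
   show False
   proof (cases "Im u = 0")
    case True
    hence "Im (T u) = 0" using B(5)[of "\<i> * u"] by (simp add: T_def A_def)
    thus False using `0 < Im (T u)` by simp
   next
    case False
    hence "\<i> * cnj u : S" using n u(1) by (simp add: strip_def R_def)
    hence "Re (B (\<i> * cnj u)) < 0" using B(2) by (force simp: strip_def)
    hence "Im (T u) < 0" using n False by (simp add: T_def A_def)
    thus False using `0 < Im (T u)` by simp
   qed
  qed
  hence iu: "\<i> * u : S" using u(1) by (simp add: strip_def R_def)
  have "- \<i> * B (\<i> * u) = - \<i> * v" using TS[OF iu] u(3) by simp
  hence "v = B (\<i> * u)" by simp
  moreover have "dist s (\<i> * u) = dist (- \<i> * s) u"
  proof -
   have "s - \<i> * u = \<i> * (- \<i> * s - u)" by (simp add: algebra_simps)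
   thus ?thesis unfolding dist_norm by (simp only: norm_mult) simp
  qed
  ultimately show "v : B ` (S Int ball s r)" using iu u(2) by (intro image_eqI[of _ _ "\<i> * u"]) auto
 qed
 thus ?thesis using ep(1) by blast
qed

text \<open>The Lipschitz estimate extends the model to the closed strip, and the estimate for real
  parts sends the axis into itself.\<close>

lemma bdry_model_exists: assumes "G : lifts (Suc m)" obtains B where "bdry_model (Suc m) G B"
proof -
 obtain b where b: "model (Suc m) G b" using lifts_model[OF assms] by blast
 have "(kp ^ Suc m)-lipschitz_on S b"
  using b kp by (intro lipschitz_onI) (auto simp: model_def dist_norm)
 then obtain B where B: "(kp ^ Suc m)-lipschitz_on (closure S) B" "!!s. s : S ==> B s = b s"
  using lipschitz_extend_closure by blast
 have m: "model (Suc m) G B"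
 proof -
  have "B hol_on S \<longleftrightarrow> b hol_on S" by (rule holomorphic_cong[OF refl B(2)])
  moreover have "B ` S = b ` S" by (rule image_cong[OF refl B(2)])
  ultimately show ?thesis using b B(2) unfolding model_def by simp
 qed
 have c: "continuous_on (closure S) B" using B(1) by (rule lipschitz_on_continuous_on)
 have ax: "Re (B s) = 0" if "Re s = 0" for s
 proof -
  have "abs(Re (B s)) - kp ^ Suc m * abs(Re s) <= 0"
  proof (rule continuous_le_on_closure[of S "%s. abs(Re (B s)) - kp ^ Suc m * abs(Re s)"])
   show "continuous_on (closure S) (%s. abs(Re (B s)) - kp ^ Suc m * abs(Re s))" by (intro cont_intros c)
   show "s : closure S" using that l(1) by (simp add: closure_strip)
  qed (use m in "simp add: model_def")
  thus ?thesis using that by simp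
 qed
 have "inj_on B S"
 proof (rule inj_onI)
  fix s t assume "s : S" "t : S" "B s = B t"
  thus "s = t" using model_inj[OF m assms, of s t 0] by auto
 qed
 hence "bdry_model (Suc m) G B" unfolding bdry_model_def
  using m B(1) ax model_halfball[OF _ _ _ c ax] by (auto simp: model_def)
 thus thesis by (rule that)
qed

text \<open>Equal boundary values would make the images of disjoint half discs overlap, against
  injectivity inside the strip.\<close>

lemma bdry_model_inj:
 assumes B: "bdry_model (Suc m) G B" and G: "G : lifts (Suc m)" and st: "Re s = 0" "Re t = 0" "B t = B s + per k"
 shows "k = 0 & t = s"
proof -
 define r where "r = (if t = s then 1 else dist s t / 2)"
 have r: "r > 0" by (simp add: r_def)
 obtain e1 where e1: "e1 > 0" "ball (B s) e1 Int {v. Re v < 0} <= B ` (S Int ball s r)" using bdry_modelD(4)[OF B st(1) r] by blast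
 obtain e2 where e2: "e2 > 0" "ball (B t) e2 Int {v. Re v < 0} <= B ` (S Int ball t r)" using bdry_modelD(4)[OF B st(2) r] by blast
 define v where "v = B s - of_real (min e1 e2 / 2)"
 have "Re (B s) = 0" using B st by (auto simp: bdry_model_def)
 hence "Re v < 0" "v : ball (B s) e1" "v + per k : ball (B t) e2"
  using e1(1) e2(1) st(3) by (auto simp: v_def dist_norm)
 hence "v : B ` (S Int ball s r)" "v + per k : B ` (S Int ball t r)" using e1(2) e2(2) by (auto simp: subset_iff)
 then obtain s' t' where v: "s' : S" "dist s s' < r" "v = B s'" "t' : S" "dist t t' < r" "v + per k = B t'"
  by (elim imageE) auto
 hence "k = 0 & t' = s'" using model_inj[OF _ G v(1,4), of B k] B by (auto simp: bdry_model_def)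
 moreover have "t = s"
 proof (rule ccontr)
  assume "t ~= s"
  hence "dist s s' < dist s t / 2" "dist t s' < dist s t / 2" using v(2,5) `k = 0 & t' = s'` by (auto simp: r_def)
  thus False using dist_triangle[of s t s'] by (simp add: dist_commute)
 qed
 ultimately show ?thesis by simp
qed

lemma bdry_model_axis:
 assumes B: "bdry_model (Suc m) G B"
 shows "continuous_on A (%y. Im (B (Complex 0 y)))"
proof -
 have "continuous_on (closure S) B" using B lipschitz_on_continuous_on by (auto simp: bdry_model_def)
 hence "continuous_on A (%y. B (Complex 0 y))"
  by (rule cont_comp) (use l(1) in "auto intro!: cont_intros simp: closure_strip complex_eq_iff Complex_eq")
 thus ?thesis by (intro cont_intros)
qed

text \<open>The image of the axis under a first-level model has length at most
  \<open>2 * pi\<close>, and moving two points of the strip to the axis costs at most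
  \<open>l\<close> each.\<close>

definition "C0 = 2 * pi + 2 * l"

text \<open>If the image of the axis reached the length of a period it would contain two points that
  differ by \<open>per 1\<close>.\<close>

lemma bdry_model_diam1:
 assumes B: "bdry_model (Suc 0) G B" and G: "G : lifts (Suc 0)" and st: "s : closure S" "t : closure S"
 shows "norm (B s - B t) <= C0"
proof -
 define I where "I y = Im (B (Complex 0 y))" for y
 have BI: "B (Complex 0 y) = Complex 0 (I y)" for y using B by (auto simp: I_def bdry_model_def complex_eq_iff)
 have small: "I a - I b < 2 * pi" for a b
 proof (rule ccontr)
  assume "~ I a - I b < 2 * pi"
  hence "I b + 2 * pi <= I a" "I b <= I a" using pi_gt_zero by linarith+
  hence "I b + 2 * pi : closed_segment (I b) (I a)" by (simp add: closed_segment_eq_real_ivl)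
  then obtain y where "I y = I b + 2 * pi"
   using IVT'_closed_segment_real[of "I b + 2 * pi" I b a] bdry_model_axis[OF B] unfolding I_def by blast
  hence "B (Complex 0 y) = B (Complex 0 b) + per 1" unfolding BI by (simp add: complex_eq_iff)
  thus False using bdry_model_inj[OF B G, of "Complex 0 b" "Complex 0 y" 1] by simp
 qed
 have near: "norm (B s - B (Complex 0 (Im s))) <= l" if s: "s : closure S" for s
 proof -
  have c: "Complex 0 (Im s) : closure S" using l(1) by (simp add: closure_strip)
  have "s - Complex 0 (Im s) = of_real (Re s)" by (simp add: complex_eq_iff)
  hence "dist s (Complex 0 (Im s)) <= l" using s l(1) by (simp add: dist_norm closure_strip)
  moreover have "dist (B s) (B (Complex 0 (Im s))) <= kp ^ Suc 0 * dist s (Complex 0 (Im s))"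
   using B s c by (intro lipschitz_onD) (auto simp: bdry_model_def)
  moreover have "kp * dist s (Complex 0 (Im s)) <= 1 * dist s (Complex 0 (Im s))" using kp by (intro mult_right_mono) auto
  ultimately show ?thesis by (simp add: dist_norm)
 qed
 have "norm (B (Complex 0 (Im s)) - B (Complex 0 (Im t))) <= 2 * pi"
  unfolding BI using small[of "Im s" "Im t"] small[of "Im t" "Im s"] by (simp add: cmod_def)
 hence "norm ((B s - B (Complex 0 (Im s))) + (B (Complex 0 (Im s)) - B (Complex 0 (Im t))) + (B (Complex 0 (Im t)) - B t)) <= l + 2 * pi + l"
  using near[OF st(1)] near[OF st(2)] by (intro norm_triangle_le add_mono) (auto simp: norm_minus_commute)
 thus ?thesis by (simp add: C0_def)
qed

lemma model_unique: "model m G b ==> model n G c ==> s : S ==> b s = c s"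
 using lam_inj[of "c s" "b s" 0] by (auto simp: model_def image_subset_iff)

text \<open>Split off the innermost lift: its model has image of diameter at most \<open>C0\<close>,
  and the remaining \<open>m\<close> factors contract.\<close>

lemma bdry_model_diam:
 assumes B: "bdry_model (Suc m) G B" and G: "G : lifts (Suc m)" and st: "s : S" "t : S"
 shows "norm (B s - B t) <= kp ^ m * C0"
proof -
 obtain H K where HK: "H : lifts m" "lift1 K" "G = H o K" using lifts_Suc_right[OF G] by blast
 have K: "K : lifts (Suc 0)" using HK(2) by auto
 obtain c where c: "bdry_model (Suc 0) K c" using bdry_model_exists[OF K] by blast
 obtain b where b: "model m H b" using lifts_model[OF HK(1)] by blast
 have mc: "model (Suc 0) K c" using c by (simp add: bdry_model_def)
 have "model (m + Suc 0) G (b o c)" unfolding HK(3) by (rule model_comp[OF b mc])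
 hence e: "B s = b (c s)" "B t = b (c t)" using model_unique[of "Suc m" G B "m + Suc 0" "b o c"] B st by (auto simp: bdry_model_def)
 have cS: "c s : S" "c t : S" using mc st by (auto simp: model_def)
 have "norm (B s - B t) <= kp ^ m * norm (c s - c t)" unfolding e using b cS by (simp add: model_def)
 also have "... <= kp ^ m * C0"
  using bdry_model_diam1[OF c K, of s t] st kp subsetD[OF closure_subset] by (intro mult_left_mono) auto
 finally show ?thesis .
qed

end

section \<open>Extension of the Riemann map to the Julia set\<close>

text \<open>The value at \<open>z\<close> is chosen together with its distance estimate for every
  neighbourhood of small oscillation, so continuity follows without further sequences.\<close>

lemma dense_extension:
 fixes f :: "'a::metric_space => 'b::complete_space"
 assumes dense: "closure S = UNIV"
  and osc: "!!z e. e > 0 ==> EX U. open U & z : U & (ALL x:S Int U. ALL y:S Int U. dist (f x) (f y) <= e)"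
 obtains g where "continuous_on UNIV g" "!!x. x : S ==> g x = f x"
proof -
 have "EX y. ALL e>0. ALL U. open U --> z : U --> (ALL x:S Int U. ALL y:S Int U. dist (f x) (f y) <= e) --> (ALL x:S Int U. dist (f x) y <= e)" for z
 proof -
  obtain X where X: "!!n. X n : S" "X ----> z" using dense closure_sequential[of z S] by auto
  have "Cauchy (%n. f (X n))"
  proof (rule metric_CauchyI)
   fix e :: real assume "e > 0"
   hence "e / 2 > 0" by simp
   from osc[OF this, of z] obtain U where U: "open U" "z : U" "ALL x:S Int U. ALL y:S Int U. dist (f x) (f y) <= e / 2" by blast
   obtain N where "!!n. n >= N ==> X n : U" using topological_tendstoD[OF X(2) U(1,2)] by (auto simp: eventually_sequentially)
   hence "dist (f (X m)) (f (X n)) <= e / 2" if "m >= N" "n >= N" for m n using U(3) X(1) that by blast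
   moreover have "e / 2 < e" using `e > 0` by simp
   ultimately show "EX N. ALL m>=N. ALL n>=N. dist (f (X m)) (f (X n)) < e" by (meson le_less_trans)
  qed
  then obtain y where y: "(%n. f (X n)) ----> y" using Cauchy_convergent convergent_def by blast
  show ?thesis
  proof (intro exI allI impI ballI)
   fix e :: real and U x assume e: "0 < e" "open U" "z : U" "ALL x:S Int U. ALL y:S Int U. dist (f x) (f y) <= e" "x : S Int U"
   have "eventually (%n. dist (f x) (f (X n)) <= e) sequentially"
    using topological_tendstoD[OF X(2) e(2,3)] by eventually_elim (use e X(1) in blast)
   thus "dist (f x) y <= e" using tendsto_upperbound[OF tendsto_dist[OF tendsto_const y]] by simp
  qed
 qed
 then obtain g where g: "!!z e U x. 0 < e ==> open U ==> z : U ==> (ALL x:S Int U. ALL y:S Int U. dist (f x) (f y) <= e) ==> x : S Int U ==> dist (f x) (g z) <= e"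
  by metis
 have "isCont g z" for z unfolding cont_eps
 proof (intro allI impI)
  fix e :: real assume e: "e > 0"
  hence e3: "e / 3 > 0" by simp
  from osc[OF this, of z] obtain U where U: "open U" "z : U" "ALL x:S Int U. ALL y:S Int U. dist (f x) (f y) <= e / 3" by blast
  obtain x where x: "x : S Int U" using U(1,2) dense open_Int_closure_eq_empty[OF U(1), of S] by auto
  obtain d where d: "d > 0" "!!w. dist w z < d ==> w : U" using U(1,2) unfolding open_dist by blast
  have "dist (g w) (g z) < e" if "dist w z < d" for w
   using g[OF e3 U(1,2,3) x] g[OF e3 U(1) d(2)[OF that] U(3) x] dist_triangle3[of "g w" "g z" "f x"] e by simp
  thus "EX d>0. ALL w. dist w z < d --> dist (g w) (g z) < e" using d(1) by blast
 qed
 hence "continuous_on UNIV g" by (simp add: cont_at)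
 moreover have "g x = f x" if x: "x : S" for x
 proof (rule ccontr)
  assume "g x ~= f x"
  hence e: "dist (f x) (g x) / 2 > 0" by simp
  then obtain U where "open U" "x : U" "ALL u:S Int U. ALL y:S Int U. dist (f u) (f y) <= dist (f x) (g x) / 2" using osc by metis
  hence "dist (f x) (g x) <= dist (f x) (g x) / 2" using g[OF e] x by blast
  thus False using e by simp
 qed
 ultimately show thesis by (rule that)
qed

lemma connected_in_one:
 assumes A: "connected A" and U: "!!U. U : Uc ==> open U" "!!U V. U : Uc ==> V : Uc ==> U Int V ~= {} ==> U = V"
  and cov: "A <= \<Union>Uc" and V: "V : Uc" "A Int V ~= {}"
 shows "A <= V"
proof -
 have "open (\<Union>(Uc - {V}))" using U(1) by blast
 moreover have "V Int \<Union>(Uc - {V}) Int A = {}" using U(2) V(1) by blast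
 moreover have "A <= V Un \<Union>(Uc - {V})" using cov by blast
 ultimately have "V Int A = {} | \<Union>(Uc - {V}) Int A = {}" using connectedD[OF A U(1)[OF V(1)]] by blast
 thus ?thesis using cov V(2) by blast
qed

lemma exp_diff_le: assumes "Re a <= 0" "Re b <= 0" shows "norm (exp a - exp b) <= norm (a - b)"
proof -
 have "norm (exp a - exp b) <= 1 * norm (a - b)"
  by (rule diff_bound[OF convex_halfspace_Re_le, of 0 exp exp])
   (use assms in "auto intro: has_field_derivative_at_within")
 thus ?thesis by simp
qed

context exterior begin

lemma lifts_inj_on: assumes "G : lifts m" shows "inj_on G hp"
proof (rule inj_onI)
 fix a b assume "a : hp" "b : hp" "G a = G b"
 thus "a = b" using lifts_inj[OF assms, of a b 0] assms by (cases m) auto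
qed

lemma lifts_open: assumes "G : lifts m" "open T" "T <= hp" shows "open (G ` T)"
 using invariance_of_domain[OF cont_sub[OF hol_cont[OF lifts_hol[OF assms(1)]] assms(3)] assms(2)
  inj_on_subset[OF lifts_inj_on[OF assms(1)] assms(3)]] .

lemma q_open: assumes "open T" "T <= hp" shows "open (q ` T)"
proof (rule open_mapping_thm[OF q_hol hp_facts(1,3) assms])
 show "~ q constant_on hp"
 proof
  assume "q constant_on hp"
  hence "q 1 = q 2" by (auto simp: constant_on_def)
  hence "exp (- 1) = exp (- 2 :: complex)" using q_W(2)[of 1] q_W(2)[of 2] by simp
  then obtain n where "(-1::complex) = -2 + per n" using exp_eq_per by blast
  thus False by (simp add: complex_eq_iff)
 qed
qed

lemma tract_eq: assumes "G : lifts m" "H : lifts m" "0 < Re a" "0 < Re b" "q (G a) = q (H b)"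
 shows "q ` G ` hp = q ` H ` hp" and "G a = H b ==> G ` hp = H ` hp"
proof -
 obtain j k where j: "b = a + per j" "!!w. 0 < Re w ==> H (w + per j) = G w + per k"
  using lifts_unique[OF assms] by blast
 have H: "H ` hp = (%w. G w + per k) ` hp"
 proof -
  have "H w = G (w - per j) + per k" if "0 < Re w" for w using j(2)[of "w - per j"] that by simp
  hence "H w : (%w. G w + per k) ` hp" if "0 < Re w" for w
   using that by (intro image_eqI[of _ _ "w - per j"]) auto
  moreover have "G w + per k : H ` hp" if "0 < Re w" for w
   using j(2)[OF that] that by (intro image_eqI[of _ _ "w + per j"]) auto
  ultimately show ?thesis by auto
 qed
 show "q ` G ` hp = q ` H ` hp" unfolding H image_image by simp
 assume "G a = H b"
 hence "k = 0" using j assms(3) by simp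
 thus "G ` hp = H ` hp" using H by simp
qed

text \<open>Beyond \<open>de\<close> a vertical move by at most one period has hyperbolic length at
  most \<open>D\<close>, and \<open>m\<close> lifts contract it by \<open>La ^ m\<close>.\<close>

lemma lift_near:
 assumes w: "0 < Re w" and e: "e > 0"
 obtains m0 where "!!m G zt et. m >= m0 ==> G : lifts m ==> de < Re zt ==> G zt = w ==> Re et = Re zt ==>
  abs(Im et - Im zt) <= 2 * pi ==> norm (G et - w) < e"
proof -
 define D where "D = 2 * ln (1 + 2 * pi / de) + 1"
 have D: "D > 0" using de(1) by (auto simp: D_def intro!: add_nonneg_pos)
 have "(%m. Re w * ((La ^ m * D) * exp (La ^ m * D))) ----> Re w * ((0 * D) * exp (0 * D))"
  using La by (intro tendsto_intros LIMSEQ_power_zero) auto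
 hence "eventually (%m. Re w * ((La ^ m * D) * exp (La ^ m * D)) < e) sequentially"
  using e by (intro order_tendstoD(2)) auto
 then obtain m0 where m0: "!!m. m >= m0 ==> Re w * ((La ^ m * D) * exp (La ^ m * D)) < e" by (auto simp: eventually_sequentially)
 show thesis
 proof (rule that[of m0])
  fix m G zt et assume m: "m0 <= m" and G: "G : lifts m" "de < Re zt" "G zt = w" "Re et = Re zt" "abs(Im et - Im zt) <= 2 * pi"
  define M where "M = Re zt + 2 * pi"
  have z0: "0 < Re zt" using G(2) de(1) by simp
  define t where "t = La ^ m * (ln (M / Re zt) + ln (M / Re et) + 1)"
  have "M / Re zt = 1 + 2 * pi / Re zt" using z0 by (simp add: M_def field_simps)
  moreover have "2 * pi / Re zt <= 2 * pi / de" using G(2) de(1) by (simp add: frac_le)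
  ultimately have "ln (M / Re zt) <= ln (1 + 2 * pi / de)" "0 <= ln (M / Re zt)" using z0 de(1) by (auto intro!: ln_mono add_pos_pos)
  hence t: "t <= La ^ m * D" "0 <= t" using La G(4) by (auto simp: t_def D_def intro!: mult_left_mono)
  have "norm (G zt - G et) <= Re (G zt) * (t * exp t)"
   unfolding t_def by (rule lifts_increment[OF G(1) z0]) (use G z0 in "auto simp: M_def abs_minus_commute")
  also have "... <= Re w * ((La ^ m * D) * exp (La ^ m * D))"
   using t w G(3) La D by (intro mult_mono) auto
  finally show "norm (G et - w) < e" using m0[OF m] G(3) by (simp add: norm_minus_commute)
 qed
qed

text \<open>A vertical segment of length \<open>2 * pi\<close> over \<open>J\<close> would lie in
  the image of a single lift, which contains no two points differing by a period.\<close>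

lemma vertical_escape:
 assumes zt: "0 < Re zt"
 obtains et where "Re et = Re zt" "abs(Im et - Im zt) <= 2 * pi" "q et : F"
proof (rule ccontr)
 note escape = that
 assume c: "~ thesis"
 define A where "A = (%t. zt + of_real t * \<i>) ` {0..2 * pi}"
 have A: "connected A" unfolding A_def by (intro conn_im cont_intros) auto
 have A1: "f (q et) : W" "0 < Re et" if "et : A" for et
 proof -
  have "~ q et : F" using c escape[of et] `et : A` by (auto simp: A_def)
  thus "f (q et) : W" using W(4) F_invariant J_eq by blast
  show "0 < Re et" using `et : A` zt by (auto simp: A_def)
 qed
 define Uc where "Uc = (%G. G ` hp) ` lifts 1"
 have "A <= \<Union>Uc"
 proof
  fix et assume et: "et : A"
  have "(f ^^ 1) (q et) : W" using A1(1)[OF et] by simp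
  then obtain G a where "G : lifts 1" "0 < Re a" "G a = et" using lifts_through[OF A1(2)[OF et]] by blast
  thus "et : \<Union>Uc" unfolding Uc_def by blast
 qed
 moreover have "zt : A" by (auto simp: A_def intro!: image_eqI[of _ _ 0])
 ultimately obtain G where G: "G : lifts 1" "zt : G ` hp" unfolding Uc_def by blast
 have "A <= G ` hp"
 proof (rule connected_in_one[OF A])
  show "open U" if "U : Uc" for U using that lifts_open[OF _ hp_facts(1) order_refl] unfolding Uc_def by blast
  show "U = V" if "U : Uc" "V : Uc" "U Int V ~= {}" for U V
  proof -
   obtain G H where GH: "G : lifts 1" "H : lifts 1" "U = G ` hp" "V = H ` hp" using `U : Uc` `V : Uc` by (auto simp only: Uc_def)
   obtain x where "x : G ` hp" "x : H ` hp" using `U Int V ~= {}` GH(3,4) by blast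
   then obtain a b where "0 < Re a" "0 < Re b" "G a = H b" by (elim imageE) auto
   thus ?thesis using tract_eq(2)[OF GH(1,2)] GH(3,4) by simp
  qed
  show "G ` hp : Uc" "A Int G ` hp ~= {}" using G `zt : A` by (auto simp only: Uc_def)
 qed fact
 moreover have "zt + per 1 : A" by (auto simp: A_def per_def intro!: image_eqI[of _ _ "2 * pi"])
 ultimately have "zt + per 1 : G ` hp" by blast
 then obtain a b where "0 < Re a" "0 < Re b" "G a = zt" "G b = zt + per 1" using G(2) by (elim imageE) auto
 thus False using lifts_inj[OF G(1), where a = a and b = b and n = 1] by simp
qed

lemma J_lift_Re: assumes "0 < Re zt" "q zt : J" shows "de < Re zt"
 using de(2)[OF assms(1)] J_iff[of "q zt", THEN iffD1, rule_format, OF assms(2), of 1] by simp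

lemma J_f: "z : J ==> (f ^^ m) z : J" using Fn_invariant J_eq by simp

lemma J_lift: assumes "z : J" obtains w where "0 < Re w" "q w = z"
 using q_surj W(4) assms by blast

lemma J_lifts: assumes "0 < Re w" "q w : J"
 obtains G zt where "G : lifts m" "de < Re zt" "0 < Re zt" "G zt = w" "q zt = (f ^^ m) (q w)" "q zt : J"
proof -
 have "(f ^^ m) (q w) : W" using assms(2) J_iff by blast
 then obtain G a where G: "G : lifts m" "0 < Re a" "G a = w" "q a = (f ^^ m) (q w)" using lifts_through[OF assms(1)] by blast
 thus thesis using that[OF G(1) J_lift_Re[OF G(2)]] J_f[OF assms(2)] by simp
qed

lemma lifts_J: assumes "G : lifts m" "0 < Re zt" shows "q (G zt) : F \<longleftrightarrow> q zt : F"
 using lifts_f[OF assms] Fn_invariant by metis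

text \<open>Follow a point of \<open>J\<close> for many steps in the covering, move vertically into
  \<open>F\<close> and pull back; the displacement has become small.\<close>

lemma F_dense: "closure F = UNIV"
proof -
 have "z : closure F" if z: "z : J" for z unfolding closure_approachable
 proof (intro allI impI)
  fix e :: real assume e: "e > 0"
  obtain w where w: "0 < Re w" "q w = z" using J_lift[OF z] by blast
  have "isCont q w" using q_cont w(1) hp_facts(1) by (simp add: cont_at)
  then obtain d where d: "d > 0" "!!v. dist v w < d ==> dist (q v) (q w) < e" unfolding cont_eps using e by blast
  obtain m0 where m0: "!!m G zt et. m >= m0 ==> G : lifts m ==> de < Re zt ==> G zt = w ==> Re et = Re zt ==>
   abs(Im et - Im zt) <= 2 * pi ==> norm (G et - w) < d" using lift_near[OF w(1) d(1)] by blast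
  obtain G zt where G: "G : lifts m0" "de < Re zt" "0 < Re zt" "G zt = w" using J_lifts[of w m0] w z by metis
  obtain et where et: "Re et = Re zt" "abs(Im et - Im zt) <= 2 * pi" "q et : F" using vertical_escape[OF G(3)] by blast
  have "dist (q (G et)) z < e" using d(2)[of "G et"] m0[OF order_refl G(1,2,4) et(1,2)] w(2) by (simp add: dist_norm)
  moreover have "q (G et) : F" using lifts_J[OF G(1), of et] et G(3) by simp
  ultimately show "EX y:F. dist y z < e" by blast
 qed
 moreover have "z : closure F" if "z : F" for z using that by (rule subsetD[OF closure_subset])
 ultimately show ?thesis using J_eq by blast
qed

lemma tract_F:
 assumes B: "model m G B" and G: "G : lifts m" and x: "x : q ` G ` hp" "x : F"
 obtains s where "s : S" "ph x = exp (B s)" "q (G (lam s)) = x"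
proof -
 obtain et where et: "0 < Re et" "x = q (G et)" using x(1) by auto
 hence "q et : F" using lifts_J[OF G] x(2) by simp
 then obtain s where s: "s : S" "lam s = et" using lam_surj[OF et(1)] by blast
 have Bs: "B s : S" "lam (B s) = G (lam s)" using B s(1) by (auto simp: model_def)
 have "x = ps (exp (B s))" using lam(3)[OF Bs(1)] Bs(2) et(2) s(2) by simp
 thus thesis using that[OF s(1)] phps[OF exp_strip(1)[OF l(1) Bs(1)]] et s(2) by simp
qed

lemma C0_pos: "C0 > 0" using l(1) pi_gt_zero by (simp add: C0_def add_pos_pos)

lemma kp_small: assumes "e > 0" obtains m where "kp ^ m * C0 < e"
proof -
 obtain m where "kp ^ m < e / C0" using real_arch_pow_inv[of "e / C0" kp] kp C0_pos assms by auto
 thus thesis using that[of m] C0_pos by (simp add: pos_less_divide_eq)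
qed

text \<open>The Fatou part of the tract corresponds to the image of the strip under the model, whose
  diameter is at most \<open>kp ^ m * C0\<close>; \<open>exp\<close> does not increase distances in
  the left half-plane.\<close>

lemma J_tract: assumes z: "z : J"
 obtains G B where "G : lifts (Suc m)" "bdry_model (Suc m) G B" "z : q ` G ` hp" "open (q ` G ` hp)"
  "!!x y. x : F Int q ` G ` hp ==> y : F Int q ` G ` hp ==> dist (ph x) (ph y) <= kp ^ m * C0"
  "!!x. x : F Int q ` G ` hp ==> exp (- (kp ^ m * C0)) <= norm (ph x)"
proof -
 obtain w where w: "0 < Re w" "q w = z" using J_lift[OF z] by blast
 obtain G zt where G: "G : lifts (Suc m)" "0 < Re zt" "G zt = w" using J_lifts[of w "Suc m"] w z by metis
 obtain B where B: "bdry_model (Suc m) G B" using bdry_model_exists[OF G(1)] by blast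
 note mB = bdry_modelD(1)[OF B]
 have Gp: "G ` hp <= hp" using lifts_Re[OF G(1)] by auto
 have BS: "B s : S" if "s : S" for s using mB that by (auto simp: model_def)
 show thesis
 proof (rule that[OF G(1) B])
  show "z : q ` G ` hp" using G w by blast
  show "open (q ` G ` hp)" by (rule q_open[OF lifts_open[OF G(1) hp_facts(1) order_refl] Gp])
  show "dist (ph x) (ph y) <= kp ^ m * C0" if xy: "x : F Int q ` G ` hp" "y : F Int q ` G ` hp" for x y
  proof -
   obtain s where s: "s : S" "ph x = exp (B s)" using tract_F[OF mB G(1), of x] xy(1) by blast
   obtain t where t: "t : S" "ph y = exp (B t)" using tract_F[OF mB G(1), of y] xy(2) by blast
   have "Re (B s) <= 0" "Re (B t) <= 0" using BS[OF s(1)] BS[OF t(1)] by (auto simp: strip_def)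
   thus ?thesis using exp_diff_le[of "B s" "B t"] bdry_model_diam[OF B G(1) s(1) t(1)] s t by (simp add: dist_norm)
  qed
  show "exp (- (kp ^ m * C0)) <= norm (ph x)" if x: "x : F Int q ` G ` hp" for x
  proof -
   obtain s where s: "s : S" "ph x = exp (B s)" using tract_F[OF mB G(1), of x] x by blast
   have "abs(Re (B s)) <= kp ^ Suc m * abs(Re s)" using mB s(1) unfolding model_def by blast
   also have "... <= kp ^ m * C0"
   proof (rule mult_mono)
    have "kp * kp ^ m <= 1 * kp ^ m" using kp by (intro mult_right_mono) auto
    thus "kp ^ Suc m <= kp ^ m" by simp
    have "- l < Re s" "Re s < 0" using s(1) by (auto simp: strip_def)
    thus "abs(Re s) <= C0" unfolding C0_def using l(1) pi_gt_zero by linarith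
   qed (use kp in auto)
   finally show ?thesis using s(2) by simp
  qed
 qed
qed

lemma phih_ex: "EX h. continuous_on UNIV h & (ALL x:F. h x = ph x)"
proof -
 have "EX U. open U & z : U & (ALL x:F Int U. ALL y:F Int U. dist (ph x) (ph y) <= e)" if e: "e > 0" for z e
 proof (cases "z : F")
  case True
  hence "isCont ph z" using ph_cont F_open by (simp add: cont_at)
  then obtain d where d: "d > 0" "!!w. dist w z < d ==> dist (ph w) (ph z) < e / 2"
   unfolding cont_eps using e half_gt_zero by blast
  have "dist (ph x) (ph y) <= e" if "x : ball z d" "y : ball z d" for x y
   using d(2)[of x] d(2)[of y] that dist_triangle_half_l[of "ph x" "ph z" e "ph y"] by (simp add: dist_commute)
  thus ?thesis using d(1) by (intro exI[of _ "ball z d"]) auto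
 next
  case False
  hence z: "z : J" by (simp add: J_eq)
  obtain m where m: "kp ^ m * C0 < e" using kp_small[OF e] by blast
  obtain G B where G: "z : q ` G ` hp" "open (q ` G ` hp)"
   "!!x y. x : F Int q ` G ` hp ==> y : F Int q ` G ` hp ==> dist (ph x) (ph y) <= kp ^ m * C0"
   using J_tract[OF z, of m] by metis
  have "ALL x:F Int q ` G ` hp. ALL y:F Int q ` G ` hp. dist (ph x) (ph y) <= e"
   using G(3) m by (meson less_imp_le order_trans)
  thus ?thesis using G(1,2) by blast
 qed
 thus ?thesis using dense_extension[OF F_dense, of ph] by metis
qed

definition "phih = (SOME h. continuous_on UNIV h & (ALL x:F. h x = ph x))"

lemma phih: "continuous_on A phih" "x : F ==> phih x = ph x"
 using someI_ex[OF phih_ex] cont_sub unfolding phih_def by blast+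

lemma phih_cont: "isCont phih z" using phih(1)[of UNIV] by (simp add: cont_at)

lemma phih_J: assumes z: "z : J" shows "norm (phih z) = 1"
proof (rule antisym)
 have c: "continuous_on (closure A) (%x. norm (phih x))" for A by (intro cont_intros phih(1))
 show "norm (phih z) <= 1"
  by (rule continuous_le_on_closure[OF c, of _ F]) (use F_dense phih(2) ph_in in "auto intro: less_imp_le")
 show "1 <= norm (phih z)"
 proof (rule ccontr)
  assume "~ 1 <= norm (phih z)"
  hence "norm (phih z) < exp (- 0)" by simp
  moreover have "((%x::real. exp (- x)) ---> exp (- 0)) (at_right 0)" by (intro tendsto_intros)
  ultimately have "eventually (%x::real. norm (phih z) < exp (- x)) (at_right 0)" using order_tendstoD(1) by blast
  then obtain e where e: "e > 0" "!!x. 0 < x ==> x < e ==> norm (phih z) < exp (- x)"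
   unfolding eventually_at_right_field by blast
  obtain m where m: "kp ^ m * C0 < e" using kp_small[OF e(1)] by blast
  obtain G B where G: "z : q ` G ` hp" "open (q ` G ` hp)"
   "!!x. x : F Int q ` G ` hp ==> exp (- (kp ^ m * C0)) <= norm (ph x)"
   using J_tract[OF z, of m] by metis
  have "z : closure (F Int q ` G ` hp)"
   using G(1,2) F_dense open_Int_closure_subset[OF G(2), of F] by (auto simp: Int_commute)
  hence "exp (- (kp ^ m * C0)) <= norm (phih z)"
   by (rule continuous_ge_on_closure[OF c]) (use G(3) phih(2) in auto)
  thus False using e(2)[of "kp ^ m * C0"] m kp C0_pos by simp
 qed
qed

lemma phih_norm: "norm (phih z) < 1 \<longleftrightarrow> z : F"
 using phih_J[of z] phih(2)[of z] ph_in[of z] by (cases "z : F") (auto simp: J_eq)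

text \<open>\<open>zt\<close> is approached by points \<open>lam (s n)\<close>, where the
  \<open>s n\<close> stay bounded because they lie in the image of a first-level model;
  \<open>sig\<close> is a limit of them. One \<open>sig\<close> serves all \<open>k\<close>, since
  \<open>lam\<close> commutes with periods.\<close>

lemma axis_value:
 assumes G: "G : lifts (Suc m)" and B: "bdry_model (Suc m) G B" and zt: "0 < Re zt" "q zt : J"
 obtains sig where "Re sig = 0" "!!k. phih (q (G (zt + per k))) = exp (B (sig + per k))"
proof -
 obtain K a where K: "K : lifts (Suc 0)" "0 < Re a" "K a = zt" using J_lifts[OF zt, of "Suc 0"] by metis
 obtain b where b: "bdry_model (Suc 0) K b" using bdry_model_exists[OF K(1)] by blast
 note mb = bdry_modelD(1)[OF b] and mB = bdry_modelD(1)[OF B]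
 have "EX s:S. dist (lam s) zt < inverse (real (Suc n)) & s : b ` S" for n
 proof -
  define T where "T = ball zt (inverse (real (Suc n))) Int K ` hp"
  have T: "open T" "T <= hp" "zt : T"
   using lifts_open[OF K(1) hp_facts(1) order_refl] lifts_Re[OF K(1)] K(2,3) by (auto simp: T_def)
  hence "q zt : q ` T" "open (q ` T)" using q_open by auto
  hence "q ` T Int F ~= {}" using F_dense open_Int_closure_eq_empty[of "q ` T" F] by auto
  then obtain et where et: "et : T" "q et : F" by blast
  then obtain c where c: "0 < Re c" "et = K c" by (auto simp: T_def)
  hence "q c : F" using lifts_J[OF K(1), of c] et(2) by simp
  then obtain t where t: "t : S" "lam t = c" using lam_surj[OF c(1)] by blast
  have "b t : S" "lam (b t) = et" using mb t c by (auto simp: model_def)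
  thus ?thesis using et(1) t(1) by (intro bexI[of _ "b t"]) (auto simp: T_def dist_commute)
 qed
 then obtain s where s: "!!n. s n : S" "!!n. dist (lam (s n)) zt < inverse (real (Suc n))" "!!n. s n : b ` S" by metis
 have ls: "(%n. lam (s n)) ----> zt" by (rule LIMSEQ_dist_inverse[OF s(2)])
 have "bounded (range s)"
 proof (rule boundedI[of _ "norm (s 0) + C0"])
  fix x assume "x : range s"
  hence "x : b ` S" using s(3) by auto
  then obtain t u where "t : S" "u : S" "x = b t" "s 0 = b u" using s(3)[of 0] by auto
  hence "norm (x - s 0) <= C0" using bdry_model_diam[OF b K(1), of t u] by simp
  thus "norm x <= norm (s 0) + C0" using norm_triangle_ineq2[of x "s 0"] by simp
 qed
 then obtain sig r where r: "strict_mono r" "(s o r) ----> sig" using bounded_imp_convergent_subsequence by blast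
 have lr: "(%n. lam (s (r n))) ----> zt" using LIMSEQ_subseq_LIMSEQ[OF ls r(1)] by (simp add: o_def)
 have sr: "(%n. s (r n)) ----> sig" using r(2) by (simp add: o_def)
 have qc: "isCont q v" if "0 < Re v" for v using q_cont hp_facts(1) that by (simp add: cont_at)
 have e: "phih (q (lam t)) = exp t" if "t : S" for t
  using lam(3)[OF that] phih(2)[OF exp_strip(2)[OF l(1) that]] phps[OF exp_strip(1)[OF l(1) that]] by simp
 have "(%n. phih (q (lam (s (r n))))) ----> phih (q zt)"
  by (rule isCont_comp[OF phih_cont isCont_comp[OF qc[OF zt(1)] lr]])
 hence "(%n. exp (s (r n))) ----> phih (q zt)" using e s(1) by simp
 moreover have "(%n. exp (s (r n))) ----> exp sig" by (intro tendsto_intros sr)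
 ultimately have "exp sig = phih (q zt)" using LIMSEQ_unique by blast
 hence "norm (exp sig) = 1" using phih_J[OF zt(2)] by simp
 hence Rsig: "Re sig = 0" by simp
 have "phih (q (G (zt + per k))) = exp (B (sig + per k))" for k
 proof -
  have pk: "s n + per k : S" for n using s(1) strip_shift by blast
  have Gk: "G (lam (s n) + per k) = lam (B (s n + per k))" for n
   using mB pk[of n] lam(4)[OF s(1)] by (simp add: model_def)
  have BS: "B (s n + per k) : S" for n using mB pk by (auto simp: model_def)
  have "isCont G (zt + per k)"
   using hol_cont[OF lifts_hol[OF G]] hp_facts(1) zt(1) by (simp add: cont_at)
  hence "(%n. G (lam (s (r n)) + per k)) ----> G (zt + per k)"
   by (rule isCont_comp) (intro tendsto_intros lr)
  hence "(%n. phih (q (G (lam (s (r n)) + per k)))) ----> phih (q (G (zt + per k)))"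
   using qc[OF lifts_Re[OF G, of "zt + per k"]] zt(1) by (intro isCont_comp[OF phih_cont] isCont_comp[of _ q]) auto
  hence 1: "(%n. exp (B (s (r n) + per k))) ----> phih (q (G (zt + per k)))" unfolding Gk e[OF BS] .
  have "continuous_on (closure S) B" using bdry_modelD(2)[OF B] lipschitz_on_continuous_on by blast
  moreover have "(%n. s (r n) + per k) ----> sig + per k" by (intro tendsto_intros sr)
  moreover have "sig + per k : closure S" using Rsig l(1) by (simp add: closure_strip)
  moreover have "eventually (%n. s (r n) + per k : closure S) sequentially"
   by (rule always_eventually, rule allI, rule subsetD[OF closure_subset pk])
  ultimately have "(%n. B (s (r n) + per k)) ----> B (sig + per k)"
   by (rule continuous_on_tendsto_compose)
  hence "(%n. exp (B (s (r n) + per k))) ----> exp (B (sig + per k))" by (intro tendsto_intros)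
  thus ?thesis using 1 LIMSEQ_unique by blast
 qed
 thus thesis using that Rsig by blast
qed

section \<open>Fibres of the extended Riemann map\<close>

lemma halfballs_meet:
 assumes B: "bdry_model m G B" and C: "bdry_model n H C" and st: "Re s = 0" "Re t = 0" "C t = B s + per k"
 obtains s' t' where "s' : S" "t' : S" "C t' = B s' + per k"
proof -
 obtain e1 where e1: "e1 > 0" "ball (B s) e1 Int {v. Re v < 0} <= B ` (S Int ball s 1)" using bdry_modelD(4)[OF B st(1), of 1] by auto
 obtain e2 where e2: "e2 > 0" "ball (C t) e2 Int {v. Re v < 0} <= C ` (S Int ball t 1)" using bdry_modelD(4)[OF C st(2), of 1] by auto
 define v where "v = B s - of_real (min e1 e2 / 2)"
 have "Re (B s) = 0" using bdry_modelD(3)[OF B] st by blast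
 hence "Re v < 0" "v : ball (B s) e1" "v + per k : ball (C t) e2"
  using e1(1) e2(1) st(3) by (auto simp: v_def dist_norm)
 hence "v : B ` (S Int ball s 1)" "v + per k : C ` (S Int ball t 1)" using e1(2) e2(2) by (auto simp: subset_iff)
 then obtain s' t' where "s' : S" "v = B s'" "t' : S" "v + per k = C t'" by (elim imageE) auto
 thus thesis using that by metis
qed

text \<open>Equal boundary values make half discs in the images of the two models overlap, so the
  tracts of \<open>z\<close> and \<open>w\<close> coincide at every level: points of a fibre have
  the same itinerary.\<close>

lemma fibre_tract:
 assumes z: "z : J" and w: "w : J" and eq: "phih z = phih w" and G: "G : lifts (Suc m)" and zt: "0 < Re zt" "q (G zt) = z"
 obtains zt' where "0 < Re zt'" "q (G zt') = w"
proof -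
 obtain v where v: "0 < Re v" "q v = w" using J_lift[OF w] by blast
 obtain H et where H: "H : lifts (Suc m)" "0 < Re et" "H et = v" "q et : J" using J_lifts[OF v(1), of "Suc m"] v w by metis
 obtain B where B: "bdry_model (Suc m) G B" using bdry_model_exists[OF G] by blast
 obtain C where C: "bdry_model (Suc m) H C" using bdry_model_exists[OF H(1)] by blast
 have "q zt : J" using lifts_J[OF G zt(1)] zt(2) z J_eq by simp
 then obtain sig where sig: "Re sig = 0" "phih (q (G (zt + per 0))) = exp (B (sig + per 0))" using axis_value[OF G B zt(1)] by metis
 obtain ta where ta: "Re ta = 0" "phih (q (H (et + per 0))) = exp (C (ta + per 0))" using axis_value[OF H(1) C H(2,4)] by metis
 have "exp (C ta) = exp (B sig)" using sig ta zt H(3) v(2) eq by simp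
 then obtain k where "C ta = B sig + per k" using exp_eq_per by blast
 then obtain s t where st: "s : S" "t : S" "C t = B s + per k" using halfballs_meet[OF B C sig(1) ta(1)] by blast
 have "lam (B s) = G (lam s)" "lam (C t) = H (lam t)" "B s : S"
  using bdry_modelD(1)[OF B] bdry_modelD(1)[OF C] st by (auto simp: model_def)
 hence "H (lam t) = G (lam s) + per k" using st(3) lam(4) by metis
 hence "q (G (lam s)) = q (H (lam t))" by simp
 hence "q ` G ` hp = q ` H ` hp" using tract_eq(1)[OF G H(1) lam(2)[OF st(1)] lam(2)[OF st(2)]] by blast
 moreover have "w : q ` H ` hp" using H v by blast
 ultimately show thesis using that by (metis (mono_tags, lifting) imageE mem_Collect_eq)
qed

lemma lifts_shift: "G : lifts (Suc m) ==> (%w. G w + per k) : lifts (Suc m)"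
proof -
 assume "G : lifts (Suc m)"
 then obtain K H where KH: "G = K o H" "lift1 K" "H : lifts m" by auto
 have "lift1 (%w. K w + per k)" using KH(2) by (auto simp: lift1_def intro!: hol_intros)
 moreover have "(%w. G w + per k) = (%w. K w + per k) o H" by (auto simp: KH(1))
 ultimately show ?thesis using KH(3) by auto
qed

text \<open>An arc inside the image of the Julia set would lie, at every level, in the part of the axis
  belonging to a single tract, and these parts shrink.\<close>

lemma circle_gap:
 assumes e: "e > 0"
 obtains t' where "abs(t' - t) < e" "exp (\<i> * of_real t') ~: phih ` J"
proof (rule ccontr)
 note gap = that
 assume nt: "~ thesis"
 have all: "exp (\<i> * of_real t') : phih ` J" if "abs(t' - t) < e" for t' using gap[OF that] nt by blast
 define A where "A = {t - e <..< t + e}"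
 obtain m where m: "kp ^ m * C0 < e / 4" using kp_small[of "e/4"] e by auto
 \<comment> \<open>The part of the axis that belongs to the tract of \<open>G\<close>, recognised
   from the half discs next to it. It depends only on the image of \<open>G\<close>, so overlapping
   parts are equal.\<close>
 define V where "V G = {y. EX d>0. ALL v. Re v < 0 --> dist (Complex 0 y) v < d --> v : S & lam v : G ` hp}" for G
 have Vop: "open (V G)" for G unfolding open_dist
 proof
  fix y assume "y : V G"
  then obtain d where d: "d > 0" "!!v. Re v < 0 ==> dist (Complex 0 y) v < d ==> v : S & lam v : G ` hp" unfolding V_def by blast
  have "y' : V G" if y': "dist y' y < d / 2" for y'
  proof -
   have "dist (Complex 0 y) (Complex 0 y') = dist y' y" by (simp add: dist_norm cmod_def abs_minus_commute)
   hence "dist (Complex 0 y) v < d" if "dist (Complex 0 y') v < d / 2" for v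
    using that y' dist_triangle[of "Complex 0 y" v "Complex 0 y'"] by simp
   thus ?thesis unfolding V_def using d by (intro CollectI exI[of _ "d / 2"]) auto
  qed
  thus "EX e>0. ALL y'. dist y' y < e --> y' : V G" using d(1) half_gt_zero by blast
 qed
 have Veq: "V G = V H" if GH: "G : lifts (Suc m)" "H : lifts (Suc m)" "V G Int V H ~= {}" for G H
 proof -
  obtain y d d' where y: "d > 0" "!!v. Re v < 0 ==> dist (Complex 0 y) v < d ==> lam v : G ` hp"
   "d' > 0" "!!v. Re v < 0 ==> dist (Complex 0 y) v < d' ==> lam v : H ` hp" using GH(3) unfolding V_def by blast
  define v where "v = Complex (- min d d' / 2) y"
  have "dist (Complex 0 y) v = min d d' / 2" using y(1,3) by (simp add: v_def dist_norm cmod_def)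
  hence "lam v : G ` hp" "lam v : H ` hp" using y(2)[of v] y(4)[of v] y(1,3) by (auto simp: v_def)
  hence "G ` hp = H ` hp" using tract_eq(2)[OF GH(1,2)] by force
  thus ?thesis by (simp add: V_def)
 qed
 have cov: "A <= \<Union>(V ` lifts (Suc m))"
 proof
  fix y assume "y : A"
  hence "abs(y - t) < e" by (auto simp: A_def)
  then obtain z where z: "z : J" "phih z = exp (\<i> * of_real y)" using all by force
  obtain w where w: "0 < Re w" "q w = z" using J_lift[OF z(1)] by blast
  obtain G zt where G: "G : lifts (Suc m)" "0 < Re zt" "G zt = w" "q zt : J" using J_lifts[of w "Suc m"] w z(1) by metis
  obtain B where B: "bdry_model (Suc m) G B" using bdry_model_exists[OF G(1)] by blast
  obtain sig where sig: "Re sig = 0" "phih (q (G (zt + per 0))) = exp (B (sig + per 0))" using axis_value[OF G(1) B G(2,4)] by metis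
  have "exp (\<i> * of_real y) = exp (B sig)" using sig(2) G(3) w(2) z(2) by simp
  then obtain k where k: "\<i> * of_real y = B sig + per k" using exp_eq_per by blast
  have c: "Complex 0 y = B sig + per k" using k by (simp add: Complex_eq)
  obtain d where d: "d > 0" "ball (B sig) d Int {v. Re v < 0} <= B ` (S Int ball sig 1)" using bdry_modelD(4)[OF B sig(1), of 1] by auto
  have "v : S & lam v : (%w. G w + per k) ` hp" if v: "Re v < 0" "dist (Complex 0 y) v < d" for v
  proof -
   have "dist (B sig) (v - per k) = dist (B sig + per k) v" by (simp add: dist_norm algebra_simps)
   hence "v - per k : ball (B sig) d Int {v. Re v < 0}" using v c by simp
   then obtain s where s: "s : S" "v - per k = B s" using d(2) by blast
   have Bs: "B s : S" "lam (B s) = G (lam s)" using bdry_modelD(1)[OF B] s(1) by (auto simp: model_def)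
   have v': "v = B s + per k" using s(2) by (simp add: algebra_simps)
   show ?thesis unfolding v' using Bs lam(4)[OF Bs(1)] lam(2)[OF s(1)] strip_shift by auto
  qed
  hence "y : V (%w. G w + per k)" unfolding V_def using d(1) by blast
  thus "y : \<Union>(V ` lifts (Suc m))" using lifts_shift[OF G(1)] by blast
 qed
 have "t : A" using e by (simp add: A_def)
 then obtain G where G: "G : lifts (Suc m)" "t : V G" using cov by blast
 have "A <= V G"
 proof (rule connected_in_one[of A "V ` lifts (Suc m)"])
  show "connected A" by (simp add: A_def)
  show "open U" if "U : V ` lifts (Suc m)" for U using that Vop by (auto simp del: lifts.simps)
  show "U = U'" if "U : V ` lifts (Suc m)" "U' : V ` lifts (Suc m)" "U Int U' ~= {}" for U U'
   using that Veq by (elim imageE) (simp del: lifts.simps)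
 qed (use G cov `t : A` in "auto simp del: lifts.simps")
 moreover have "t + e / 2 : A" using e by (simp add: A_def)
 ultimately have G2: "t + e / 2 : V G" by blast
 obtain d1 where d1: "d1 > 0" "!!v. Re v < 0 ==> dist (Complex 0 t) v < d1 ==> v : S & lam v : G ` hp" using G(2) unfolding V_def by blast
 obtain d2 where d2: "d2 > 0" "!!v. Re v < 0 ==> dist (Complex 0 (t + e / 2)) v < d2 ==> v : S & lam v : G ` hp" using G2 unfolding V_def by blast
 define d where "d = min d1 d2 / 2"
 define v1 v2 where "v1 = Complex (- d) t" and "v2 = Complex (- d) (t + e / 2)"
 have "dist (Complex 0 t) v1 = d" "dist (Complex 0 (t + e / 2)) v2 = d" using d1(1) d2(1) by (auto simp: v1_def v2_def dist_norm cmod_def d_def)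
 hence v: "v1 : S" "lam v1 : G ` hp" "v2 : S" "lam v2 : G ` hp"
  using d1(2)[of v1] d2(2)[of v2] d1(1) d2(1) by (auto simp: v1_def v2_def d_def)
 obtain B where B: "bdry_model (Suc m) G B" using bdry_model_exists[OF G(1)] by blast
 have inB: "EX s:S. v = B s" if v: "v : S" "lam v : G ` hp" for v
 proof -
  obtain a where a: "0 < Re a" "lam v = G a" using v(2) by auto
  have "q (G a) : F" using lam(3)[OF v(1)] exp_strip(2)[OF l(1) v(1)] a(2) by simp
  hence "q a : F" using lifts_J[OF G(1) a(1)] by simp
  then obtain s where s: "s : S" "lam s = a" using lam_surj[OF a(1)] by blast
  have Bs: "B s : S" "lam (B s) = lam v" using bdry_modelD(1)[OF B] s a by (auto simp: model_def)
  thus ?thesis using lam_inj[OF Bs(1) v(1), of 0] s(1) by auto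
 qed
 obtain s1 s2 where "s1 : S" "s2 : S" "v1 = B s1" "v2 = B s2" using inB v by metis
 hence "norm (v1 - v2) <= kp ^ m * C0" using bdry_model_diam[OF B G(1)] by simp
 moreover have "norm (v1 - v2) = e / 2" using e by (simp add: v1_def v2_def cmod_def)
 ultimately show False using m e by simp
qed

text \<open>The neighbours are the translates by \<open>per 1\<close> and \<open>per (-1)\<close> in
  the coordinate of a high level. Contraction brings them close to \<open>z\<close>; the boundary
  map \<open>I\<close> is continuous and injective, hence monotone, so their arguments fall on
  opposite sides.\<close>

lemma two_sided:
 assumes z: "z : J" and e: "e > 0"
 obtains z1 z2 t1 t t2 where "z1 : J" "z2 : J" "dist z1 z < e" "dist z2 z < e" "t1 < t" "t < t2" "t2 - t1 < e"
  "phih z1 = exp (\<i> * of_real t1)" "phih z = exp (\<i> * of_real t)" "phih z2 = exp (\<i> * of_real t2)"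
proof -
 obtain w where w: "0 < Re w" "q w = z" using J_lift[OF z] by blast
 have "isCont q w" using q_cont w(1) hp_facts(1) by (simp add: cont_at)
 then obtain d where d: "d > 0" "!!v. dist v w < d ==> dist (q v) (q w) < e" unfolding cont_eps using e by blast
 obtain m0 where m0: "!!m G zt et. m >= m0 ==> G : lifts m ==> de < Re zt ==> G zt = w ==> Re et = Re zt ==>
  abs(Im et - Im zt) <= 2 * pi ==> norm (G et - w) < d" using lift_near[OF w(1) d(1)] by blast
 obtain m1 where m1: "kp ^ m1 * C0 < e" using kp_small[OF e] by blast
 define m where "m = max m0 m1"
 have "kp ^ m * C0 <= kp ^ m1 * C0" using kp C0_pos by (intro mult_right_mono power_decreasing) (auto simp: m_def)
 hence m: "kp ^ m * C0 < e" "m0 <= Suc m" using m1 by (auto simp: m_def)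
 obtain G zt where G: "G : lifts (Suc m)" "de < Re zt" "0 < Re zt" "G zt = w" "q zt : J" using J_lifts[of w "Suc m"] w z by metis
 obtain B where B: "bdry_model (Suc m) G B" using bdry_model_exists[OF G(1)] by blast
 obtain sig where sig: "Re sig = 0" "!!k. phih (q (G (zt + per k))) = exp (B (sig + per k))" using axis_value[OF G(1) B G(3,5)] by blast
 define I where "I y = Im (B (Complex 0 y))" for y
 have BI: "B (Complex 0 y) = \<i> * of_real (I y)" for y using bdry_modelD(3)[OF B, of "Complex 0 y"] by (simp add: I_def complex_eq_iff)
 define y where "y = Im sig"
 have val: "phih (q (G (zt + per k))) = exp (\<i> * of_real (I (y + 2 * pi * of_int k)))" for k
 proof -
  have "sig + per k = Complex 0 (y + 2 * pi * of_int k)" using sig(1) by (simp add: y_def complex_eq_iff)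
  thus ?thesis using sig(2)[of k] BI by simp
 qed
 have inj: "inj_on I {y - 2 * pi..y + 2 * pi}"
 proof (rule inj_onI)
  fix a b assume "I a = I b"
  hence "B (Complex 0 b) = B (Complex 0 a) + per 0" by (simp add: BI)
  thus "a = b" using bdry_model_inj[OF B G(1), of "Complex 0 a" "Complex 0 b" 0] by simp
 qed
 have "continuous_on {y - 2 * pi..y + 2 * pi} I" unfolding I_def by (rule bdry_model_axis[OF B])
 hence mon: "I (y - 2 * pi) < I y & I y < I (y + 2 * pi) | I (y + 2 * pi) < I y & I y < I (y - 2 * pi)"
  using continuous_inj_imp_mono[of "y - 2 * pi" y "y + 2 * pi" I] inj by auto
 have near: "dist (q (G (zt + per k))) z < e" "q (G (zt + per k)) : J" if "abs k <= 1" for k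
 proof -
  have "abs(2 * pi * real_of_int k) <= 2 * pi * 1" unfolding abs_mult using that by (intro mult_mono) auto
  hence "norm (G (zt + per k) - w) < d" by (intro m0[OF m(2) G(1,2,4)]) auto
  thus "dist (q (G (zt + per k))) z < e" using d(2)[of "G (zt + per k)"] w(2) by (simp add: dist_norm)
  show "q (G (zt + per k)) : J" using lifts_J[OF G(1), of "zt + per k"] G(3,5) J_eq by simp
 qed
 have diam: "abs(I a - I b) <= kp ^ m * C0" for a b
 proof -
  have cB: "continuous_on (closure S) B" using bdry_modelD(2)[OF B] lipschitz_on_continuous_on by blast
  have 1: "norm (B s - B t) <= kp ^ m * C0" if s: "s : closure S" and t: "t : S" for s t
   by (rule continuous_le_on_closure[OF _ s]) (use cB bdry_model_diam[OF B G(1) _ t] in "auto intro!: cont_intros")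
  have 2: "norm (B s - B t) <= kp ^ m * C0" if s: "s : closure S" and t: "t : closure S" for s t
   by (rule continuous_le_on_closure[OF _ t]) (use cB 1[OF s] in "auto intro!: cont_intros")
  have "abs(I a - I b) <= norm (B (Complex 0 a) - B (Complex 0 b))"
   unfolding I_def using abs_Im_le_cmod[of "B (Complex 0 a) - B (Complex 0 b)"] by simp
  thus ?thesis using 2[of "Complex 0 a" "Complex 0 b"] l(1) by (auto simp: closure_strip)
 qed
 have z0: "phih z = exp (\<i> * of_real (I y))" using val[of 0] G(4) w(2) by simp
 have v1: "phih (q (G (zt + per 1))) = exp (\<i> * of_real (I (y + 2 * pi)))" "phih (q (G (zt + per (-1)))) = exp (\<i> * of_real (I (y - 2 * pi)))"
  using val[of 1] val[of "-1"] by (simp_all del: of_real_add of_real_diff)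
 have dd: "abs(I (y - 2 * pi) - I (y + 2 * pi)) < e" using diam m(1) by (meson le_less_trans)
 from mon show thesis
 proof
  assume "I (y - 2 * pi) < I y & I y < I (y + 2 * pi)"
  thus thesis using that[OF near(2)[of "-1"] near(2)[of 1] near(1)[of "-1"] near(1)[of 1] _ _ _ v1(2) z0 v1(1)] dd by auto
 next
  assume "I (y + 2 * pi) < I y & I y < I (y - 2 * pi)"
  thus thesis using that[OF near(2)[of 1] near(2)[of "-1"] near(1)[of 1] near(1)[of "-1"] _ _ _ v1(1) z0 v1(2)] dd by auto
 qed
qed

end

section \<open>Order on the fibres\<close>

text \<open>The complement J of a simply connected domain, in half-plane coordinates P with inverse R;
  le is the order on the fibres of Im P over J. Lines of constant Im P together with the fibres
  are the leaves of the foliation to be straightened.\<close>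

locale leaf_space =
 fixes P R :: "complex => complex" and le :: "complex => complex => bool"
 assumes P_cont: "continuous_on UNIV P" and P_Re: "Re (P z) <= 0"
  and R_hol: "R hol_on {v. Re v < 0}" and PR: "Re v < 0 ==> P (R v) = v"
  and RP: "Re (P z) < 0 ==> R (P z) = z"
  and dense: "closure {z. Re (P z) < 0} = UNIV" and nonempty: "EX z. Re (P z) = 0"
  and sides: "Re (P z) = 0 ==> 0 < e ==> EX z1 z2. Re (P z1) = 0 & Re (P z2) = 0 & dist z1 z < e & dist z2 z < e &
   Im (P z1) < Im (P z) & Im (P z) < Im (P z2)"
  and gaps: "c < d ==> EX y. c < y & y < d & (ALL z. Re (P z) = 0 --> Im (P z) ~= y)"
  and le_fibre: "le z w ==> Re (P z) = 0 & P z = P w"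
  and le_total: "Re (P z) = 0 ==> P z = P w ==> le z w | le w z"
  and le_antisym: "le z w ==> le w z ==> z = w" and le_trans: "le z w ==> le w v ==> le z v"
  and le_closed: "(!!n. le (a n) (b n)) ==> a ----> z ==> b ----> w ==> le z w"
  and le_bounded: "(!!n. le (a n) (b n)) ==> b ----> w ==> bounded (range a)"
  and escape: "Re (P z) = 0 ==> P w = P z ==> ~ le w z ==> EX Q e. compact Q & connected Q & 0 < e & ball z e <= Q &
   (EX u:Q. Re (P u) < 0) & ball w e Int Q = {} & (ALL b u. dist b w < e --> le b u --> u ~: Q)"
  and escape_inf: "Re (P z) = 0 ==> EX Q e. compact Q & connected Q & 0 < e & ball z e <= Q &
   (EX u:Q. Re (P u) < 0) & (ALL b u. 1 / e < norm b --> le b u --> u ~: Q)"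

locale ordered_exterior = exterior +
 fixes al be K M :: real
 assumes const: "0 <= al" "0 <= be" "1 <= K" "0 < M"
  and slope: "lift1 G ==> de <= Re a ==> de <= Re b ==> abs(Im (G a) - Im (G b)) <= al * max (Re (G a)) (Re (G b)) + be"
  and head: "lift1 G ==> lift1 H ==> de <= Re a ==> de <= Re b ==> K * Re (G (H a)) + M <= Re (G (H b)) ==>
    K * Re (H a) + 2 * M <= Re (H b)"
begin

definition "nn m z = N ((f ^^ m) z)" for m z
definition "fib z w \<longleftrightarrow> z : J & w : J & phih z = phih w" for z w
definition "lt z w \<longleftrightarrow> (EX m. ALL n>=m. K * nn n z + M <= nn n w)" for z w
text \<open>At no time is \<open>z\<close> ahead of \<open>w\<close> by the linear head start;
  unlike \<open>lt\<close> this is a closed condition. It is total on fibres because a lead once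
  gained is kept.\<close>

definition "lee z w \<longleftrightarrow> fib z w & (ALL m. nn m z <= K * nn m w + M)" for z w

lemma K_ge: "0 <= x ==> x <= K * x" using mult_right_mono[OF const(3), of x] by (simp only: mult_1)

lemma leeD: "lee z w ==> nn m z <= K * nn m w + M" by (simp add: lee_def)

lemma nn_pos: "z : J ==> 0 < nn m z" unfolding nn_def using N_pos J_iff by blast

lemma nn_lift: "G : lifts m ==> 0 < Re a ==> nn m (q (G a)) = Re a"
 by (simp add: nn_def lifts_f N_q)

lemma nn_cont: assumes "z : J" shows "isCont (nn m) z"
proof -
 have "isCont N ((f ^^ m) z)" using N_cont W(2) assms J_iff by (simp add: cont_at)
 moreover have "isCont (f ^^ m) z"
  using hol_cont[OF fn_hol[of m UNIV]] by (simp add: cont_at)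
 ultimately show ?thesis unfolding nn_def[abs_def] using isCont_o2 by blast
qed

lemma fib_lifts:
 assumes zw: "fib z w" and v: "0 < Re v" "q v = z"
 obtains G a b where "G : lifts (Suc m)" "de < Re a" "de < Re b" "0 < Re a" "0 < Re b" "G a = v" "q (G b) = w"
proof -
 have J: "z : J" "w : J" "phih z = phih w" using zw by (auto simp: fib_def)
 obtain G a where G: "G : lifts (Suc m)" "de < Re a" "0 < Re a" "G a = v" using J_lifts[of v "Suc m"] v J(1) by metis
 have "q (G a) = z" using G v by simp
 then obtain b where b: "0 < Re b" "q (G b) = w" using fibre_tract[OF J G(1,3)] by blast
 have "de < Re b" using J_lift_Re[OF b(1)] lifts_J[OF G(1) b(1)] b(2) J(2) J_eq by simp
 thus thesis using that G b by blast
qed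

text \<open>Both points lie under one lift of level \<open>m + 2\<close>; splitting off its two
  innermost factors exposes the times \<open>m\<close> and \<open>m + 1\<close> in the form of
  \<open>head\<close>.\<close>

lemma dom_step:
 assumes zw: "fib z w" and d: "K * nn m z + M <= nn m w"
 shows "K * nn (Suc m) z + 2 * M <= nn (Suc m) w"
proof -
 obtain v where v: "0 < Re v" "q v = z" using J_lift zw by (auto simp: fib_def)
 obtain G a b where G: "G : lifts (Suc (Suc m))" "de < Re a" "de < Re b" "0 < Re a" "0 < Re b" "G a = v" "q (G b) = w"
  by (rule fib_lifts[OF zw v, of "Suc m"]) blast
 obtain H2 K2 where 2: "H2 : lifts (Suc m)" "lift1 K2" "G = H2 o K2" using lifts_Suc_right[OF G(1)] by blast
 obtain H1 K1 where 1: "H1 : lifts m" "lift1 K1" "H2 = H1 o K1" using lifts_Suc_right[OF 2(1)] by blast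
 have p: "0 < Re (K2 a)" "0 < Re (K2 b)" "0 < Re (K1 (K2 a))" "0 < Re (K1 (K2 b))" using 1(2) 2(2) G(4,5) by (auto simp: lift1_def)
 have "q (H2 (K2 a)) = z" "q (H2 (K2 b)) = w" "q (H1 (K1 (K2 a))) = z" "q (H1 (K1 (K2 b))) = w"
  using 1(3) 2(3) G(6,7) v(2) by auto
 hence "nn (Suc m) z = Re (K2 a)" "nn (Suc m) w = Re (K2 b)" "nn m z = Re (K1 (K2 a))" "nn m w = Re (K1 (K2 b))"
  using nn_lift[OF 2(1) p(1)] nn_lift[OF 2(1) p(2)] nn_lift[OF 1(1) p(3)] nn_lift[OF 1(1) p(4)] by auto
 thus ?thesis using head[OF 1(2) 2(2), of a b] G(2,3) d by simp
qed

lemma dom_lt: assumes "fib z w" "K * nn m z + M <= nn m w" shows "lt z w"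
proof -
 have "K * nn n z + M <= nn n w" if "m <= n" for n
  using that
 proof (induction n rule: dec_induct)
  case (step n)
  thus ?case using dom_step[OF assms(1), of n] const(4) by simp
 qed (rule assms(2))
 thus ?thesis unfolding lt_def by blast
qed

lemma lt_le_nn: "lt z w ==> z : J ==> EX m. ALL n>=m. nn n z + M <= nn n w"
proof -
 assume "lt z w" and z: "z : J"
 then obtain m where m: "!!n. n >= m ==> K * nn n z + M <= nn n w" by (auto simp: lt_def)
 have "1 * nn n z <= K * nn n z" for n using nn_pos[OF z, of n] const(3) by (intro mult_right_mono) auto
 hence "nn n z + M <= nn n w" if "n >= m" for n using m[OF that] by (smt (verit))
 thus ?thesis by blast
qed

lemma fib_sym: "fib z w ==> fib w z" and fib_trans: "fib z w ==> fib w v ==> fib z v" by (auto simp: fib_def)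

lemma not_lee: "fib z w ==> ~ lee z w ==> lt w z"
 using dom_lt[OF fib_sym, of z w] unfolding lee_def by (meson less_imp_le not_le)

lemma lee_total: "fib z w ==> lee z w | lee w z"
proof (rule ccontr)
 assume zw: "fib z w" and "~ (lee z w | lee w z)"
 hence "lt z w" "lt w z" using not_lee fib_sym by blast+
 then obtain m1 m2 where "!!n. n >= m1 ==> nn n z + M <= nn n w" "!!n. n >= m2 ==> nn n w + M <= nn n z"
  using lt_le_nn zw unfolding fib_def by metis
 from this(1)[of "max m1 m2"] this(2)[of "max m1 m2"] show False using const(4) by simp
qed

text \<open>Two points of a fibre neither of which runs ahead stay at bounded hyperbolic distance
  under iteration, so contraction identifies them.\<close>

lemma lee_antisym: assumes zw: "lee z w" "lee w z" shows "z = w"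
proof -
 have fb: "fib z w" using zw(1) by (simp add: lee_def)
 obtain v where v: "0 < Re v" "q v = z" using J_lift fb by (auto simp: fib_def)
 \<comment> \<open>Bounds the ratio of the scale \<open>X\<close> of the pair to either real part:
   the real parts are comparable up to \<open>K\<close> and \<open>M\<close>, the slope bounds the
   imaginary distance, and both real parts exceed \<open>de\<close>.\<close>
 define Q where "Q = (1 + al) * (K + M / de) + be / de"
 define D where "D = 2 * ln Q + 1"
 have Q: "Q >= 1"
 proof -
  have "1 * 1 <= (1 + al) * (K + M / de)" using const de(1) by (intro mult_mono) (auto intro: add_increasing2)
  thus ?thesis using const de(1) by (simp add: Q_def add_increasing2)
 qed
 hence D: "D > 0" by (simp add: D_def add_nonneg_pos)
 have ex: "EX u. 0 < Re u & q u = w & norm (v - u) <= Re v * ((La ^ m * D) * exp (La ^ m * D))" for m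
 proof -
  obtain G a b where G: "G : lifts (Suc m)" "de < Re a" "de < Re b" "0 < Re a" "0 < Re b" "G a = v" "q (G b) = w"
   by (rule fib_lifts[OF fb v, of m]) blast
  obtain H K1 where H: "H : lifts m" "lift1 K1" "G = H o K1" using lifts_Suc_right[OF G(1)] by blast
  define x y where "x = K1 a" and "y = K1 b"
  have xy: "de < Re x" "de < Re y" "0 < Re x" "0 < Re y" using lift1_de[OF H(2)] G(4,5) de(1) by (auto simp: x_def y_def intro: less_trans)
  have e: "H x = v" "q (H y) = w" using G(6,7) H(3) by (auto simp: x_def y_def)
  have "nn m z = Re x" "nn m w = Re y" using nn_lift[OF H(1) xy(3)] nn_lift[OF H(1) xy(4)] e v(2) by auto
  hence c: "Re x <= K * Re y + M" "Re y <= K * Re x + M" using leeD[OF zw(1), of m] leeD[OF zw(2), of m] by auto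
  define X where "X = (1 + al) * max (Re x) (Re y) + be"
  have s: "abs(Im x - Im y) <= al * max (Re x) (Re y) + be" using slope[OF H(2), of a b] G(2,3) by (simp add: x_def y_def)
  have X: "Re x <= X" "Re y <= X" "abs(Im x - Im y) <= X"
  proof -
   have "0 <= al * max (Re x) (Re y)" using const xy by simp
   thus "Re x <= X" "Re y <= X" "abs(Im x - Im y) <= X" using s const(2) xy by (auto simp: X_def distrib_right)
  qed
  have r: "0 <= ln (X / t) & ln (X / t) <= ln Q" if t: "de < t" "Re x <= K * t + M" "Re y <= K * t + M" "t <= X" for t
  proof -
   have t0: "0 < t" using t(1) de(1) by simp
   have "X <= (1 + al) * (K * t + M) + be" unfolding X_def using t const by (intro add_mono mult_left_mono) auto
   hence "X / t <= ((1 + al) * (K * t + M) + be) / t" using t0 by (simp add: divide_right_mono)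
   also have "... = (1 + al) * (K + M / t) + be / t" using t0 by (simp add: field_simps)
   also have "... <= Q" unfolding Q_def using t(1) const de(1) by (intro add_mono mult_left_mono divide_left_mono) auto
   finally show ?thesis using t0 t(4) Q by (auto intro!: ln_ge_zero ln_mono)
  qed
  have rx: "Re x <= K * Re x + M" "Re y <= K * Re y + M"
   using K_ge[of "Re x"] K_ge[of "Re y"] const(4) xy by linarith+
  define t where "t = La ^ m * (ln (X / Re x) + ln (X / Re y) + 1)"
  have t: "0 <= t" "t <= La ^ m * D"
   using r[OF xy(1) rx(1) c(2) X(1)] r[OF xy(2) c(1) rx(2) X(2)] La by (auto simp: t_def D_def intro!: mult_left_mono)
  have "norm (H x - H y) <= Re (H x) * (t * exp t)" unfolding t_def by (rule lifts_increment[OF H(1) xy(3,4) X])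
  also have "... <= Re v * ((La ^ m * D) * exp (La ^ m * D))" unfolding e using t v(1) La D by (intro mult_mono) auto
  finally have "norm (v - H y) <= Re v * ((La ^ m * D) * exp (La ^ m * D))" unfolding e(1) .
  thus ?thesis using lifts_Re[OF H(1) xy(4)] e(2) by blast
 qed
 then obtain u where u: "!!m. 0 < Re (u m)" "!!m. q (u m) = w" "!!m. norm (v - u m) <= Re v * ((La ^ m * D) * exp (La ^ m * D))" by metis
 have "(%m. Re v * ((La ^ m * D) * exp (La ^ m * D))) ----> Re v * ((0 * D) * exp (0 * D))"
  using La by (intro tendsto_intros LIMSEQ_power_zero) auto
 hence lim: "(%m. Re v * ((La ^ m * D) * exp (La ^ m * D))) ----> 0" by simp
 have "(%m. v - u m) ----> 0" by (rule Lim_null_comparison[OF always_eventually lim]) (rule allI, rule u(3))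
 hence "u ----> v" using tendsto_diff[OF tendsto_const[of v], of "%m. v - u m" 0] by simp
 moreover have "isCont q v" using q_cont v(1) hp_facts(1) by (simp add: cont_at)
 ultimately have "(%m. q (u m)) ----> q v" by (rule isCont_comp[rotated])
 hence "(%m::nat. w) ----> z" using u(2) v(2) by simp
 from LIMSEQ_unique[OF this tendsto_const] show ?thesis .
qed

text \<open>Otherwise the three points would eventually lead one another in a cycle, each time by at
  least \<open>M\<close>.\<close>

lemma lee_trans: assumes zw: "lee z w" and wv: "lee w v" shows "lee z v"
proof (rule ccontr)
 assume n: "~ lee z v"
 have fb: "fib z w" "fib w v" "fib z v" using zw wv fib_trans by (auto simp: lee_def)
 have 1: "lt v z" by (rule not_lee[OF fb(3) n])
 have 2: "lt z w" using not_lee[OF fib_sym[OF fb(1)]] lee_antisym[OF zw] n wv by blast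
 have 3: "lt w v" using not_lee[OF fib_sym[OF fb(2)]] lee_antisym[OF wv] n zw by blast
 obtain m1 m2 m3 where "!!n. n >= m1 ==> nn n v + M <= nn n z" "!!n. n >= m2 ==> nn n z + M <= nn n w" "!!n. n >= m3 ==> nn n w + M <= nn n v"
  using lt_le_nn[OF 1] lt_le_nn[OF 2] lt_le_nn[OF 3] fb unfolding fib_def by metis
 from this(1)[of "m1 + m2 + m3"] this(2)[of "m1 + m2 + m3"] this(3)[of "m1 + m2 + m3"] show False using const(4) by simp
qed

lemma lee_closed:
 assumes "!!n. lee (a n) (b n)" "a ----> z" "b ----> w" shows "lee z w"
proof -
 have J: "a n : J" "b n : J" "phih (a n) = phih (b n)" for n using assms(1)[of n] by (auto simp: lee_def fib_def)
 have zw: "z : J" "w : J" using closed_sequentially[OF J_closed] J assms(2,3) by blast+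
 have "(%n. phih (a n)) ----> phih z" "(%n. phih (b n)) ----> phih w"
  by (rule isCont_comp[OF phih_cont], fact)+
 hence "phih z = phih w" using J(3) LIMSEQ_unique by auto
 moreover have "nn m z <= K * nn m w + M" for m
 proof (rule LIMSEQ_le)
  show "(%n. nn m (a n)) ----> nn m z" by (rule isCont_comp[OF nn_cont[OF zw(1)] assms(2)])
  show "(%n. K * nn m (b n) + M) ----> K * nn m w + M"
   by (intro tendsto_intros isCont_comp[OF nn_cont[OF zw(2)] assms(3)])
 qed (use assms(1) in "auto simp: lee_def")
 ultimately show ?thesis using zw by (simp add: lee_def fib_def)
qed

lemma lee_bounded:
 assumes "!!n. lee (a n) (b n)" "b ----> w" shows "bounded (range a)"
proof -
 have J: "a n : J" "b n : J" for n using assms(1)[of n] by (auto simp: lee_def fib_def)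
 have "w : J" using closed_sequentially[OF J_closed] J assms(2) by blast
 hence "(%n. nn 0 (b n)) ----> nn 0 w" by (rule isCont_comp[OF nn_cont assms(2)])
 hence "bounded (range (%n. nn 0 (b n)))" by (rule convergent_imp_bounded)
 then obtain c where c: "!!n. abs(nn 0 (b n)) <= c" by (auto simp: bounded_iff)
 obtain B where B: "!!z. z : W ==> N z <= K * c + M ==> norm z <= B" using N_bounded_imp[of "K * c + M"] by metis
 have "N (a n) <= K * c + M" for n
 proof -
  have "N (a n) <= K * nn 0 (b n) + M" using leeD[OF assms(1)[of n], of 0] by (simp add: nn_def)
  also have "... <= K * c + M" using c[of n] const by (intro add_mono mult_left_mono) auto
  finally show ?thesis .
 qed
 hence "norm (a n) <= B" for n using B W(4) J by blast
 thus ?thesis by (auto simp: bounded_iff)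
qed

text \<open>The image of a rectangle in the coordinate of level \<open>m\<close>: its right side
  stays below \<open>T\<close>, and its left side, at \<open>de / 2\<close>, lies over
  \<open>F\<close>, since points over \<open>J\<close> have real part above
  \<open>de\<close>.\<close>

lemma escape_box:
 assumes z: "z : J" and T: "nn m z < T"
 obtains Q e where "compact Q" "connected Q" "0 < e" "ball z e <= Q" "EX u:Q. u : F" "!!u. u : Q ==> u : J ==> nn m u < T"
  "!!u. u : Q ==> (f ^^ m) u : W & nn m u < T"
proof -
 obtain v where v: "0 < Re v" "q v = z" using J_lift[OF z] by blast
 obtain G a where G: "G : lifts m" "de < Re a" "0 < Re a" "G a = v" using J_lifts[of v m] v z by metis
 have Ra: "Re a < T" using nn_lift[OF G(1,3)] G(4) v(2) T by simp
 define B where "B = cbox (Complex (de / 2) (Im a - 1)) (Complex ((Re a + T) / 2) (Im a + 1))"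
 have B: "B <= hp" "!!u. u : B ==> Re u < T" using de(1) Ra by (auto simp: B_def in_cbox_complex_iff)
 have cG: "continuous_on B (%u. q (G u))"
  by (rule cont_comp[OF q_cont]) (use B(1) lifts_Re[OF G(1)] hol_cont[OF lifts_hol[OF G(1)]] cont_sub in auto)
 define O' where "O' = box (Complex (de / 2) (Im a - 1)) (Complex ((Re a + T) / 2) (Im a + 1))"
 have O: "O' <= B" "a : O'" "open O'" using G(2) Ra de(1) by (auto simp: B_def O'_def in_cbox_complex_iff in_box_complex_iff)
 have "open (q ` G ` O')"
  by (rule q_open[OF lifts_open[OF G(1) O(3)]]) (use O(1) B(1) lifts_Re[OF G(1)] in auto)
 moreover have "z : q ` G ` O'" using O(2) G(4) v(2) by force
 ultimately obtain e where e: "e > 0" "ball z e <= q ` G ` O'" using open_contains_ball by blast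
 have fin: "(f ^^ m) u : W & nn m u < T" if u: "u : (%u. q (G u)) ` B" for u
 proof -
  obtain b where b: "b : B" "u = q (G b)" using u by blast
  hence "0 < Re b" using B(1) by auto
  thus ?thesis using b B(2) nn_lift[OF G(1)] lifts_f[OF G(1)] q_W(1) by simp
 qed
 show thesis
 proof (rule that)
  show "compact ((%u. q (G u)) ` B)" "connected ((%u. q (G u)) ` B)"
   by (intro compact_im conn_im cG; simp add: B_def convex_connected)+
  show "ball z e <= (%u. q (G u)) ` B" using e(2) O(1) by (auto simp: image_image)
  define c where "c = Complex (de / 2) (Im a)"
  have c: "c : B" "0 < Re c" "~ de < Re c" using de(1) G(2) Ra by (auto simp: c_def B_def in_cbox_complex_iff)
  hence "q c : F" using J_lift_Re[of c] J_eq by blast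
  thus "EX u:(%u. q (G u)) ` B. u : F" using lifts_J[OF G(1) c(2)] c(1) by blast
 qed (use e(1) fin in auto)
qed

text \<open>The box around \<open>z\<close> stays below \<open>T'\<close> at time \<open>m\<close>,
  too low for any point that lies above a neighbour of \<open>w\<close>. So it joins
  \<open>z\<close> to the Fatou set without meeting the upper parts of fibres near
  \<open>w\<close>.\<close>

lemma lee_escape:
 assumes z: "z : J" and w: "fib w z" "~ lee w z"
 shows "EX Q e. compact Q & connected Q & 0 < e & ball z e <= Q & (EX u:Q. u : F) & ball w e Int Q = {} &
  (ALL b u. dist b w < e --> lee b u --> u ~: Q)"
proof -
 have wJ: "w : J" using w(1) by (simp add: fib_def)
 obtain m where m: "K * nn m z + M < nn m w" using w by (auto simp: lee_def not_le)
 define T where "T = (nn m w - M) / K"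
 have T: "nn m z < T" "K * T + M = nn m w" using m const(3) by (auto simp: T_def field_simps)
 define T' where "T' = (nn m z + T) / 2"
 have T': "nn m z < T'" "T' < T" using T(1) by (auto simp: T'_def)
 obtain Q e where Q: "compact Q" "connected Q" "0 < e" "ball z e <= Q" "EX u:Q. u : F" "!!u. u : Q ==> nn m u < T'"
  using escape_box[OF z T'(1)] by metis
 have "K * T' + M < nn m w" using T' T(2) const(3) by (smt (verit) mult_strict_left_mono)
 hence "0 < nn m w - (K * T' + M)" by simp
 with nn_cont[OF wJ, of m] obtain d where d: "d > 0" "!!b. dist b w < d ==> dist (nn m b) (nn m w) < nn m w - (K * T' + M)"
  unfolding cont_eps by blast
 note d0 = d(1)
 have d: "K * T' + M < nn m b" if "dist b w < d" for b using d(2)[OF that] by (auto simp: dist_real_def)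
 have TT: "T' < K * T' + M"
  using K_ge[of T'] const(4) nn_pos[OF z, of m] T'(1) by linarith
 show ?thesis
 proof (intro exI[of _ Q] exI[of _ "min d e"] conjI allI impI)
  show "ball w (min d e) Int Q = {}"
  proof (rule equals0I)
   fix u assume "u : ball w (min d e) Int Q"
   thus False using d[of u] Q(6)[of u] TT by (auto simp: dist_commute)
  qed
  show "u ~: Q" if b: "dist b w < min d e" "lee b u" for b u
  proof
   assume "u : Q"
   hence "K * nn m u <= K * T'" using Q(6)[of u] const(3) by (intro mult_left_mono) auto
   moreover have "nn m b <= K * nn m u + M" using b(2) by (simp add: lee_def)
   ultimately show False using d[of b] b(1) by simp
  qed
 qed (use Q d0 in auto)
qed

text \<open>The same at time 0 with infinity in place of \<open>w\<close>: what lies above a point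
  of large modulus has large height itself.\<close>

lemma lee_escape_inf:
 assumes z: "z : J"
 shows "EX Q e. compact Q & connected Q & 0 < e & ball z e <= Q & (EX u:Q. u : F) & (ALL b u. 1 / e < norm b --> lee b u --> u ~: Q)"
proof -
 obtain Q e where Q: "compact Q" "connected Q" "0 < e" "ball z e <= Q" "EX u:Q. u : F" "!!u. u : Q ==> nn 0 u < nn 0 z + 1"
  using escape_box[OF z, of 0 "nn 0 z + 1"] by (metis less_add_one)
 obtain B where B: "!!b. b : W ==> N b <= K * (nn 0 z + 1) + M ==> norm b <= B" using N_bounded_imp by metis
 define d where "d = min e (1 / (abs B + 1))"
 have d: "d > 0" "d <= e" "1 / d >= abs B + 1"
 proof -
  show "d > 0" "d <= e" using Q(3) by (auto simp: d_def)
  have "d <= 1 / (abs B + 1)" by (simp add: d_def)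
  thus "1 / d >= abs B + 1" using `d > 0` by (simp add: field_simps)
 qed
 have "u ~: Q" if b: "1 / d < norm b" "lee b u" for b u
 proof
  assume "u : Q"
  hence "K * nn 0 u <= K * (nn 0 z + 1)" using Q(6)[of u] const(3) by (intro mult_left_mono) auto
  moreover have "nn 0 b <= K * nn 0 u + M" "b : W" using b(2) W(4) by (auto simp: lee_def fib_def)
  ultimately have "norm b <= B" using B[of b] by (simp add: nn_def)
  thus False using b(1) d(3) by simp
 qed
 moreover have "ball z d <= Q" using Q(4) d(2) by auto
 ultimately show ?thesis using Q d(1) by blast
qed

text \<open>The circle is cut at a point \<open>c\<close> omitted by \<open>phih\<close>, and the
  Moebius map \<open>m\<close> sends \<open>c\<close> to infinity, so that \<open>P\<close> is
  finite on the whole plane.\<close>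

lemma leaf_space_exists: obtains P R le where "leaf_space P R le" "J = {z. Re (P z) = 0}"
proof -
 obtain t0 where t0: "exp (\<i> * of_real t0) ~: phih ` J" using circle_gap[of 1 0] by auto
 define c where "c = exp (\<i> * of_real t0)"
 have c: "norm c = 1" "c ~= 0" by (auto simp: c_def)
 have pc: "phih z ~= c" for z
  using t0 phih_norm[of z] c(1) J_eq unfolding c_def[symmetric] by (cases "z : F") auto
 define m where "m u = (u + c) / (u - c)" for u
 define m' where "m' v = c * ((v + 1) / (v - 1))" for v
 have Rem: "Re (m u) = ((norm u)\<^sup>2 - 1) / (norm (u - c))\<^sup>2" for u
 proof -
  have "(Re c)\<^sup>2 + (Im c)\<^sup>2 = 1" using c(1) cmod_power2[of c] by simp
  thus ?thesis unfolding m_def Re_divide cmod_power2 by (simp add: power2_eq_square algebra_simps)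
 qed
 have m'm: "m u ~= 1 & m' (m u) = u" if "u ~= c" for u
 proof -
  have "m u - 1 = 2 * c / (u - c)" "m u + 1 = 2 * u / (u - c)" using that by (simp_all add: m_def field_simps)
  thus ?thesis using that c(2) by (auto simp: m'_def)
 qed
 have mm': "m' v ~= c & m (m' v) = v" if "v ~= 1" for v
 proof -
  have "m' v - c = c * 2 / (v - 1)" "m' v + c = c * 2 * v / (v - 1)" using that by (simp_all add: m'_def field_simps)
  thus ?thesis using that c(2) by (auto simp: m_def)
 qed
 have m'1: "norm (m' v) < 1" if "Re v < 0" for v
 proof -
  have "v ~= 1" using that by auto
  hence "((norm (m' v))\<^sup>2 - 1) / (norm (m' v - c))\<^sup>2 < 0" "0 < (norm (m' v - c))\<^sup>2" using Rem[of "m' v"] mm' that by auto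
  hence "(norm (m' v))\<^sup>2 < 1\<^sup>2" by (simp add: divide_less_0_iff)
  thus ?thesis using power_less_imp_less_base by fastforce
 qed
 define P where "P z = m (phih z)" for z
 define R where "R v = ps (m' v)" for v
 have P0: "Re (P z) < 0 \<longleftrightarrow> z : F" "Re (P z) <= 0" for z
 proof -
  have d: "(norm (phih z - c))\<^sup>2 > 0" using pc by simp
  have "(norm (phih z))\<^sup>2 < 1 \<longleftrightarrow> z : F" using phih_norm[of z] by (simp add: power_less_one_iff)
  thus "Re (P z) < 0 \<longleftrightarrow> z : F" using d by (auto simp: P_def Rem divide_less_0_iff)
  have "norm (phih z) <= 1" using phih_J[of z] phih_norm[of z] J_eq by (cases "z : F") auto
  hence "(norm (phih z))\<^sup>2 <= 1" by (simp add: power_le_one)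
  thus "Re (P z) <= 0" using d by (simp add: P_def Rem divide_le_0_iff)
 qed
 have PJ: "Re (P z) = 0 \<longleftrightarrow> z : J" for z
 proof -
  have "Re (P z) = 0 \<longleftrightarrow> ~ Re (P z) < 0" using P0(2)[of z] by linarith
  thus ?thesis unfolding P0(1) J_eq by simp
 qed
 have Peq: "P z = P w \<longleftrightarrow> phih z = phih w" for z w unfolding P_def using m'm pc by metis
 have im0: "Re (m (exp (\<i> * of_real s))) = 0" for s :: real by (simp add: Rem)
 have mc: "continuous_on A m" if "c ~: A" for A unfolding m_def[abs_def] using that by (auto intro!: cont_intros)
 have "leaf_space P R lee"
 proof
  show "continuous_on UNIV P" unfolding P_def[abs_def]
   by (rule cont_comp[OF mc[of "- {c}"] phih(1)]) (use pc in auto)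
  show "Re (P z) <= 0" for z by (rule P0)
  have "(ps o m') hol_on {v. Re v < 0}"
   by (rule hol_comp[OF _ ps_hol]) (use m'1 in "auto simp: m'_def[abs_def] intro!: hol_intros")
  thus "R hol_on {v. Re v < 0}" by (simp add: R_def[abs_def] o_def)
  show "P (R v) = v" if "Re v < 0" for v
  proof -
   have "v ~= 1" using that by auto
   thus ?thesis using m'1[OF that] ps_in[of "m' v"] phps[of "m' v"] mm' phih(2) by (simp add: P_def R_def)
  qed
  show "R (P z) = z" if "Re (P z) < 0" for z
   using that P0(1) m'm[OF pc[of z]] phih(2) psph by (simp add: P_def R_def)
  show "closure {z. Re (P z) < 0} = UNIV" using F_dense by (simp add: P0)
  show "EX z. Re (P z) = 0" using F_not_UNIV PJ J_eq by auto
  show "EX z1 z2. Re (P z1) = 0 & Re (P z2) = 0 & dist z1 z < e & dist z2 z < e & Im (P z1) < Im (P z) & Im (P z) < Im (P z2)"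
   if z: "Re (P z) = 0" "0 < e" for z e
  proof -
   \<comment> \<open>Keeps the arc shorter than a full turn and away from the cut
     \<open>c\<close>.\<close>
   define e' where "e' = min e (min 1 (norm (phih z - c)))"
   have e': "e' > 0" "e' <= e" "e' <= 1" "e' <= norm (phih z - c)" using z(2) pc by (auto simp: e'_def)
   obtain z1 z2 t1 t t2 where zz: "z1 : J" "z2 : J" "dist z1 z < e'" "dist z2 z < e'" "t1 < t" "t < t2" "t2 - t1 < e'"
    "phih z1 = exp (\<i> * of_real t1)" "phih z = exp (\<i> * of_real t)" "phih z2 = exp (\<i> * of_real t2)"
    using two_sided[of z e'] z(1) PJ e'(1) by blast
   define h where "h s = Im (m (exp (\<i> * of_real s)))" for s :: real
   have ne: "exp (\<i> * of_real s) ~= c" if "s : {t1..t2}" for s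
   proof
    assume "exp (\<i> * of_real s) = c"
    hence "norm (phih z - c) <= norm (\<i> * of_real t - \<i> * of_real s)" using exp_diff_le[of "\<i> * of_real t" "\<i> * of_real s"] zz(9) by simp
    also have "... = abs(t - s)" unfolding right_diff_distrib[symmetric] norm_mult by (simp flip: of_real_diff)
    finally show False using that zz(5,6,7) e'(4) by auto
   qed
   have "continuous_on {t1..t2} h" unfolding h_def
    by (intro cont_intros cont_comp[OF mc[of "- {c}"]]) (auto dest: ne)
   moreover have "inj_on h {t1..t2}"
   proof (rule inj_onI)
    fix s s' assume s: "s : {t1..t2}" "s' : {t1..t2}" "h s = h s'"
    hence "m (exp (\<i> * of_real s)) = m (exp (\<i> * of_real s'))" using im0 by (simp add: h_def complex_eq_iff)
    hence "exp (\<i> * of_real s) = exp (\<i> * of_real s')" using m'm ne s by metis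
    then obtain n where "\<i> * of_real s = \<i> * of_real s' + per n" using exp_eq_per by blast
    hence n: "s = s' + 2 * pi * of_int n" by (simp add: complex_eq_iff)
    hence "abs(2 * pi * of_int n) < 1" using s zz(7) e'(3) by auto
    moreover have "abs(of_int n) <= abs(2 * pi * of_int n)"
     unfolding abs_mult using pi_gt3 by (intro mult_le_cancel_right1[THEN iffD2]) auto
    ultimately have "n = 0" by linarith
    thus "s = s'" using n by simp
   qed
   ultimately have mon: "h t1 < h t & h t < h t2 | h t2 < h t & h t < h t1"
    using continuous_inj_imp_mono[OF zz(5,6)] by blast
   have "Im (P z1) = h t1" "Im (P z) = h t" "Im (P z2) = h t2" using zz by (auto simp: P_def h_def)
   moreover have "Re (P z1) = 0" "Re (P z2) = 0" "dist z1 z < e" "dist z2 z < e" using zz e'(2) PJ by auto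
   ultimately show ?thesis using mon by metis
  qed
  show "EX y. a < y & y < b & (ALL z. Re (P z) = 0 --> Im (P z) ~= y)" if ab: "a < b" for a b
  proof -
   define u where "u = m' (\<i> * of_real ((a + b) / 2))"
   have i1: "\<i> * of_real ((a + b) / 2) ~= 1" by (simp add: complex_eq_iff)
   have u: "u ~= c" "m u = \<i> * of_real ((a + b) / 2)" using mm'[OF i1] by (auto simp: u_def)
   hence "Re (m u) = 0" by (simp only: Re_i_times Im_complex_of_real)
   hence "(norm u)\<^sup>2 - 1 = 0" using u(1) by (simp add: Rem)
   hence "norm u = 1" using norm_ge_zero[of u] by (auto simp: power2_eq_1_iff)
   then obtain t where t: "u = exp (\<i> * of_real t)" by (metis complex_norm_eq_1_exp)
   have "isCont m u" unfolding m_def[abs_def] using u(1) by (auto intro!: cont_intros)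
   hence "isCont (%u. Im (m u)) u" unfolding isCont_def by (rule tendsto_Im)
   moreover have "(b - a) / 2 > 0" using ab by simp
   ultimately obtain d where d: "d > 0" "!!v. dist v u < d ==> dist (Im (m v)) (Im (m u)) < (b - a) / 2"
    unfolding cont_eps by blast
   obtain t' where t': "abs(t' - t) < min d (norm (u - c))" "exp (\<i> * of_real t') ~: phih ` J"
    using circle_gap[of "min d (norm (u - c))" t] d(1) u(1) by auto
   define v where "v = exp (\<i> * of_real t')"
   have "norm (v - u) <= norm (\<i> * of_real t' - \<i> * of_real t)" using exp_diff_le[of "\<i> * of_real t'" "\<i> * of_real t"] by (simp add: v_def t)
   also have "... = abs(t' - t)" unfolding right_diff_distrib[symmetric] norm_mult by (simp flip: of_real_diff)
   finally have v: "norm (v - u) < d" "norm (v - u) < norm (u - c)" using t'(1) by auto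
   hence "v ~= c" by (auto simp: norm_minus_commute)
   have "Im (m u) = (a + b) / 2" unfolding u(2) by (simp only: Im_i_times Re_complex_of_real)
   hence "a < Im (m v) & Im (m v) < b" using d(2)[of v] v(1) by (auto simp: dist_norm dist_real_def field_simps abs_if split: if_splits)
   moreover have "Im (P z) ~= Im (m v)" if "Re (P z) = 0" for z
   proof
    assume "Im (P z) = Im (m v)"
    hence "m (phih z) = m v" using that im0[of t'] by (simp add: P_def v_def complex_eq_iff)
    hence "phih z = v" using m'm pc `v ~= c` by metis
    hence "v : phih ` J" using that PJ by blast
    thus False using t'(2) by (simp add: v_def)
   qed
   ultimately show ?thesis by blast
  qed
  show "Re (P z) = 0 & P z = P w" if "lee z w" for z w using that PJ Peq by (auto simp: lee_def fib_def)
  have fb: "fib z w" if "Re (P z) = 0" "P z = P w" for z w using that PJ Peq by (metis fib_def)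
  show "lee z w | lee w z" if "Re (P z) = 0" "P z = P w" for z w using lee_total[OF fb[OF that]] .
  show "z = w" if "lee z w" "lee w z" for z w using lee_antisym[OF that] .
  show "lee z v" if "lee z w" "lee w v" for z w v using lee_trans[OF that] .
  show "lee z w" if "!!n. lee (a n) (b n)" "a ----> z" "b ----> w" for a b z w using lee_closed[OF that] .
  show "bounded (range a)" if "!!n. lee (a n) (b n)" "b ----> w" for a b w using lee_bounded[OF that] .
  show "EX Q e. compact Q & connected Q & 0 < e & ball z e <= Q & (EX u:Q. Re (P u) < 0) & ball w e Int Q = {} &
   (ALL b u. dist b w < e --> lee b u --> u ~: Q)" if "Re (P z) = 0" "P w = P z" "~ lee w z" for z w
   using lee_escape[of z w] fb[of w z] that PJ P0(1) by auto
  show "EX Q e. compact Q & connected Q & 0 < e & ball z e <= Q & (EX u:Q. Re (P u) < 0) &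
   (ALL b u. 1 / e < norm b --> lee b u --> u ~: Q)" if "Re (P z) = 0" for z
   using lee_escape_inf[of z] that PJ P0(1) by auto
 qed
 thus thesis by (rule that) (use PJ in auto)
qed

end

section \<open>Crosscuts\<close>

context leaf_space begin

abbreviation "lh == {v::complex. Re v < 0}"

lemma P_isCont: "isCont P z" using P_cont by (simp add: cont_at)

text \<open>Inverting \<open>R\<close> at the base point \<open>R (-2)\<close> makes it bounded near
  the axis, so image areas are finite, and infinity becomes the ordinary limit 0.\<close>

definition "k v = 1 / (R v - R (-2))" for v

definition "ar U = measure lebesgue (k ` U)" for U

abbreviation "pstrip == {v::complex. -1 < Re v & Re v < 0}"

lemma R_inj: "inj_on R lh" by (rule inj_on_inverseI[where g = P]) (simp add: PR)

lemma R_cont: "continuous_on lh R" by (rule hol_cont[OF R_hol])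

lemma lh_facts: "open lh" "convex lh" by (auto simp: open_halfspace_Re_lt convex_halfspace_Re_lt)

lemma k_facts: "k hol_on pstrip" "inj_on k pstrip" "EX B>0. ALL v:pstrip. norm (k v) <= B" "v : pstrip ==> k v ~= 0 & R v = R (-2) + 1 / k v"
proof -
 obtain d where d: "d > 0" "!!z. dist z (R (-2)) < d ==> dist (P z) (P (R (-2))) < 1"
  using P_isCont[of "R (-2)"] unfolding cont_eps by (meson zero_less_one)
 have far: "d <= norm (R v - R (-2))" if v: "v : pstrip" for v
 proof (rule ccontr)
  assume "~ d <= norm (R v - R (-2))"
  hence "dist v (-2) < 1" using d(2)[of "R v"] v PR by (auto simp: dist_norm)
  thus False using abs_Re_le_cmod[of "v - (-2)"] v by (simp add: dist_norm)
 qed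
 hence nz: "R v - R (-2) ~= 0" if "v : pstrip" for v using d(1) that by fastforce
 thus "v : pstrip ==> k v ~= 0 & R v = R (-2) + 1 / k v" by (simp add: k_def)
 have "R hol_on pstrip" by (rule hol_sub[OF R_hol]) auto
 thus "k hol_on pstrip" unfolding k_def[abs_def] using nz by (intro hol_intros) auto
 show "inj_on k pstrip"
 proof (rule inj_onI)
  fix v w assume "v : pstrip" "w : pstrip" "k v = k w"
  thus "v = w" using inj_onD[OF R_inj, of v w] by (simp add: k_def)
 qed
 show "EX B>0. ALL v:pstrip. norm (k v) <= B" using far d(1) by (intro exI[of _ "1/d"]) (simp add: k_def norm_divide frac_le)
qed

lemma pstrip_facts: "open pstrip" "convex pstrip"
proof -
 have "pstrip = strip 1" by (auto simp: strip_def)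
 thus "open pstrip" "convex pstrip" by (simp_all add: strip_open strip_convex)
qed

lemma ar_meas: assumes "open U" "U <= pstrip" shows "k ` U : lmeasurable"
proof (rule lmeasurable_open)
 obtain B where "ALL v:pstrip. norm (k v) <= B" using k_facts(3) by blast
 thus "bounded (k ` U)" using assms(2) by (intro boundedI[of _ B]) auto
 show "open (k ` U)" using invariance_of_domain[OF cont_sub[OF hol_cont[OF k_facts(1)] assms(2)] assms(1)]
   inj_on_subset[OF k_facts(2) assms(2)] by simp
qed

lemma ar_mono: assumes "open U" "open V" "U <= V" "V <= pstrip" shows "ar U <= ar V"
 unfolding ar_def
 by (rule measure_mono_fmeasurable[OF image_mono[OF assms(3)] fmeasurableD[OF ar_meas[OF assms(1) order_trans[OF assms(3,4)]]] ar_meas[OF assms(2,4)]])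

lemma ar_add: assumes "open U" "open V" "U Int V = {}" "U Un V <= T" "open T" "T <= pstrip" shows "ar U + ar V <= ar T"
proof -
 have UV: "U <= pstrip" "V <= pstrip" using assms(4,6) by blast+
 have "k ` U Int k ` V = {}" using inj_on_image_Int[OF k_facts(2) UV] assms(3) by simp
 hence "measure lebesgue (k ` U Un k ` V) = ar U + ar V"
  unfolding ar_def using measure_Un3[OF ar_meas[OF assms(1) UV(1)] ar_meas[OF assms(2) UV(2)]] by simp
 thus ?thesis using ar_mono[OF open_Un[OF assms(1,2)] assms(5,4,6)] by (simp only: ar_def image_Un)
qed

text \<open>Bloch's theorem finds a disc of radius \<open>r * norm (deriv k s) / 12\<close> in the
  image, and its area is at most \<open>ar U\<close>.\<close>

lemma ar_deriv: assumes "ball s r <= U" "0 < r" "open U" "U <= pstrip" shows "norm (deriv k s) * r <= 12 * sqrt (ar U)"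
proof -
 define c where "c = r * norm (deriv k s) / 12"
 have c: "c >= 0" using assms(2) by (simp add: c_def)
 have sub: "ball s r <= pstrip" using assms by blast
 obtain b where b: "ball b c <= k ` ball s r"
  using Bloch[OF hol_sub[OF k_facts(1) sub] assms(2), of c] by (auto simp: c_def)
 have "c\<^sup>2 <= pi * c\<^sup>2" using pi_gt3 by (simp add: mult_le_cancel_right1)
 also have "... = measure lebesgue (ball b c)" using content_ball[OF c, of b] by (simp add: unit_ball_vol_2)
 also have "... <= ar (ball s r)" unfolding ar_def
  using b ar_meas[OF open_ball sub] by (intro measure_mono_fmeasurable) auto
 also have "... <= ar U" using assms by (intro ar_mono) auto
 finally have "c <= sqrt (ar U)" using c by (simp add: real_le_rsqrt)
 thus ?thesis by (simp add: c_def mult.commute)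
qed

lemma ar_diff:
 assumes U: "open U" "U <= pstrip" and r: "0 < r" "!!w. w : closed_segment u v ==> ball w r <= U"
 shows "norm (k u - k v) <= 12 * sqrt (ar U) / r * norm (u - v)"
proof (rule diff_bound[OF convex_closed_segment, where f' = "deriv k"])
 fix w assume w: "w : closed_segment u v"
 have "w : ball w r" using r(1) by simp
 hence "w : pstrip" using r(2)[OF w] U(2) by blast
 thus "(k has_field_derivative deriv k w) (at w within closed_segment u v)"
  by (rule holomorphic_derivI[OF k_facts(1) pstrip_facts(1)])
 show "norm (deriv k w) <= 12 * sqrt (ar U) / r" using ar_deriv[OF r(2)[OF w] r(1) U] r(1) by (simp add: pos_le_divide_eq)
qed auto

definition "Q y h = {v. - h < Re v & Re v < 0 & y < Im v & Im v < y + h}" for y h :: real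

lemma Q_facts: "open (Q y h)" "h <= 1 ==> Q y h <= pstrip"
 by (auto simp: Q_def open_Collect_conj open_Collect_less continuous_on_Re continuous_on_Im continuous_on_id)

lemma ball_coords: "w : ball v r ==> abs(Re w - Re v) < r & abs(Im w - Im v) < r" for v w :: complex
 using abs_Re_le_cmod[of "v - w"] abs_Im_le_cmod[of "v - w"] by (auto simp: dist_norm)

text \<open>Repeatedly passing to the quarter with the smaller image area yields a horizontal line
  whose image has finite length.\<close>

lemma short_line:
 fixes y h :: real assumes h: "0 < h" "h <= 1"
 defines "s == sqrt (ar (Q y h))"
 obtains et c where "y + h/4 <= et" "et <= y + 3*h/4"
  "!!t. - (3/4*h) <= t ==> t < 0 ==> norm (k (Complex t et) - k (Complex (-(3/4*h)) et)) <= 144 * s"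
  "((%t. k (Complex t et)) ---> c) (at_left 0)"
proof -
 define hh where "hh j = h / 4 ^ j" for j :: nat
 have hh: "0 < hh j" "hh j <= 1" "hh (Suc j) = hh j / 4" for j
 proof -
  show "0 < hh j" using h by (simp add: hh_def)
  have "h * 1 <= 1 * 4 ^ j" using h by (intro mult_mono) auto
  thus "hh j <= 1" by (simp add: hh_def divide_le_eq)
 qed (simp add: hh_def)
 \<comment> \<open>Only the two middle quarters are candidates, so that the limit height keeps a
   quarter of the side away from the edges of every box.\<close>
 define Y where "Y = rec_nat y (%j z. if ar (Q (z + hh j/4) (hh j/4)) <= ar (Q (z + hh j/2) (hh j/4)) then z + hh j/4 else z + hh j/2)"
 have Y0: "Y 0 = y" by (simp add: Y_def)
 have YS: "Y (Suc j) = (if ar (Q (Y j + hh j/4) (hh j/4)) <= ar (Q (Y j + hh j/2) (hh j/4)) then Y j + hh j/4 else Y j + hh j/2)" for j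
  by (simp add: Y_def)
 have Yc: "Y j + hh j/4 <= Y (Suc j)" "Y (Suc j) + hh (Suc j) <= Y j + 3*hh j/4" for j using hh(1)[of j] by (auto simp: YS hh(3))
 define a where "a j = ar (Q (Y j) (hh j))" for j
 have a0: "0 <= a j" for j by (simp add: a_def ar_def)
 have "2 * a (Suc j) <= a j" for j
 proof -
  let ?A = "Q (Y j + hh j/4) (hh j/4)" and ?B = "Q (Y j + hh j/2) (hh j/4)"
  have "ar ?A + ar ?B <= a j" unfolding a_def
  proof (rule ar_add)
   show "open ?A" "open ?B" "open (Q (Y j) (hh j))" by (rule Q_facts)+
   show "Q (Y j) (hh j) <= pstrip" by (rule Q_facts(2)[OF hh(2)])
  qed (use hh(1)[of j] in "auto simp: Q_def")
  thus ?thesis by (auto simp: a_def YS hh(3))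
 qed
 \<comment> \<open>The actual rate is 1/2; 9/16 is taken because its square root is
   rational.\<close>
 hence "a j <= (9/16) ^ j * a 0" for j
 proof (induction j)
  case (Suc j)
  hence "2 * a (Suc j) <= (9/16) ^ j * a 0" by (meson order_trans)
  moreover have "0 <= (9/16) ^ j * a 0" using a0 by simp
  ultimately show ?case by (simp add: field_simps)
 qed simp
 moreover have "(9/16::real) ^ j = ((3/4) ^ j)\<^sup>2" for j by (simp add: power2_eq_square flip: power_mult_distrib)
 ultimately have "sqrt (a j) <= sqrt (((3/4) ^ j)\<^sup>2 * a 0)" for j by (intro real_sqrt_le_mono) simp
 hence sa: "sqrt (a j) <= (3/4) ^ j * s" for j by (simp add: real_sqrt_mult a_def Y0 hh_def s_def)
 have mono: "Y j <= Y (j + d) & Y (j + d) + hh (j + d) <= Y j + hh j" for j d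
 proof (induction d)
  case (Suc d)
  have "Y j <= Y (Suc (j + d)) & Y (Suc (j + d)) + hh (Suc (j + d)) <= Y j + hh j"
   using Suc Yc[of "j + d"] hh(1)[of "j + d"] by linarith
  thus ?case by simp
 qed simp
 have "Y n <= y + hh 0" for n using mono[of 0 n] hh(1)[of n] by (simp add: Y0)
 hence "bdd_above (range Y)" by (intro bdd_aboveI[of _ "y + hh 0"]) auto
 moreover have "incseq Y" using mono[of _ 1] by (intro incseq_SucI) simp
 ultimately have lim: "Y ----> (SUP j. Y j)" by (rule LIMSEQ_incseq_SUP)
 define et where "et = (SUP j. Y j)"
 have et: "Y j + hh j/4 <= et" "et <= Y j + 3*hh j/4" for j
 proof -
  have 1: "ALL n>=Suc j. Y j + hh j/4 <= Y n & Y n <= Y j + 3*hh j/4"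
  proof (intro allI impI)
   fix n assume "Suc j <= n"
   then obtain d where "n = Suc j + d" using le_Suc_ex by blast
   thus "Y j + hh j/4 <= Y n & Y n <= Y j + 3*hh j/4" using mono[of "Suc j" d] Yc[of j] hh(1)[of n] by auto
  qed
  show "Y j + hh j/4 <= et" by (rule LIMSEQ_le_const[OF lim[folded et_def]]) (use 1 in blast)
  show "et <= Y j + 3*hh j/4" by (rule LIMSEQ_le_const2[OF lim[folded et_def]]) (use 1 in blast)
 qed
 define K where "K t = k (Complex t et)" for t
 \<comment> \<open>The segment of stage \<open>j\<close> has length \<open>9/16 * hh j\<close> and
   keeps distance \<open>3/16 * hh j\<close> from the edges of its box, so it costs
   \<open>36 * s * (3/4) ^ j\<close>; \<open>B\<close> is the tail of this geometric series.\<close>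
 define B where "B j = 144 * s * (3/4) ^ j" for j :: nat
 have s0: "s >= 0" using a0[of 0] by (simp add: s_def a_def Y0 hh_def)
 define x where "x j = - (3/4 * hh j)" for j
 have near: "norm (K t - K (x j)) <= B j - B (Suc j)" if t: "x j <= t" "t <= x (Suc j)" for t j
 proof -
  have "norm (K t - K (x j)) <= 12 * sqrt (a j) / (3/16 * hh j) * norm (Complex t et - Complex (x j) et)"
   unfolding K_def a_def
  proof (rule ar_diff)
   fix w assume "w : closed_segment (Complex t et) (Complex (x j) et)"
   hence "Re w : closed_segment t (x j)" "Im w = et"
    by (auto simp: in_segment complex_eq_iff algebra_simps)
   hence w: "x j <= Re w" "Re w <= x (Suc j)" "Im w = et" using t by (auto simp: closed_segment_eq_real_ivl split: if_splits)
   show "ball w (3/16 * hh j) <= Q (Y j) (hh j)"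
   proof
    fix u assume "u : ball w (3/16 * hh j)"
    from ball_coords[OF this] have "- hh j < Re u" "Re u < 0" "Y j < Im u" "Im u < Y j + hh j"
     using w et[of j] hh(1)[of j] unfolding x_def hh(3) by linarith+
    thus "u : Q (Y j) (hh j)" by (simp add: Q_def)
   qed
  qed (use Q_facts hh[of j] in auto)
  also have "norm (Complex t et - Complex (x j) et) = t - x j" using t(1) by (simp add: cmod_def)
  also have "12 * sqrt (a j) / (3/16 * hh j) * (t - x j) <= 12 * sqrt (a j) / (3/16 * hh j) * (9/16 * hh j)"
   using t hh(1)[of j] a0[of j] by (intro mult_left_mono divide_nonneg_nonneg) (auto simp: x_def hh(3))
  also have "... = 36 * sqrt (a j)" using hh(1)[of j] by simp
  also have "... <= 36 * ((3/4) ^ j * s)" using sa by simp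
  also have "... = B j - B (Suc j)" by (simp add: B_def)
  finally show ?thesis .
 qed
 have tele: "norm (K (x (j + d)) - K (x j)) <= B j - B (j + d)" for j d
 proof (induction d)
  case (Suc d)
  have "norm (K (x (Suc (j + d))) - K (x (j + d))) <= B (j + d) - B (Suc (j + d))"
   by (rule near) (use hh(1)[of "j + d"] in "auto simp: x_def hh(3)")
  thus ?case using Suc norm_triangle_ineq[of "K (x (Suc (j + d))) - K (x (j + d))" "K (x (j + d)) - K (x j)"] by simp
 qed simp
 have line: "norm (K t - K (x j)) <= B j" if t: "x j <= t" "t < 0" for t j
 proof -
  have "EX n. t < x (Suc (j + n))"
  proof -
   have "0 < - t / hh j" using t(2) hh(1)[of j] by (intro divide_pos_pos) auto
   then obtain n where "(1/4::real) ^ n < - t / hh j" using real_arch_pow_inv[of "- t / hh j" "1/4"] by auto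
   hence "hh j / 4 ^ n < - t" using hh(1)[of j] by (simp add: power_one_over field_simps)
   moreover have "hh (j + n) = hh j / 4 ^ n" by (simp add: hh_def power_add)
   ultimately show ?thesis using hh(1)[of "j + n"] by (intro exI[of _ n]) (simp add: x_def hh(3))
  qed
  hence ex: "t < x (Suc (j + (LEAST n. t < x (Suc (j + n)))))" by (rule LeastI_ex)
  define n where "n = (LEAST n. t < x (Suc (j + n)))"
  have "x (j + n) <= t"
  proof (cases n)
   case (Suc i)
   hence "~ t < x (Suc (j + i))" using not_less_Least[of i "%n. t < x (Suc (j + n))"] by (simp add: n_def)
   thus ?thesis using Suc by simp
  qed (use t in simp)
  hence "norm (K t - K (x (j + n))) <= B (j + n) - B (Suc (j + n))" using ex by (intro near) (auto simp: n_def)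
  hence "norm (K t - K (x j)) <= B j - B (Suc (j + n))"
   using tele[of j n] norm_triangle_ineq[of "K t - K (x (j + n))" "K (x (j + n)) - K (x j)"] by simp
  moreover have "0 <= B (Suc (j + n))" using s0 by (simp add: B_def)
  ultimately show ?thesis by simp
 qed
 have "B ----> 144 * s * 0" unfolding B_def by (intro tendsto_intros LIMSEQ_power_zero) auto
 hence B0: "B ----> 0" by simp
 have "Cauchy (%j. K (x j))"
 proof (rule CauchyI')
  fix e :: real assume "0 < e"
  then obtain j where j: "!!i. i >= j ==> abs(B i) < e" using LIMSEQ_D[OF B0] by auto
  have "norm (K (x m) - K (x n)) < e" if mn: "j <= m" "m < n" for m n
  proof -
   obtain d where d: "n = m + d" using mn(2) less_imp_add_positive by blast
   have "0 <= B (m + d)" using s0 by (simp add: B_def)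
   thus ?thesis using tele[of m d] j[of m] mn(1) by (simp add: d norm_minus_commute)
  qed
  thus "EX M. ALL m>=M. ALL n>m. dist (K (x m)) (K (x n)) < e" by (auto simp: dist_norm)
 qed
 then obtain c where c: "(%j. K (x j)) ----> c" using Cauchy_convergent convergent_def by blast
 have "(K ---> c) (at_left 0)"
 proof (rule tendstoI)
  fix e :: real assume "0 < e"
  hence "eventually (%j. B j < e/2) sequentially" "eventually (%j. dist (K (x j)) c < e/2) sequentially"
   using order_tendstoD(2)[OF B0, of "e/2"] tendstoD[OF c, of "e/2"] by auto
  then obtain j where j: "B j < e/2" "dist (K (x j)) c < e/2" using eventually_happens[OF eventually_conj] by fastforce
  have "x j < 0" using hh(1)[of j] by (simp add: x_def)
  hence "eventually (%t. t : {x j<..<0}) (at_left 0)" by (rule eventually_at_left_real)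
  thus "eventually (%t. dist (K t) c < e) (at_left 0)"
  proof eventually_elim
   case (elim t)
   hence "dist (K t) (K (x j)) < e/2" using line[of j t] j(1) by (simp add: dist_norm)
   thus ?case using j(2) dist_triangle[of "K t" c "K (x j)"] by simp
  qed
 qed
 moreover have "norm (K t - K (- (3/4*h))) <= 144 * s" if "- (3/4*h) <= t" "t < 0" for t
  using line[of 0 t] that by (simp add: x_def hh_def B_def)
 ultimately show thesis using that[of et c] et[of 0] by (auto simp: K_def[abs_def] Y0 hh_def)
qed

text \<open>The images of the strips decrease to the empty set and have finite area.\<close>

lemma strip_area: assumes "e > 0" obtains d where "0 < d" "d < 1" "ar {v. - d < Re v & Re v < 0 & abs(Im v) < Y} < e"
proof -
 define U where "U n = {v. - (1 / (2 + real n)) < Re v & Re v < 0 & abs(Im v) < Y}" for n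
 have U: "open (U n)" "U n <= pstrip" for n
 proof -
  have "U n = {v. - (1 / (2 + real n)) < Re v} Int {v. Re v < 0} Int {v. - Y < Im v} Int {v. Im v < Y}" by (auto simp: U_def)
  thus "open (U n)" by (auto intro!: open_Int open_halfspace_Re_gt open_halfspace_Re_lt open_halfspace_Im_gt open_halfspace_Im_lt)
  have "1 / (2 + real n) <= 1" by simp
  hence "- 1 < Re v" if "- (1 / (2 + real n)) < Re v" for v using that by linarith
  thus "U n <= pstrip" by (auto simp: U_def)
 qed
 have "(%n. measure lebesgue (k ` U n)) ----> measure lebesgue (\<Inter>n. k ` U n)"
 proof (rule Lim_measure_decseq)
  show "range (%n. k ` U n) <= sets lebesgue" using ar_meas[OF U] by auto
  show "decseq (%n. k ` U n)"
  proof (rule decseq_SucI, rule image_mono)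
   fix n
   have "1 / (2 + real (Suc n)) <= 1 / (2 + real n)" by (intro divide_left_mono) auto
   thus "U (Suc n) <= U n" by (auto simp: U_def)
  qed
  show "emeasure lebesgue (k ` U n) ~= \<infinity>" for n using fmeasurableD2[OF ar_meas[OF U]] by simp
 qed
 moreover have "(\<Inter>n. k ` U n) = {}"
 proof (rule equals0I)
  fix w assume w: "w : (\<Inter>n. k ` U n)"
  then obtain v where v: "v : U 0" "w = k v" by blast
  have vU: "v : U n" for n
  proof -
   obtain v' where "v' : U n" "w = k v'" using w by blast
   thus ?thesis using inj_onD[OF k_facts(2), of v v'] v U by auto
  qed
  have "- Re v < 1 / (2 + real n)" for n using vU[of n] unfolding U_def by (simp only: mem_Collect_eq) linarith
  moreover have "0 < - Re v" using v(1) by (simp add: U_def)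
  then obtain n where "inverse (real (Suc n)) < - Re v" using reals_Archimedean by blast
  moreover have "1 / (2 + real n) <= inverse (real (Suc n))" by (simp add: inverse_eq_divide frac_le)
  ultimately show False by (meson less_asym less_le_trans)
 qed
 ultimately have "(%n. ar (U n)) ----> 0" by (simp add: ar_def)
 then obtain n where "ar (U n) < e" using order_tendstoD(2)[OF _ assms] eventually_happens by (metis sequentially_bot)
 thus thesis using that[of "1 / (2 + real n)"] by (simp add: U_def)
qed

definition "cross v a b = {u. Re v <= Re u & Re u < 0 & (Im u = a | Im u = b)} Un {u. Re u = Re v & a <= Im u & Im u <= b}" for v a b

text \<open>Two lines from \<open>short_line\<close>, one above and one below \<open>v\<close>, are
  joined by a vertical side through \<open>v\<close>. All estimates are governed by the image area
  of a thin strip along the axis, which is small.\<close>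

lemma crosscut:
 assumes "e > 0"
 obtains d where "d > 0" "!!v. - d < Re v ==> Re v < 0 ==> abs(Im v) < Y ==>
  EX a b ca cb. a < Im v & Im v < b & (ALL u:cross v a b. norm (k u - k v) < e) &
   ((%t. k (Complex t a)) ---> ca) (at_left 0) & ((%t. k (Complex t b)) ---> cb) (at_left 0)"
proof -
 have "(e / 200)\<^sup>2 > 0" using assms by simp
 from strip_area[OF this, of "Y + 1"]
 obtain d where d: "0 < d" "d < 1" "ar {v. - d < Re v & Re v < 0 & abs(Im v) < Y + 1} < (e / 200)\<^sup>2" by blast
 have "EX a b ca cb. a < Im v & Im v < b & (ALL u:cross v a b. norm (k u - k v) < e) &
   ((%t. k (Complex t a)) ---> ca) (at_left 0) & ((%t. k (Complex t b)) ---> cb) (at_left 0)"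
  if v: "- (3/4*d) < Re v" "Re v < 0" "abs(Im v) < Y" for v
 proof -
  \<comment> \<open>Makes \<open>- (3/4 * h) = Re v\<close>, so the lines of
    \<open>short_line\<close> begin at the abscissa of \<open>v\<close>. The estimates
    \<open>144 * s\<close> and \<open>36 * s\<close> add up to less than the allowance
    \<open>200 * s\<close>.\<close>
  define h y where "h = - (4/3) * Re v" and "y = Im v"
  define Z where "Z = {v. - h < Re v & Re v < 0} Int {v. y - h < Im v & Im v < y + h}"
  define s where "s = sqrt (ar Z)"
  have h: "0 < h" "h <= 1" "h < d" "- (3/4*h) = Re v" using v d(2) by (auto simp: h_def)
  have "Z = {v. - h < Re v} Int {v. Re v < 0} Int {v. y - h < Im v} Int {v. Im v < y + h}" by (auto simp: Z_def)
  hence Z: "open Z" "Z <= pstrip" using h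
   by (auto intro!: open_Int open_halfspace_Re_gt open_halfspace_Re_lt open_halfspace_Im_gt open_halfspace_Im_lt)
  have "{v. - d < Re v & Re v < 0 & abs(Im v) < Y + 1} = {v. - d < Re v} Int {v. Re v < 0} Int {v. - (Y + 1) < Im v} Int {v. Im v < Y + 1}" by auto
  hence "open {v. - d < Re v & Re v < 0 & abs(Im v) < Y + 1}"
   by (simp add: open_Int open_halfspace_Re_gt open_halfspace_Re_lt open_halfspace_Im_gt open_halfspace_Im_lt)
  hence "ar Z <= ar {v. - d < Re v & Re v < 0 & abs(Im v) < Y + 1}"
   by (rule ar_mono[OF Z(1)]) (use h v(3) d(2) in "auto simp: Z_def y_def")
  hence s: "s < e / 200" "0 <= s" using real_sqrt_less_mono[of "ar Z" "(e/200)\<^sup>2"] d(3) assms by (auto simp: s_def ar_def)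
  have Qs: "sqrt (ar (Q y h)) <= s" "sqrt (ar (Q (y - h) h)) <= s" unfolding s_def
   by (intro real_sqrt_le_mono ar_mono Q_facts Z; use h in "auto simp: Q_def Z_def")+
  obtain b cb where b: "y + h/4 <= b" "b <= y + 3*h/4"
   "!!t. - (3/4*h) <= t ==> t < 0 ==> norm (k (Complex t b) - k (Complex (-(3/4*h)) b)) <= 144 * sqrt (ar (Q y h))"
   "((%t. k (Complex t b)) ---> cb) (at_left 0)" by (rule short_line[OF h(1,2), of y]) blast
  obtain a ca where a: "y - h + h/4 <= a" "a <= y - h + 3*h/4"
   "!!t. - (3/4*h) <= t ==> t < 0 ==> norm (k (Complex t a) - k (Complex (-(3/4*h)) a)) <= 144 * sqrt (ar (Q (y - h) h))"
   "((%t. k (Complex t a)) ---> ca) (at_left 0)" by (rule short_line[OF h(1,2), of "y - h"]) blast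
  have top: "norm (k (Complex (Re v) t) - k v) <= 36 * s" if t: "a <= t" "t <= b" for t
  proof -
   have "norm (k (Complex (Re v) t) - k v) <= 12 * sqrt (ar Z) / (h/4) * norm (Complex (Re v) t - v)"
   proof (rule ar_diff[OF Z])
    fix w assume "w : closed_segment (Complex (Re v) t) v"
    moreover have "closed_segment (Complex (Re v) t) v <= {w. Re w = Re v} Int {w. y - 3*h/4 <= Im w & Im w <= y + 3*h/4}"
    proof (rule closed_segment_subset)
     have "{w. Re w = Re v} Int {w. y - 3*h/4 <= Im w & Im w <= y + 3*h/4} =
      {w. Re w <= Re v} Int {w. Re w >= Re v} Int {w. y - 3*h/4 <= Im w} Int {w. Im w <= y + 3*h/4}" by auto
     thus "convex ({w. Re w = Re v} Int {w. y - 3*h/4 <= Im w & Im w <= y + 3*h/4})"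
      by (simp add: convex_Int convex_halfspace_Im_ge convex_halfspace_Im_le convex_halfspace_Re_ge convex_halfspace_Re_le)
    qed (use a b t h(1) in "auto simp: y_def")
    ultimately have w: "Re w = Re v" "y - 3*h/4 <= Im w" "Im w <= y + 3*h/4" by auto
    show "ball w (h/4) <= Z"
    proof
     fix u assume "u : ball w (h/4)"
     from ball_coords[OF this] have "- h < Re u" "Re u < 0" "y - h < Im u" "Im u < y + h" using w h(1,4) by linarith+
     thus "u : Z" by (simp add: Z_def)
    qed
   qed (use h in simp)
   also have "norm (Complex (Re v) t - v) = abs(t - y)" by (simp add: cmod_def y_def)
   also have "12 * sqrt (ar Z) / (h/4) * abs(t - y) <= 12 * sqrt (ar Z) / (h/4) * (3*h/4)"
   proof (rule mult_left_mono)
    show "abs(t - y) <= 3*h/4" using a(1,2) b(1,2) t h(1) by linarith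
   qed (use h(1) s(2) in "simp add: s_def")
   also have "... = 36 * s" using h(1) by (simp add: s_def)
   finally show ?thesis .
  qed
  have "norm (k u - k v) < e" if u: "u : cross v a b" for u
  proof (cases "Re u = Re v & a <= Im u & Im u <= b")
   case True
   hence "u = Complex (Re v) (Im u)" by (simp add: complex_eq_iff)
   thus ?thesis using top[of "Im u"] True s by simp
  next
   case False
   hence u': "Re v <= Re u" "Re u < 0" "Im u = a | Im u = b" using u by (auto simp: cross_def)
   have "norm (k (Complex (Re u) (Im u)) - k (Complex (Re v) (Im u))) <= 144 * s"
    using u'(3) a(3)[of "Re u"] b(3)[of "Re u"] u'(1,2) Qs unfolding h(4) by auto
   moreover have "norm (k (Complex (Re v) (Im u)) - k v) <= 36 * s" using u'(3) a b h(1) by (intro top) auto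
   ultimately show ?thesis
    using norm_triangle_ineq[of "k u - k (Complex (Re v) (Im u))" "k (Complex (Re v) (Im u)) - k v"] s assms by simp
  qed
  thus ?thesis using a b h(1) by (intro exI[of _ a] exI[of _ b] exI[of _ ca] exI[of _ cb]) (auto simp: y_def)
 qed
 thus thesis using that[of "3/4*d"] d(1) by auto
qed

end

section \<open>Leaves\<close>

context leaf_space begin

abbreviation "JJ == {z. Re (P z) = 0}"
abbreviation "FF == {z. Re (P z) < 0}"

lemma FF_cases: "z : FF | z : JJ" using P_Re[of z] by auto

lemma P_seq: "a ----> z ==> (%n. P (a n)) ----> P z"
 by (rule isCont_comp[OF P_isCont])

lemma FF_eq: "FF = R ` lh" using PR RP by (force simp: image_iff)

lemma FF_facts: "open FF" "connected FF" "path_connected FF"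
proof -
 show "open FF" unfolding FF_eq by (rule invariance_of_domain[OF R_cont lh_facts(1) R_inj])
 show "connected FF" unfolding FF_eq by (rule conn_im[OF R_cont convex_connected[OF lh_facts(2)]])
 thus "path_connected FF" using `open FF` connected_open_path_connected by blast
qed

lemma le_refl: "z : JJ ==> le z z" using le_total[of z z] by auto

lemma le_JJ: "le z w ==> z : JJ & w : JJ" using le_fibre[of z w] by auto

lemma le_cl: "closed {v. le v w}" "closed {v. le w v}"
proof -
 show "closed {v. le v w}" unfolding closed_sequential_limits
 proof (intro allI impI, elim conjE)
  fix x v assume "ALL n::nat. x n : {v. le v w}" "x ----> v"
  thus "v : {v. le v w}" using le_closed[OF _ _ tendsto_const, of x w v] by simp
 qed
 show "closed {v. le w v}" unfolding closed_sequential_limits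
 proof (intro allI impI, elim conjE)
  fix x v assume "ALL n::nat. x n : {v. le w v}" "x ----> v"
  thus "v : {v. le w v}" using le_closed[OF _ tendsto_const, of w x v] by simp
 qed
qed

lemma le_compact: "compact {v. le v w}"
proof -
 have "bounded {v. le v w}"
 proof (rule ccontr)
  assume "~ bounded {v. le v w}"
  hence "ALL n::nat. EX v. le v w & real n < norm v" unfolding bounded_iff by (metis mem_Collect_eq not_le)
  then obtain a where a: "!!n. le (a n) w" "!!n. real n < norm (a n)" by metis
  have "bounded (range a)" using le_bounded[of a "%_. w" w] a(1) by auto
  then obtain B where "!!n. norm (a n) <= B" by (auto simp: bounded_iff)
  thus False using a(2) reals_Archimedean2[of B] by (meson not_le order_trans less_imp_le less_le_trans)
 qed
 thus ?thesis using le_cl(1) compact_eq_bounded_closed by blast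
qed

text \<open>Initial segments are closed and finitely many points of a chain have a least one, so
  compactness gives a least point of \<open>K\<close>.\<close>

lemma fibre_min:
 assumes K: "compact K" "K ~= {}" "K <= JJ" "!!u v. u : K ==> v : K ==> P u = P v"
 obtains e where "e : K" "!!v. v : K ==> le e v"
proof -
 have "K Int \<Inter>((%w. {v. le v w}) ` K) ~= {}"
 proof (rule compact_imp_fip[OF K(1)])
  show "closed T" if "T : (%w. {v. le v w}) ` K" for T using that le_cl(1) by auto
  fix Tc assume "finite Tc" "Tc <= (%w. {v. le v w}) ` K"
  then obtain A where A: "finite A" "A <= K" "Tc = (%w. {v. le v w}) ` A" by (meson finite_subset_image)
  have "EX u:K. ALL w:A. le u w" using A(1,2)
  proof (induction A)
   case (insert x A)
   then obtain u where u: "u : K" "ALL w:A. le u w" by auto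
   show ?case
   proof (cases "le u x")
    case False
    hence "le x u" using le_total[of u x] K(3) K(4)[of u x] u insert.prems by auto
    thus ?thesis using u insert.prems le_trans le_refl K(3) by (intro bexI[of _ x]) auto
   qed (use u in auto)
  qed (use K(2) in auto)
  thus "K Int \<Inter>Tc ~= {}" unfolding A(3) by blast
 qed
 thus thesis using that by blast
qed

lemma leaf_min: assumes "z : JJ" obtains e where "le e z" "!!v. P v = P z ==> le e v"
proof -
 obtain e where e: "e : {v. le v z}" "!!v. v : {v. le v z} ==> le e v"
 proof (rule fibre_min[OF le_compact, of z])
  show "{v. le v z} ~= {}" using le_refl[OF assms] by blast
  show "{v. le v z} <= JJ" using le_JJ by blast
  show "P u = P v" if "u : {v. le v z}" "v : {v. le v z}" for u v using le_fibre[of u z] le_fibre[of v z] that by simp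
 qed blast
 have "le e v" if "P v = P z" for v using e le_total[of v z] that assms le_trans by auto
 thus thesis using that e(1) by blast
qed

definition "line y = (%x. R (Complex x y)) ` {..<0}"

lemma line_eq: "line y = {z : FF. Im (P z) = y}"
proof -
 have "z = R (Complex (Re (P z)) y)" if "z : FF" "Im (P z) = y" for z using RP[of z] that by (metis complex.collapse mem_Collect_eq)
 thus ?thesis using PR by (force simp: line_def image_iff)
qed

text \<open>Both sides of a leaf accumulate at each of its points in J, so by Janiszewski's theorem
  the leaf has no gap there.\<close>

lemma no_gap:
 assumes b: "b : JJ" and land: "closure (line (Im (P b))) Int JJ <= {b'}"
 shows "b : closure (line (Im (P b)) Un {v. le v b & v ~= b})"
proof (rule ccontr)
 define y where "y = Im (P b)"
 define A where "A = closure (line y Un {v. le v b & v ~= b})"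
 assume "b ~: closure (line (Im (P b)) Un {v. le v b & v ~= b})"
 hence bA: "b ~: A" by (simp add: A_def y_def)
 have cl: "closed {z. Im (P z) = y}" by (intro closed_Collect_eq cont_intros P_cont)
 have fib: "v : JJ & Im (P v) = y \<longleftrightarrow> v : JJ & P v = P b" for v using b by (auto simp: y_def complex_eq_iff)
 have "A <= {z. Im (P z) = y}"
  unfolding A_def by (rule closure_minimal[OF _ cl]) (use le_fibre in "auto simp: line_eq y_def")
 obtain c where c: "le b c" "b' : closure (line y) ==> le b b' ==> c = b'" "c = b ==> (ALL v. le b v --> v = b)"
 proof (cases "b' : closure (line y) & le b b'")
  case True
  hence "b' ~= b" using bA closure_mono[of "line y" "line y Un {v. le v b & v ~= b}"] by (auto simp: A_def)
  thus thesis using that[of b'] True by auto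
 next
  case False
  thus thesis using that le_refl[OF b] by (cases "EX v. le b v & v ~= b") auto
 qed
 define T where "T = A Un {v. le c v & c ~= b}"
 define S where "S = {v. le b v} Int {v. le v c}"
 have "closed T" unfolding T_def A_def using le_cl(2)[of c] by (cases "c = b") auto
 moreover have "compact S" unfolding S_def using le_cl(2) le_compact by (rule closed_Int_compact)
 moreover have "S Int T <= {c}"
 proof
  fix v assume v: "v : S Int T"
  hence bv: "le b v" "le v c" by (auto simp: S_def)
  show "v : {c}"
  proof (cases "v : A")
   case True
   have "closure {v. le v b & v ~= b} <= {v. le v b}" by (rule closure_minimal) (auto simp: le_cl)
   moreover have "v ~= b" using True bA by auto
   ultimately have "v : closure (line y)" using True bv(1) le_antisym by (auto simp: A_def closure_Un)
   thus ?thesis using land c(2) bv(1) le_JJ by (auto simp: y_def)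
  next
   case False
   thus ?thesis using v bv(2) le_antisym by (auto simp: T_def)
  qed
 qed
 hence "connected (S Int T)" by (metis connected_empty connected_sing subset_singletonD)
 moreover have ST: "S Un T = {z. Im (P z) = y}"
 proof
  show "S Un T <= {z. Im (P z) = y}"
  proof
   fix v assume "v : S Un T"
   then consider "le b v" | "v : A" | "le c v" by (auto simp: S_def T_def)
   thus "v : {z. Im (P z) = y}"
   proof cases
    case 1
    thus ?thesis using le_fibre[OF 1] by (simp add: y_def)
   next
    case 3
    thus ?thesis using le_fibre[OF 3] le_fibre[OF c(1)] by (simp add: y_def)
   qed (use `A <= _` in blast)
  qed
  show "{z. Im (P z) = y} <= S Un T"
  proof
   fix v assume v: "v : {z. Im (P z) = y}"
   have lA: "line y Un {v. le v b & v ~= b} <= A" unfolding A_def by (rule closure_subset)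
   show "v : S Un T"
   proof (cases "v : FF")
    case True
    thus ?thesis using v lA by (auto simp: T_def line_eq)
   next
    case False
    hence vJ: "v : JJ" "P v = P b" using FF_cases fib[of v] v by auto
    then consider "le v b" "v ~= b" | "le b v" using le_total[of v b] le_refl[OF b] by blast
    thus ?thesis
    proof cases
     case 2
     have "le v c | le c v" using le_total[of v c] vJ c(1) le_fibre by auto
     thus ?thesis using 2 c by (auto simp: S_def T_def)
    qed (use lA in "auto simp: T_def")
   qed
  qed
 qed
 moreover have "b ~: T" using bA le_antisym[OF c(1)] by (auto simp: T_def)
 with `closed T` obtain r where r: "r > 0" "ball b r <= - T" by (metis ComplI open_Compl open_contains_ball)
 then obtain z1 z2 where z: "dist z1 b < r" "dist z2 b < r" "Im (P z1) < y" "y < Im (P z2)"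
  using sides[of b r] b unfolding y_def by auto
 have "connected_component (- T) z1 z2"
  by (rule connected_componentI[OF convex_connected[OF convex_ball] r(2)]) (use z in "auto simp: dist_commute")
 moreover have "connected (- S)"
  by (rule connected_intermediate_closure[OF FF_facts(2)]) (use le_JJ dense in "auto simp: S_def")
 hence "connected_component (- S) z1 z2"
  by (rule connected_componentI[OF _ order_refl]) (use z le_fibre[of b] in "auto simp: S_def y_def")
 ultimately have "connected_component (- (S Un T)) z1 z2" using Janiszewski by blast
 then obtain C where C: "connected C" "C <= - {z. Im (P z) = y}" "z1 : C" "z2 : C" unfolding ST connected_component_def by blast
 have "connected ((%z. Im (P z)) ` C)"
  by (intro conn_im C(1) cont_intros cont_sub[OF P_cont]) auto
 hence "y : (%z. Im (P z)) ` C" using z(3,4) C(3,4) by (meson connectedD_interval imageI less_imp_le)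
 thus False using C(2) by auto
qed

text \<open>At the least point of a fibre the second set in \<open>no_gap\<close> is empty.\<close>

lemma landing:
 assumes land: "closure (line (Im (P z))) Int JJ <= {b'}" and e: "le e z" "!!v. P v = P z ==> le e v"
 shows "e : closure (line (Im (P z)))"
proof -
 have P: "P e = P z" "e : JJ" using le_fibre[OF e(1)] by auto
 have "{v. le v e & v ~= e} = {}"
 proof (rule equals0I)
  fix v assume "v : {v. le v e & v ~= e}"
  hence v: "le v e" "v ~= e" by auto
  hence "le e v" using e(2)[of v] le_fibre[OF v(1)] P by simp
  thus False using le_antisym v by blast
 qed
 hence "line (Im (P e)) Un {v. le v e & v ~= e} = line (Im (P z))" by (simp only: P Un_empty_right)
 thus ?thesis using no_gap[of e b'] land P by metis
qed

lemma kR_seq: assumes "!!n. a n : FF" "a ----> z" "z ~= R (-2)" shows "(%n. k (P (a n))) ----> 1 / (z - R (-2))"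
 unfolding k_def using assms RP by (auto intro!: tendsto_intros)

lemma p0_FF: "R (-2) : FF" using PR[of "-2"] by simp

lemma limit_landing:
 assumes c: "((%t. k (Complex t y)) ---> c) (at_left 0)" and z: "z : closure (line y)" "z : JJ"
 shows "c = 1 / (z - R (-2))"
proof -
 obtain a where a: "!!n. a n : line y" "a ----> z" using z(1) closure_sequential by metis
 have aF: "a n : FF" "P (a n) = Complex (Re (P (a n))) y" for n using a(1)[of n] by (auto simp: line_eq complex_eq_iff)
 have "(%n. Re (P (a n))) ----> Re (P z)" by (intro tendsto_intros P_seq a)
 hence "filterlim (%n. Re (P (a n))) (at_left 0) sequentially"
  using z(2) aF(1) less_irrefl by (simp add: filterlim_at) (metis (mono_tags, lifting) always_eventually less_irrefl)
 hence "(%n. k (Complex (Re (P (a n))) y)) ----> c" by (rule filterlim_compose[OF c])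
 hence "(%n. k (P (a n))) ----> c" using aF(2) by simp
 thus ?thesis using kR_seq[OF aF(1) a(2)] z(2) p0_FF LIMSEQ_unique by fastforce
qed

definition "ple z w \<longleftrightarrow> Im (P z) = Im (P w) & (z : FF & Re (P z) <= Re (P w) | le z w)" for z w

text \<open>A small crosscut around a n together with the hairs at its ends would separate the points
  b n near z from the base, although escape connects them.\<close>

lemma no_jump:
 fixes a b :: "nat => complex" and Q :: "complex set"
 assumes a: "!!n. a n : FF" "!!n. ple (a n) (b n)" "(%n. Re (P (a n))) ----> 0" "(%n. k (P (a n))) ----> kp"
  and b: "b ----> z" "z : JJ" and Q: "compact Q" "connected Q" "0 < e" "ball z e <= Q" "u0 : Q" "u0 : FF"
  and ep: "0 < ep" "!!x. x ~= R (-2) ==> norm (1 / (x - R (-2)) - kp) < ep ==> x ~: Q & (ALL u. le x u --> u ~: Q)"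
 shows False
proof -
 obtain g where g: "path g" "path_image g <= FF" "pathstart g = u0" "pathfinish g = R (-2)"
  using FF_facts(3) Q(6) p0_FF unfolding path_connected_def by metis
 have "continuous_on (path_image g) (%u. Re (P u))" by (intro cont_intros cont_sub[OF P_cont]) auto
 from continuous_attains_sup[OF compact_path_image[OF g(1)] path_image_nonempty this]
 obtain m where m: "m : path_image g" "ALL u:path_image g. Re (P u) <= Re (P m)" by (elim bexE)
 define Y where "Y = abs(Im (P z)) + 1"
 obtain d where d: "d > 0" "!!v. - d < Re v ==> Re v < 0 ==> abs(Im v) < Y ==>
  EX a b ca cb. a < Im v & Im v < b & (ALL u:cross v a b. norm (k u - k v) < ep/2) &
   ((%t. k (Complex t a)) ---> ca) (at_left 0) & ((%t. k (Complex t b)) ---> cb) (at_left 0)"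
  by (rule crosscut[of "ep/2" Y]) (use ep in auto)
 \<comment> \<open>To the right of \<open>- D\<close> there is neither a point of the path
   \<open>g\<close> nor the base point, so the crosscut meets neither.\<close>
 define D where "D = min (min d 1) (- Re (P m))"
 have D: "D > 0" using d(1) m(1) g(2) by (auto simp: D_def)
 have "(%n. abs(Im (P (b n)))) ----> abs(Im (P z))" by (intro tendsto_intros P_seq b)
 hence "eventually (%n. abs(Im (P (b n))) < Y) sequentially" by (rule order_tendstoD) (simp add: Y_def)
 moreover have "eventually (%n. - D < Re (P (a n))) sequentially" using order_tendstoD(1)[OF a(3)] D by simp
 moreover have "eventually (%n. dist (k (P (a n))) kp < ep/2) sequentially" using tendstoD[OF a(4), of "ep/2"] ep(1) by simp
 moreover have "eventually (%n. dist (b n) z < e) sequentially" using tendstoD[OF b(1) Q(3)] .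
 ultimately have "eventually (%n. abs(Im (P (b n))) < Y & - D < Re (P (a n)) & dist (k (P (a n))) kp < ep/2 & dist (b n) z < e) sequentially"
  by (intro eventually_conj)
 then obtain n where n: "abs(Im (P (b n))) < Y" "- D < Re (P (a n))" "dist (k (P (a n))) kp < ep/2" "dist (b n) z < e"
  using eventually_happens by fastforce
 define v where "v = P (a n)"
 have v: "Im v = Im (P (b n))" "Re v < 0" "Re v <= Re (P (b n))" "- D < Re v" using a(1,2)[of n] n le_fibre by (auto simp: v_def ple_def)
 obtain y1 y2 c1 c2 where y: "y1 < Im v" "Im v < y2" "!!u. u : cross v y1 y2 ==> norm (k u - k v) < ep/2"
  "((%t. k (Complex t y1)) ---> c1) (at_left 0)" "((%t. k (Complex t y2)) ---> c2) (at_left 0)"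
 proof -
  have "- d < Re v" "abs(Im v) < Y" using v n(1) by (auto simp: D_def)
  from d(2)[OF this(1) v(2) this(2)] show thesis using that by blast
 qed
 have close: "norm (w - kp) < ep" if "norm (w - k v) <= ep/2" for w
  using that n(3) norm_triangle_ineq[of "w - k v" "k v - kp"] by (simp add: dist_norm v_def)
 \<comment> \<open>By \<open>landing\<close> the end of the crosscut leads to the least point
   \<open>m\<close> of its fibre. This \<open>m\<close> is as close to the limit \<open>kp\<close>
   as the crosscut, so the hypothesis on \<open>le\<close> removes the entire fibre from
   \<open>Q\<close>.\<close>
 have hair: "u ~: Q" if u: "u : JJ" "Im (P u) = t" and c: "((%x. k (Complex x t)) ---> c) (at_left 0)" and t: "t = y1 | t = y2" for u t c
 proof -
  obtain m where m: "le m u" "!!w. P w = P u ==> le m w" using leaf_min[OF u(1)] by blast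
  have "closure (line t) Int JJ <= {R (-2) + 1 / c}" using limit_landing[OF c] p0_FF by fastforce
  hence "m : closure (line t)" using landing[OF _ m] u(2) by blast
  hence cm: "c = 1 / (m - R (-2))" using limit_landing[OF c] le_JJ m(1) by blast
  have "eventually (%x. x : {Re v<..<0}) (at_left 0)" using v(2) by (rule eventually_at_left_real)
  hence "eventually (%x. norm (k (Complex x t) - k v) <= ep/2) (at_left 0)"
   by eventually_elim (intro less_imp_le y(3), use t in "auto simp: cross_def")
  hence "norm (c - k v) <= ep/2" by (rule tendsto_upperbound[OF tendsto_norm[OF tendsto_diff[OF c tendsto_const]] _ trivial_limit_at_left_real])
  thus ?thesis using ep(2)[of m] close[of c] cm m(1) le_JJ p0_FF by fastforce
 qed
 have on: "u ~: Q" if u: "u : FF" "P u : cross v y1 y2" for u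
 proof (cases "u = R (-2)")
  case True
  hence "Re v <= -2" using u(2) PR[of "-2"] by (auto simp: cross_def)
  thus ?thesis using v(4) by (simp add: D_def)
 next
  case False
  have "k (P u) = 1 / (u - R (-2))" using u(1) RP by (simp add: k_def)
  thus ?thesis using ep(2)[OF False] close[of "k (P u)"] y(3)[OF u(2)] by simp
 qed
 \<comment> \<open>\<open>V\<close> is the region cut off by the crosscut and the fibres at its
   ends, \<open>X\<close> the region outside; \<open>b n\<close> lies in the former and the base
   point in the latter.\<close>
 define V where "V = {u. Re v < Re (P u)} Int ({u. y1 < Im (P u)} Int {u. Im (P u) < y2})"
 define X where "X = {u. Re (P u) < Re v} Un ({u. Im (P u) < y1} Un {u. y2 < Im (P u)})"
 have op: "open V" "open X" unfolding V_def X_def by (intro open_Int open_Un open_Collect_less cont_intros P_cont)+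
 have "Q Un path_image g <= V Un X"
 proof
  fix u assume u: "u : Q Un path_image g"
  have "u : Q" if "Re v <= Re (P u)" using u m v(4) that by (auto simp: D_def)
  moreover have "P u : cross v y1 y2 | Re (P u) = 0 & (Im (P u) = y1 | Im (P u) = y2)" if "u ~: V Un X"
   using that FF_cases[of u] v(2) by (auto simp: V_def X_def cross_def)
  moreover have "P u ~: cross v y1 y2" if "Re (P u) = 0" "Im (P u) ~= y1" "Im (P u) ~= y2" using that v(2) by (auto simp: cross_def)
  ultimately show "u : V Un X" using on[of u] hair[of u _ c1] hair[of u _ c2] y(4,5) FF_cases[of u] by (fastforce simp: X_def)
 qed
 moreover have "connected (Q Un path_image g)" using Q(2,5) g(1,3) connected_path_image pathstart_in_path_image by (intro connected_Un) blast+
 moreover have "V Int X = {}" by (auto simp: V_def X_def)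
 moreover have "R (-2) : X Int (Q Un path_image g)"
 proof -
  have "- 1 < Re v" using v(4) by (simp add: D_def)
  thus ?thesis using g(4) PR[of "-2"] pathfinish_in_path_image[of g] by (auto simp: X_def)
 qed
 moreover have bQ: "b n : Q" using n(4) Q(4) by (auto simp: dist_commute)
 hence "b n : V"
 proof -
  have "Re (P (b n)) ~= Re v"
  proof
   assume eq: "Re (P (b n)) = Re v"
   hence "P (b n) : cross v y1 y2" using v y(1,2) by (auto simp: cross_def)
   thus False using on[of "b n"] eq v(2) bQ by simp
  qed
  thus ?thesis using v y(1,2) by (simp add: V_def)
 qed
 ultimately show False using connectedD[OF _ op, of "Q Un path_image g"] bQ by blast
qed

lemma subseq_dichotomy: fixes A :: "nat => bool" obtains r :: "nat => nat" where "strict_mono r" "(ALL n. A (r n)) | (ALL n. ~ A (r n))"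
proof (cases "infinite {n. A n}")
 case True
 thus thesis using infinite_enumerate[of "{n. A n}"] that by auto
next
 case False
 hence "infinite {n. ~ A n}" using infinite_UNIV_nat by (metis Collect_neg_eq finite_compl)
 thus thesis using infinite_enumerate[of "{n. ~ A n}"] that by auto
qed

lemma ple_P: assumes "!!n. ple (a n) (b n)" "b ----> z" shows "(%n. Im (P (a n))) ----> Im (P z)"
proof -
 have "(%n. Im (P (b n))) ----> Im (P z)" by (intro tendsto_intros P_seq assms)
 thus ?thesis using assms(1) by (simp add: ple_def)
qed

lemma ple_Re: "ple z w ==> Re (P z) <= Re (P w)" using le_fibre[of z w] by (auto simp: ple_def)

text \<open>For points in \<open>JJ\<close> this is \<open>le_bounded\<close>. Unbounded points of
  \<open>FF\<close> must approach the boundary while \<open>k\<close> tends to 0, and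
  \<open>no_jump\<close> applies with the set from \<open>escape_inf\<close>.\<close>

lemma ple_bounded:
 assumes a: "!!n. ple (a n) (b n)" "!!n. -1 <= Re (P (a n))" "b ----> z"
 shows "bounded (range a)"
proof (rule ccontr)
 assume "~ bounded (range a)"
 hence "ALL n::nat. EX m. real n < norm (a m)" unfolding bounded_iff by (metis not_le rangeE)
 then obtain s where s: "!!n. real n < norm (a (s n))" by metis
 have "filterlim s at_top sequentially" unfolding filterlim_at_top
 proof
  fix m
  obtain N where N: "Max ((%i. norm (a i)) ` {..m}) < real N" using reals_Archimedean2 by blast
  have "m <= s n" if "N <= n" for n
  proof (rule ccontr)
   assume "~ m <= s n"
   hence "norm (a (s n)) <= Max ((%i. norm (a i)) ` {..m})" by (intro Max_ge) auto
   thus False using N s[of n] that by simp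
  qed
  thus "eventually (%n. m <= s n) sequentially" by (auto simp: eventually_sequentially)
 qed
 hence bs: "(%n. b (s n)) ----> z" by (rule filterlim_compose[OF a(3)])
 obtain r :: "nat => nat" where r: "strict_mono r" "(ALL n. a (s (r n)) : JJ) | (ALL n. a (s (r n)) ~: JJ)"
  using subseq_dichotomy[of "%n. a (s n) : JJ"] by blast
 have br: "(%n. b (s (r n))) ----> z" using LIMSEQ_subseq_LIMSEQ[OF bs r(1)] by (simp add: o_def)
 have unb: "~ bounded (range (%n. a (s (t n))))" if "strict_mono t" for t :: "nat => nat"
 proof
  assume "bounded (range (%n. a (s (t n))))"
  then obtain B where B: "!!n. norm (a (s (t n))) <= B" by (auto simp: bounded_iff)
  obtain n where "B < real n" using reals_Archimedean2 by blast
  thus False using B[of n] s[of "t n"] seq_suble[OF that, of n] by (smt (verit) of_nat_le_iff)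
 qed
 have aF: "a (s (r n)) : FF" for n
 proof (rule ccontr)
  assume "a (s (r n)) ~: FF"
  hence "ALL n. a (s (r n)) : JJ" using r(2) FF_cases[of "a (s (r n))"] by blast
  hence "le (a (s (r n))) (b (s (r n)))" for n using a(1)[of "s (r n)"] by (simp add: ple_def)
  from le_bounded[OF this br] show False using unb[OF r(1)] by simp
 qed
 have "bounded (range (%n. P (a (s (r n)))))"
 proof -
  have "bounded (range (%n. Im (P (a (s (r n))))))" by (rule convergent_imp_bounded[OF ple_P[OF a(1) br]])
  then obtain B where "!!n. abs(Im (P (a (s (r n))))) <= B" by (auto simp: bounded_iff)
  moreover have "abs(Re (P (a (s (r n))))) <= 1" for n using a(2)[of "s (r n)"] P_Re[of "a (s (r n))"] by simp
  ultimately have "norm (P (a (s (r n)))) <= 1 + B" for n using cmod_le[of "P (a (s (r n)))"] by (smt (verit))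
  thus ?thesis by (auto simp: bounded_iff)
 qed
 then obtain v t where t: "strict_mono t" "((%n. P (a (s (r n)))) o t) ----> v" using bounded_imp_convergent_subsequence by blast
 have Pv: "(%n. P (a (s (r (t n))))) ----> v" using t(2) by (simp add: o_def)
 have rt: "strict_mono (%n. r (t n))" using strict_mono_o[OF r(1) t(1)] by (simp add: o_def)
 have "Re v <= 0" using P_Re by (intro LIMSEQ_le_const2[OF tendsto_Re[OF Pv]]) auto
 moreover have "~ Re v < 0"
 proof
  assume "Re v < 0"
  hence "isCont R v" using R_cont lh_facts(1) by (simp add: cont_at)
  from isCont_comp[OF this Pv] have "(%n. a (s (r (t n)))) ----> R v" using RP aF by simp
  thus False using convergent_imp_bounded unb[OF rt] by blast
 qed
 ultimately have v: "Re v = 0" by simp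
 have bt: "(%n. b (s (r (t n)))) ----> z" using LIMSEQ_subseq_LIMSEQ[OF br t(1)] by (simp add: o_def)
 have "Re v <= Re (P z)"
  by (rule LIMSEQ_le[OF tendsto_Re[OF Pv] tendsto_Re[OF P_seq[OF bt]]]) (use ple_Re a(1) in auto)
 hence z: "z : JJ" using v P_Re[of z] by simp
 obtain Q e where Q: "compact Q" "connected Q" "0 < e" "ball z e <= Q" "EX u:Q. Re (P u) < 0" "ALL b u. 1 / e < norm b --> le b u --> u ~: Q"
  using escape_inf[of z] z by (simp only: mem_Collect_eq) blast
 then obtain u0 where u0: "u0 : Q" "u0 : FF" by blast
 obtain B where B: "0 < B" "!!u. u : Q ==> norm u <= B" using compact_imp_bounded[OF Q(1)] by (auto simp: bounded_pos)
 define C where "C = B + 1 / e + norm (R (-2))"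
 have C: "C > 0" using B Q(3) by (simp add: C_def add_pos_pos add_pos_nonneg)
 have kap: "(%n. k (P (a (s (r (t n)))))) ----> 0"
 proof -
  have "filterlim (%n. a (s (r (t n)))) at_infinity sequentially"
  proof (rule filterlim_norm_at_top_imp_at_infinity, rule filterlim_at_top_mono[OF filterlim_real_sequentially])
   show "eventually (%n. real n <= norm (a (s (r (t n))))) sequentially"
    using s seq_suble[OF rt] by (intro always_eventually allI) (smt (verit) of_nat_le_iff)
  qed
  hence "filterlim (%n. - R (-2) + a (s (r (t n)))) at_infinity sequentially"
   by (rule tendsto_add_filterlim_at_infinity[OF tendsto_const])
  from tendsto_divide_0[OF tendsto_const[of 1] this] show ?thesis using RP aF by (simp add: k_def)
 qed
 show False
 proof (rule no_jump[OF aF a(1) _ kap bt z Q(1-4) u0, of "1 / C"])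
  show "(%n. Re (P (a (s (r (t n)))))) ----> 0" using tendsto_Re[OF Pv] v by simp
  fix x assume x: "x ~= R (-2)" "norm (1 / (x - R (-2)) - 0) < 1 / C"
  hence "C < norm (x - R (-2))" using C by (simp add: norm_divide field_simps)
  hence "B + 1 / e < norm x" using norm_triangle_ineq4[of x "R (-2)"] by (simp add: C_def)
  hence "B < norm x" "1 / e < norm x" using B(1) Q(3) by (auto intro: less_trans add_strict_increasing)
   (smt (verit) divide_pos_pos)+
  thus "x ~: Q & (ALL u. le x u --> u ~: Q)" using B(2) Q(6) by (meson not_le)
 qed (use C in simp)
qed

text \<open>The critical case has points of \<open>FF\<close> converging to a point of the fibre
  that is not below \<open>z\<close>; \<open>escape\<close> then supplies the connected set that
  \<open>no_jump\<close> forbids.\<close>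

lemma ple_closed:
 assumes a: "!!n. ple (a n) (b n)" "a ----> w" "b ----> z"
 shows "ple w z"
proof (rule ccontr)
 assume n: "~ ple w z"
 obtain r :: "nat => nat" where r: "strict_mono r" "(ALL n. a (r n) : JJ) | (ALL n. a (r n) ~: JJ)"
  using subseq_dichotomy[of "%n. a n : JJ"] by blast
 have lim: "(%n. a (r n)) ----> w" "(%n. b (r n)) ----> z"
  using LIMSEQ_subseq_LIMSEQ[OF a(2) r(1)] LIMSEQ_subseq_LIMSEQ[OF a(3) r(1)] by (simp_all add: o_def)
 have Im: "Im (P w) = Im (P z)" using LIMSEQ_unique[OF tendsto_Im[OF P_seq[OF a(2)]] ple_P[OF a(1,3)]] .
 have Re: "Re (P w) <= Re (P z)"
  by (rule LIMSEQ_le[OF tendsto_Re[OF P_seq[OF a(2)]] tendsto_Re[OF P_seq[OF a(3)]]]) (use ple_Re a(1) in auto)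
 have w: "w : JJ" using n Im Re FF_cases[of w] by (auto simp: ple_def)
 hence z: "z : JJ" "P w = P z" using Re P_Re[of z] Im by (auto simp: complex_eq_iff)
 have nl: "~ le w z" using n Im by (simp add: ple_def)
 have aF: "a (r n) : FF" for n
 proof (rule ccontr)
  assume "a (r n) ~: FF"
  hence "ALL n. a (r n) : JJ" using r(2) FF_cases[of "a (r n)"] by blast
  hence "le (a (r n)) (b (r n))" for n using a(1)[of "r n"] by (simp add: ple_def)
  from le_closed[OF this lim] show False using nl by simp
 qed
 obtain Q e where Q: "compact Q" "connected Q" "0 < e" "ball z e <= Q" "EX u:Q. Re (P u) < 0" "ball w e Int Q = {}"
  "ALL b u. dist b w < e --> le b u --> u ~: Q" using escape[OF _ z(2) nl] z(1) by (simp only: mem_Collect_eq) blast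
 then obtain u0 where u0: "u0 : Q" "u0 : FF" by blast
 have w0: "w - R (-2) ~= 0" using w p0_FF by auto
 have "isCont (%y. 1 / y) (1 / (w - R (-2)))" using w0 by (intro cont_intros) auto
 then obtain d where d: "d > 0" "!!y. dist y (1 / (w - R (-2))) < d ==> dist (1 / y) (1 / (1 / (w - R (-2)))) < e"
  unfolding cont_eps using Q(3) by blast
 show False
 proof (rule no_jump[OF aF a(1) _ kR_seq[OF aF lim(1)] lim(2) z(1) Q(1-4) u0 d(1)])
  show "(%n. Re (P (a (r n)))) ----> 0" using tendsto_Re[OF P_seq[OF lim(1)]] w by simp
  show "w ~= R (-2)" using w0 by auto
  fix x assume x: "x ~= R (-2)" "norm (1 / (x - R (-2)) - 1 / (w - R (-2))) < d"
  hence "dist (x - R (-2)) (w - R (-2)) < e" using d(2)[of "1 / (x - R (-2))"] by (simp add: dist_norm)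
  hence "dist x w < e" by (simp add: dist_norm)
  thus "x ~: Q & (ALL u. le x u --> u ~: Q)" using Q(6,7) by (auto simp: dist_commute)
 qed
qed

lemma ple_refl: "ple z z" using FF_cases[of z] le_refl[of z] by (auto simp: ple_def)

lemma ple_antisym: assumes "ple z w" "ple w z" shows "z = w"
proof -
 have P: "P z = P w" using assms ple_Re[of z w] ple_Re[of w z] by (simp add: ple_def complex_eq_iff)
 show ?thesis
 proof (cases "z : FF")
  case True
  thus ?thesis using RP P by (metis mem_Collect_eq)
 next
  case False
  hence "le z w" "le w z" using assms P by (auto simp: ple_def)
  thus ?thesis by (rule le_antisym)
 qed
qed

lemma ple_trans: assumes zw: "ple z w" and wv: "ple w v" shows "ple z v"
proof (cases "z : FF")
 case True
 thus ?thesis using ple_Re[OF wv] ple_Re[OF zw] zw wv by (simp add: ple_def)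
next
 case False
 hence 1: "le z w" using zw by (simp add: ple_def)
 hence "w ~: FF" using le_JJ by auto
 hence "le w v" using wv by (simp add: ple_def)
 thus ?thesis using le_trans[OF 1] zw wv by (simp add: ple_def)
qed

lemma ple_total: assumes "Im (P z) = Im (P w)" shows "ple z w | ple w z"
proof (cases "z : FF | w : FF")
 case False
 hence "Re (P z) = 0" "P z = P w" using FF_cases[of z] FF_cases[of w] assms by (auto simp: complex_eq_iff)
 thus ?thesis using le_total[of z w] assms by (auto simp: ple_def)
qed (use assms FF_cases[of z] FF_cases[of w] in "auto simp: ple_def")

end

section \<open>A Whitney map along the leaves\<close>

context leaf_space begin

definition "sec y = R (Complex (-1) y)" for y
text \<open>Cutting leaves at the section \<open>Re (P u) = -1\<close> makes their initial segments
  compact and gives them a starting point that varies continuously.\<close>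

definition "seg z = {u. ple u z & -1 <= Re (P u)}" for z

lemma sec: "P (sec y) = Complex (-1) y" "sec y : FF" unfolding sec_def using PR[of "Complex (-1) y"] by auto

lemma sec_cont: "continuous_on A (%z. sec (Im (P z)))" unfolding sec_def
 by (rule cont_comp[OF R_cont]) (auto intro!: cont_intros cont_sub[OF P_cont] simp: Complex_eq)

lemma sec_ple: "Im (P u) = y ==> -1 <= Re (P u) ==> ple (sec y) u" using sec[of y] by (simp add: ple_def)

lemma seg_ends: "-1 <= Re (P z) ==> z : seg z & sec (Im (P z)) : seg z"
 using ple_refl sec_ple[of z] sec by (simp add: seg_def)

text \<open>Compactness of one segment and upper semicontinuity in \<open>z\<close> need the same
  argument, so the segments are allowed to vary.\<close>

lemma seg_limit:
 assumes "!!n. u n : seg (a n)" "a ----> z"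
 obtains r v where "strict_mono r" "(%n. u (r n)) ----> v" "v : seg z"
proof -
 have u: "ple (u n) (a n)" "-1 <= Re (P (u n))" for n using assms(1) by (auto simp: seg_def)
 have "bounded (range u)" by (rule ple_bounded[OF u assms(2)])
 then obtain v r where r: "strict_mono r" "(u o r) ----> v" using bounded_imp_convergent_subsequence by blast
 hence v: "(%n. u (r n)) ----> v" by (simp add: o_def)
 have "(%n. a (r n)) ----> z" using LIMSEQ_subseq_LIMSEQ[OF assms(2) r(1)] by (simp add: o_def)
 hence "ple v z" by (rule ple_closed[OF u(1) v])
 moreover have "-1 <= Re (P v)" by (rule LIMSEQ_le_const[OF tendsto_Re[OF P_seq[OF v]]]) (use u(2) in auto)
 ultimately show thesis using that[OF r(1) v] by (simp add: seg_def)
qed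

lemma seg_compact: "compact (seg z)"
 unfolding compact_def
proof (intro allI impI)
 fix u :: "nat => complex" assume "ALL n. u n : seg z"
 then obtain r v where "strict_mono r" "(%n. u (r n)) ----> v" "v : seg z"
  using seg_limit[of u "%_. z" z, OF _ tendsto_const] by blast
 thus "EX l:seg z. EX r. strict_mono r & (u o r) ----> l" by (auto simp: o_def)
qed

text \<open>Two accumulation points in \<open>JJ\<close> are below each other by
  \<open>ple_closed\<close>, hence equal.\<close>

lemma line_landing: obtains b' where "closure (line y) Int JJ <= {b'}"
proof (cases "closure (line y) Int JJ = {}")
 case False
 then obtain c where c: "c : closure (line y)" "c : JJ" by blast
 have *: "ple d v" if d: "d : closure (line y)" "v : JJ" "Im (P v) = y" for d v
 proof -
  obtain a where a: "!!n. a n : line y" "a ----> d" using d(1) unfolding closure_sequential by blast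
  have "ple (a n) v" for n using a(1)[of n] d by (simp add: ple_def line_eq)
  thus ?thesis by (rule ple_closed[OF _ a(2) tendsto_const])
 qed
 have "closed {z. Im (P z) = y}" by (intro closed_Collect_eq cont_intros P_cont)
 hence "closure (line y) <= {z. Im (P z) = y}" by (intro closure_minimal) (auto simp: line_eq)
 hence "d = c" if "d : closure (line y)" "d : JJ" for d using *[of d c] *[of c d] that c ple_antisym by blast
 thus thesis using that[of c] by blast
qed (use that in blast)

text \<open>The part in \<open>FF\<close> is an arc. A further closed piece would be a compact part
  of one fibre; by \<open>no_gap\<close> its least point is approached by earlier points of the
  leaf, and these belong to the other piece.\<close>

lemma seg_connected: "connected (seg z)"
proof (cases "-1 <= Re (P z)")
 case False
 hence "seg z = {}" using ple_Re by (fastforce simp: seg_def)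
 thus ?thesis by simp
next
 case True
 define y where "y = Im (P z)"
 define L where "L = seg z Int FF"
 have Leq: "L = R ` ((%x. Complex x y) ` ({-1..Re (P z)} Int {..<0}))"
 proof
  show "L <= R ` ((%x. Complex x y) ` ({-1..Re (P z)} Int {..<0}))"
  proof
   fix u assume "u : L"
   hence u: "ple u z" "-1 <= Re (P u)" "Re (P u) < 0" by (auto simp: L_def seg_def)
   hence "P u = Complex (Re (P u)) y" by (simp add: ple_def y_def complex_eq_iff)
   hence "u = R (Complex (Re (P u)) y)" "Re (P u) : {-1..Re (P z)} Int {..<0}"
    using ple_Re[OF u(1)] RP[OF u(3)] u by auto
   thus "u : R ` ((%x. Complex x y) ` ({-1..Re (P z)} Int {..<0}))" by blast
  qed
  show "R ` ((%x. Complex x y) ` ({-1..Re (P z)} Int {..<0})) <= L"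
   using PR by (auto simp: L_def seg_def ple_def y_def)
 qed
 have "connected ({-1..Re (P z)} Int {..<0})" by (intro convex_connected convex_Int) auto
 hence Lc: "connected L" unfolding Leq
  by (intro conn_im cont_sub[OF R_cont] cont_intros) (auto intro!: cont_intros simp: Complex_eq)
 have se: "z : seg z" "sec y : L" using seg_ends[OF True] sec by (auto simp: L_def y_def)
 show ?thesis unfolding connected_closed_set[OF compact_imp_closed[OF seg_compact]]
 proof (rule notI, elim exE conjE)
  have no: False if AB: "closed A" "closed B" "A Int B = {}" "A Un B = seg z" "B ~= {}" "sec y : A" for A B
  proof -
   have "A Int L = {} | B Int L = {}" using connected_closed[THEN iffD1, OF Lc] AB by (metis Int_assoc Int_commute Int_empty_left L_def Int_subset_iff inf_le1)
   hence BJ: "B <= JJ" "L <= A" using se AB FF_cases by (auto simp: L_def)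
   have "B Int seg z = B" using AB(4) by blast
   hence cB: "compact B" using closed_Int_compact[OF AB(2) seg_compact] by metis
   have Bz: "le v z" if "v : B" for v
   proof -
    have "ple v z" using that AB(4) by (auto simp: seg_def)
    thus ?thesis using BJ(1) that by (auto simp: ple_def)
   qed
   obtain b where b: "b : B" "!!v. v : B ==> le b v"
   proof (rule fibre_min[OF cB AB(5) BJ(1)])
    show "P u = P v" if "u : B" "v : B" for u v using le_fibre[OF Bz[OF that(1)]] le_fibre[OF Bz[OF that(2)]] by simp
   qed blast
   have bz: "P b = P z" "b : JJ" using le_fibre[OF Bz[OF b(1)]] by auto
   obtain b' where "closure (line y) Int JJ <= {b'}" by (rule line_landing)
   hence "b : closure (line y Un {v. le v b & v ~= b})" using no_gap[OF bz(2)] bz(1) by (simp add: y_def)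
   then obtain s where s: "!!n. s n : line y Un {v. le v b & v ~= b}" "s ----> b" unfolding closure_sequential by blast
   have "eventually (%n. -1 < Re (P (s n))) sequentially"
    by (rule order_tendstoD[OF tendsto_Re[OF P_seq[OF s(2)]]]) (use bz in auto)
   hence "eventually (%n. s n : A) sequentially"
   proof eventually_elim
    case (elim n)
    show "s n : A"
    proof (cases "s n : FF")
     case True
     hence "Im (P (s n)) = y" using s(1)[of n] le_JJ by (auto simp: line_eq)
     hence "s n : L" using True elim bz by (auto simp: L_def seg_def ple_def y_def)
     thus ?thesis using BJ(2) by blast
    next
     case False
     hence sn: "le (s n) b" "s n ~= b" using s(1)[of n] by (auto simp: line_eq)
     hence "ple (s n) z" using le_trans[OF sn(1) Bz[OF b(1)]] le_fibre[OF sn(1)] bz(1) by (simp add: ple_def)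
     hence "s n : seg z" using elim by (simp add: seg_def)
     moreover have "s n ~: B" using b(2) le_antisym sn by blast
     ultimately show ?thesis using AB(4) by blast
    qed
   qed
   hence "b : A" using Lim_in_closed_set[OF AB(1) _ sequentially_bot s(2)] by blast
   thus False using AB(3) b(1) by blast
  qed
  fix A B assume AB: "closed A" "closed B" "A ~= {}" "B ~= {}" "A Un B = seg z" "A Int B = {}"
  have "sec y : A | sec y : B" using se AB(5) by (auto simp: L_def)
  thus False using no[of A B] no[of B A] AB by (auto simp: Int_commute Un_commute)
 qed
qed

lemma seg_usc:
 assumes "open O'" "seg z <= O'"
 obtains e where "e > 0" "!!z'. dist z' z < e ==> seg z' <= O'"
proof (rule ccontr)
 assume "~ thesis"
 hence "~ (ALL z'. dist z' z < inverse (real (Suc n)) --> seg z' <= O')" for n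
  using that[of "inverse (real (Suc n))"] by (metis inverse_positive_iff_positive of_nat_0_less_iff zero_less_Suc)
 hence "EX a u. dist a z < inverse (real (Suc n)) & u : seg a & u ~: O'" for n by blast
 then obtain a u where a: "!!n. dist (a n) z < inverse (real (Suc n))" "!!n. u n : seg (a n)" "!!n. u n ~: O'" by metis
 have az: "a ----> z" by (rule LIMSEQ_dist_inverse[OF a(1)])
 obtain r v where r: "(%n. u (r n)) ----> v" "v : seg z" using seg_limit[OF a(2) az] by blast
 have "v : - O'" using Lim_in_closed_set[OF _ _ sequentially_bot r(1), of "- O'"] assms(1) a(3) by (auto simp: closed_def)
 thus False using r(2) assms(2) by blast
qed

text \<open>Outside the ball about \<open>u\<close>, the earlier and the later part of the segment
  have disjoint neighbourhoods. A nearby segment avoiding the ball would start in one, end in the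
  other and be disconnected.\<close>

lemma seg_lsc:
 assumes z: "-1 <= Re (P z)" and u: "u : seg z" and r: "r > 0"
 obtains e where "e > 0" "!!z'. dist z' z < e ==> -1 <= Re (P z') ==> seg z' Int ball u r ~= {}"
proof -
 define A where "A = (seg z - ball u r) Int {v. ple v u}"
 define B where "B = (seg z - ball u r) Int {v. ple u v}"
 have Imu: "Im (P v) = Im (P z)" if "v : seg z" for v using that by (simp add: seg_def ple_def)
 have cl: "closed {v. ple v u}" "closed {v. ple u v}"
 proof -
  show "closed {v. ple v u}" unfolding closed_sequential_limits using ple_closed[OF _ _ tendsto_const] by blast
  show "closed {v. ple u v}" unfolding closed_sequential_limits using ple_closed[OF _ tendsto_const] by blast
 qed
 have cs: "compact (seg z - ball u r)" by (intro compact_diff seg_compact open_ball)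
 have "closed A" "closed B" unfolding A_def B_def by (intro compact_imp_closed compact_Int_closed cs cl)+
 moreover have "A Int B = {}" using ple_antisym r by (force simp: A_def B_def)
 ultimately obtain U V where UV: "open U" "open V" "A <= U" "B <= V" "U Int V = {}" by (rule separation_normal)
 have "seg z <= U Un V Un ball u r"
 proof
  fix v assume v: "v : seg z"
  hence "ple v u | ple u v" using ple_total Imu u by metis
  thus "v : U Un V Un ball u r" using v UV(3,4) by (auto simp: A_def B_def)
 qed
 moreover have "open (U Un V Un ball u r)" using UV by blast
 ultimately obtain e1 where e1: "e1 > 0" "!!z'. dist z' z < e1 ==> seg z' <= U Un V Un ball u r" using seg_usc by metis
 have "ple u z" "ple (sec (Im (P z))) u" using u sec_ple[of u "Im (P z)"] Imu[OF u] by (auto simp: seg_def)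
 hence "z : V Un ball u r" "sec (Im (P z)) : U Un ball u r"
  using seg_ends[OF z] UV(3,4) by (auto simp: A_def B_def)
 moreover have "open ((V Un ball u r) Int (%z. sec (Im (P z))) -` (U Un ball u r))"
  by (intro open_Int open_vimage open_Un UV open_ball sec_cont)
 ultimately obtain e2 where e2: "e2 > 0" "ball z e2 <= (V Un ball u r) Int (%z. sec (Im (P z))) -` (U Un ball u r)"
  by (metis Int_iff open_contains_ball vimageI2)
 have e2: "e2 > 0" "!!z'. dist z' z < e2 ==> z' : V Un ball u r & sec (Im (P z')) : U Un ball u r"
  using e2 by (auto simp: dist_commute subset_iff)
 have "seg z' Int ball u r ~= {}" if z': "dist z' z < min e1 e2" "-1 <= Re (P z')" for z'
 proof
  assume em: "seg z' Int ball u r = {}"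
  have "z' : seg z'" "sec (Im (P z')) : seg z'" using seg_ends[OF z'(2)] by auto
  moreover from this have "z' : V" "sec (Im (P z')) : U" using e2(2)[of z'] z'(1) em by auto
  moreover have "seg z' <= U Un V" using e1(2)[of z'] z'(1) em by auto
  ultimately show False using connectedD[OF seg_connected UV(1,2), of z'] UV(5) by blast
 qed
 thus thesis using that[of "min e1 e2"] e1(1) e2(1) by auto
qed

lemma seg_sup_cont:
 fixes h :: "complex => real" assumes h: "continuous_on UNIV h"
 shows "continuous_on {z. -1 <= Re (P z)} (%z. Sup (h ` seg z))"
proof -
 have at: "EX u:seg z. ALL v:seg z. h v <= h u" "u : seg z ==> ALL v:seg z. h v <= h u ==> Sup (h ` seg z) = h u" if "-1 <= Re (P z)" for z u
 proof -
  show "EX u:seg z. ALL v:seg z. h v <= h u"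
   by (rule continuous_attains_sup[OF seg_compact _ cont_sub[OF h]]) (use seg_ends[OF that] in auto)
  show "Sup (h ` seg z) = h u" if "u : seg z" "ALL v:seg z. h v <= h u" using that by (intro cSup_eq_maximum) auto
 qed
 show ?thesis unfolding continuous_on_iff
 proof (intro ballI allI impI)
  fix z and e :: real assume "z : {z. -1 <= Re (P z)}" and e: "0 < e"
  hence z: "-1 <= Re (P z)" by simp
  obtain u where u: "u : seg z" "ALL v:seg z. h v <= h u" using at(1)[OF z] by blast
  have "open {v. h v < h u + e}" by (intro open_Collect_less h cont_intros)
  moreover have "seg z <= {v. h v < h u + e}" using u(2) e by fastforce
  ultimately obtain d1 where d1: "d1 > 0" "!!z'. dist z' z < d1 ==> seg z' <= {v. h v < h u + e}" using seg_usc by metis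
  obtain r where r: "r > 0" "!!v. dist v u < r ==> dist (h v) (h u) < e"
   using h e unfolding continuous_on_iff by (metis UNIV_I)
  obtain d2 where d2: "d2 > 0" "!!z'. dist z' z < d2 ==> -1 <= Re (P z') ==> seg z' Int ball u r ~= {}" using seg_lsc[OF z u(1) r(1)] by metis
  have "dist (Sup (h ` seg z')) (Sup (h ` seg z)) < e" if z': "-1 <= Re (P z')" "dist z' z < min d1 d2" for z'
  proof -
   obtain u' where u': "u' : seg z'" "ALL v:seg z'. h v <= h u'" using at(1)[OF z'(1)] by blast
   obtain v where v: "v : seg z'" "dist v u < r" using d2(2)[of z'] z' by (auto simp: dist_commute)
   have "h u' < h u + e" using d1(2)[of z'] z'(2) u'(1) by auto
   moreover have "h u - e < h u'" using r(2)[OF v(2)] u'(2) v(1) by (force simp: dist_real_def)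
   ultimately show ?thesis using at(2)[OF z u] at(2)[OF z'(1) u'] by (simp add: dist_real_def)
  qed
  thus "EX d>0. ALL z':{z. -1 <= Re (P z)}. dist z' z < d --> dist (Sup (h ` seg z')) (Sup (h ` seg z)) < e"
   using d1(1) d2(1) by (intro exI[of _ "min d1 d2"]) auto
 qed
qed

text \<open>A Whitney map along the leaves: sums of suprema over initial segments against a countable
  family of functions separating points from compacta.\<close>

lemma leaf_coordinate:
 obtains X :: "complex => real" where "continuous_on UNIV X" "!!z w. ple z w ==> z ~= w ==> X z < X w"
  "!!z. Re (P z) <= -1 ==> X z = Re (P z)" "!!z. X z <= 1"
proof -
 obtain D :: "complex set" where D: "countable D" "!!T. open T ==> T ~= {} ==> EX d:D. d : T" by (rule countable_dense_setE) blast
 define h where "h n u = 1 / (1 + dist u (from_nat_into D n))" for n u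
 have h: "0 < h n u" "h n u <= 1" "continuous_on A (h n)" for n u A
  unfolding h_def by (auto intro!: cont_intros simp: add_pos_nonneg add_nonneg_eq_0_iff)
 define S where "S n z = Sup (h n ` seg z)" for n z
 have Sge: "h n u <= S n z" if "u : seg z" for n z u
  unfolding S_def using that h(2) by (intro cSup_upper bdd_aboveI[of _ 1]) auto
 have Sle: "S n z <= 1" if "-1 <= Re (P z)" for n z
  unfolding S_def using seg_ends[OF that] h(2) by (intro cSup_least) auto
 \<comment> \<open>Subtracting the value at the start of the leaf makes the sum vanish on the
   section, so that it can be glued to \<open>Re (P z)\<close>; the weights give uniform convergence
   and keep \<open>X\<close> at most 1.\<close>
 define T where "T n z = (1/2) ^ n * (S n z - h n (sec (Im (P z))))" for n z
 have T: "0 <= T n z" "T n z <= (1/2) ^ n" if "-1 <= Re (P z)" for n z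
 proof -
  show "0 <= T n z" using Sge[of "sec (Im (P z))"] seg_ends[OF that] by (simp add: T_def)
  have "(1/2) ^ n * (S n z - h n (sec (Im (P z)))) <= (1/2) ^ n * 1"
   using Sle[OF that, of n] h(1)[of n "sec (Im (P z))"] by (intro mult_left_mono) auto
  thus "T n z <= (1/2) ^ n" by (simp add: T_def)
 qed
 have geo: "summable (%n. (1/2::real) ^ n)" "(\<Sum>n. (1/2::real) ^ n) = 2" by (auto simp: suminf_geometric)
 have sum: "summable (%n. T n z)" if "-1 <= Re (P z)" for z
  by (rule summable_comparison_test'[OF geo(1), of 0]) (use T[OF that] in auto)
 define X where "X z = (if Re (P z) <= -1 then Re (P z) else -1 + (\<Sum>n. T n z))" for z
 have seg1: "seg z = {z}" if "Re (P z) = -1" for z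
 proof -
  have "u = z" if u: "u : seg z" for u
  proof (rule ple_antisym)
   show uz: "ple u z" using u by (simp add: seg_def)
   have "-1 <= Re (P u)" "Re (P u) <= -1" "Im (P u) = Im (P z)" using u ple_Re[OF uz] `Re (P z) = -1` uz by (auto simp: seg_def ple_def)
   hence "Re (P u) = -1" "Im (P u) = Im (P z)" by auto
   thus "ple z u" using that `Re (P z) = -1` by (simp add: ple_def)
  qed
  thus ?thesis using seg_ends[of z] that by auto
 qed
 have T1: "T n z = 0" if "Re (P z) = -1" for n z
  using seg_ends[of z] seg1[OF that] that by (auto simp: T_def S_def)
 have X2: "X z = -1 + (\<Sum>n. T n z)" if "-1 <= Re (P z)" for z using that T1[of z] by (auto simp: X_def)
 have cT: "continuous_on {z. -1 <= Re (P z)} (T n)" for n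
 proof -
  have "continuous_on {z. -1 <= Re (P z)} (%z. sec (Im (P z)))" by (rule sec_cont)
  hence "continuous_on {z. -1 <= Re (P z)} (%z. h n (sec (Im (P z))))" by (rule cont_comp[OF h(3)[of UNIV]]) auto
  thus ?thesis unfolding T_def[abs_def] S_def by (intro cont_intros seg_sup_cont h(3))
 qed
 have "uniform_limit {z. -1 <= Re (P z)} (%n z. SUM i<n. T i z) (%z. \<Sum>i. T i z) sequentially"
  by (rule Weierstrass_m_test[OF _ geo(1)]) (use T in auto)
 hence "continuous_on {z. -1 <= Re (P z)} (%z. \<Sum>n. T n z)"
  by (rule uniform_limit_theorem[rotated]) (auto intro!: always_eventually cont_intros cT)
 hence "continuous_on UNIV (%z. if Re (P z) <= -1 then Re (P z) else -1 + (\<Sum>n. T n z))"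
  by (intro continuous_on_cases_le cont_intros cont_sub[OF P_cont]) (use T1 in auto)
 hence Xc: "continuous_on UNIV X" by (simp add: X_def[abs_def])
 have strict: "X z < X w" if zw: "ple z w" "z ~= w" "-1 <= Re (P z)" for z w
 proof -
  have w1: "-1 <= Re (P w)" using ple_Re[OF zw(1)] zw(3) by simp
  have sub: "seg z <= seg w" using ple_trans[OF _ zw(1)] by (auto simp: seg_def)
  have Im: "Im (P z) = Im (P w)" using zw(1) by (simp add: ple_def)
  have "S n z <= S n w" for n unfolding S_def
   using seg_ends[OF zw(3)] sub h(2) by (intro cSup_subset_mono bdd_aboveI[of _ 1]) auto
  hence mono: "0 <= T n w - T n z" for n by (simp add: T_def Im mult_left_mono flip: right_diff_distrib)
  have wz: "w ~: seg z" using ple_antisym[OF zw(1)] zw(2) by (auto simp: seg_def)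
  hence d: "infdist w (seg z) > 0" using seg_ends[OF zw(3)] by (intro infdist_pos_not_in_closed compact_imp_closed seg_compact) auto
  define d where "d = infdist w (seg z) / 2"
  have "ball w d ~= {}" using d by (simp add: d_def)
  then obtain n where n: "dist w (from_nat_into D n) < d" using D from_nat_into_surj[OF D(1)] by (metis open_ball mem_ball)
  have hw: "1 / (1 + d) < h n w" using n d by (simp add: h_def frac_less2 add_pos_nonneg)
  have "S n z <= 1 / (1 + d)" unfolding S_def
  proof (rule cSup_least)
   fix t assume "t : h n ` seg z"
   then obtain u where u: "u : seg z" "t = h n u" by blast
   have "2 * d <= dist w u" using infdist_le[OF u(1), of w] by (simp add: d_def)
   hence "d <= dist u (from_nat_into D n)" using n dist_triangle[of w u "from_nat_into D n"] by (simp add: dist_commute)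
   thus "t <= 1 / (1 + d)" using d by (simp add: u(2) h_def frac_le d_def)
  qed (use seg_ends[OF zw(3)] in auto)
  hence "S n z < S n w" using hw Sge[of w w n] seg_ends[OF w1] by auto
  hence "0 < T n w - T n z" by (simp add: T_def Im flip: right_diff_distrib)
  hence "0 < (\<Sum>n. T n w - T n z)" by (intro suminf_pos2[of _ n] summable_diff sum w1 zw(3) mono)
  thus ?thesis unfolding X2[OF zw(3)] X2[OF w1] suminf_diff[OF sum[OF w1] sum[OF zw(3)], symmetric] by simp
 qed
 show thesis
 proof (rule that[OF Xc])
  show "X z = Re (P z)" if "Re (P z) <= -1" for z using that by (simp add: X_def)
  show "X z <= 1" for z
  proof (cases "Re (P z) <= -1")
   case False
   hence "(\<Sum>n. T n z) <= 2" using suminf_le[OF T(2) sum geo(1), of z] geo(2) by simp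
   thus ?thesis using X2[of z] False by simp
  qed (simp add: X_def)
  show "X z < X w" if zw: "ple z w" "z ~= w" for z w
  proof (cases "-1 <= Re (P z)")
   case False
   hence zF: "z : FF" "X z = Re (P z)" by (auto simp: X_def)
   show ?thesis
   proof (cases "Re (P w) <= -1")
    case True
    hence "Re (P z) ~= Re (P w)" using RP[of z] RP[of w] zw zF by (metis complex_eq_iff mem_Collect_eq ple_def)
    thus ?thesis using ple_Re[OF zw(1)] True zF by (simp add: X_def)
   next
    case Fw: False
    have "0 <= (\<Sum>n. T n w)" using Fw T sum by (intro suminf_nonneg) auto
    thus ?thesis using zF False X2[of w] Fw by simp
   qed
  qed (use strict zw in blast)
 qed
qed

end

section \<open>Straightening\<close>

context leaf_space begin

text \<open>\<open>Ph\<close> is injective since \<open>X\<close> increases along leaves, so it is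
  open by invariance of domain; its image \<open>U\<close> meets each horizontal line in a left
  half-line. Adding \<open>1 / D\<close>, which tends to infinity at the right end, stretches each
  half-line to a full line.\<close>

lemma straighten:
 obtains G where "homeomorphism UNIV UNIV G (inv G)" "!!z. Im (G z) = Im (P z)" "!!z w. ple z w ==> z ~= w ==> Re (G z) < Re (G w)"
  "!!z. z : JJ ==> 0 <= Re (G z)"
proof -
 obtain X where X: "continuous_on UNIV X" "!!z w. ple z w ==> z ~= w ==> X z < X w"
  "!!z. Re (P z) <= -1 ==> X z = Re (P z)" "!!z. X z <= 1" by (rule leaf_coordinate) blast
 define Ph where "Ph z = Complex (X z) (Im (P z))" for z
 define U where "U = range Ph"
 have cPh: "continuous_on UNIV Ph" unfolding Ph_def[abs_def] Complex_eq by (intro cont_intros X P_cont)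
 have same: "z = w" if "Im (P z) = Im (P w)" "X z = X w" for z w
  using ple_total[OF that(1)] X(2)[of z w] X(2)[of w z] that(2) by auto
 have "inj Ph" by (rule injI) (use same in "auto simp: Ph_def")
 hence U: "open U" unfolding U_def by (intro invariance_of_domain cPh) auto
 have Xlow: "X z = -1" if "Re (P z) = -1" for z using X(3)[of z] that by simp
 have low: "Complex x y : U" if "x <= -1" for x y
 proof -
  have "Ph (R (Complex x y)) = Complex x y" using that PR[of "Complex x y"] X(3)[of "R (Complex x y)"] by (simp add: Ph_def)
  thus ?thesis unfolding U_def by (metis rangeI)
 qed
 have left: "Complex x' y : U" if xy: "Complex x y : U" "x' <= x" for x x' y
 proof (cases "x' <= -1")
  case False
  obtain z where z: "X z = x" "Im (P z) = y" using xy(1) by (auto simp: U_def Ph_def)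
  have Rz: "-1 <= Re (P z)" using X(3)[of z] z(1) xy(2) False by fastforce
  have "connected (X ` seg z)" by (intro conn_im cont_sub[OF X(1)] seg_connected) auto
  moreover have "X (sec y) = -1" using sec Xlow by simp
  ultimately have "x' : X ` seg z"
   using connectedD_interval[of "X ` seg z" "-1" x x'] seg_ends[OF Rz] z False xy(2) by (metis image_eqI less_imp_le not_le)
  then obtain u where u: "u : seg z" "X u = x'" by blast
  hence "Im (P u) = y" using z(2) by (simp add: seg_def ple_def)
  thus ?thesis using u(2) by (auto simp: U_def Ph_def)
 qed (rule low)
 have bound: "x <= 1" if "Complex x y : U" for x y using that X(4) by (auto simp: U_def Ph_def)
 define D where "D p = infdist p (- U)" for p
 have ne: "- U ~= {}" using bound[of 2 0] by auto
 have Dpos: "0 < D p" if "p : U" for p unfolding D_def using infdist_pos_not_in_closed[OF closed_Compl[OF U] ne] that by blast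
 have Dmono: "D (Complex x y) <= D (Complex x' y)" if "x' <= x" for x x' y
  unfolding D_def infdist_notempty[OF ne]
 proof (rule cINF_greatest[OF ne])
  fix a assume a: "a : - U"
  \<comment> \<open>The complement of \<open>U\<close> is carried into itself by translation to the
    right, so the distance to it does not grow to the right.\<close>
  have "a + of_real (x - x') : - U"
  proof
   assume "a + of_real (x - x') : U"
   hence "Complex (Re a + (x - x')) (Im a) : U" by (metis complex_of_real_def complex_add complex.collapse add_0_right)
   hence "Complex (Re a) (Im a) : U" by (rule left) (use that in simp)
   thus False using a by simp
  qed
  hence "(INF a\<in>- U. dist (Complex x y) a) <= dist (Complex x y) (a + of_real (x - x'))" by (intro cINF_lower) auto
  also have "... = dist (Complex x' y) a" unfolding dist_norm by (rule arg_cong[of _ _ norm]) (simp add: complex_eq_iff)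
  finally show "(INF a\<in>- U. dist (Complex x y) a) <= dist (Complex x' y) a" .
 qed
 \<comment> \<open>The summand \<open>Re p\<close> makes the growth strict, and \<open>+ 1\<close>
   makes the values on \<open>JJ\<close> nonnegative, as \<open>X > -1\<close> there.\<close>
 define H where "H p = Re p + 1 + 1 / D p" for p
 have cH: "continuous_on U H" unfolding H_def D_def
  using Dpos by (intro cont_intros) (auto simp: D_def[symmetric], force)
 have Hmono: "H (Complex x' y) < H (Complex x y)" if "x' < x" "Complex x y : U" for x x' y
  using Dmono[of x' x y] Dpos[OF that(2)] that(1) by (simp add: H_def frac_le add_less_le_mono)
 define G where "G z = Complex (H (Ph z)) (Im (P z))" for z
 have cG: "continuous_on UNIV G" unfolding G_def[abs_def] Complex_eq
  by (intro cont_intros P_cont cont_comp[OF cH cPh]) (auto simp: U_def)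
 have Gmono: "Re (G z) < Re (G w)" if "ple z w" "z ~= w" for z w
 proof -
  have "Im (P z) = Im (P w)" "Ph w : U" using that by (auto simp: ple_def U_def)
  thus ?thesis using Hmono[of "X z" "X w" "Im (P w)"] X(2)[OF that] by (simp add: G_def Ph_def)
 qed
 have "inj G"
 proof (rule injI, rule ccontr)
  fix z w assume zw: "G z = G w" "z ~= w"
  hence "Im (P z) = Im (P w)" by (simp add: G_def)
  thus False using ple_total[of z w] Gmono[of z w] Gmono[of w z] zw by auto
 qed
 moreover have "v : range G" for v
 proof -
  define y s where "y = Im v" and "s = Re v"
  define x1 where "x1 = min (-1) (s - 2 - 1 / D (Complex (-1) y))"
  have x1: "x1 <= -1" "Complex x1 y : U" using low by (auto simp: x1_def)
  have "1 / D (Complex x1 y) <= 1 / D (Complex (-1) y)" using Dmono[OF x1(1)] Dpos[OF low] by (simp add: frac_le)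
  hence H1: "H (Complex x1 y) <= s" by (auto simp: H_def x1_def)
  define be where "be = Sup {x. Complex x y : U}"
  have bd: "bdd_above {x. Complex x y : U}" "{x. Complex x y : U} ~= {}" using bound low[of "-1" y] by (auto intro!: bdd_aboveI[of _ 1])
  have b1: "-1 <= be" unfolding be_def using low by (intro cSup_upper bd) auto
  have be: "Complex be y ~: U"
  proof
   assume "Complex be y : U"
   then obtain e where e: "e > 0" "ball (Complex be y) e <= U" using U open_contains_ball by blast
   have "Complex (be + e/2) y : ball (Complex be y) e" using e(1) by (simp add: dist_norm cmod_def)
   hence "be + e/2 : {x. Complex x y : U}" using e(2) by blast
   from cSup_upper[OF this bd(1)] have "be + e/2 <= be" by (simp add: be_def)
   thus False using e(1) by simp
  qed
  \<comment> \<open>Within \<open>t\<close> of the right end, \<open>1 / D\<close> is at least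
    \<open>abs s + 3\<close>, which outweighs \<open>x2 + 1 > -1\<close>.\<close>
  define t where "t = 1 / (abs s + 3)"
  have t: "0 < t" "t <= 1" by (auto simp: t_def field_simps)
  obtain x2 where x2: "Complex x2 y : U" "be - t < x2" using less_cSupD[OF bd(2), of "be - t"] t(1) by (auto simp: be_def)
  have "x2 <= be" unfolding be_def using x2 by (intro cSup_upper bd) auto
  hence "D (Complex x2 y) <= t"
   unfolding D_def using be x2(2) by (intro infdist_le2[of "Complex be y"]) (auto simp: dist_norm cmod_def)
  hence "1 / t <= 1 / D (Complex x2 y)" using Dpos[OF x2(1)] by (simp add: frac_le)
  hence "abs s + 3 <= 1 / D (Complex x2 y)" by (simp add: t_def)
  hence H2: "s <= H (Complex x2 y)" using x2(2) b1 t(2) abs_ge_self[of s] unfolding H_def complex.sel by linarith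
  have "x1 <= x2"
  proof (rule ccontr)
   assume "~ x1 <= x2"
   thus False using Hmono[of x2 x1 y] x1(2) H1 H2 by simp
  qed
  moreover have "continuous_on {x1..x2} (%x. H (Complex x y))"
  proof (rule cont_comp[OF cH])
   show "continuous_on {x1..x2} (%x. Complex x y)" unfolding Complex_eq by (intro cont_intros)
  qed (use left[OF x2(1)] in auto)
  ultimately obtain x where x: "x1 <= x" "x <= x2" "H (Complex x y) = s" using IVT'[of "%x. H (Complex x y)" x1 s x2] H1 H2 by auto
  obtain z where z: "Ph z = Complex x y" using left[OF x2(1) x(2)] by (auto simp: U_def)
  hence "Im (P z) = y" by (simp add: Ph_def)
  hence "G z = v" using z x(3) by (simp add: G_def y_def s_def)
  thus ?thesis by blast
 qed
 hence sG: "range G = UNIV" by blast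
 ultimately obtain k where k: "homeomorphism UNIV (range G) G k"
  using invariance_of_domain_homeomorphism[OF open_UNIV cG] by auto
 have "inv G = k" using k by (intro inv_equality) (auto simp: homeomorphism_def sG)
 hence "homeomorphism UNIV UNIV G (inv G)" using k by (simp add: sG)
 moreover have "0 <= Re (G z)" if z: "z : JJ" for z
 proof -
  have "Re (P (sec (Im (P z)))) = -1" by (simp add: sec(1))
  hence "sec (Im (P z)) ~= z" "ple (sec (Im (P z))) z" using z sec_ple[of z] by auto
  hence "-1 < X z" using X(2) sec(1) Xlow by fastforce
  moreover have "0 < 1 / D (Ph z)" using Dpos[of "Ph z"] by (simp add: U_def)
  ultimately show ?thesis by (simp add: G_def H_def Ph_def)
 qed
 ultimately show thesis using that[of G] Gmono by (simp add: G_def)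
qed

text \<open>On an arc without heights, k would extend continuously by 0, hence vanish identically.\<close>

lemma heights_dense: assumes "a < b" shows "EX z:JJ. a < Im (P z) & Im (P z) < b"
proof (rule ccontr)
 assume no: "~ ?thesis"
 define y0 where "y0 = (a + b) / 2"
 define r where "r = min 1 ((b - a) / 2)"
 have r: "0 < r" "r <= 1" using assms by (auto simp: r_def)
 define A where "A u = (if 0 < Im u then k (\<i> * u + \<i> * of_real y0) else 0)" for u
 have pt: "\<i> * u + \<i> * of_real y0 : pstrip" if "0 < Im u" "norm u < r" for u
  using that abs_Im_le_cmod[of u] r(2) by auto
 have lim: "(A ---> 0) (at u within ball 0 r Int {z. 0 <= Im z})" if u: "u : ball 0 r" "Im u = 0" for u
  unfolding tendsto_iff
 proof (rule allI, rule impI, rule ccontr)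
  fix e :: real assume e: "0 < e" and ne: "~ eventually (%x. dist (A x) 0 < e) (at u within ball 0 r Int {z. 0 <= Im z})"
  have "EX x. norm x < r & dist x u < inverse (real (Suc n)) & e <= norm (A x)" for n
  proof (rule ccontr)
   assume "~ ?thesis"
   hence "ALL x. norm x < r --> dist x u < inverse (real (Suc n)) --> norm (A x) < e" by (meson not_le)
   hence "EX d>0. ALL x:ball 0 r Int {z. 0 <= Im z}. x ~= u & dist x u < d --> dist (A x) 0 < e"
    by (intro exI[of _ "inverse (real (Suc n))"]) auto
   thus False using ne unfolding eventually_at by blast
  qed
  then obtain x where x: "!!n. norm (x n) < r" "!!n. dist (x n) u < inverse (real (Suc n))" "!!n. e <= norm (A (x n))" by metis
  have Ix: "0 < Im (x n)" for n using x(3)[of n] e by (auto simp: A_def split: if_splits)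
  define v where "v n = \<i> * x n + \<i> * of_real y0" for n
  have v: "v n : pstrip" "e <= norm (k (v n))" for n using pt[OF Ix x(1)] x(3)[of n] Ix[of n] by (auto simp: v_def A_def)
  have xu: "x ----> u" by (rule LIMSEQ_dist_inverse[OF x(2)])
  hence vl: "v ----> \<i> * u + \<i> * of_real y0" unfolding v_def by (intro tendsto_intros)
  have "norm (R (v n)) <= norm (R (-2)) + 1 / e" for n
  proof -
   have "R (v n) = R (-2) + 1 / k (v n)" "k (v n) ~= 0" using k_facts(4)[OF v(1)] by auto
   moreover have "norm (1 / k (v n)) <= 1 / e" using v(2)[of n] e by (simp add: norm_divide frac_le)
   ultimately show ?thesis using norm_triangle_ineq[of "R (-2)" "1 / k (v n)"] by simp
  qed
  hence "bounded (range (%n. R (v n)))" by (auto simp: bounded_iff)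
  then obtain z s where s: "strict_mono s" "((%n. R (v n)) o s) ----> z" using bounded_imp_convergent_subsequence by blast
  have "(%n. P (R (v (s n)))) ----> P z" using P_seq[OF s(2)] by (simp add: o_def)
  moreover have "P (R (v (s n))) = v (s n)" for n using PR v(1) by blast
  ultimately have "(%n. v (s n)) ----> P z" by simp
  moreover have "(%n. v (s n)) ----> \<i> * u + \<i> * of_real y0" using LIMSEQ_subseq_LIMSEQ[OF vl s(1)] by (simp add: o_def)
  ultimately have "P z = \<i> * u + \<i> * of_real y0" using LIMSEQ_unique by blast
  hence z: "z : JJ" "Im (P z) = Re u + y0" using u(2) by auto
  have "abs(Re u) < (b - a) / 2" using abs_Re_le_cmod[of u] u(1) by (auto simp: r_def)
  hence "2 * Re u < b - a" "2 * - Re u < b - a" using abs_ge_self[of "Re u"] abs_ge_minus_self[of "Re u"] by argo+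
  hence "a < Im (P z)" "Im (P z) < b" unfolding z(2) y0_def by (simp_all add: field_simps)
  thus False using no z(1) by blast
 qed
 have hol: "(%z. if 0 <= Im z then A z else cnj (A (cnj z))) hol_on ball 0 r"
 proof (rule Schwarz_reflection)
  have "(k o (%u. \<i> * u + \<i> * of_real y0)) hol_on (ball 0 r Int {z. 0 < Im z})"
   by (rule hol_comp[OF _ k_facts(1)]) (use pt in "auto intro!: hol_intros")
  thus A: "A hol_on (ball 0 r Int {z. 0 < Im z})"
   by (rule holomorphic_transform) (auto simp: A_def)
  show "continuous_on (ball 0 r Int {z. 0 <= Im z}) A" unfolding continuous_on_def
  proof
   fix u assume u: "u : ball 0 r Int {z. 0 <= Im z}"
   show "(A ---> A u) (at u within ball 0 r Int {z. 0 <= Im z})"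
   proof (cases "Im u = 0")
    case True
    thus ?thesis using lim[of u] u by (simp add: A_def)
   next
    case False
    have "open (ball 0 r Int {z. 0 < Im z})" by (intro open_Int open_ball open_halfspace_Im_gt)
    hence "isCont A u" using hol_cont[OF A] False u by (simp add: cont_at)
    thus ?thesis unfolding isCont_def by (rule tendsto_within_subset) auto
   qed
  qed
  show "A z : \<real>" if "z : \<real>" for z using that by (auto simp: A_def complex_is_Real_iff)
 qed auto
 have z0: "(0::complex) islimpt of_real ` {0<..<r}"
 proof (subst islimpt_approachable, intro allI impI)
  fix e :: real assume "0 < e"
  thus "EX x':complex_of_real ` {0<..<r}. x' ~= 0 & dist x' 0 < e"
   using r(1) by (intro bexI[of _ "of_real (min e r / 2)"] imageI) auto
 qed
 define w where "w = \<i> * of_real (r / 2)"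
 have "(if 0 <= Im w then A w else cnj (A (cnj w))) = 0"
 proof (rule analytic_continuation[OF hol open_ball connected_ball _ _ z0])
  show "complex_of_real ` {0<..<r} <= ball 0 r" "0 : ball (0::complex) r" "w : ball 0 r" using r(1) by (auto simp: w_def norm_mult)
  show "(if 0 <= Im z then A z else cnj (A (cnj z))) = 0" if "z : complex_of_real ` {0<..<r}" for z using that by (auto simp: A_def)
 qed
 hence "k (\<i> * w + \<i> * of_real y0) = 0" using r(1) by (simp add: w_def A_def)
 thus False using k_facts(4)[OF pt[of w]] r(1) by (simp add: w_def norm_mult)
qed

text \<open>By \<open>gaps\<close> the compact sets \<open>E n\<close> have empty interior, so by
  Baire's theorem some \<open>c\<close> avoids their countably many rational translates.\<close>

lemma irrational_shift: obtains c where "!!z. z : JJ ==> Im (P z) - c ~: \<rat>"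
proof -
 define E where "E n = (%z. Im (P z)) ` (JJ Int cball 0 (real n))" for n
 have "closed JJ" by (intro closed_Collect_eq cont_intros P_cont)
 hence E: "compact (E n)" for n unfolding E_def
  by (intro compact_im closed_Int_compact cont_intros cont_sub[OF P_cont]) auto
 define Gc where "Gc = (%(n, q). - ((%y. - q + y) ` E n)) ` (UNIV \<times> \<rat>)"
 have "UNIV <= closure (\<Inter>Gc)"
 proof (rule Baire)
  show "countable Gc" unfolding Gc_def by (intro countable_image countable_SIGMA countable_rat) auto
  fix T assume "T : Gc"
  then obtain n q where T: "T = - ((%y. - q + y) ` E n)" by (auto simp: Gc_def)
  have "closed ((%y. - q + y) ` E n)" by (intro compact_imp_closed compact_translation E)
  moreover have "x : closure T" for x unfolding closure_approachable
  proof (intro allI impI)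
   fix e :: real assume "0 < e"
   then obtain y where y: "x + q < y" "y < x + q + e" "ALL z. Re (P z) = 0 --> Im (P z) ~= y" using gaps[of "x + q" "x + q + e"] by auto
   hence "y - q : T" by (auto simp: T E_def)
   thus "EX t:T. dist t x < e" using y(1,2) by (intro bexI[of _ "y - q"]) (auto simp: dist_real_def)
  qed
  ultimately show "openin (top_of_set UNIV) T & UNIV <= closure T" unfolding T by (auto simp: open_Compl)
 qed simp
 hence "\<Inter>Gc ~= {}" by (metis closure_empty empty_not_UNIV subset_empty)
 then obtain c where c: "c : \<Inter>Gc" by blast
 have "Im (P z) - c ~: \<rat>" if z: "z : JJ" for z
 proof
  assume q: "Im (P z) - c : \<rat>"
  obtain n where n: "norm z <= real n" using real_arch_simple by blast
  have "- ((%y. - (Im (P z) - c) + y) ` E n) : Gc" using q by (force simp: Gc_def)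
  hence "c ~: (%y. - (Im (P z) - c) + y) ` E n" using c by blast
  moreover have "c = - (Im (P z) - c) + Im (P z)" "Im (P z) : E n" using z n by (auto simp: E_def)
  ultimately show False by blast
 qed
 thus thesis by (rule that)
qed

text \<open>The brush is the image of \<open>JJ\<close> under \<open>G\<close>, lowered by
  \<open>c\<close>, and \<open>t\<close> is the abscissa of the least point of a fibre. Convergence
  of end points combines two facts: \<open>t\<close> is lower semicontinuous because
  \<open>B\<close> is closed, and points of \<open>JJ\<close> near an end point bound it from
  above.\<close>

theorem Cantor_bouquet_JJ: "Cantor_bouquet JJ"
proof -
 obtain G where G: "homeomorphism UNIV UNIV G (inv G)" "!!z. Im (G z) = Im (P z)" "!!z w. ple z w ==> z ~= w ==> Re (G z) < Re (G w)"
  "!!z. z : JJ ==> 0 <= Re (G z)" by (rule straighten) blast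
 obtain c where c: "!!z. z : JJ ==> Im (P z) - c ~: \<rat>" by (rule irrational_shift) blast
 define k where "k = inv G"
 have Gk: "G (k v) = v" "k (G z) = z" "continuous_on UNIV G" "continuous_on UNIV k" for v z
  using G(1) by (auto simp: homeomorphism_def k_def)
 define B where "B = {(x, y). k (Complex x (y + c)) : JJ}"
 have Pk: "Im (P (k (Complex x y))) = y" for x y using G(2)[of "k (Complex x y)"] Gk(1) by simp
 have mono: "Re (G z) <= Re (G w)" if "ple z w" for z w using G(3)[OF that] by (cases "z = w") auto
 have "closed JJ" by (intro closed_Collect_eq cont_intros P_cont)
 moreover have "continuous_on UNIV (%p. k (Complex (fst p) (snd p + c)))"
  by (rule cont_comp[OF Gk(4)]) (auto intro!: cont_intros simp: Complex_eq)
 ultimately have "closed ((%p. k (Complex (fst p) (snd p + c))) -` JJ)" by (rule closed_vimage)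
 moreover have "(%p. k (Complex (fst p) (snd p + c))) -` JJ = B" by (auto simp: B_def)
 ultimately have clB: "closed B" by simp
 have BI: "(Re (G z), Im (P z) - c) : B" if "z : JJ" for z
 proof -
  have "Complex (Re (G z)) (Im (P z) - c + c) = G z" using G(2)[of z] by (simp add: complex_eq_iff)
  thus ?thesis using that Gk(2) by (simp add: B_def)
 qed
 have BD: "EX z:JJ. x = Re (G z) & y = Im (P z) - c" if "(x, y) : B" for x y
  using that Gk(1) Pk[of x "y + c"] by (intro bexI[of _ "k (Complex x (y + c))"]) (auto simp: B_def)
 have slice: "EX s>=0. {x. (x, y) : B} = {s..}" if y: "y : hair_addresses B" for y
 proof -
  obtain z where z: "z : JJ" "y = Im (P z) - c" using y BD by (auto simp: hair_addresses_def)
  obtain e where e: "le e z" "!!v. P v = P z ==> le e v" by (rule leaf_min[OF z(1)]) blast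
  have eJ: "e : JJ" "P e = P z" using le_fibre[OF e(1)] by auto
  have "(x, y) : B" if x: "Re (G e) <= x" for x
  proof -
   define v where "v = k (Complex x (y + c))"
   have v: "Re (G v) = x" "Im (P v) = Im (P z)" using Gk(1) Pk z(2) by (auto simp: v_def)
   have "ple e v"
   proof (rule ccontr)
    assume "~ ple e v"
    hence "ple v e" "v ~= e" using ple_total[of e v] ple_refl v(2) eJ by auto
    thus False using G(3) x v(1) by fastforce
   qed
   hence "v : JJ" using eJ(1) le_JJ by (auto simp: ple_def)
   thus ?thesis using BI[of v] v z(2) by simp
  qed
  moreover have "Re (G e) <= x" if "(x, y) : B" for x
  proof -
   obtain v where v: "v : JJ" "x = Re (G v)" "y = Im (P v) - c" using BD[OF `(x, y) : B`] by blast
   hence "P v = P z" using z by (simp add: complex_eq_iff)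
   hence "ple e v" using e(2)[of v] le_fibre by (simp add: ple_def eJ)
   thus ?thesis using mono v(2) by simp
  qed
  ultimately show ?thesis using G(4)[OF eJ(1)] by (intro exI[of _ "Re (G e)"]) auto
 qed
 then obtain t where t: "!!y. y : hair_addresses B ==> 0 <= t y & {x. (x, y) : B} = {t y..}" by metis
 have tB: "(t y, y) : B" if "y : hair_addresses B" for y using t[OF that] by auto
 have tle: "t y <= x" if "(x, y) : B" for x y
 proof -
  have "y : hair_addresses B" using that by (auto simp: hair_addresses_def)
  from t[OF this] that show ?thesis by auto
 qed
 have hairI: "Im (P z) - c : hair_addresses B" if "z : JJ" for z using BI[OF that] by (auto simp: hair_addresses_def)
 \<comment> \<open>Points of \<open>B\<close> with abscissa in the compact interval from 0 to
   \<open>s\<close> have a closed projection, and \<open>y\<close> is not in it.\<close>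
 have lower: "eventually (%n. s < t (be n)) sequentially"
  if be: "!!n. be n : hair_addresses B" "be ----> y" and s: "s < t y" for be :: "nat => real" and y s
 proof -
  have "closed {y. EX x. x : {0..s} & (x, y) : B}" by (rule closed_compact_projection[OF compact_Icc clB])
  hence "open (- {y. EX x. x : {0..s} & (x, y) : B})" by (rule open_Compl)
  moreover have "y : - {y. EX x. x : {0..s} & (x, y) : B}" using tle s by fastforce
  ultimately have "eventually (%n. be n : - {y. EX x. x : {0..s} & (x, y) : B}) sequentially"
   by (rule topological_tendstoD[OF be(2)])
  thus ?thesis
  proof eventually_elim
   case (elim n)
   hence "~ t (be n) <= s" using tB[OF be(1)[of n]] t[OF be(1)[of n]] by auto
   thus ?case by simp
  qed
 qed
 have approx: "EX be ga :: nat => real. (ALL n. be n : hair_addresses B & ga n : hair_addresses B & be n < y & y < ga n) &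
   be ----> y & ga ----> y & (%n. t (be n)) ----> t y & (%n. t (ga n)) ----> t y" if y: "y : hair_addresses B" for y
 proof -
  obtain e where e: "e : JJ" "t y = Re (G e)" "y = Im (P e) - c" using BD[OF tB[OF y]] by blast
  have "EX z1 z2. z1 : JJ & z2 : JJ & dist z1 e < inverse (real (Suc n)) & dist z2 e < inverse (real (Suc n)) &
   Im (P z1) < Im (P e) & Im (P e) < Im (P z2)" for n
   using sides[of e "inverse (real (Suc n))"] e(1) by auto
  then obtain z1 z2 where z: "!!n. z1 n : JJ" "!!n. z2 n : JJ" "!!n. dist (z1 n) e < inverse (real (Suc n))"
   "!!n. dist (z2 n) e < inverse (real (Suc n))" "!!n. Im (P (z1 n)) < Im (P e)" "!!n. Im (P e) < Im (P (z2 n))" by metis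
  have to: "(%n. Im (P (w n)) - c) ----> y & (%n. t (Im (P (w n)) - c)) ----> t y"
   if w: "!!n. w n : JJ" "!!n. dist (w n) e < inverse (real (Suc n))" for w
  proof -
   have we: "w ----> e" by (rule LIMSEQ_dist_inverse[OF w(2)])
   have h: "(%n. Im (P (w n)) - c) ----> y" unfolding e(3) by (intro tendsto_intros P_seq we)
   have "(%n. Re (G (w n))) ----> t y" unfolding e(2)
    by (intro tendsto_intros continuous_on_tendsto_compose[OF Gk(3) we]) auto
   hence "(%n. t (Im (P (w n)) - c)) ----> t y"
    unfolding order_tendsto_iff
   proof (intro conjI allI impI)
    fix s assume "s < t y"
    thus "eventually (%n. s < t (Im (P (w n)) - c)) sequentially" by (rule lower[OF hairI[OF w(1)] h])
   next
    fix s assume "(ALL l<t y. eventually (%n. l < Re (G (w n))) sequentially) & (ALL u>t y. eventually (%n. Re (G (w n)) < u) sequentially)" "t y < s"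
    hence "eventually (%n. Re (G (w n)) < s) sequentially" by blast
    thus "eventually (%n. t (Im (P (w n)) - c) < s) sequentially"
     by eventually_elim (use tle[OF BI[OF w(1)]] in "auto intro: le_less_trans")
   qed
   thus ?thesis using h by blast
  qed
  show ?thesis
   using to[OF z(1,3)] to[OF z(2,4)] z hairI e(3)
   by (intro exI[of _ "%n. Im (P (z1 n)) - c"] exI[of _ "%n. Im (P (z2 n)) - c"]) auto
 qed
 have "straight_brush B" unfolding straight_brush_def
 proof (intro conjI exI[of _ t] ballI)
  show "B <= {0..} \<times> (UNIV - \<rat>)" using BD c G(4) by fastforce
  show "UNIV - \<rat> <= closure (hair_addresses B)"
  proof
   fix y :: real
   show "y : closure (hair_addresses B)" unfolding closure_approachable
   proof (intro allI impI)
    fix e :: real assume "0 < e"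
    then obtain z where "z : JJ" "y + c < Im (P z)" "Im (P z) < y + c + e" using heights_dense[of "y + c" "y + c + e"] by auto
    thus "EX x:hair_addresses B. dist x y < e" using hairI by (intro bexI[of _ "Im (P z) - c"]) (auto simp: dist_real_def)
   qed
  qed
 qed (use clB t approx in auto)
 moreover define h where "h v = k (v + \<i> * of_real c)" for v
 define h' where "h' z = G z - \<i> * of_real c" for z
 have "homeomorphism UNIV UNIV h h'"
  by (rule homeomorphismI) (use Gk in "auto simp: h_def h'_def intro!: cont_comp[OF Gk(4)] cont_intros")
 moreover have "JJ = h ` (%(x, y). Complex x y) ` B"
 proof
  show "JJ <= h ` (%(x, y). Complex x y) ` B"
  proof
   fix z assume z: "z : JJ"
   have "Complex (Re (G z)) (Im (P z) - c) + \<i> * of_real c = G z" using G(2)[of z] by (simp add: complex_eq_iff)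
   hence "h (Complex (Re (G z)) (Im (P z) - c)) = z" by (simp add: h_def Gk(2))
   thus "z : h ` (%(x, y). Complex x y) ` B" using BI[OF z] by force
  qed
  have "Complex x y + \<i> * of_real c = Complex x (y + c)" for x y by (simp add: complex_eq_iff)
  thus "h ` (%(x, y). Complex x y) ` B <= JJ" by (auto simp: B_def h_def)
 qed
 ultimately show ?thesis unfolding Cantor_bouquet_def by blast
qed

end

theorem theorem1p5:
  fixes f :: "complex \<Rightarrow> complex"
  assumes "transcendental_entire f"
    and "disjoint_type f"
    and "finite_order f \<or>
         (\<exists>gs. gs \<noteq> [] \<and> (\<forall>g \<in> set gs. finite_order g \<and> g \<in> class_B) \<and>
               f = foldr (\<circ>) gs id)"
  shows "Cantor_bouquet (Julia_set f)"
proof -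
 interpret disjoint_type_map f using assms(1,2) by unfold_locales
 obtain ph ps p where "uniformised f ph ps p" by (rule uniformised_exists)
 then interpret uniformised f ph ps p .
 obtain l0 l kp mu mu' where "exterior f ph ps p l0 l kp mu mu'" by (rule exterior_exists)
 then interpret exterior f ph ps p l0 l kp mu mu' .
 \<comment> \<open>Boundedness of the singular values comes from the compact postsingular set of a
   hyperbolic map.\<close>
 have "f : class_B" using assms(1) sing_bounded by (simp add: class_B_def)
 hence "linear_head_start f"
  using assms(3) linear_head_start_finite_order linear_head_start_composition by blast
 then obtain al be K M where "0 <= al" "0 <= be" "1 <= K" "0 < M"
  "!!G a b. lift1 G ==> de <= Re a ==> de <= Re b ==> abs(Im (G a) - Im (G b)) <= al * max (Re (G a)) (Re (G b)) + be"
  "!!G H a b. lift1 G ==> lift1 H ==> de <= Re a ==> de <= Re b ==> K * Re (G (H a)) + M <= Re (G (H b)) ==>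
    K * Re (H a) + 2 * M <= Re (H b)" by (rule head_start_lifts) blast
 then interpret ordered_exterior f ph ps p l0 l kp mu mu' al be K M by unfold_locales
 obtain P R le where "leaf_space P R le" and J: "J = {z. Re (P z) = 0}" by (rule leaf_space_exists)
 thus ?thesis unfolding J by (simp add: leaf_space.Cantor_bouquet_JJ)
qed

end
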